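(* Let $K$ be a $\rho$-uniform primitive triangulation of a smooth $(n+1)$-dimensional lattice polytope $P$, with associated wave $\rho\in H^1(X_0;\mathcal W_1)$. If a sign distribution $\varepsilon\in C^0(K;\mathbb F_2)$ is a solution of $$\nabla^2\varepsilon|_{X_0}=\rho\quad\text{in }H^1(X_0;\mathcal W_1),$$ then the T-hypersurface $\mathbb RX_\varepsilon$ is made of (1) $h^{n,0}(X)$ spheres contained in the torus of $\mathcal Y(\mathbb R)$, where they bound disjoint balls; and (2) one additional connected component, which intersects every toric divisor of $\mathcal Y(\mathbb R)$.
   Context: Polytope and triangulation. $M,N$ are dual lattices of rank $n+1$, $n\ge1$, with pairing $\langle-,-\rangle$; $M_2=M\otimes\mathbb F_2$, $N_2=N\otimes\mathbb F_2$. A full-dimensional lattice polytope $P\subset M\otimes\mathbb R$ is smooth if it is simple and at each vertex the primitive edge directions form a basis of $M$. A primitive triangulation $K$ of $P$ is a triangulation into lattice simplices whose maximal simplices have volume $1/(n+1)!$ (unit volume = parallelepiped on a basis of $M$); its vertices are exactly $P\cap M$. $\sigma^p$ denotes a $p$-simplex; $\sigma\le\tau$ means $\sigma$ is a face of $\tau$; a simplex is interior if it is not contained in $\partial P$. $T\sigma,TQ$ are linear tangent spaces. For an edge, $\omega(\sigma^1)\in M_2$ is the class of the difference of its endpoints. Complexes. For $\sigma\le\tau$, $[\sigma,\tau]$ is the cell of the cubical subdivision of $K$ formed by the simplices of the barycentric subdivision given by flags between $\sigma$ and $\tau$. For $\sigma$ contained in a face $Q$ of $P$, $[\sigma,Q]=\bigcup_{\sigma\le\tau\subset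 Q}[\sigma,\tau]$ is a ball of dimension $\dim Q-\dim\sigma$. These are the closed cells of a regular CW structure $Y$ on $P$, with $[\sigma',Q']\le[\sigma,Q]$ iff $\sigma'\ge\sigma$, $Q'\subset Q$. $X\le Y$ is the subcomplex of cells with $\dim\sigma\ge1$. Put $\sigma^*=[\sigma,P]$. $X_0=X\cap\bigcup_{v\text{ interior vertex}}v^*$. Cellular (co)sheaves of $\mathbb F_2$-vector spaces: a sheaf has functorial maps $\mathcal G(e')\to\mathcal G(e)$ for $e'\le e$, a cosheaf has maps $\mathcal F(e)\to\mathcal F(e')$; $H^q,H_q$ are the cellular (co)homologies. Tropical Hodge numbers. $\mathrm{Sed}(Q)=(TQ^\perp\cap N)\otimes\mathbb F_2$. On $X$, $\mathcal F^X_p(\sigma,Q)=\sum_{\sigma^1\le\sigma}\bigwedge^p\big(((T\sigma^1)^\perp\cap N)\otimes\mathbb F_2/\mathrm{Sed}(Q)\big)\subset\bigwedge^p(N_2/\mathrm{Sed}(Q))$ (sum over edges of $\sigma$), a cosheaf with transition maps induced by projections; $h^{p,q}(X)=\dim H_q(X;\mathcal F^X_p)$. T-hypersurface. A sign distribution is an element of $C^0(K;\mathbb F_2)$. The real locus $\mathcal Y(\mathbb R)$ of the toric variety of $P$ is the quotient of $N_2\times P$ by $(u,x)\sim(u',x)$ iff $u-u'\in\mathrm{Sed}(Q_x)$, $Q_x$ the smallest face containing $x$; $u\cdot E$ is the image of $\{u\}\times E$. Its torus is the image of $N_2\times\mathrm{int}(P)$ and its toric divisors are the images of $N_2\times F$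 for $F$ a facet of $P$. $\mathbb RX_\varepsilon\subset\mathcal Y(\mathbb R)$ is the union of the cells $u\cdot(\sigma^1)^*$ over edges $\sigma^1$ of $K$ with vertices $v_0,v_1$ and $u\in N_2$ with $\langle v_0-v_1,u\rangle+\varepsilon(v_0)+\varepsilon(v_1)=1$. Waves and Hessian. $\mathcal W_1$ is the sheaf on $X$ with $\mathcal W_1(\sigma,Q)=((T\sigma)^\perp\cap N)\otimes\mathbb F_2\subset N_2$ and inclusions as transition maps. $\mathcal Z^1$ is the sheaf $[\sigma,Q]\mapsto Z^1(\sigma;\mathbb F_2)$ (simplicial 1-cocycles, restrictions). There is a short exact sequence $0\to\mathcal W_1\to N_2\xrightarrow{z}\mathcal Z^1|_X\to0$ with $N_2$ constant, $z(u)(\sigma^1)=\langle\omega(\sigma^1),u\rangle$. For $\varepsilon\in C^0(K;\mathbb F_2)$, $\nabla^2\varepsilon\in H^1(X;\mathcal W_1)$ is the image under the connecting morphism $H^0(X;\mathcal Z^1)\to H^1(X;\mathcal W_1)$ of the section $[\sigma,Q]\mapsto\mathrm d\varepsilon|_\sigma$. $\rho$-uniformity. $\chi_v\in C^0(K;\mathbb F_2)$ is $1$ on $v$ and $0$ elsewhere. $K$ is $\rho$-uniform if there is a (necessarily unique) $\rho\in H^1(X_0;\mathcal W_1)$ with $\rho|_{\partial v^*}=\nabla^2\chi_v|_{\partial v^*}$ for every interior vertex $v$ of $K$. *)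

theory Defs
  imports
    "HOL-Analysis.Analysis"
    "HOL-Library.Z2"
    "HOL-Library.Function_Algebras"
begin

text \<open>
  A basis of \<open>M\<close> is fixed, so \<open>M\<close> and \<open>N\<close> are both the integer points of \<open>real ^ 'd\<close>, paired by the
  standard inner product, and \<open>M\<^sub>2\<close>, \<open>N\<^sub>2\<close> are both \<open>bit ^ 'd\<close>; the rank \<open>n + 1\<close> is \<open>CARD('d)\<close>.
\<close>

section \<open>Vector spaces over the field with two elements\<close>

text \<open>An \<open>\<bbbF>\<^sub>2\<close>-vector space is the same thing as an abelian group of exponent two.\<close>

class f2_vector = ab_group_add +
  assumes add_self_eq_0: "x + x = 0"

instance bit :: f2_vector
  by standard simp

instance "fun" :: (type, f2_vector) f2_vector
  by standard (simp add: fun_eq_iff add_self_eq_0)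

instance vec :: (f2_vector, finite) f2_vector
  by standard (simp add: vec_eq_iff add_self_eq_0)

definition f2_scale :: "bit \<Rightarrow> 'v \<Rightarrow> 'v::f2_vector"
  where "f2_scale c x = (if c = 0 then 0 else x)"

global_interpretation f2: vector_space "f2_scale :: bit \<Rightarrow> 'v \<Rightarrow> 'v::f2_vector"
proof
  fix a b :: bit and x y :: 'v
  show "f2_scale a (x + y) = f2_scale a x + f2_scale a y"
    by (simp add: f2_scale_def)
  show "f2_scale (a + b) x = f2_scale a x + f2_scale b x"
    by (cases a; cases b) (simp_all add: f2_scale_def add_self_eq_0)
  show "f2_scale a (f2_scale b x) = f2_scale (a * b) x"
    by (simp add: f2_scale_def)
  show "f2_scale 1 x = x"
    by (simp add: f2_scale_def)
qed

definition pairing2 :: "bit ^ 'd \<Rightarrow> bit ^ 'd \<Rightarrow> bit"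
  where "pairing2 m u = (\<Sum>i\<in>UNIV. m $ i * u $ i)"

text \<open>
  The exterior power \<open>\<Lambda>\<^sup>p N\<^sub>2\<close> is modelled by its basis of wedges of coordinate vectors, indexed by
  the \<open>p\<close>-element sets \<open>I\<close> of coordinates. The \<open>I\<close>-coordinate of a wedge of \<open>p\<close> vectors is the
  corresponding \<open>p \<times> p\<close> minor (there are no signs over \<open>\<bbbF>\<^sub>2\<close>); it is \<open>0\<close> if \<open>card I \<noteq> p\<close>.
\<close>

definition wedge :: "(bit ^ 'd) list \<Rightarrow> ('d set \<Rightarrow> bit)"
  where "wedge us I =
    (\<Sum>g | g \<in> I \<rightarrow>\<^sub>E {..<length us} \<and> bij_betw g I {..<length us}. \<Prod>i\<in>I. (us ! g i) $ i)"

text \<open>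
  The kernel of \<open>\<Lambda>\<^sup>p N\<^sub>2 \<rightarrow> \<Lambda>\<^sup>p (N\<^sub>2 / S)\<close>, so that \<open>\<Lambda>\<^sup>p (N\<^sub>2 / S)\<close> is \<open>\<Lambda>\<^sup>p N\<^sub>2 / wedge_kernel p S\<close>.
\<close>

definition wedge_kernel :: "nat \<Rightarrow> (bit ^ 'd) set \<Rightarrow> ('d set \<Rightarrow> bit) set"
  where "wedge_kernel p S = f2.span {wedge us |us. length us = p \<and> set us \<inter> S \<noteq> {}}"

section \<open>Lattices, polytopes and triangulations\<close>

definition int_points :: "(real ^ 'd) set"
  where "int_points = {x. \<forall>i. x $ i \<in> \<int>}"

text \<open>Reduction modulo 2; only meaningful on \<^const>\<open>int_points\<close>.\<close>

definition mod2 :: "real ^ 'd \<Rightarrow> bit ^ 'd"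
  where "mod2 x = (\<chi> i. of_int \<lfloor>x $ i\<rfloor>)"

definition lattice_basis :: "(real ^ 'd) set \<Rightarrow> bool"
  where "lattice_basis B \<longleftrightarrow>
    independent B \<and> int_points = {\<Sum>b\<in>B. of_int (c b) *\<^sub>R b |c :: real ^ 'd \<Rightarrow> int. True}"

definition primitive_vector :: "real ^ 'd \<Rightarrow> bool"
  where "primitive_vector w \<longleftrightarrow> w \<in> int_points \<and> w \<noteq> 0 \<and>
    (\<forall>k::int. \<forall>w'\<in>int_points. w = of_int k *\<^sub>R w' \<longrightarrow> \<bar>k\<bar> = 1)"

definition tangent :: "(real ^ 'd) set \<Rightarrow> (real ^ 'd) set"
  where "tangent S = span {x - y |x y. x \<in> S \<and> y \<in> S}"

text \<open>
  \<open>((TS)\<^sup>\<bottom> \<inter> N) \<otimes> \<bbbF>\<^sub>2\<close>. As \<open>(TS)\<^sup>\<bottom> \<inter> N\<close> is saturated in \<open>N\<close>, its reduction embeds in \<open>N\<^sub>2\<close>.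
\<close>

definition perp2 :: "(real ^ 'd) set \<Rightarrow> (bit ^ 'd) set"
  where "perp2 S = mod2 ` (orthogonal_comp (tangent S) \<inter> int_points)"

abbreviation Sed :: "(real ^ 'd) set \<Rightarrow> (bit ^ 'd) set"
  where "Sed Q \<equiv> perp2 Q"

definition lattice_polytope :: "(real ^ 'd) set \<Rightarrow> bool"
  where "lattice_polytope P \<longleftrightarrow> polytope P \<and> {v. v extreme_point_of P} \<subseteq> int_points"

definition simple_polytope :: "(real ^ 'd) set \<Rightarrow> bool"
  where "simple_polytope P \<longleftrightarrow>
    (\<forall>v. v extreme_point_of P \<longrightarrow> int (card {F. F facet_of P \<and> v \<in> F}) = aff_dim P)"

definition edge_directions :: "(real ^ 'd) set \<Rightarrow> real ^ 'd \<Rightarrow> (real ^ 'd) set"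
  where "edge_directions P v =
    {w. primitive_vector w \<and> (\<exists>E t. E edge_of P \<and> v \<in> E \<and> t > 0 \<and> v + t *\<^sub>R w \<in> E)}"

definition smooth_lattice_polytope :: "(real ^ 'd) set \<Rightarrow> bool"
  where "smooth_lattice_polytope P \<longleftrightarrow>
    lattice_polytope P \<and> aff_dim P = int CARD('d) \<and> simple_polytope P \<and>
    (\<forall>v. v extreme_point_of P \<longrightarrow> lattice_basis (edge_directions P v))"

text \<open>
  Simplices are convex sets of points; the empty simplex also belongs to a \<^const>\<open>simplicial_complex\<close>.
\<close>

definition primitive_triangulation :: "(real ^ 'd) set \<Rightarrow> (real ^ 'd) set set \<Rightarrow> bool"
  where "primitive_triangulation P K \<longleftrightarrow>
    simplicial_complex K \<and> \<Union>K = P \<and>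
    (\<forall>\<sigma>\<in>K. {v. v extreme_point_of \<sigma>} \<subseteq> int_points) \<and>
    (\<forall>\<sigma>\<in>K. (\<forall>\<tau>\<in>K. \<sigma> \<subseteq> \<tau> \<longrightarrow> \<tau> = \<sigma>) \<longrightarrow> measure lebesgue \<sigma> = 1 / fact CARD('d))"

definition interior_vertices :: "(real ^ 'd) set \<Rightarrow> (real ^ 'd) set set \<Rightarrow> (real ^ 'd) set"
  where "interior_vertices P K = {v. {v} \<in> K \<and> v \<in> interior P}"

definition edge_class :: "(real ^ 'd) set \<Rightarrow> bit ^ 'd"
  \<comment> \<open>\<open>\<omega>\<close>: modulo 2 the difference of the two endpoints is their sum\<close>
  where "edge_class s = (\<Sum>v | v extreme_point_of s. mod2 v)"

section \<open>The CW structures \<open>Y\<close>, \<open>X\<close> and \<open>X\<^sub>0\<close>\<close>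

text \<open>The cell \<open>[\<sigma>, Q]\<close> is encoded by the pair \<open>(\<sigma>, Q)\<close>.\<close>

type_synonym 'd cell = "(real ^ 'd) set \<times> (real ^ 'd) set"

definition Y_cells :: "(real ^ 'd) set \<Rightarrow> (real ^ 'd) set set \<Rightarrow> 'd cell set"
  where "Y_cells P K = {(\<sigma>, Q). \<sigma> \<in> K \<and> \<sigma> \<noteq> {} \<and> Q face_of P \<and> \<sigma> \<subseteq> Q}"

definition cell_le :: "('d::finite) cell \<Rightarrow> 'd cell \<Rightarrow> bool"
  where "cell_le e' e \<longleftrightarrow> fst e face_of fst e' \<and> snd e' \<subseteq> snd e"

definition cell_dim :: "('d::finite) cell \<Rightarrow> int"
  where "cell_dim e = aff_dim (snd e) - aff_dim (fst e)"

definition X_cells :: "(real ^ 'd) set \<Rightarrow> (real ^ 'd) set set \<Rightarrow> 'd cell set"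
  where "X_cells P K = {e \<in> Y_cells P K. aff_dim (fst e) \<ge> 1}"

definition X0_cells :: "(real ^ 'd) set \<Rightarrow> (real ^ 'd) set set \<Rightarrow> 'd cell set"
  where "X0_cells P K = {e \<in> X_cells P K. \<exists>v\<in>interior_vertices P K. cell_le e ({v}, P)}"

text \<open>The boundary of the ball \<open>v\<^sup>* = [v, P]\<close>; it lies in \<open>X\<close> if \<open>v\<close> is an interior vertex.\<close>

definition star_boundary :: "(real ^ 'd) set \<Rightarrow> (real ^ 'd) set set \<Rightarrow> real ^ 'd \<Rightarrow> 'd cell set"
  where "star_boundary P K v = {e \<in> Y_cells P K. cell_le e ({v}, P) \<and> e \<noteq> ({v}, P)}"

text \<open>Geometric realisation of the cells, via the barycentric subdivision.\<close>

definition barycenter :: "(real ^ 'd) set \<Rightarrow> real ^ 'd"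
  where "barycenter \<sigma> =
    (\<Sum>v | v extreme_point_of \<sigma>. v) /\<^sub>R real (card {v. v extreme_point_of \<sigma>})"

definition flags :: "(real ^ 'd) set \<Rightarrow> (real ^ 'd) set \<Rightarrow> (real ^ 'd) set set set"
  where "flags \<sigma> \<tau> = {C. C \<noteq> {} \<and> (\<forall>a\<in>C. \<sigma> face_of a \<and> a face_of \<tau>) \<and>
    (\<forall>a\<in>C. \<forall>b\<in>C. a face_of b \<or> b face_of a)}"

definition cubical_cell :: "(real ^ 'd) set \<Rightarrow> (real ^ 'd) set \<Rightarrow> (real ^ 'd) set"
  where "cubical_cell \<sigma> \<tau> = (\<Union>C\<in>flags \<sigma> \<tau>. convex hull (barycenter ` C))"

definition cell_points :: "(real ^ 'd) set set \<Rightarrow> 'd cell \<Rightarrow> (real ^ 'd) set"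
  where "cell_points K e =
    (\<Union>\<tau>\<in>{\<tau>\<in>K. fst e face_of \<tau> \<and> \<tau> \<subseteq> snd e}. cubical_cell (fst e) \<tau>)"

section \<open>Cellular sheaves, cosheaves and their (co)homology\<close>

text \<open>\<open>A\<close> always denotes the set of cells of a finite complex.\<close>

definition cell_chains :: "('d::finite) cell set \<Rightarrow> ('d cell \<Rightarrow> 'v set) \<Rightarrow> int \<Rightarrow> ('d cell \<Rightarrow> 'v::f2_vector) set"
  where "cell_chains A S q =
    {f. \<forall>e. if e \<in> A \<and> cell_dim e = q then f e \<in> S e else f e = 0}"

record ('d, 'v) cell_sheaf =
  stalk :: "'d cell \<Rightarrow> 'v set"
  trans_map :: "'d cell \<Rightarrow> 'd cell \<Rightarrow> 'v \<Rightarrow> 'v" \<comment> \<open>\<open>trans_map G e' e\<close> goes from \<open>e'\<close> to \<open>e\<close>, for \<open>e' \<le> e\<close>\<close>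

definition coboundary ::
    "('d::finite) cell set \<Rightarrow> ('d, 'v::f2_vector) cell_sheaf \<Rightarrow> ('d cell \<Rightarrow> 'v) \<Rightarrow> 'd cell \<Rightarrow> 'v"
  where "coboundary A G f e =
    (if e \<in> A then \<Sum>e' | e' \<in> A \<and> cell_le e' e \<and> cell_dim e' + 1 = cell_dim e. trans_map G e' e (f e')
     else 0)"

definition cocycles ::
    "('d::finite) cell set \<Rightarrow> ('d, 'v::f2_vector) cell_sheaf \<Rightarrow> int \<Rightarrow> ('d cell \<Rightarrow> 'v) set"
  where "cocycles A G q = {f \<in> cell_chains A (stalk G) q. coboundary A G f = 0}"

definition coboundaries ::
    "('d::finite) cell set \<Rightarrow> ('d, 'v::f2_vector) cell_sheaf \<Rightarrow> int \<Rightarrow> ('d cell \<Rightarrow> 'v) set"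
  where "coboundaries A G q = coboundary A G ` cell_chains A (stalk G) (q - 1)"

definition cohomologous ::
    "('d::finite) cell set \<Rightarrow> ('d, 'v::f2_vector) cell_sheaf \<Rightarrow> int \<Rightarrow> (('d cell \<Rightarrow> 'v) \<times> ('d cell \<Rightarrow> 'v)) set"
  where "cohomologous A G q =
    {(f, g). f \<in> cocycles A G q \<and> g \<in> cocycles A G q \<and> f - g \<in> coboundaries A G q}"

definition cohomology ::
    "('d::finite) cell set \<Rightarrow> ('d, 'v::f2_vector) cell_sheaf \<Rightarrow> int \<Rightarrow> ('d cell \<Rightarrow> 'v) set set"
  where "cohomology A G q = cocycles A G q // cohomologous A G q"

text \<open>Restriction of a cohomology class \<open>c\<close> to the subcomplex \<open>A\<close>.\<close>

definition restrict_class ::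
    "('d::finite) cell set \<Rightarrow> ('d, 'v::f2_vector) cell_sheaf \<Rightarrow> int \<Rightarrow> ('d cell \<Rightarrow> 'v) set \<Rightarrow> ('d cell \<Rightarrow> 'v) set"
  where "restrict_class A G q c =
    cohomologous A G q `` ((\<lambda>f e. if e \<in> A then f e else 0) ` c)"

text \<open>
  The connecting morphism \<open>H\<^sup>q(A; C) \<rightarrow> H\<^sup>q\<^sup>+\<^sup>1(A; W)\<close> of a short exact sequence
  \<open>0 \<rightarrow> W \<rightarrow> E \<rightarrow> C \<rightarrow> 0\<close> whose first map is an inclusion and whose second map is \<open>z\<close>. The coboundaries
  of all lifts of all representatives of a class \<open>c\<close> form exactly one class.
\<close>

definition connecting ::
    "('d::finite) cell set \<Rightarrow> ('d, 'v::f2_vector) cell_sheaf \<Rightarrow> ('d, 'v) cell_sheaf \<Rightarrow> ('d cell \<Rightarrow> 'v \<Rightarrow> 'w) \<Rightarrow> int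
      \<Rightarrow> ('d cell \<Rightarrow> 'w) set \<Rightarrow> ('d cell \<Rightarrow> 'v) set"
  where "connecting A W E z q c =
    {x \<in> cocycles A W (q + 1). \<exists>s\<in>c. \<exists>t\<in>cell_chains A (stalk E) q.
       (\<forall>e\<in>A. cell_dim e = q \<longrightarrow> z e (t e) = s e) \<and> coboundary A E t = x}"

text \<open>
  A cosheaf is given by subquotients \<open>U e / D e\<close> of one fixed vector space, with transition maps induced
  by the identity (so \<open>U e \<subseteq> U e'\<close> and \<open>D e \<subseteq> D e'\<close> for \<open>e' \<le> e\<close>). Cycles and boundaries are those
  of the quotient chain complex, pulled back to chains with values in \<open>U\<close>.
\<close>

definition boundary_map :: "('d::finite) cell set \<Rightarrow> ('d cell \<Rightarrow> 'v::f2_vector) \<Rightarrow> 'd cell \<Rightarrow> 'v"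
  where "boundary_map A f e' =
    (if e' \<in> A then \<Sum>e | e \<in> A \<and> cell_le e' e \<and> cell_dim e' + 1 = cell_dim e. f e else 0)"

definition cell_cycles ::
    "('d::finite) cell set \<Rightarrow> ('d cell \<Rightarrow> 'v set) \<Rightarrow> ('d cell \<Rightarrow> 'v set) \<Rightarrow> int \<Rightarrow> ('d cell \<Rightarrow> 'v::f2_vector) set"
  where "cell_cycles A U D q = {f \<in> cell_chains A U q. boundary_map A f \<in> cell_chains A D (q - 1)}"

definition cell_boundaries ::
    "('d::finite) cell set \<Rightarrow> ('d cell \<Rightarrow> 'v set) \<Rightarrow> ('d cell \<Rightarrow> 'v set) \<Rightarrow> int \<Rightarrow> ('d cell \<Rightarrow> 'v::f2_vector) set"
  where "cell_boundaries A U D q =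
    {boundary_map A f + g |f g. f \<in> cell_chains A U (q + 1) \<and> g \<in> cell_chains A D q}"

definition homology_dim ::
    "('d::finite) cell set \<Rightarrow> ('d cell \<Rightarrow> 'v set) \<Rightarrow> ('d cell \<Rightarrow> 'v::f2_vector set) \<Rightarrow> int \<Rightarrow> nat"
  where "homology_dim A U D q = f2.dim (cell_cycles A U D q) - f2.dim (cell_boundaries A U D q)"

section \<open>Tropical Hodge numbers\<close>

text \<open>
  \<open>\<F>\<^sub>p\<^sup>X(\<sigma>, Q)\<close> is \<open>hodge_num p (\<sigma>, Q) / hodge_den p (\<sigma>, Q)\<close>, inside
  \<open>\<Lambda>\<^sup>p (N\<^sub>2 / Sed Q) = \<Lambda>\<^sup>p N\<^sub>2 / hodge_den p (\<sigma>, Q)\<close>.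
\<close>

definition hodge_den :: "nat \<Rightarrow> ('d::finite) cell \<Rightarrow> ('d set \<Rightarrow> bit) set"
  where "hodge_den p e = wedge_kernel p (Sed (snd e))"

definition hodge_num :: "nat \<Rightarrow> ('d::finite) cell \<Rightarrow> ('d set \<Rightarrow> bit) set"
  where "hodge_num p e = f2.span
    ((\<Union>s\<in>{s. s edge_of fst e}. {wedge us |us. length us = p \<and> set us \<subseteq> perp2 s}) \<union> hodge_den p e)"

definition hodge_number :: "(real ^ 'd) set \<Rightarrow> (real ^ 'd) set set \<Rightarrow> nat \<Rightarrow> nat \<Rightarrow> nat"
  where "hodge_number P K p q = homology_dim (X_cells P K) (hodge_num p) (hodge_den p) (int q)"

section \<open>Waves, Hessian and uniformity\<close>

definition wave_sheaf :: "('d, bit ^ 'd) cell_sheaf"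
  where "wave_sheaf = \<lparr>stalk = (\<lambda>e. perp2 (fst e)), trans_map = (\<lambda>e' e u. u)\<rparr>"

definition constant_sheaf :: "('d, bit ^ 'd) cell_sheaf"
  where "constant_sheaf = \<lparr>stalk = (\<lambda>e. UNIV), trans_map = (\<lambda>e' e u. u)\<rparr>"

definition simplex_cocycles :: "(real ^ 'd) set \<Rightarrow> ((real ^ 'd) set \<Rightarrow> bit) set"
  where "simplex_cocycles \<sigma> = {c. (\<forall>s. \<not> s edge_of \<sigma> \<longrightarrow> c s = 0) \<and>
    (\<forall>\<tau>. \<tau> face_of \<sigma> \<and> aff_dim \<tau> = 2 \<longrightarrow> (\<Sum>s | s edge_of \<tau>. c s) = 0)}"

definition cocycle_sheaf :: "('d, (real ^ 'd) set \<Rightarrow> bit) cell_sheaf"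
  where "cocycle_sheaf = \<lparr>stalk = (\<lambda>e. simplex_cocycles (fst e)),
    trans_map = (\<lambda>e' e c s. if s edge_of fst e then c s else 0)\<rparr>"

definition wave_quotient_map :: "'d cell \<Rightarrow> bit ^ 'd \<Rightarrow> (real ^ 'd) set \<Rightarrow> bit"
  where "wave_quotient_map e u s = (if s edge_of fst e then pairing2 (edge_class s) u else 0)"

text \<open>
  An element of \<open>C\<^sup>0(K; \<bbbF>\<^sub>2)\<close> is a function on all points, of which only the values at the vertices
  of \<open>K\<close> are ever used.
\<close>

definition differential :: "(real ^ 'd \<Rightarrow> bit) \<Rightarrow> (real ^ 'd) set \<Rightarrow> bit"
  where "differential \<epsilon> s = (\<Sum>v | v extreme_point_of s. \<epsilon> v)"

definition differential_section ::
    "(real ^ 'd) set \<Rightarrow> (real ^ 'd) set set \<Rightarrow> (real ^ 'd \<Rightarrow> bit) \<Rightarrow> 'd cell \<Rightarrow> (real ^ 'd) set \<Rightarrow> bit"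
  where "differential_section P K \<epsilon> e s =
    (if e \<in> X_cells P K \<and> cell_dim e = 0 \<and> s edge_of fst e then differential \<epsilon> s else 0)"
  \<comment> \<open>a global section is represented by its values on the \<open>0\<close>-cells\<close>

definition hessian ::
    "(real ^ 'd) set \<Rightarrow> (real ^ 'd) set set \<Rightarrow> (real ^ 'd \<Rightarrow> bit) \<Rightarrow> ('d cell \<Rightarrow> bit ^ 'd) set"
  where "hessian P K \<epsilon> =
    connecting (X_cells P K) wave_sheaf constant_sheaf wave_quotient_map 0
      (cohomologous (X_cells P K) cocycle_sheaf 0 `` {differential_section P K \<epsilon>})"

definition rho_uniform ::
    "(real ^ 'd) set \<Rightarrow> (real ^ 'd) set set \<Rightarrow> ('d cell \<Rightarrow> bit ^ 'd) set \<Rightarrow> bool"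
  where "rho_uniform P K \<rho> \<longleftrightarrow>
    \<rho> \<in> cohomology (X0_cells P K) wave_sheaf 1 \<and>
    (\<forall>v\<in>interior_vertices P K.
      restrict_class (star_boundary P K v) wave_sheaf 1 \<rho> =
      restrict_class (star_boundary P K v) wave_sheaf 1 (hessian P K (\<lambda>w. if w = v then 1 else 0)))"

section \<open>The real toric variety and T-hypersurfaces\<close>

definition quotient_top :: "'a topology \<Rightarrow> ('a \<times> 'a) set \<Rightarrow> 'a set topology"
  where "quotient_top T r =
    topology (\<lambda>U. U \<subseteq> topspace T // r \<and> openin T {x \<in> topspace T. r `` {x} \<in> U})"

lemma openin_quotient_top:
  "openin (quotient_top T r) U \<longleftrightarrow>
    U \<subseteq> topspace T // r \<and> openin T {x \<in> topspace T. r `` {x} \<in> U}"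
proof -
  have "istopology (\<lambda>U. U \<subseteq> topspace T // r \<and> openin T {x \<in> topspace T. r `` {x} \<in> U})"
    unfolding istopology_def
  proof (intro conjI allI impI)
    fix S U :: "'a set set"
    assume S: "S \<subseteq> topspace T // r \<and> openin T {x \<in> topspace T. r `` {x} \<in> S}"
      and U: "U \<subseteq> topspace T // r \<and> openin T {x \<in> topspace T. r `` {x} \<in> U}"
    show "S \<inter> U \<subseteq> topspace T // r" using S by blast
    have "{x \<in> topspace T. r `` {x} \<in> S \<inter> U} =
        {x \<in> topspace T. r `` {x} \<in> S} \<inter> {x \<in> topspace T. r `` {x} \<in> U}" by blast
    then show "openin T {x \<in> topspace T. r `` {x} \<in> S \<inter> U}" using S U by auto
  next
    fix \<K> :: "'a set set set"
    assume K: "\<forall>U\<in>\<K>. U \<subseteq> topspace T // r \<and> openin T {x \<in> topspace T. r `` {x} \<in> U}"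
    then show "\<Union>\<K> \<subseteq> topspace T // r" by blast
    have "{x \<in> topspace T. r `` {x} \<in> \<Union>\<K>} = (\<Union>U\<in>\<K>. {x \<in> topspace T. r `` {x} \<in> U})" by blast
    then show "openin T {x \<in> topspace T. r `` {x} \<in> \<Union>\<K>}" using K by auto
  qed
  then show ?thesis by (simp add: quotient_top_def topology_inverse')
qed

lemma topspace_quotient_top: "topspace (quotient_top T r) = topspace T // r"
proof -
  have "{x \<in> topspace T. r `` {x} \<in> topspace T // r} = topspace T"
    by (auto simp: quotient_def)
  then have "openin (quotient_top T r) (topspace T // r)"
    by (simp add: openin_quotient_top)
  then show ?thesis
    by (metis openin_quotient_top openin_subset openin_topspace subset_antisym)
qed

lemma quotient_map_quotient_top: "quotient_map T (quotient_top T r) (\<lambda>x. r `` {x})"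
  by (auto simp: quotient_map_def topspace_quotient_top openin_quotient_top quotient_def)

definition smallest_face :: "(real ^ 'd) set \<Rightarrow> real ^ 'd \<Rightarrow> (real ^ 'd) set"
  where "smallest_face P x = \<Inter>{F. F face_of P \<and> x \<in> F}"

definition real_locus_rel :: "(real ^ 'd) set \<Rightarrow> (((bit ^ 'd) \<times> (real ^ 'd)) \<times> ((bit ^ 'd) \<times> (real ^ 'd))) set"
  where "real_locus_rel P =
    {((u, x), (u', x')). x \<in> P \<and> x' = x \<and> u - u' \<in> Sed (smallest_face P x)}"

definition real_locus :: "(real ^ 'd) set \<Rightarrow> ((bit ^ 'd) \<times> (real ^ 'd)) set topology"
  where "real_locus P =
    quotient_top (prod_topology (discrete_topology UNIV) (top_of_set P)) (real_locus_rel P)"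

text \<open>The image of \<open>S \<subseteq> N\<^sub>2 \<times> P\<close>.\<close>

definition real_locus_image ::
    "(real ^ 'd) set \<Rightarrow> ((bit ^ 'd) \<times> (real ^ 'd)) set \<Rightarrow> ((bit ^ 'd) \<times> (real ^ 'd)) set set"
  where "real_locus_image P S = (\<lambda>x. real_locus_rel P `` {x}) ` S"

definition torus :: "(real ^ 'd) set \<Rightarrow> ((bit ^ 'd) \<times> (real ^ 'd)) set set"
  where "torus P = real_locus_image P (UNIV \<times> interior P)"

definition toric_divisor :: "(real ^ 'd) set \<Rightarrow> (real ^ 'd) set \<Rightarrow> ((bit ^ 'd) \<times> (real ^ 'd)) set set"
  where "toric_divisor P F = real_locus_image P (UNIV \<times> F)"

definition T_hypersurface ::
    "(real ^ 'd) set \<Rightarrow> (real ^ 'd) set set \<Rightarrow> (real ^ 'd \<Rightarrow> bit) \<Rightarrow> ((bit ^ 'd) \<times> (real ^ 'd)) set set"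
  where "T_hypersurface P K \<epsilon> =
    \<Union>{real_locus_image P ({u} \<times> cell_points K (s, P)) |u s. s \<in> K \<and> aff_dim s = 1 \<and>
       (\<exists>v\<^sub>0 v\<^sub>1. v\<^sub>0 \<noteq> v\<^sub>1 \<and> {v. v extreme_point_of s} = {v\<^sub>0, v\<^sub>1} \<and>
          pairing2 (mod2 (v\<^sub>0 - v\<^sub>1)) u + \<epsilon> v\<^sub>0 + \<epsilon> v\<^sub>1 = 1)}"

text \<open>\<open>S\<close> is a sphere of dimension \<open>CARD('d) - 1\<close> in the real locus, bounding the closed ball \<open>B\<close>.\<close>

definition sphere_bounding_ball ::
    "(real ^ 'd) set \<Rightarrow> ((bit ^ 'd) \<times> (real ^ 'd)) set set \<Rightarrow> ((bit ^ 'd) \<times> (real ^ 'd)) set set \<Rightarrow> bool"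
  where "sphere_bounding_ball P S B \<longleftrightarrow> B \<subseteq> topspace (real_locus P) \<and>
    (\<exists>h. homeomorphic_map (top_of_set (cball (0 :: real ^ 'd) 1)) (subtopology (real_locus P) B) h \<and>
         h ` sphere 0 1 = S)"

end

theory Submission
  imports Defs
begin

text \<open>
  In the orthant \<open>u\<close> a vertex \<open>v\<close> of \<open>K\<close> has the sign \<open>\<epsilon> v + \<langle>v, u\<rangle>\<close>, and the hypersurface consists of the
  points \<open>x\<close> at which the sign is not constant on the vertices with maximal barycentric coordinate. The
  equation for \<open>\<nabla>\<^sup>2\<epsilon>\<close> says that on the star of every interior vertex \<open>v\<close> the function \<open>\<epsilon> + \<chi>\<^sub>v\<close> is affine, so
  there is exactly one orthant \<open>U v\<close> in which \<open>v\<close> is the only vertex of its sign in its star; in this orthant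
  the hypersurface contains the boundary of the ball \<open>v\<^sup>*\<close> as an open and closed sphere.

  That the rest is connected is shown with a locally constant function \<open>\<phi>\<close> on the hypersurface with values in
  \<open>\<bbbF>\<^sub>2\<close>. On a maximal simplex \<open>\<tau>\<close>, where \<open>\<epsilon>\<close> is affine with gradient \<open>g\<close>, it has the moment
  \<open>\<Sum>u. \<phi> \<tau> u (u + g)\<close>. The moments satisfy a cocycle condition at every wall, hence they are the gradients of a
  function \<open>f\<close> on the vertices that vanishes on the boundary. Subtracting from \<open>\<phi>\<close> the indicator functions of
  the spheres around the vertices with \<open>f v = 1\<close> makes all moments zero; then \<open>\<phi>\<close> does not change across
  interior walls and is invariant under \<open>Sed F\<close> for every facet \<open>F\<close>. As \<open>P\<close> is smooth, these subgroups
  generate \<open>N\<^sub>2\<close>, and \<open>\<phi>\<close> is constant.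

  The families of covectors on the maximal simplices with the same cocycle condition are dual to
  \<open>H\<^sub>0(X; F\<^sub>n)\<close>, which makes \<open>h\<^sup>n\<^sup>,\<^sup>0\<close> the number of interior vertices.
\<close>

section \<open>Convexity and simplicial complexes\<close>

text \<open>Primitivity makes the edge differences of a maximal simplex a basis of the lattice, so
  over F2 each vertex function has exactly one gradient there; the combinatorics is done with these
  gradients instead of cells.

  The moment works for the following reason. Choose the free value of \<phi> at the gradient so that
  \<phi> has sum zero over all orthants; then its moment does not depend on the origin. Across an
  interior wall with conormal q the function can change only in the two orthants where the sign is
  constant on the wall. The sum condition makes both changes equal to one bit c, so the moment
  changes by c q. Hence moments agree along the wall, and equal moments force c = 0.

  That a compatible family integrates to a vertex function is the vanishing of the first cohomology
  of the convex set P, obtained by sampling along segments. It serves twice: for connectedness and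
  for the Hodge number, where a functional on 0-chains that kills boundaries is a compatible family,
  because a wedge of degree n perpendicular to an edge is a multiple of the class of that
  edge.\<close>

definition verts :: "(real ^ 'd::finite) set \<Rightarrow> (real ^ 'd) set"
  where "verts \<sigma> = {v. v extreme_point_of \<sigma>}"

text \<open>Join a point outside \<open>A j\<close> to a point outside all the other sets. Each
  \<open>A i\<close> meets the segment in at most one point, since two points would put the whole
  line and both ends into \<open>A i\<close>; finitely many points do not cover a segment. This
  provides generic points later on.\<close>

lemma convex_subset_finite_Union_affine:
  fixes C :: "'a::euclidean_space set"
  assumes "finite I" "convex C" "C \<noteq> {}" "C \<subseteq> (\<Union>i\<in>I. A i)" "\<And>i. i \<in> I \<Longrightarrow> affine (A i)"
  shows "\<exists>i\<in>I. C \<subseteq> A i"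
  using assms
proof (induction I rule: finite_induct)
  case empty
  then show ?case by simp
next
  case (insert j I)
  show ?case
  proof (rule ccontr)
    assume no: "\<not> (\<exists>i\<in>insert j I. C \<subseteq> A i)"
    then have "\<not> C \<subseteq> (\<Union>i\<in>I. A i)" using insert by auto
    then obtain y where y: "y \<in> C" "\<And>i. i \<in> I \<Longrightarrow> y \<notin> A i" by auto
    obtain x where x: "x \<in> C" "x \<notin> A j" using no by auto
    have yj: "y \<in> A j" using insert.prems(3) y by auto
    have "x \<noteq> y" using x yj by auto
    define g where "g t = (1 - t) *\<^sub>R x + t *\<^sub>R y" for t :: real
    have inj: "inj g"
    proof (rule injI)
      fix s t assume "g s = g t"
      then have "(t - s) *\<^sub>R (x - y) = 0" by (simp add: g_def algebra_simps)
      then show "s = t" using \<open>x \<noteq> y\<close> by simp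
    qed
    have two: "s = t" if "i \<in> insert j I" "g s \<in> A i" "g t \<in> A i" for i s t
    proof (rule ccontr)
      assume st: "s \<noteq> t"
      have aff: "affine (A i)" using insert.prems(4) that(1) .
      have line: "g r \<in> A i" for r
      proof -
        have "g r = (1 - (r - s) / (t - s)) *\<^sub>R g s + ((r - s) / (t - s)) *\<^sub>R g t"
        proof -
          define c where "c = (r - s) / (t - s)"
          have "c * (t - s) = r - s" using st by (simp add: c_def)
          then have c: "r = (1 - c) * s + c * t" by (simp add: algebra_simps)
          have "(1 - c) *\<^sub>R g s + c *\<^sub>R g t = g ((1 - c) * s + c * t)"
            by (simp add: g_def algebra_simps)
          also have "\<dots> = g r" by (simp only: c[symmetric])
          finally show ?thesis by (simp only: c_def)
        qed
        then show ?thesis using aff that unfolding affine_alt by metis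
      qed
      have "x \<in> A i" "y \<in> A i" using line[of 0] line[of 1] by (auto simp: g_def)
      then show False using x y that(1) by auto
    qed
    have sub: "g ` {0..1} \<subseteq> C"
      using insert.prems(1) x y unfolding g_def convex_alt by auto
    have "{0..1} \<subseteq> (\<Union>i\<in>insert j I. {t. g t \<in> A i})"
      using sub insert.prems(3) by auto
    moreover have "finite {t. g t \<in> A i}" if "i \<in> insert j I" for i
    proof (cases "{t. g t \<in> A i} = {}")
      case False
      then obtain s where "g s \<in> A i" by auto
      then have "{t. g t \<in> A i} \<subseteq> {s}" using two[OF that] by auto
      then show ?thesis using finite_subset by blast
    qed simp
    ultimately have "finite {0..1::real}"
      using insert.hyps(1) by (meson finite.insertI finite_UN finite_subset)
    then show False by (simp add: infinite_Icc)
  qed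
qed

text \<open>
  Both sides are sampled at the points \<open>b + (j / m) (x - b)\<close> of the segments from a base point; the
  differences along the rungs between the two ladders telescope.
\<close>

lemma convex_local_cocycle_is_coboundary:
  fixes S :: "'a::real_normed_vector set" and g :: "'a \<Rightarrow> 'a \<Rightarrow> 'b::ab_group_add"
  assumes "convex S" "bounded S" "\<delta> > 0"
    and cocycle: "\<And>x y z. \<lbrakk>x \<in> S; y \<in> S; z \<in> S; dist x y < \<delta>; dist y z < \<delta>; dist x z < \<delta>\<rbrakk>
        \<Longrightarrow> g x y + g y z = g x z"
  shows "\<exists>f. \<exists>\<delta>'>0. \<forall>x\<in>S. \<forall>y\<in>S. dist x y < \<delta>' \<longrightarrow> g x y = f y - f x"
proof (cases "S = {}")
  case True
  then show ?thesis using zero_less_one by blast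
next
  case False
  then obtain b where b: "b \<in> S" by auto
  obtain D where D: "D > 0" "\<And>x. x \<in> S \<Longrightarrow> dist b x < D"
  proof -
    obtain D where D: "\<forall>x\<in>S. dist b x \<le> D" using \<open>bounded S\<close> bounded_any_center by blast
    have "dist b x < \<bar>D\<bar> + 1" if "x \<in> S" for x using D that by fastforce
    then show ?thesis using that[of "\<bar>D\<bar> + 1"] by simp
  qed
  \<comment> \<open>With ladder steps and rungs both shorter than \<delta> / 2 the diagonal of every
    square is shorter than \<delta>, so the cocycle identity applies to both of its
    triangles.\<close>
  obtain m :: nat where m: "D / (\<delta> / 2) < real m" using reals_Archimedean2 by blast
  have m0: "m > 0" using m D \<open>\<delta> > 0\<close> by (metis divide_pos_pos half_gt_zero gr0I of_nat_0 order_less_asym)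
  define p where "p x j = b + (real j / real m) *\<^sub>R (x - b)" for x and j :: nat
  have p0: "p x 0 = b" and pm: "p x m = x" for x using m0 by (auto simp: p_def)
  have pS: "p x j \<in> S" if "x \<in> S" "j \<le> m" for x j
  proof -
    have "p x j = (1 - real j / real m) *\<^sub>R b + (real j / real m) *\<^sub>R x" by (simp add: p_def algebra_simps)
    then show ?thesis using \<open>convex S\<close> b that m0 unfolding convex_alt by simp
  qed
  have step: "dist (p x j) (p x (Suc j)) < \<delta> / 2" if "x \<in> S" for x j
  proof -
    have "p x (Suc j) - p x j = (1 / real m) *\<^sub>R (x - b)"
      by (simp add: p_def scaleR_diff_left[symmetric] diff_divide_distrib[symmetric])
    then have "dist (p x j) (p x (Suc j)) = dist b x / real m"
      by (metis abs_1 abs_of_nat divide_inverse_commute dist_commute dist_norm norm_scaleR abs_divide inverse_eq_divide)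
    also have "\<dots> < D / real m" using D(2)[OF that] m0 by (simp add: divide_strict_right_mono)
    also have "\<dots> < \<delta> / 2" using m m0 \<open>\<delta> > 0\<close> by (simp add: field_simps)
    finally show ?thesis .
  qed
  have rung: "dist (p x j) (p y j) \<le> dist x y" if "j \<le> m" for x y j
  proof -
    have "p x j - p y j = (real j / real m) *\<^sub>R (x - y)" by (simp add: p_def algebra_simps)
    then have "dist (p x j) (p y j) = (real j / real m) * dist x y" by (simp add: dist_norm)
    also have "\<dots> \<le> 1 * dist x y" using that m0 by (intro mult_right_mono) auto
    finally show ?thesis by simp
  qed
  define f where "f x = (\<Sum>j<m. g (p x j) (p x (Suc j)))" for x
  have bb: "g b b = 0" using cocycle[of b b b] b \<open>\<delta> > 0\<close> by simp
  have "g x y = f y - f x" if x: "x \<in> S" and y: "y \<in> S" and xy: "dist x y < \<delta> / 2" for x y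
  proof -
    have sq: "g (p x j) (p x (Suc j)) + g (p x (Suc j)) (p y (Suc j)) =
        g (p x j) (p y j) + g (p y j) (p y (Suc j))" if "j < m" for j
    proof -
      have a: "dist (p x (Suc j)) (p y (Suc j)) < \<delta> / 2" "dist (p x j) (p y j) < \<delta> / 2"
        using rung[of "Suc j" x y] rung[of j x y] xy that by auto
      have b: "dist (p x j) (p y (Suc j)) < \<delta>"
        using dist_triangle[of "p x j" "p y (Suc j)" "p x (Suc j)"] a step[OF x, of j] by simp
      have mem: "p x j \<in> S" "p x (Suc j) \<in> S" "p y j \<in> S" "p y (Suc j) \<in> S"
        using pS x y that by auto
      have "g (p x j) (p x (Suc j)) + g (p x (Suc j)) (p y (Suc j)) = g (p x j) (p y (Suc j))"
        using cocycle mem a b step[OF x, of j] \<open>\<delta> > 0\<close> by auto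
      moreover have "g (p x j) (p y j) + g (p y j) (p y (Suc j)) = g (p x j) (p y (Suc j))"
        using cocycle mem a b step[OF y, of j] \<open>\<delta> > 0\<close> by auto
      ultimately show ?thesis by simp
    qed
    have "f y - f x = (\<Sum>j<m. g (p y j) (p y (Suc j)) - g (p x j) (p x (Suc j)))"
      by (simp add: f_def sum_subtractf)
    also have "\<dots> = (\<Sum>j<m. g (p x (Suc j)) (p y (Suc j)) - g (p x j) (p y j))"
      by (rule sum.cong) (use sq in \<open>auto simp: algebra_simps\<close>)
    also have "\<dots> = g (p x m) (p y m) - g (p x 0) (p y 0)"
      using sum_lessThan_telescope[of "\<lambda>j. g (p x j) (p y j)" m] by simp
    finally show ?thesis using bb by (simp add: p0 pm)
  qed
  then show ?thesis using \<open>\<delta> > 0\<close> half_gt_zero by blast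
qed

lemma affine_independent_affine_function:
  fixes S :: "'a::euclidean_space set" and h :: "'a \<Rightarrow> real"
  assumes "\<not> affine_dependent S"
  shows "\<exists>g a. linear g \<and> (\<forall>w\<in>S. g w + a = h w)"
proof (cases "S = {}")
  case True
  have "linear (\<lambda>x::'a. 0::real)" by (rule linear_zero)
  then show ?thesis using True by blast
next
  case False
  then obtain b where b: "b \<in> S" by auto
  have "independent ((\<lambda>x. - b + x) ` (S - {b}))"
    using affine_dependent_iff_dependent2[OF b] assms by simp
  then obtain g :: "'a \<Rightarrow> real" where g: "linear g" "\<forall>z\<in>(\<lambda>x. - b + x) ` (S - {b}). g z = h (z + b) - h b"
    using linear_independent_extend[where f = "\<lambda>z. h (z + b) - h b"] by blast
  have "g w + (h b - g b) = h w" if "w \<in> S" for w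
  proof (cases "w = b")
    case False
    then have "g (- b + w) = h w - h b" using g(2) that by auto
    moreover have "g (- b + w) = g w - g b"
      using linear_diff[OF g(1), of w b] by simp
    ultimately show ?thesis by simp
  qed simp
  then show ?thesis using g(1) by blast
qed

section \<open>Faces and vertices of a simplicial complex\<close>

locale simplicial =
  fixes K :: "(real ^ 'd::finite) set set"
  assumes complex: "simplicial_complex K"
begin

lemma finite_K: "finite K"
  using complex by (simp add: simplicial_complex_def)

lemma simplex_K:
  assumes "\<sigma> \<in> K"
  shows verts_independent: "\<not> affine_dependent (verts \<sigma>)"
    and convex_hull_verts: "convex hull (verts \<sigma>) = \<sigma>"
    and finite_verts: "finite (verts \<sigma>)"
    and aff_dim_eq_card: "aff_dim \<sigma> = int (card (verts \<sigma>)) - 1"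
proof -
  obtain n where "n simplex \<sigma>" using complex assms by (auto simp: simplicial_complex_def)
  then obtain C where C: "\<not> affine_dependent C" "\<sigma> = convex hull C" "int (card C) = n + 1"
    unfolding simplex_def by blast
  then have V: "verts \<sigma> = C" using extreme_point_of_convex_hull_affine_independent by (auto simp: verts_def)
  show "\<not> affine_dependent (verts \<sigma>)" "convex hull (verts \<sigma>) = \<sigma>" "finite (verts \<sigma>)"
    using V C aff_independent_finite by auto
  show "aff_dim \<sigma> = int (card (verts \<sigma>)) - 1"
    using C V aff_dim_simplex[OF \<open>n simplex \<sigma>\<close>] by simp
qed

lemma verts_sub: "\<sigma> \<in> K \<Longrightarrow> verts \<sigma> \<subseteq> \<sigma>"
  by (auto simp: verts_def extreme_point_of_def)

lemma convex_simplex: "\<sigma> \<in> K \<Longrightarrow> convex \<sigma>"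
  using convex_hull_verts convex_convex_hull by metis

lemma compact_simplex: "\<sigma> \<in> K \<Longrightarrow> compact \<sigma>"
  using convex_hull_verts finite_verts finite_imp_compact_convex_hull by metis

lemma closed_simplex: "\<sigma> \<in> K \<Longrightarrow> closed \<sigma>"
  by (simp add: compact_simplex compact_imp_closed)

lemma sub_simplex:
  assumes "\<sigma> \<in> K" "A \<subseteq> verts \<sigma>"
  shows sub_simplex_face: "convex hull A face_of \<sigma>"
    and sub_simplex_K: "convex hull A \<in> K"
    and verts_sub_simplex: "verts (convex hull A) = A"
proof -
  show 1: "convex hull A face_of \<sigma>"
    using assms face_of_convex_hull_affine_independent[OF verts_independent[OF assms(1)]]
    by (metis convex_hull_verts)
  then show "convex hull A \<in> K" using complex assms(1) by (auto simp: simplicial_complex_def)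
  show "verts (convex hull A) = A"
    using extreme_point_of_convex_hull_affine_independent
      affine_independent_subset[OF verts_independent[OF assms(1)] assms(2)] by (auto simp: verts_def)
qed

lemma face_K: "\<sigma> \<in> K \<Longrightarrow> \<rho> face_of \<sigma> \<Longrightarrow> \<rho> \<in> K"
  using complex by (auto simp: simplicial_complex_def)

lemma Int_face: "\<sigma> \<in> K \<Longrightarrow> \<tau> \<in> K \<Longrightarrow> \<sigma> \<inter> \<tau> face_of \<sigma>"
  using complex by (auto simp: simplicial_complex_def)

lemma Int_K: "\<sigma> \<in> K \<Longrightarrow> \<tau> \<in> K \<Longrightarrow> \<sigma> \<inter> \<tau> \<in> K"
  using Int_face face_K by blast

lemma verts_face: "\<rho> face_of \<sigma> \<Longrightarrow> verts \<rho> \<subseteq> verts \<sigma>"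
  by (auto simp: verts_def extreme_point_of_face)

lemma face_of_iff_subset:
  assumes "\<sigma> \<in> K" "\<tau> \<in> K"
  shows "\<sigma> face_of \<tau> \<longleftrightarrow> \<sigma> \<subseteq> \<tau>"
proof
  assume "\<sigma> \<subseteq> \<tau>"
  then have "\<tau> \<inter> \<sigma> = \<sigma>" by auto
  then show "\<sigma> face_of \<tau>" using Int_face[of \<tau> \<sigma>] assms by simp
qed (rule face_of_imp_subset)

lemma subset_iff_verts:
  assumes "\<sigma> \<in> K" "\<tau> \<in> K"
  shows "\<sigma> \<subseteq> \<tau> \<longleftrightarrow> verts \<sigma> \<subseteq> verts \<tau>"
proof
  assume "\<sigma> \<subseteq> \<tau>"
  then show "verts \<sigma> \<subseteq> verts \<tau>" using face_of_iff_subset[OF assms] verts_face by blast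
next
  assume "verts \<sigma> \<subseteq> verts \<tau>"
  then show "\<sigma> \<subseteq> \<tau>" using hull_mono convex_hull_verts assms by metis
qed

lemma verts_inject: "\<sigma> \<in> K \<Longrightarrow> \<tau> \<in> K \<Longrightarrow> verts \<sigma> = verts \<tau> \<longleftrightarrow> \<sigma> = \<tau>"
  using convex_hull_verts by metis

lemma verts_Int:
  assumes "\<sigma> \<in> K" "\<tau> \<in> K"
  shows "verts (\<sigma> \<inter> \<tau>) = verts \<sigma> \<inter> verts \<tau>"
proof
  show "verts (\<sigma> \<inter> \<tau>) \<subseteq> verts \<sigma> \<inter> verts \<tau>"
    using verts_face Int_face[OF assms] Int_face[OF assms(2,1)] by (metis Int_commute le_inf_iff)
  show "verts \<sigma> \<inter> verts \<tau> \<subseteq> verts (\<sigma> \<inter> \<tau>)"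
    by (auto simp: verts_def extreme_point_of_def)
qed

lemma vertex_in_simplex:
  assumes "\<sigma> \<in> K" "\<tau> \<in> K" "v \<in> verts \<tau>" "v \<in> \<sigma>"
  shows "v \<in> verts \<sigma>"
proof -
  have "v \<in> verts (\<sigma> \<inter> \<tau>)" using assms by (auto simp: verts_def extreme_point_of_def)
  then show ?thesis using verts_Int[OF assms(1,2)] by simp
qed

definition vertices :: "(real ^ 'd) set"
  where "vertices = (\<Union>\<sigma>\<in>K. verts \<sigma>)"

lemma finite_vertices: "finite vertices"
  unfolding vertices_def using finite_K finite_verts by auto

lemma verts_subset_vertices: "\<sigma> \<in> K \<Longrightarrow> verts \<sigma> \<subseteq> vertices"
  by (auto simp: vertices_def)

lemma vertices_eq: "vertices = {v. {v} \<in> K}"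
proof -
  have "{v} \<in> K" if "v \<in> verts \<sigma>" "\<sigma> \<in> K" for v \<sigma>
    using sub_simplex_K[of \<sigma> "{v}"] that by simp
  moreover have "v \<in> vertices" if "{v} \<in> K" for v
    using verts_subset_vertices[OF that] by (simp add: verts_def)
  ultimately show ?thesis by (auto simp: vertices_def)
qed

subsection \<open>Barycentric coordinates\<close>

text \<open>Coordinates are functions on all points that vanish off the vertices of the simplex, so
  that coordinates taken in different simplices can be compared as functions.\<close>

definition is_bc :: "real ^ 'd \<Rightarrow> (real ^ 'd \<Rightarrow> real) \<Rightarrow> bool"
  where "is_bc x l \<longleftrightarrow> (\<exists>\<sigma>\<in>K. (\<forall>v. 0 \<le> l v) \<and> (\<forall>v. v \<notin> verts \<sigma> \<longrightarrow> l v = 0) \<and> sum l (verts \<sigma>) = 1 \<and>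
    (\<Sum>v\<in>verts \<sigma>. l v *\<^sub>R v) = x)"

definition bc :: "real ^ 'd \<Rightarrow> real ^ 'd \<Rightarrow> real"
  where "bc x = (SOME l. is_bc x l)"

lemma affine_coordinate:
  fixes g :: "real ^ 'd \<Rightarrow> real"
  assumes "\<sigma> \<in> K" "linear g" "\<And>w. w \<in> verts \<sigma> \<Longrightarrow> g w + a = h w" "sum l (verts \<sigma>) = 1"
  shows "g (\<Sum>v\<in>verts \<sigma>. l v *\<^sub>R v) + a = (\<Sum>v\<in>verts \<sigma>. l v * h v)"
proof -
  have "g (\<Sum>v\<in>verts \<sigma>. l v *\<^sub>R v) + a = (\<Sum>v\<in>verts \<sigma>. l v * g v) + a * sum l (verts \<sigma>)"
    using assms(4) by (simp add: linear_sum[OF assms(2)] linear_scale[OF assms(2)])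
  also have "\<dots> = (\<Sum>v\<in>verts \<sigma>. l v * (g v + a))"
    by (simp add: sum_distrib_left sum.distrib algebra_simps)
  also have "\<dots> = (\<Sum>v\<in>verts \<sigma>. l v * h v)" by (rule sum.cong) (use assms(3) in auto)
  finally show ?thesis .
qed

lemma bary_unique_simplex:
  assumes "\<sigma> \<in> K" "sum l (verts \<sigma>) = 1" "sum l' (verts \<sigma>) = 1"
    "(\<Sum>v\<in>verts \<sigma>. l v *\<^sub>R v) = (\<Sum>v\<in>verts \<sigma>. l' v *\<^sub>R v)" "w \<in> verts \<sigma>"
  shows "l w = l' w"
proof -
  obtain g :: "real ^ 'd \<Rightarrow> real" and a where g: "linear g" "\<forall>v\<in>verts \<sigma>. g v + a = (if v = w then 1 else 0)"
    using affine_independent_affine_function[OF verts_independent[OF assms(1)], of "\<lambda>v. if v = w then 1 else 0"] by blast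
  have "(\<Sum>v\<in>verts \<sigma>. k v * (if v = w then 1 else 0)) = k w" for k :: "_ \<Rightarrow> real"
    using finite_verts[OF assms(1)] assms(5) by (simp add: if_distrib cong: if_cong)
  then show ?thesis
    using affine_coordinate[OF assms(1) g(1) _ assms(2), of a "\<lambda>v. if v = w then 1 else 0"]
      affine_coordinate[OF assms(1) g(1) _ assms(3), of a "\<lambda>v. if v = w then 1 else 0"] g(2) assms(4)
    by simp
qed

lemma bary_exists:
  assumes "\<sigma> \<in> K" "x \<in> \<sigma>"
  shows "\<exists>l. (\<forall>v. 0 \<le> l v) \<and> (\<forall>v. v \<notin> verts \<sigma> \<longrightarrow> l v = 0) \<and> sum l (verts \<sigma>) = 1 \<and>
    (\<Sum>v\<in>verts \<sigma>. l v *\<^sub>R v) = x"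
proof -
  have "x \<in> convex hull (verts \<sigma>)" using assms convex_hull_verts by simp
  then obtain u where "\<forall>v\<in>verts \<sigma>. 0 \<le> u v" "sum u (verts \<sigma>) = 1" "(\<Sum>v\<in>verts \<sigma>. u v *\<^sub>R v) = x"
    using convex_hull_finite[OF finite_verts[OF assms(1)]] by auto
  then show ?thesis
    by (intro exI[of _ "\<lambda>v. if v \<in> verts \<sigma> then u v else 0"])
      (auto simp: if_distrib[of "\<lambda>c. c *\<^sub>R _"] cong: if_cong sum.cong)
qed

text \<open>The intersection of the two simplices is a common face containing x. Coordinates of x in
  that face, extended by zero, represent x in both simplices, and within one simplex coordinates are
  unique.\<close>

lemma is_bc_unique:
  assumes "is_bc x l" "\<tau> \<in> K" "x \<in> \<tau>" "\<forall>v. v \<notin> verts \<tau> \<longrightarrow> l' v = 0" "sum l' (verts \<tau>) = 1"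
    "(\<Sum>v\<in>verts \<tau>. l' v *\<^sub>R v) = x"
  shows "l = l'"
proof -
  obtain \<sigma> where s: "\<sigma> \<in> K" "\<forall>v. 0 \<le> l v" "\<forall>v. v \<notin> verts \<sigma> \<longrightarrow> l v = 0" "sum l (verts \<sigma>) = 1"
    "(\<Sum>v\<in>verts \<sigma>. l v *\<^sub>R v) = x"
    using assms(1) unfolding is_bc_def by blast
  have "x \<in> \<sigma>"
    unfolding s(5)[symmetric] using s(2,4) verts_sub[OF s(1)] finite_verts[OF s(1)] convex_simplex[OF s(1)]
    by (intro convex_sum) auto
  then have "x \<in> \<sigma> \<inter> \<tau>" using assms by simp
  then obtain k where k: "\<forall>v. v \<notin> verts (\<sigma> \<inter> \<tau>) \<longrightarrow> k v = 0" "sum k (verts (\<sigma> \<inter> \<tau>)) = 1"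
    "(\<Sum>v\<in>verts (\<sigma> \<inter> \<tau>). k v *\<^sub>R v) = x"
    using bary_exists Int_K[OF s(1) assms(2)] by blast
  have sub: "verts (\<sigma> \<inter> \<tau>) \<subseteq> verts \<sigma>" "verts (\<sigma> \<inter> \<tau>) \<subseteq> verts \<tau>" using verts_Int[OF s(1) assms(2)] by auto
  have k1: "sum k (verts \<rho>) = 1" "(\<Sum>v\<in>verts \<rho>. k v *\<^sub>R v) = x"
    if "\<rho> \<in> K" "verts (\<sigma> \<inter> \<tau>) \<subseteq> verts \<rho>" for \<rho>
    using sum.mono_neutral_left[OF finite_verts[OF that(1)] that(2), of k]
      sum.mono_neutral_left[OF finite_verts[OF that(1)] that(2), of "\<lambda>v. k v *\<^sub>R v"] k by auto
  have "l w = k w" for w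
    using bary_unique_simplex[OF s(1) s(4) k1(1)[OF s(1) sub(1)], of w] k1(2)[OF s(1) sub(1)] s(3,5) k(1) sub
    by (cases "w \<in> verts \<sigma>") auto
  moreover have "l' w = k w" for w
    using bary_unique_simplex[OF assms(2) assms(5) k1(1)[OF assms(2) sub(2)], of w] k1(2)[OF assms(2) sub(2)] assms(4,6) k(1) sub
    by (cases "w \<in> verts \<tau>") auto
  ultimately show ?thesis by auto
qed

lemma is_bc_bc: "\<sigma> \<in> K \<Longrightarrow> x \<in> \<sigma> \<Longrightarrow> is_bc x (bc x)"
  unfolding bc_def using bary_exists[of \<sigma> x] by (intro someI_ex[of "is_bc x"]) (auto simp: is_bc_def)

lemma bc_unique:
  assumes "\<tau> \<in> K" "x \<in> \<tau>" "\<forall>v. v \<notin> verts \<tau> \<longrightarrow> l v = 0" "sum l (verts \<tau>) = 1"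
    "(\<Sum>v\<in>verts \<tau>. l v *\<^sub>R v) = x"
  shows "bc x = l"
  using is_bc_unique[OF is_bc_bc[OF assms(1,2)] assms] .

lemma bc_props:
  assumes "\<sigma> \<in> K" "x \<in> \<sigma>"
  shows bc_nonneg: "0 \<le> bc x v" and bc_zero: "v \<notin> verts \<sigma> \<Longrightarrow> bc x v = 0"
    and bc_sum: "sum (bc x) (verts \<sigma>) = 1" and bc_combination: "(\<Sum>v\<in>verts \<sigma>. bc x v *\<^sub>R v) = x"
proof -
  obtain l where l: "\<forall>v. 0 \<le> l v" "\<forall>v. v \<notin> verts \<sigma> \<longrightarrow> l v = 0" "sum l (verts \<sigma>) = 1"
    "(\<Sum>v\<in>verts \<sigma>. l v *\<^sub>R v) = x"
    using bary_exists[OF assms] by blast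
  have "bc x = l" using bc_unique[OF assms l(2-4)] .
  then show "0 \<le> bc x v" "v \<notin> verts \<sigma> \<Longrightarrow> bc x v = 0"
    "sum (bc x) (verts \<sigma>) = 1" "(\<Sum>v\<in>verts \<sigma>. bc x v *\<^sub>R v) = x"
    using l by auto
qed

lemma bc_sum_vertices: "\<sigma> \<in> K \<Longrightarrow> x \<in> \<sigma> \<Longrightarrow> sum (bc x) vertices = 1"
  using sum.mono_neutral_right[OF finite_vertices verts_subset_vertices, of \<sigma> "bc x"] bc_zero bc_sum by auto

lemma bc_convex_combination:
  assumes "\<sigma> \<in> K" "x \<in> \<sigma>" "y \<in> \<sigma>" "0 \<le> t" "t \<le> 1"
  shows "bc ((1 - t) *\<^sub>R x + t *\<^sub>R y) v = (1 - t) * bc x v + t * bc y v"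
proof -
  have "bc ((1 - t) *\<^sub>R x + t *\<^sub>R y) = (\<lambda>v. (1 - t) * bc x v + t * bc y v)"
  proof (rule bc_unique[OF assms(1)])
    show "(1 - t) *\<^sub>R x + t *\<^sub>R y \<in> \<sigma>"
      using convex_simplex[OF assms(1)] assms by (simp add: convex_alt)
    show "(\<Sum>v\<in>verts \<sigma>. ((1 - t) * bc x v + t * bc y v) *\<^sub>R v) = (1 - t) *\<^sub>R x + t *\<^sub>R y"
      using bc_combination[OF assms(1,2)] bc_combination[OF assms(1,3)]
      by (simp add: scaleR_add_left sum.distrib flip: scaleR_scaleR scaleR_sum_right)
  qed (use assms bc_zero bc_sum in \<open>auto simp: sum.distrib simp flip: sum_distrib_left\<close>)
  then show ?thesis by simp
qed

lemma bc_vertex: "\<sigma> \<in> K \<Longrightarrow> v \<in> verts \<sigma> \<Longrightarrow> bc v = (\<lambda>w. if w = v then 1 else 0)"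
  by (rule bc_unique[of \<sigma>]) (use verts_sub finite_verts in \<open>auto simp: if_distrib[of "\<lambda>c. c *\<^sub>R _"] cong: if_cong\<close>)

lemma bc_affine_on_simplex:
  assumes "\<sigma> \<in> K"
  shows "\<exists>g a. linear g \<and> (\<forall>x\<in>\<sigma>. bc x v = g x + a) \<and> (\<forall>w\<in>verts \<sigma>. g w + a = (if w = v then 1 else 0))"
proof -
  obtain g :: "real ^ 'd \<Rightarrow> real" and a where g: "linear g" "\<forall>w\<in>verts \<sigma>. g w + a = (if w = v then 1 else 0)"
    using affine_independent_affine_function[OF verts_independent[OF assms], of "\<lambda>w. if w = v then 1 else 0"] by blast
  have "bc x v = g x + a" if "x \<in> \<sigma>" for x
  proof -
    have "g x + a = (\<Sum>w\<in>verts \<sigma>. bc x w * (if w = v then 1 else 0))"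
      using affine_coordinate[OF assms g(1), of a _ "bc x"] g(2) bc_combination[OF assms that] bc_sum[OF assms that]
      by simp
    also have "\<dots> = bc x v"
      using finite_verts[OF assms] bc_zero[OF assms that] by (simp add: if_distrib cong: if_cong)
    finally show ?thesis by simp
  qed
  then show ?thesis using g by blast
qed

lemma continuous_on_bc: "continuous_on (\<Union>K) (\<lambda>x. bc x v)"
proof -
  have "continuous_on \<sigma> (\<lambda>x. bc x v)" if s: "\<sigma> \<in> K" for \<sigma>
  proof -
    obtain g :: "real ^ 'd \<Rightarrow> real" and a where "linear g" and eq: "\<forall>x\<in>\<sigma>. bc x v = g x + a"
      using bc_affine_on_simplex[OF s] by blast
    then have "continuous_on \<sigma> (\<lambda>x. g x + a)"
      by (intro continuous_intros linear_continuous_on) (simp add: linear_conv_bounded_linear)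
    then show ?thesis using eq by (metis (no_types, lifting) continuous_on_cong)
  qed
  then have "continuous_on (\<Union>\<sigma>\<in>K. \<sigma>) (\<lambda>x. bc x v)"
    by (intro continuous_on_closed_Union finite_K closed_simplex)
  then show ?thesis by simp
qed

text \<open>The vertex set of the smallest simplex containing x, for x in the union of K.\<close>

definition carrier :: "real ^ 'd \<Rightarrow> (real ^ 'd) set"
  where "carrier x = {v. bc x v > 0}"

lemma carrier_subset_iff:
  assumes "\<sigma> \<in> K" "x \<in> \<Union>K"
  shows "carrier x \<subseteq> verts \<sigma> \<longleftrightarrow> x \<in> \<sigma>"
proof
  assume sub: "carrier x \<subseteq> verts \<sigma>"
  obtain \<tau> where t: "\<tau> \<in> K" "x \<in> \<tau>" using assms by auto
  have z: "bc x v = 0" if "v \<notin> verts \<sigma>" for v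
    using sub bc_nonneg[OF t, of v] that by (force simp: carrier_def)
  have zt: "\<forall>v\<in>verts \<tau> - verts \<tau> \<inter> verts \<sigma>. bc x v = 0" using z by auto
  have zs: "\<forall>v\<in>verts \<sigma> - verts \<tau> \<inter> verts \<sigma>. bc x v = 0" using bc_zero[OF t] by auto
  have "x = (\<Sum>v\<in>verts \<sigma>. bc x v *\<^sub>R v)"
    using bc_combination[OF t] sum.mono_neutral_left[OF finite_verts[OF t(1)], of "verts \<tau> \<inter> verts \<sigma>" "\<lambda>v. bc x v *\<^sub>R v"]
      sum.mono_neutral_left[OF finite_verts[OF assms(1)], of "verts \<tau> \<inter> verts \<sigma>" "\<lambda>v. bc x v *\<^sub>R v"] zt zs by auto
  moreover have "sum (bc x) (verts \<sigma>) = 1"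
    using bc_sum[OF t] sum.mono_neutral_left[OF finite_verts[OF t(1)], of "verts \<tau> \<inter> verts \<sigma>" "bc x"]
      sum.mono_neutral_left[OF finite_verts[OF assms(1)], of "verts \<tau> \<inter> verts \<sigma>" "bc x"] zt zs by auto
  ultimately show "x \<in> \<sigma>"
    using convex_sum[OF finite_verts[OF assms(1)] convex_simplex[OF assms(1)], of "bc x" "\<lambda>v. v"] bc_nonneg[OF t]
      verts_sub[OF assms(1)] by auto
next
  assume "x \<in> \<sigma>"
  then show "carrier x \<subseteq> verts \<sigma>" using bc_zero[OF assms(1)] by (force simp: carrier_def)
qed

lemma carrier_simplex:
  assumes "x \<in> \<Union>K"
  shows "convex hull (carrier x) \<in> K" "verts (convex hull (carrier x)) = carrier x"
    "x \<in> convex hull (carrier x)" "carrier x \<noteq> {}" "finite (carrier x)"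
proof -
  obtain \<tau> where t: "\<tau> \<in> K" "x \<in> \<tau>" using assms by auto
  have sub: "carrier x \<subseteq> verts \<tau>" using carrier_subset_iff[OF t(1) assms] t by simp
  show 1: "convex hull (carrier x) \<in> K" "verts (convex hull (carrier x)) = carrier x"
    using sub_simplex[OF t(1) sub] by auto
  then show "x \<in> convex hull (carrier x)" using carrier_subset_iff[OF 1(1) assms] by simp
  then show "carrier x \<noteq> {}" by auto
  show "finite (carrier x)" using finite_subset[OF sub finite_verts[OF t(1)]] .
qed

text \<open>This set encodes the dual cells: x lies in [s, P] exactly when all vertices of s belong
  to it (\<open>cell_points_eq\<close>). The barycentric subdivision is thereby replaced by
  inequalities between coordinates.\<close>

definition maxset :: "real ^ 'd \<Rightarrow> (real ^ 'd) set"
  where "maxset x = {v \<in> vertices. \<forall>w. bc x w \<le> bc x v}"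

lemma maxset_subset_carrier: "x \<in> \<Union>K \<Longrightarrow> maxset x \<subseteq> carrier x"
  using carrier_simplex(4) by (force simp: maxset_def carrier_def intro: less_le_trans)

lemma maxset_nonempty:
  assumes "x \<in> \<Union>K"
  shows "maxset x \<noteq> {}"
proof -
  obtain \<tau> where t: "\<tau> \<in> K" "x \<in> \<tau>" using assms by auto
  have ne: "vertices \<noteq> {}" using carrier_simplex(1,2,4)[OF assms] verts_subset_vertices by blast
  define m where "m = Max (bc x ` vertices)"
  have "m \<in> bc x ` vertices" using Max_in finite_vertices ne by (auto simp: m_def)
  then obtain v where v: "v \<in> vertices" "bc x v = m" by auto
  have "bc x w \<le> m" for w
  proof (cases "w \<in> vertices")
    case True
    then show ?thesis using finite_vertices by (auto simp: m_def)
  next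
    case False
    then have "bc x w = 0" using bc_zero[OF t] verts_subset_vertices[OF t(1)] by blast
    then show ?thesis using bc_nonneg[OF t, of v] v by simp
  qed
  then show ?thesis using v by (auto simp: maxset_def)
qed

lemma maxset_subset_verts: "\<sigma> \<in> K \<Longrightarrow> x \<in> \<sigma> \<Longrightarrow> maxset x \<subseteq> verts \<sigma>"
  using maxset_subset_carrier carrier_subset_iff by blast

end

section \<open>Unimodular simplices\<close>

text \<open>
  The library computes the volume of a simplex only for index types of class \<^class>\<open>wellorder\<close>;
  every finite type has a copy of that class.
\<close>

typedef 'a ordered_copy = "UNIV :: 'a set" morphisms of_copy to_copy
  by simp

lemma bij_of_copy: "bij of_copy"
  by (metis UNIV_I bij_betw_byWitness of_copy_inverse subset_UNIV to_copy_inverse)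

instance ordered_copy :: (finite) finite
proof
  have "finite (of_copy -` UNIV :: 'a ordered_copy set)"
    by (rule finite_vimageI) (use bij_of_copy bij_is_inj in auto)
  then show "finite (UNIV :: 'a ordered_copy set)" by simp
qed

definition copy_index :: "'a::finite ordered_copy \<Rightarrow> nat"
  where "copy_index = (SOME f. inj f)"

lemma inj_copy_index: "inj copy_index"
proof -
  have "\<exists>f :: 'a ordered_copy \<Rightarrow> nat. inj f"
    using finite_imp_inj_to_nat_seg[of "UNIV :: 'a ordered_copy set"] by auto
  then show ?thesis unfolding copy_index_def by (rule someI_ex)
qed

instantiation ordered_copy :: (finite) wellorder
begin

definition less_eq_ordered_copy :: "'a ordered_copy \<Rightarrow> 'a ordered_copy \<Rightarrow> bool"
  where "x \<le> y \<longleftrightarrow> copy_index x \<le> copy_index y"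

definition less_ordered_copy :: "'a ordered_copy \<Rightarrow> 'a ordered_copy \<Rightarrow> bool"
  where "x < y \<longleftrightarrow> copy_index x < copy_index y"

instance
proof
  fix x y z :: "'a ordered_copy"
  show "(x < y) = (x \<le> y \<and> \<not> y \<le> x)" "x \<le> x" "x \<le> y \<Longrightarrow> y \<le> z \<Longrightarrow> x \<le> z" "x \<le> y \<or> y \<le> x"
    by (auto simp: less_eq_ordered_copy_def less_ordered_copy_def)
  show "x \<le> y \<Longrightarrow> y \<le> x \<Longrightarrow> x = y"
    using inj_copy_index by (auto simp: less_eq_ordered_copy_def inj_def)
next
  fix Q :: "'a ordered_copy \<Rightarrow> bool" and a
  assume step: "\<And>x. (\<And>y. y < x \<Longrightarrow> Q y) \<Longrightarrow> Q x"
  show "Q a"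
    by (induction a rule: measure_induct_rule[of copy_index]) (use step less_ordered_copy_def in blast)
qed

end

section \<open>Integral covectors on simplices of minimal volume\<close>

lemma det_Ints:
  fixes A :: "real ^ 'n ^ 'n::finite"
  assumes "\<And>i j. A $ i $ j \<in> \<int>"
  shows "det A \<in> \<int>"
  unfolding det_def by (intro Ints_sum Ints_mult Ints_prod) (use assms in auto)

text \<open>Cramer's rule: every coordinate of the solution is an integral determinant divided by
  det A, which is 1 or -1.\<close>

lemma unimodular_solution:
  fixes A :: "real ^ 'n ^ 'n::finite"
  assumes "\<And>i j. A $ i $ j \<in> \<int>" "\<bar>det A\<bar> = 1" "b \<in> int_points"
  shows "\<exists>y\<in>int_points. A *v y = b"
proof -
  define y where "y = (\<chi> k. det (\<chi> i j. if j = k then b $ i else A $ i $ j) / det A)"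
  have "A *v y = b" using cramer[of A y b] assms(2) by (auto simp: y_def)
  moreover have "y \<in> int_points"
  proof -
    have "det (\<chi> i j. if j = k then b $ i else A $ i $ j) / det A \<in> \<int>" for k
    proof -
      have "det (\<chi> i j. if j = k then b $ i else A $ i $ j) \<in> \<int>"
        using assms(1,3) by (intro det_Ints) (auto simp: int_points_def)
      moreover have "det A = 1 \<or> det A = -1" using assms(2) by linarith
      ultimately show ?thesis by auto
    qed
    then show ?thesis by (simp add: int_points_def y_def)
  qed
  ultimately show ?thesis by blast
qed

text \<open>The matrix of edge vectors at \<open>x0\<close> has determinant of absolute value
  \<open>fact CARD('n)\<close> times the volume, that is 1, and y solves the transposed integral
  system.\<close>

lemma unimodular_simplex_wellorder:
  fixes X :: "(real ^ 'n :: {finite, wellorder}) set" and f :: "'n :: _ \<Rightarrow> real ^ ('n :: _)"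
  assumes X: "finite X" "card X = Suc CARD('n)" "x0 \<in> X" "bij_betw f UNIV (X - {x0})" "X \<subseteq> int_points"
    and vol: "measure lborel (convex hull X) = 1 / fact CARD('n)"
  shows "\<exists>y\<in>int_points. \<forall>j. y \<bullet> (f j - x0) = of_int (g j)"
proof -
  define M :: "real ^ ('n :: _) ^ ('n :: _)" where "M = (\<chi> i j. f j $ i - x0 $ i)"
  have "\<bar>det M\<bar> = 1"
    using content_simplex[OF X(1-4)] vol by (simp add: M_def)
  then have "\<bar>det (transpose M)\<bar> = 1" by (simp add: det_transpose)
  moreover have "f j \<in> int_points" for j using X(4,5) by (auto simp: bij_betw_def)
  then have "transpose M $ i $ j \<in> \<int>" for i j
    using X(3,5) by (auto simp: transpose_def M_def int_points_def)
  moreover have "(\<chi> j. of_int (g j)) \<in> int_points" by (simp add: int_points_def)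
  ultimately obtain y where y: "y \<in> int_points" "transpose M *v y = (\<chi> j. of_int (g j))"
    using unimodular_solution by blast
  have "y \<bullet> (f j - x0) = of_int (g j)" for j
  proof -
    have "y \<bullet> (f j - x0) = (transpose M *v y) $ j"
      by (simp add: inner_vec_def matrix_vector_mult_def transpose_def M_def mult.commute)
    then show ?thesis using y by simp
  qed
  then show ?thesis using y by blast
qed

definition copy_vec :: "real ^ 'n \<Rightarrow> real ^ ('n::finite ordered_copy)"
  where "copy_vec x = (\<chi> i. x $ of_copy i)"

lemma copy_vec_nth [simp]: "copy_vec x $ i = x $ of_copy i"
  by (simp add: copy_vec_def)

lemma linear_copy_vec: "linear copy_vec"
  by (rule linearI) (auto simp: vec_eq_iff)

lemma continuous_on_copy_vec: "continuous_on S copy_vec"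
  using linear_copy_vec linear_continuous_on linear_conv_bounded_linear by blast

lemma inner_copy_vec: "copy_vec x \<bullet> copy_vec y = x \<bullet> y"
  using sum.reindex_bij_betw[OF bij_of_copy, of "\<lambda>i. x $ i * y $ i"] by (simp add: inner_vec_def)

lemma bij_copy_vec: "bij copy_vec"
proof (rule bij_betw_byWitness[where f' = "\<lambda>y. \<chi> i. y $ to_copy i"])
qed (auto simp: vec_eq_iff to_copy_inverse of_copy_inverse)

lemma copy_vec_int_points: "copy_vec x \<in> int_points \<longleftrightarrow> x \<in> int_points"
proof -
  have "(\<forall>i. x $ of_copy i \<in> \<int>) \<longleftrightarrow> (\<forall>i. x $ i \<in> \<int>)" by (metis UNIV_I to_copy_inverse)
  then show ?thesis by (simp add: int_points_def)
qed

lemma prod_Basis_vec: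
  fixes x :: "real ^ 'n::finite"
  shows "(\<Prod>b\<in>Basis. x \<bullet> b) = (\<Prod>i\<in>UNIV. x $ i)"
proof -
  have B: "Basis = range (\<lambda>i. axis i (1::real) :: real ^ 'n)" by (auto simp: Basis_vec_def)
  have "inj (\<lambda>i. axis i (1::real) :: real ^ 'n)" by (auto simp: inj_def axis_eq_axis)
  then show ?thesis unfolding B by (subst prod.reindex) (simp_all add: inner_axis)
qed

text \<open>Lebesgue measure is determined by its values on boxes, and renaming coordinates permutes
  the factors of the volume of a box.\<close>

lemma lborel_copy_vec: "distr lborel borel copy_vec = lborel"
proof (rule lborel_eqI[symmetric])
  have meas: "copy_vec \<in> borel_measurable lborel"
    using borel_measurable_continuous_onI[OF continuous_on_copy_vec] by simp
  fix l u :: "real ^ 'a ordered_copy"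
  assume le: "\<And>b. b \<in> Basis \<Longrightarrow> l \<bullet> b \<le> u \<bullet> b"
  obtain l' u' where lu: "l = copy_vec l'" "u = copy_vec u'" by (metis bij_copy_vec bij_pointE)
  have le': "l' $ i \<le> u' $ i" for i
    using le[of "axis (to_copy i) 1"] by (simp add: inner_axis lu to_copy_inverse)
  have "copy_vec -` box l u = box l' u'"
  proof -
    have "(\<forall>i. l' $ of_copy i < x $ of_copy i \<and> x $ of_copy i < u' $ of_copy i) \<longleftrightarrow>
        (\<forall>i. l' $ i < x $ i \<and> x $ i < u' $ i)" for x
      by (metis UNIV_I to_copy_inverse)
    then show ?thesis by (auto simp: mem_box_cart lu)
  qed
  then have "emeasure (distr lborel borel copy_vec) (box l u) = emeasure lborel (box l' u')"
    using emeasure_distr[OF meas, of "box l u"] by simp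
  also have "\<dots> = (\<Prod>b\<in>Basis. (u' - l') \<bullet> b)"
    by (rule emeasure_lborel_box) (use le' in \<open>auto simp: Basis_vec_def inner_axis\<close>)
  also have "(\<Prod>b\<in>Basis. (u' - l') \<bullet> b) = (\<Prod>b\<in>Basis. (u - l) \<bullet> b)"
    using prod_Basis_vec[of "u' - l'"] prod_Basis_vec[of "u - l"]
      prod.reindex_bij_betw[OF bij_of_copy, of "\<lambda>i. (u' - l') $ i"] by (simp add: lu)
  finally show "emeasure (distr lborel borel copy_vec) (box l u) = (\<Prod>b\<in>Basis. (u - l) \<bullet> b)" .
qed simp

lemma measure_copy_vec:
  assumes "compact S"
  shows "measure lborel (copy_vec ` S) = measure lborel S"
proof -
  have "measure lborel (copy_vec ` S) = measure (distr lborel borel copy_vec) (copy_vec ` S)"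
    by (simp add: lborel_copy_vec)
  also have "\<dots> = measure lborel (copy_vec -` copy_vec ` S)"
    using continuous_on_copy_vec assms
    by (subst measure_distr) (auto intro!: borel_compact compact_continuous_image borel_measurable_continuous_onI)
  also have "copy_vec -` copy_vec ` S = S" using bij_copy_vec bij_is_inj inj_vimage_image_eq by blast
  finally show ?thesis .
qed

text \<open>The edge vectors at a base vertex form a lattice basis, so an integral covector can take
  prescribed integral values on them. The real constant a absorbs the value at the base
  vertex.\<close>

lemma unimodular_simplex:
  fixes X :: "(real ^ 'n::finite) set" and g :: "real ^ 'n \<Rightarrow> int"
  assumes X: "finite X" "card X = Suc CARD('n)" "X \<subseteq> int_points"
    and vol: "measure lebesgue (convex hull X) = 1 / fact CARD('n)"
  shows "\<exists>y\<in>int_points. \<exists>a. \<forall>x\<in>X. y \<bullet> x = of_int (g x) + a"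
proof -
  have inj: "inj copy_vec" using bij_copy_vec bij_is_inj by blast
  obtain x0 where x0: "x0 \<in> X" using X(2) by fastforce
  define X' where "X' = copy_vec ` X"
  have c: "CARD('n ordered_copy) = CARD('n)" using bij_betw_same_card[OF bij_of_copy] .
  have X': "finite X'" "card X' = Suc CARD('n ordered_copy)" "X' \<subseteq> int_points"
    using X card_image[OF inj_on_subset[OF inj subset_UNIV], of X] by (auto simp: X'_def c copy_vec_int_points)
  have comp: "compact (convex hull X)" using X(1) finite_imp_compact_convex_hull by blast
  have "convex hull X' = copy_vec ` (convex hull X)"
    by (simp add: X'_def convex_hull_linear_image linear_copy_vec)
  then have "measure lborel (convex hull X') = measure lborel (convex hull X)"
    using measure_copy_vec[OF comp] by simp
  also have "\<dots> = 1 / fact CARD('n ordered_copy)"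
    using vol comp by (simp add: c measure_completion borel_compact)
  finally have vol': "measure lborel (convex hull X') = 1 / fact CARD('n ordered_copy)" .
  have x0': "copy_vec x0 \<in> X'" using x0 by (simp add: X'_def)
  have "card (X' - {copy_vec x0}) = CARD('n ordered_copy)" using X' x0' by simp
  then obtain f where f: "bij_betw f (UNIV :: 'n ordered_copy set) (X' - {copy_vec x0})"
    using X'(1) by (metis finite_Diff finite_same_card_bij finite)
  obtain y where y: "y \<in> int_points"
    "\<forall>j. y \<bullet> (f j - copy_vec x0) = of_int (g (inv copy_vec (f j)) - g x0)"
    using unimodular_simplex_wellorder[OF X'(1,2) x0' f X'(3) vol', of "\<lambda>j. g (inv copy_vec (f j)) - g x0"]
    by blast
  obtain z where z: "y = copy_vec z" by (metis bij_copy_vec bij_pointE)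
  have "z \<bullet> x = of_int (g x) + (z \<bullet> x0 - of_int (g x0))" if "x \<in> X" for x
  proof (cases "x = x0")
    case False
    then have "copy_vec x \<in> X' - {copy_vec x0}" using that inj by (auto simp: X'_def inj_def)
    then obtain j where j: "copy_vec x = f j" using f by (metis bij_betw_iff_bijections)
    have "y \<bullet> (f j - copy_vec x0) = of_int (g x - g x0)"
      using y(2) j inj by (metis inv_f_f)
    then show ?thesis
      by (simp add: z inner_copy_vec inner_diff_right flip: j)
  qed simp
  moreover have "z \<in> int_points" using y z copy_vec_int_points by auto
  ultimately show ?thesis by blast
qed

section \<open>Reduction modulo two\<close>

text \<open>Sums and products of bits stay in ring form, where the rules of linear algebra and the
  cancellation of doubled summands apply.\<close>

declare add_bit_eq_xor [simp del] mult_bit_eq_and [simp del] add_self_eq_0 [simp]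

lemma int_points_add: "x \<in> int_points \<Longrightarrow> y \<in> int_points \<Longrightarrow> x + y \<in> int_points"
  by (simp add: int_points_def)

lemma int_points_diff: "x \<in> int_points \<Longrightarrow> y \<in> int_points \<Longrightarrow> x - y \<in> int_points"
  by (simp add: int_points_def)

lemma int_points_scaleR: "x \<in> int_points \<Longrightarrow> of_int k *\<^sub>R x \<in> int_points"
  by (simp add: int_points_def)

lemma int_points_nth: "x \<in> int_points \<Longrightarrow> of_int \<lfloor>x $ i\<rfloor> = x $ i"
  by (simp add: int_points_def)

lemma f2_add_self_left [simp]: "x + (x + y) = y" for x y :: "'v::f2_vector"
  by (simp add: add_self_eq_0 flip: add.assoc)

lemma mod2_add:
  assumes "x \<in> int_points" "y \<in> int_points"
  shows "mod2 (x + y) = mod2 x + mod2 y"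
proof -
  have "\<lfloor>x $ i + y $ i\<rfloor> = \<lfloor>x $ i\<rfloor> + \<lfloor>y $ i\<rfloor>" for i
    using int_points_nth[OF assms(1), of i] by (metis floor_add_int add.commute)
  then show ?thesis by (simp add: mod2_def vec_eq_iff)
qed

lemma mod2_diff:
  assumes "x \<in> int_points" "y \<in> int_points"
  shows "mod2 (x - y) = mod2 x + mod2 y"
proof -
  have "mod2 (x - y) + mod2 y = mod2 x"
    using mod2_add[OF int_points_diff[OF assms] assms(2)] by simp
  then show ?thesis by (metis add.right_neutral add.assoc add_self_eq_0)
qed

lemma vec_bit_eq_add: "x + y = z \<longleftrightarrow> x = z + y" for x y z :: "'v::f2_vector"
  by (metis add.assoc add.right_neutral add_self_eq_0)

lemma pairing2_add_left: "pairing2 (a + b) u = pairing2 a u + pairing2 b u"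
  by (simp add: pairing2_def distrib_right sum.distrib)

lemma pairing2_add_right: "pairing2 a (u + w) = pairing2 a u + pairing2 a w"
  by (simp add: pairing2_def distrib_left sum.distrib)

lemma pairing2_zero [simp]: "pairing2 0 u = 0" "pairing2 a 0 = 0"
  by (simp_all add: pairing2_def)

lemma pairing2_sum_right: "pairing2 a (sum f A) = (\<Sum>x\<in>A. pairing2 a (f x))"
  by (induction A rule: infinite_finite_induct) (simp_all add: pairing2_add_right)

lemma pairing2_axis [simp]: "pairing2 (axis i 1) u = u $ i" "pairing2 u (axis i 1) = u $ i"
  by (simp_all add: pairing2_def axis_def if_distrib[of "\<lambda>c. c * _"] if_distrib[of "\<lambda>c. _ * c"] cong: if_cong)

lemma pairing2_mod2:
  assumes "m \<in> int_points" "y \<in> int_points"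
  shows "pairing2 (mod2 m) (mod2 y) = of_int \<lfloor>m \<bullet> y\<rfloor>"
proof -
  have "m \<bullet> y = of_int (\<Sum>i\<in>UNIV. \<lfloor>m $ i\<rfloor> * \<lfloor>y $ i\<rfloor>)"
    using assms by (simp add: inner_vec_def int_points_nth)
  then have "\<lfloor>m \<bullet> y\<rfloor> = (\<Sum>i\<in>UNIV. \<lfloor>m $ i\<rfloor> * \<lfloor>y $ i\<rfloor>)" by (metis floor_of_int)
  then show ?thesis by (simp add: pairing2_def mod2_def)
qed

lemma UNIV_bit: "(UNIV :: bit set) = {0, 1}"
  using bit.exhaust by blast

instance bit :: finite
  by standard (simp add: UNIV_bit)

lemma CARD_bit: "CARD(bit) = 2"
  by (simp add: UNIV_bit)

section \<open>Primitive triangulations\<close>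

definition affine_function :: "('a::real_vector \<Rightarrow> real) \<Rightarrow> bool"
  where "affine_function h \<longleftrightarrow> (\<exists>g a. linear g \<and> h = (\<lambda>x. g x + a))"

lemma affine_function_comb: "affine_function h \<Longrightarrow> h (p + t *\<^sub>R (z - p)) = (1 - t) * h p + t * h z"
  unfolding affine_function_def
  by (auto simp: linear_add linear_diff linear_scale algebra_simps)

lemma affine_function_scale: "affine_function h \<Longrightarrow> affine_function (\<lambda>x. c * h x)"
  unfolding affine_function_def
proof (elim exE conjE)
  fix g a assume "linear g" "h = (\<lambda>x. g x + a)"
  then have "linear (\<lambda>x. c * g x)" "(\<lambda>x. c * h x) = (\<lambda>x. c * g x + c * a)"
    using linear_compose_scale_right[of g c] by (auto simp: algebra_simps)
  then show "\<exists>g a. linear g \<and> (\<lambda>x. c * h x) = (\<lambda>x. g x + a)" by blast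
qed

lemma affine_function_sum_scaleR:
  assumes "affine_function h" "sum l A = 1"
  shows "h (\<Sum>v\<in>A. l v *\<^sub>R v) = (\<Sum>v\<in>A. l v * h v)"
proof -
  obtain g a where g: "linear g" "h = (\<lambda>x. g x + a)" using assms(1) by (auto simp: affine_function_def)
  have "(\<Sum>v\<in>A. l v * h v) = (\<Sum>v\<in>A. l v * g v) + a * sum l A"
    unfolding g(2) by (simp add: sum_distrib_left sum.distrib algebra_simps)
  then show ?thesis using assms(2) g by (simp add: linear_sum linear_scale)
qed

locale primitive_triangulated =
  fixes P :: "(real ^ 'd::finite) set" and K :: "(real ^ 'd) set set"
  assumes polytope_P: "polytope P" and full_dim: "aff_dim P = int CARD('d)"
    and primitive: "primitive_triangulation P K"
begin

sublocale simplicial K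
  using primitive by unfold_locales (simp add: primitive_triangulation_def)

lemma Union_K: "\<Union>K = P"
  using primitive by (simp add: primitive_triangulation_def)

lemma compact_P: "compact P" and closed_P: "closed P" and convex_P: "convex P"
  using polytope_P polytope_imp_compact polytope_imp_closed polytope_imp_convex by auto

lemma in_P: "\<sigma> \<in> K \<Longrightarrow> x \<in> \<sigma> \<Longrightarrow> x \<in> P"
  using Union_K by blast

lemma verts_int: "\<sigma> \<in> K \<Longrightarrow> verts \<sigma> \<subseteq> int_points"
  using primitive by (auto simp: primitive_triangulation_def verts_def)

definition chambers :: "(real ^ 'd) set set"
  where "chambers = {\<tau> \<in> K. aff_dim \<tau> = int CARD('d)}"

definition walls :: "(real ^ 'd) set set"
  where "walls = {\<sigma> \<in> K. aff_dim \<sigma> = int CARD('d) - 1}"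

lemma chamber_K: "\<tau> \<in> chambers \<Longrightarrow> \<tau> \<in> K"
  and wall_K: "\<sigma> \<in> walls \<Longrightarrow> \<sigma> \<in> K"
  by (auto simp: chambers_def walls_def)

lemma finite_chambers: "finite chambers"
  using finite_K by (simp add: chambers_def)

lemma card_verts_chamber: "\<tau> \<in> chambers \<Longrightarrow> card (verts \<tau>) = Suc CARD('d)"
  using aff_dim_eq_card by (fastforce simp: chambers_def)

lemma card_verts_wall: "\<sigma> \<in> walls \<Longrightarrow> card (verts \<sigma>) = CARD('d)"
  using aff_dim_eq_card by (fastforce simp: walls_def)

lemma maximal_volume:
  assumes "\<tau> \<in> K" "\<And>\<sigma>. \<sigma> \<in> K \<Longrightarrow> \<tau> \<subseteq> \<sigma> \<Longrightarrow> \<sigma> = \<tau>"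
  shows "measure lebesgue \<tau> = 1 / fact CARD('d)"
  using primitive assms by (auto simp: primitive_triangulation_def)

text \<open>A maximal simplex containing \<sigma> has positive volume by primitivity, hence nonempty
  interior and full dimension.\<close>

lemma chamber_above:
  assumes "\<sigma> \<in> K"
  shows "\<exists>\<tau>\<in>chambers. \<sigma> \<subseteq> \<tau>"
proof -
  obtain \<tau> where t: "\<tau> \<in> K" "\<sigma> \<subseteq> \<tau>" "\<And>\<rho>. \<rho> \<in> K \<Longrightarrow> \<tau> \<subseteq> \<rho> \<Longrightarrow> \<rho> = \<tau>"
    using finite_has_maximal2[OF finite_K assms] by metis
  have "measure lebesgue \<tau> \<noteq> 0" using maximal_volume[OF t(1,3)] by simp
  then have "\<not> negligible \<tau>" using negligible_imp_measure0 by blast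
  then have "interior \<tau> \<noteq> {}" using negligible_convex_interior[OF convex_simplex[OF t(1)]] by blast
  then have "aff_dim \<tau> = int CARD('d)" using aff_dim_nonempty_interior[of \<tau>] by simp
  then show ?thesis using t by (auto simp: chambers_def)
qed

lemma P_covered: "x \<in> P \<Longrightarrow> \<exists>\<tau>\<in>chambers. x \<in> \<tau>"
  using Union_K chamber_above by blast

lemma chamber_maximal:
  assumes "\<tau> \<in> chambers" "\<sigma> \<in> K" "\<tau> \<subseteq> \<sigma>"
  shows "\<sigma> = \<tau>"
proof -
  have "aff_dim \<sigma> \<le> int CARD('d)" using aff_dim_le_DIM[of \<sigma>] by simp
  then have "card (verts \<sigma>) \<le> card (verts \<tau>)"
    using aff_dim_eq_card[OF assms(2)] card_verts_chamber[OF assms(1)] by simp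
  then have "verts \<tau> = verts \<sigma>"
    using card_seteq[OF finite_verts[OF assms(2)]] subset_iff_verts[OF chamber_K[OF assms(1)] assms(2)] assms(3)
    by blast
  then show ?thesis using verts_inject assms chamber_K by blast
qed

lemma chamber_lift:
  assumes "\<tau> \<in> chambers"
  shows "\<exists>y\<in>int_points. \<exists>a. \<forall>x\<in>verts \<tau>. y \<bullet> x = of_int (g x) + a"
proof (rule unimodular_simplex)
  show "measure lebesgue (convex hull verts \<tau>) = 1 / fact CARD('d)"
    using maximal_volume chamber_maximal[OF assms] chamber_K[OF assms] convex_hull_verts by simp
qed (use assms finite_verts chamber_K card_verts_chamber verts_int in auto)

subsection \<open>Gradients modulo two\<close>

text \<open>Lift the bits to the integers 0 and 1, take an integral covector with these values up to
  a constant, and reduce it modulo 2. Differences of vertices do not see the constant.\<close>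

lemma gradient_exists:
  assumes "\<tau> \<in> chambers"
  shows "\<exists>u. \<forall>v\<in>verts \<tau>. \<forall>w\<in>verts \<tau>. pairing2 (mod2 v + mod2 w) u = g v + g w"
proof -
  obtain y a where y: "y \<in> int_points" "\<forall>x\<in>verts \<tau>. y \<bullet> x = of_int (if g x = 0 then 0 else 1 :: int) + a"
    using chamber_lift[OF assms, of "\<lambda>x. if g x = 0 then 0 else 1"] by blast
  have "pairing2 (mod2 v + mod2 w) (mod2 y) = g v + g w" if v: "v \<in> verts \<tau>" and w: "w \<in> verts \<tau>" for v w
  proof -
    have vw: "v \<in> int_points" "w \<in> int_points" using v w verts_int chamber_K[OF assms] by auto
    have "(v - w) \<bullet> y = y \<bullet> v - y \<bullet> w" by (metis inner_commute inner_diff_right)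
    then have "(v - w) \<bullet> y = of_int ((if g v = 0 then 0 else 1) - (if g w = 0 then 0 else 1))"
      using y(2) v w by simp
    then have "\<lfloor>(v - w) \<bullet> y\<rfloor> = (if g v = 0 then 0 else 1) - (if g w = 0 then 0 else 1)"
      by (metis floor_of_int)
    then have "of_int \<lfloor>(v - w) \<bullet> y\<rfloor> = g v + g w"
      by (cases "g v"; cases "g w") simp_all
    then show ?thesis
      using pairing2_mod2[OF int_points_diff[OF vw] y(1)] mod2_diff[OF vw] by simp
  qed
  then show ?thesis by blast
qed

text \<open>Counting replaces a determinant modulo 2: evaluation on the edges at one vertex is onto
  by \<open>gradient_exists\<close>, and source and target both have 2 ^ CARD('d) elements.\<close>

lemma gradient_unique:
  assumes "\<tau> \<in> chambers"
    and eq: "\<And>v w. v \<in> verts \<tau> \<Longrightarrow> w \<in> verts \<tau> \<Longrightarrow> pairing2 (mod2 v + mod2 w) u = pairing2 (mod2 v + mod2 w) u'"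
  shows "u = u'"
proof -
  obtain v0 where v0: "v0 \<in> verts \<tau>" using card_verts_chamber[OF assms(1)] by fastforce
  let ?V = "verts \<tau> - {v0}"
  let ?F = "?V \<rightarrow>\<^sub>E (UNIV :: bit set)"
  define r where "r u = (\<lambda>v\<in>?V. pairing2 (mod2 v + mod2 v0) u)" for u
  have fin: "finite ?V" using finite_verts chamber_K assms(1) by blast
  have "card ?V = CARD('d)" using v0 card_verts_chamber[OF assms(1)] by simp
  then have "card ?F = 2 ^ CARD('d)" using fin by (simp add: card_PiE CARD_bit)
  moreover have "CARD(bit ^ 'd) = 2 ^ CARD('d)" by (simp add: CARD_bit)
  ultimately have c: "CARD(bit ^ 'd) = card ?F" by simp
  have surj: "?F \<subseteq> range r"
  proof
    fix h assume h: "h \<in> ?F"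
    obtain u where u: "\<forall>v\<in>verts \<tau>. \<forall>w\<in>verts \<tau>. pairing2 (mod2 v + mod2 w) u = (if v = v0 then 0 else h v) + (if w = v0 then 0 else h w)"
      using gradient_exists[OF assms(1), of "\<lambda>v. if v = v0 then 0 else h v"] by blast
    have "r u = h"
      using h u v0 by (fastforce simp: r_def fun_eq_iff PiE_iff extensional_def)
    then show "h \<in> range r" by blast
  qed
  have "r ` UNIV \<subseteq> ?F" by (rule image_subsetI) (simp add: r_def restrict_PiE_iff)
  then have "r ` UNIV = ?F" using surj by (rule subset_antisym)
  then have "card (range r) = CARD(bit ^ 'd)" by (simp only: c)
  then have "inj r" by (rule eq_card_imp_inj_on[rotated]) simp
  moreover have "r u = r u'" using eq v0 by (auto simp: r_def fun_eq_iff)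
  ultimately show ?thesis by (simp add: inj_def)
qed

definition grad :: "(real ^ 'd) set \<Rightarrow> (real ^ 'd \<Rightarrow> bit) \<Rightarrow> bit ^ 'd"
  where "grad \<tau> g = (SOME u. \<forall>v\<in>verts \<tau>. \<forall>w\<in>verts \<tau>. pairing2 (mod2 v + mod2 w) u = g v + g w)"

lemma grad:
  "\<tau> \<in> chambers \<Longrightarrow> v \<in> verts \<tau> \<Longrightarrow> w \<in> verts \<tau> \<Longrightarrow> pairing2 (mod2 v + mod2 w) (grad \<tau> g) = g v + g w"
  using someI_ex[OF gradient_exists[of \<tau> g]] unfolding grad_def by blast

lemma grad_eqI:
  "\<tau> \<in> chambers \<Longrightarrow> (\<And>v w. v \<in> verts \<tau> \<Longrightarrow> w \<in> verts \<tau> \<Longrightarrow> pairing2 (mod2 v + mod2 w) u = g v + g w) \<Longrightarrow> grad \<tau> g = u"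
  by (rule gradient_unique) (auto simp: grad)

subsection \<open>Chambers and walls\<close>

text \<open>The finitely many simplices that miss p have a closed union. The radius makes local
  arguments at p see only simplices through p.\<close>

lemma simplex_near_point:
  shows "\<exists>r>0. \<forall>\<sigma>\<in>K. \<sigma> \<inter> ball p r \<noteq> {} \<longrightarrow> p \<in> \<sigma>"
proof -
  let ?L = "\<Union>{\<sigma> \<in> K. p \<notin> \<sigma>}"
  have "closed ?L" using finite_K closed_simplex by (intro closed_Union) auto
  then have "open (- ?L)" by (rule open_Compl)
  moreover have "p \<in> - ?L" by auto
  ultimately obtain r where "r > 0" "ball p r \<subseteq> - ?L" using open_contains_ball by blast
  then show ?thesis by blast
qed

lemma interior_chamber:
  assumes "\<tau> \<in> chambers"
  shows "interior \<tau> \<noteq> {}"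
proof -
  have "affine hull \<tau> = UNIV" using assms aff_dim_eq_full[of \<tau>] by (simp add: chambers_def)
  then have "interior \<tau> = rel_interior \<tau>" by (simp add: rel_interior_interior)
  moreover have "\<tau> \<noteq> {}" using assms by (auto simp: chambers_def)
  ultimately show ?thesis using rel_interior_eq_empty convex_simplex[OF chamber_K[OF assms]] by metis
qed

text \<open>A segment in \<open>U\<close> from a point of \<open>interior \<tau>\<close> to a
  generic point of \<open>interior \<tau>'\<close> misses all simplices of codimension two or more,
  so it passes between chambers through walls only. Taking a ball for \<open>U\<close> yields the
  connectedness of stars, the whole space that of all chambers.\<close>

lemma chambers_connected:
  assumes "open U" "convex U" "\<tau> \<in> chambers" "\<tau>' \<in> chambers"
    "interior \<tau> \<inter> U \<noteq> {}" "interior \<tau>' \<inter> U \<noteq> {}"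
    and step: "\<And>\<tau>1 \<tau>2. \<lbrakk>\<tau>1 \<in> chambers; \<tau>2 \<in> chambers; \<tau>1 \<inter> \<tau>2 \<in> walls; \<tau>1 \<inter> \<tau>2 \<inter> U \<noteq> {}\<rbrakk>
      \<Longrightarrow> \<phi> \<tau>1 = \<phi> \<tau>2"
  shows "\<phi> \<tau> = \<phi> \<tau>'"
proof (rule ccontr)
  assume ne: "\<phi> \<tau> \<noteq> \<phi> \<tau>'"
  obtain x where x: "x \<in> interior \<tau>" "x \<in> U" using assms by auto
  \<comment> \<open>These are the simplices of codimension at least two. Joined with x they span
    affine subspaces of dimension at most CARD('d) - 1, so the open set C defined next is not
    covered by them and a generic end point y exists.\<close>
  define L where "L = {\<rho> \<in> K. aff_dim \<rho> \<le> int CARD('d) - 2}"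
  define C where "C = interior \<tau>' \<inter> U"
  have C: "convex C" "open C" "C \<noteq> {}"
    using assms convex_simplex[OF chamber_K] by (auto simp: C_def convex_Int convex_interior)
  have "\<not> C \<subseteq> (\<Union>\<rho>\<in>L. affine hull (insert x \<rho>))"
  proof
    assume "C \<subseteq> (\<Union>\<rho>\<in>L. affine hull (insert x \<rho>))"
    moreover have "finite L" using finite_K by (simp add: L_def)
    ultimately obtain \<rho> where r: "\<rho> \<in> L" "C \<subseteq> affine hull (insert x \<rho>)"
      using convex_subset_finite_Union_affine[of L C] C by (metis affine_affine_hull)
    have "aff_dim C = int CARD('d)" using aff_dim_open C by fastforce
    moreover have "aff_dim (insert x \<rho>) \<le> aff_dim \<rho> + 1" by (simp add: aff_dim_insert)
    moreover have "aff_dim C \<le> aff_dim (insert x \<rho>)" using aff_dim_subset[OF r(2)] by simp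
    ultimately show False using r(1) by (auto simp: L_def)
  qed
  then obtain y where y: "y \<in> interior \<tau>'" "y \<in> U" "\<And>\<rho>. \<rho> \<in> L \<Longrightarrow> y \<notin> affine hull (insert x \<rho>)"
    by (auto simp: C_def)
  define S where "S = closed_segment x y"
  have SU: "S \<subseteq> U" unfolding S_def using x y assms(2) by (simp add: closed_segment_subset)
  have xP: "x \<in> P" "y \<in> P" using x y interior_subset in_P chamber_K assms by blast+
  then have SP: "S \<subseteq> P" unfolding S_def using convex_P by (simp add: closed_segment_subset)
  have avoid: "z \<notin> \<rho>" if "z \<in> S" "\<rho> \<in> L" for z \<rho>
  proof
    assume z: "z \<in> \<rho>"
    have rK: "\<rho> \<in> K" using that by (simp add: L_def)
    have "x \<notin> \<rho>"
    proof
      assume "x \<in> \<rho>"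
      then have "x \<in> \<tau> \<inter> \<rho> \<inter> interior \<tau>" using x interior_subset by blast
      then have "\<tau> \<inter> \<rho> = \<tau>"
        using face_of_disjoint_interior[OF Int_face[OF chamber_K[OF assms(3)] rK]] by (metis empty_iff)
      then have "\<rho> = \<tau>" using chamber_maximal[OF assms(3) rK] by (metis inf.cobounded2)
      then show False using \<open>\<rho> \<in> L\<close> assms(3) by (simp add: L_def chambers_def)
    qed
    obtain t where t: "z = (1 - t) *\<^sub>R x + t *\<^sub>R y"
      using \<open>z \<in> S\<close> by (auto simp: S_def in_segment)
    have "t \<noteq> 0" using t z \<open>x \<notin> \<rho>\<close> by auto
    have "t *\<^sub>R y = z - (1 - t) *\<^sub>R x" by (simp add: t)
    then have "y = (1 - 1 / t) *\<^sub>R x + (1 / t) *\<^sub>R z"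
      using \<open>t \<noteq> 0\<close> by (simp add: t algebra_simps)
    moreover have "x \<in> affine hull (insert x \<rho>)" "z \<in> affine hull (insert x \<rho>)" using z by (auto simp: hull_inc)
    ultimately have "y \<in> affine hull (insert x \<rho>)" by (metis affine_affine_hull affine_alt)
    then show False using y(3) that(2) by blast
  qed
  \<comment> \<open>Chambers with the value of \<tau> and chambers with another value form two
    closed sets that cover the connected segment, so they share a point of it. That point avoids L,
    which leaves only a wall as intersection of the two chambers.\<close>
  define A where "A = \<Union>{\<tau>1 \<in> chambers. \<phi> \<tau>1 = \<phi> \<tau>}"
  define B where "B = \<Union>{\<tau>1 \<in> chambers. \<phi> \<tau>1 \<noteq> \<phi> \<tau>}"
  have cl: "closed A" "closed B" unfolding A_def B_def
    using finite_chambers closed_simplex chamber_K by (auto intro!: closed_Union)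
  have cover: "S \<subseteq> A \<union> B" using P_covered SP unfolding A_def B_def by blast
  have "x \<in> A \<inter> S" using subsetD[OF interior_subset x(1)] assms(3) by (auto simp: A_def S_def)
  moreover have "y \<in> B \<inter> S" using subsetD[OF interior_subset y(1)] assms(4) ne by (auto simp: B_def S_def)
  moreover have "connected S" by (simp add: S_def)
  ultimately have "A \<inter> B \<inter> S \<noteq> {}"
    using connected_closedD[OF _ _ cover cl] by (metis empty_iff)
  then obtain z where zAB: "z \<in> A" "z \<in> B" and "z \<in> S" by blast
  obtain \<tau>1 where 1: "\<tau>1 \<in> chambers" "\<phi> \<tau>1 = \<phi> \<tau>" "z \<in> \<tau>1" using zAB(1) unfolding A_def by blast
  obtain \<tau>2 where 2: "\<tau>2 \<in> chambers" "\<phi> \<tau>2 \<noteq> \<phi> \<tau>" "z \<in> \<tau>2" using zAB(2) unfolding B_def by blast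
  have z: "z \<in> S" "z \<in> \<tau>1" "z \<in> \<tau>2" "\<tau>1 \<in> chambers" "\<tau>2 \<in> chambers" "\<phi> \<tau>1 \<noteq> \<phi> \<tau>2"
    using \<open>z \<in> S\<close> 1 2 by simp_all
  have IK: "\<tau>1 \<inter> \<tau>2 \<in> K" using Int_K chamber_K z by blast
  have "aff_dim (\<tau>1 \<inter> \<tau>2) \<noteq> int CARD('d)"
  proof
    assume "aff_dim (\<tau>1 \<inter> \<tau>2) = int CARD('d)"
    then have "\<tau>1 \<inter> \<tau>2 \<in> chambers" using IK by (simp add: chambers_def)
    then have "\<tau>1 = \<tau>1 \<inter> \<tau>2" "\<tau>2 = \<tau>1 \<inter> \<tau>2"
      using chamber_maximal[of "\<tau>1 \<inter> \<tau>2"] z chamber_K by blast+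
    then show False using z(6) by metis
  qed
  moreover have "aff_dim (\<tau>1 \<inter> \<tau>2) \<le> int CARD('d)" using aff_dim_le_DIM[of "\<tau>1 \<inter> \<tau>2"] by simp
  moreover have "\<tau>1 \<inter> \<tau>2 \<notin> L" using avoid[OF z(1)] z by blast
  ultimately have "\<tau>1 \<inter> \<tau>2 \<in> walls" using IK by (auto simp: L_def walls_def)
  then show False using step[OF z(4,5)] z SU by blast
qed

lemma all_chambers_connected:
  assumes "\<tau> \<in> chambers" "\<tau>' \<in> chambers"
    and "\<And>\<tau>1 \<tau>2. \<lbrakk>\<tau>1 \<in> chambers; \<tau>2 \<in> chambers; \<tau>1 \<inter> \<tau>2 \<in> walls\<rbrakk> \<Longrightarrow> \<phi> \<tau>1 = \<phi> \<tau>2"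
  shows "\<phi> \<tau> = \<phi> \<tau>'"
  by (rule chambers_connected[of UNIV]) (use assms interior_chamber in auto)

text \<open>In a ball around p that meets only simplices through p, any wall that is crossed belongs
  to two chambers containing p.\<close>

lemma star_connected:
  assumes "\<tau> \<in> chambers" "\<tau>' \<in> chambers" "p \<in> \<tau>" "p \<in> \<tau>'"
    and step: "\<And>\<tau>1 \<tau>2. \<lbrakk>\<tau>1 \<in> chambers; \<tau>2 \<in> chambers; \<tau>1 \<inter> \<tau>2 \<in> walls; p \<in> \<tau>1; p \<in> \<tau>2\<rbrakk> \<Longrightarrow> \<phi> \<tau>1 = \<phi> \<tau>2"
  shows "\<phi> \<tau> = \<phi> \<tau>'"
proof -
  obtain r where r: "r > 0" "\<And>\<sigma>. \<sigma> \<in> K \<Longrightarrow> \<sigma> \<inter> ball p r \<noteq> {} \<Longrightarrow> p \<in> \<sigma>"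
    using simplex_near_point[of p] by blast
  have meets: "interior \<tau>1 \<inter> ball p r \<noteq> {}" if "\<tau>1 \<in> chambers" "p \<in> \<tau>1" for \<tau>1
  proof -
    have "p \<in> closure (interior \<tau>1)"
      using convex_closure_interior[OF convex_simplex[OF chamber_K[OF that(1)]] interior_chamber[OF that(1)]] that(2)
        closure_subset by blast
    then obtain y where "y \<in> interior \<tau>1" "dist y p < r" using \<open>r > 0\<close> closure_approachable by blast
    then show ?thesis by (auto simp: dist_commute)
  qed
  show ?thesis
  proof (rule chambers_connected[of "ball p r"])
    fix \<tau>1 \<tau>2 assume a: "\<tau>1 \<in> chambers" "\<tau>2 \<in> chambers" "\<tau>1 \<inter> \<tau>2 \<in> walls" "\<tau>1 \<inter> \<tau>2 \<inter> ball p r \<noteq> {}"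
    then show "\<phi> \<tau>1 = \<phi> \<tau>2" using step r(2)[OF wall_K[OF a(3)] a(4)] by blast
  qed (use assms meets in auto)
qed

lemma affine_function_eq:
  assumes "\<tau> \<in> chambers" "affine_function h" "affine_function h'" "\<And>v. v \<in> verts \<tau> \<Longrightarrow> h v = h' v"
  shows "h y = h' y"
proof -
  have "affine {y. h y = h' y}"
    unfolding affine_alt
  proof (intro ballI allI)
    fix x y and u :: real assume xy: "x \<in> {y. h y = h' y}" "y \<in> {y. h y = h' y}"
    have "(1 - u) *\<^sub>R x + u *\<^sub>R y = x + u *\<^sub>R (y - x)" by (simp add: algebra_simps)
    then show "(1 - u) *\<^sub>R x + u *\<^sub>R y \<in> {y. h y = h' y}"
      using affine_function_comb[OF assms(2), of x u y] affine_function_comb[OF assms(3), of x u y] xy by simp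
  qed
  then have "affine hull (verts \<tau>) \<subseteq> {y. h y = h' y}" using assms(4) by (intro hull_minimal) auto
  moreover have "affine hull (verts \<tau>) = UNIV"
    using assms(1) aff_dim_eq_full[of \<tau>] convex_hull_verts[OF chamber_K[OF assms(1)]]
      affine_hull_convex_hull[of "verts \<tau>"] by (simp add: chambers_def)
  ultimately show ?thesis by blast
qed

text \<open>For a vertex w of \<tau> this is its barycentric coordinate extended affinely beyond
  \<tau>. In contrast to \<open>bc\<close> it takes negative values, and its sign tells the sides of
  the wall opposite to w apart.\<close>

definition coord :: "(real ^ 'd) set \<Rightarrow> real ^ 'd \<Rightarrow> real ^ 'd \<Rightarrow> real"
  where "coord \<tau> w = (SOME h. affine_function h \<and> (\<forall>v\<in>verts \<tau>. h v = (if v = w then 1 else 0)))"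

lemma coord:
  assumes "\<tau> \<in> chambers"
  shows affine_coord: "affine_function (coord \<tau> w)"
    and coord_vertex: "v \<in> verts \<tau> \<Longrightarrow> coord \<tau> w v = (if v = w then 1 else 0)"
proof -
  obtain g :: "real ^ 'd \<Rightarrow> real" and a where "linear g" "\<forall>v\<in>verts \<tau>. g v + a = (if v = w then 1 else 0)"
    using affine_independent_affine_function[OF verts_independent[OF chamber_K[OF assms]], of "\<lambda>v. if v = w then 1 else 0"]
    by blast
  then have "affine_function (\<lambda>x. g x + a) \<and> (\<forall>v\<in>verts \<tau>. (\<lambda>x. g x + a) v = (if v = w then 1 else 0))"
    unfolding affine_function_def by blast
  then have "affine_function (coord \<tau> w) \<and> (\<forall>v\<in>verts \<tau>. coord \<tau> w v = (if v = w then 1 else 0))"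
    unfolding coord_def by (rule someI[of "\<lambda>h. affine_function h \<and> (\<forall>v\<in>verts \<tau>. h v = (if v = w then 1 else 0))"])
  then show "affine_function (coord \<tau> w)" "v \<in> verts \<tau> \<Longrightarrow> coord \<tau> w v = (if v = w then 1 else 0)" by auto
qed

lemma coord_eq_bc:
  assumes "\<tau> \<in> chambers" "x \<in> \<tau>" "w \<in> verts \<tau>"
  shows "coord \<tau> w x = bc x w"
proof -
  have t: "\<tau> \<in> K" using assms chamber_K by simp
  have "coord \<tau> w x = (\<Sum>v\<in>verts \<tau>. bc x v * coord \<tau> w v)"
    using affine_function_sum_scaleR[OF affine_coord[OF assms(1)] bc_sum[OF t assms(2)]] bc_combination[OF t assms(2)]
    by metis
  also have "\<dots> = (\<Sum>v\<in>verts \<tau>. bc x v * (if v = w then 1 else 0))"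
    using coord_vertex[OF assms(1)] by (intro sum.cong) auto
  also have "\<dots> = bc x w" using finite_verts[OF t] assms(3) by (simp add: if_distrib cong: if_cong)
  finally show ?thesis .
qed

lemma coord_combination:
  assumes "\<tau> \<in> chambers"
  shows "(\<Sum>w\<in>verts \<tau>. coord \<tau> w y) = 1" "(\<Sum>w\<in>verts \<tau>. coord \<tau> w y *\<^sub>R w) = y"
proof -
  have fin: "finite (verts \<tau>)" using finite_verts chamber_K assms by blast
  have lin: "affine_function (\<lambda>y. \<Sum>w\<in>verts \<tau>. c w * coord \<tau> w y)" for c
  proof -
    have "\<exists>g a. linear g \<and> coord \<tau> w = (\<lambda>x. g x + a)" for w
      using affine_coord[OF assms] unfolding affine_function_def by blast
    then obtain g a where ga: "\<And>w. linear (g w)" "\<And>w. coord \<tau> w = (\<lambda>x. g w x + a w)" by metis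
    have "linear (\<lambda>y. \<Sum>w\<in>verts \<tau>. c w * g w y)"
    proof (rule linear_compose_sum, rule ballI)
      show "linear (\<lambda>y. c w * g w y)" for w
        using linear_compose_scale_right[OF ga(1), of "c w" w] by simp
    qed
    moreover have "(\<lambda>y. \<Sum>w\<in>verts \<tau>. c w * coord \<tau> w y) =
        (\<lambda>y. (\<Sum>w\<in>verts \<tau>. c w * g w y) + (\<Sum>w\<in>verts \<tau>. c w * a w))"
      by (simp add: ga(2) distrib_left sum.distrib)
    ultimately show ?thesis unfolding affine_function_def by blast
  qed
  have at: "(\<Sum>w\<in>verts \<tau>. c w * coord \<tau> w v) = c v" if "v \<in> verts \<tau>" for c v
  proof -
    have "(\<Sum>w\<in>verts \<tau>. c w * coord \<tau> w v) = (\<Sum>w\<in>verts \<tau>. c w * (if v = w then 1 else 0))"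
      using coord_vertex[OF assms that] by simp
    also have "\<dots> = c v" using fin that by (simp add: if_distrib cong: if_cong)
    finally show ?thesis .
  qed
  have const: "affine_function (\<lambda>y::real ^ 'd. 1)"
    unfolding affine_function_def by (intro exI[of _ "\<lambda>_. 0"] exI[of _ 1]) (auto simp: linear_zero)
  show "(\<Sum>w\<in>verts \<tau>. coord \<tau> w y) = 1"
    using affine_function_eq[OF assms lin[of "\<lambda>_. 1"] const] at[of _ "\<lambda>_. 1"] by simp
  have "(\<Sum>w\<in>verts \<tau>. coord \<tau> w y *\<^sub>R w) $ i = y $ i" for i
  proof -
    have "linear (\<lambda>y::real ^ 'd. y $ i)" by (simp add: linear_iff)
    then have aff: "affine_function (\<lambda>y::real ^ 'd. y $ i)"
      unfolding affine_function_def by (intro exI[of _ "\<lambda>y. y $ i"] exI[of _ 0]) auto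
    have "(\<Sum>w\<in>verts \<tau>. w $ i * coord \<tau> w y) = y $ i"
      by (rule affine_function_eq[OF assms lin[of "\<lambda>w. w $ i"] aff]) (rule at)
    then show ?thesis by (simp add: mult.commute)
  qed
  then show "(\<Sum>w\<in>verts \<tau>. coord \<tau> w y *\<^sub>R w) = y" by (simp add: vec_eq_iff)
qed

lemma coord_nonneg_mem:
  assumes "\<tau> \<in> chambers" "\<And>w. w \<in> verts \<tau> \<Longrightarrow> 0 \<le> coord \<tau> w y"
  shows "y \<in> \<tau>"
proof -
  have "(\<Sum>w\<in>verts \<tau>. coord \<tau> w y *\<^sub>R w) \<in> convex hull (verts \<tau>)"
    by (rule convex_sum)
      (use finite_verts[OF chamber_K[OF assms(1)]] coord_combination(1)[OF assms(1)] assms(2) hull_inc in auto)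
  then have "y \<in> convex hull (verts \<tau>)" by (simp add: coord_combination(2)[OF assms(1)])
  then show ?thesis using convex_hull_verts[OF chamber_K[OF assms(1)]] by simp
qed

end

section \<open>Barycenters\<close>

context simplicial
begin

lemma barycenter:
  assumes "\<sigma> \<in> K" "\<sigma> \<noteq> {}"
  shows barycenter_mem: "barycenter \<sigma> \<in> \<sigma>"
    and bc_barycenter: "bc (barycenter \<sigma>) v = (if v \<in> verts \<sigma> then 1 / real (card (verts \<sigma>)) else 0)"
proof -
  have ne: "verts \<sigma> \<noteq> {}" using assms convex_hull_verts by fastforce
  have fin: "finite (verts \<sigma>)" using finite_verts assms by blast
  then have c: "card (verts \<sigma>) > 0" using ne by (simp add: card_gt_0_iff)
  have b: "barycenter \<sigma> = (\<Sum>v\<in>verts \<sigma>. (1 / real (card (verts \<sigma>))) *\<^sub>R v)"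
    by (simp add: barycenter_def verts_def scaleR_sum_right divide_inverse)
  show mem: "barycenter \<sigma> \<in> \<sigma>"
    unfolding b using fin c verts_sub[OF assms(1)] by (intro convex_sum convex_simplex assms) auto
  have "bc (barycenter \<sigma>) = (\<lambda>v. if v \<in> verts \<sigma> then 1 / real (card (verts \<sigma>)) else 0)"
    by (rule bc_unique[OF assms(1) mem]) (use fin c b in \<open>auto cong: sum.cong\<close>)
  then show "bc (barycenter \<sigma>) v = (if v \<in> verts \<sigma> then 1 / real (card (verts \<sigma>)) else 0)" by simp
qed

lemma carrier_barycenter: "\<sigma> \<in> K \<Longrightarrow> \<sigma> \<noteq> {} \<Longrightarrow> carrier (barycenter \<sigma>) = verts \<sigma>"
  using finite_verts[of \<sigma>] by (auto simp: carrier_def bc_barycenter card_gt_0_iff split: if_splits)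

lemma maxset_barycenter:
  assumes "\<sigma> \<in> K" "\<sigma> \<noteq> {}"
  shows "maxset (barycenter \<sigma>) = verts \<sigma>"
proof
  show "maxset (barycenter \<sigma>) \<subseteq> verts \<sigma>"
    using maxset_subset_verts[OF assms(1) barycenter_mem[OF assms]] .
  show "verts \<sigma> \<subseteq> maxset (barycenter \<sigma>)"
    using verts_subset_vertices[OF assms(1)] by (auto simp: maxset_def bc_barycenter[OF assms])
qed

lemma barycenter_in_iff:
  assumes "\<sigma> \<in> K" "\<sigma> \<noteq> {}" "\<tau> \<in> K"
  shows "barycenter \<sigma> \<in> \<tau> \<longleftrightarrow> \<sigma> \<subseteq> \<tau>"
  using carrier_subset_iff[OF assms(3), of "barycenter \<sigma>"] carrier_barycenter[OF assms(1,2)]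
    subset_iff_verts[OF assms(1,3)] barycenter_mem[OF assms(1,2)] assms(1) by blast

end

lemma eventually_combination_pos:
  fixes a b :: real
  assumes "a > 0"
  shows "\<forall>\<^sub>F t in at_right 0. (1 - t) * a + t * b > 0"
proof -
  have "((\<lambda>t. (1 - t) * a + t * b) \<longlongrightarrow> (1 - 0) * a + 0 * b) (at_right 0)" by (intro tendsto_intros)
  then show ?thesis using order_tendstoD(1)[of _ _ _ 0] assms by simp
qed

lemma eventually_ray_in_open:
  fixes p :: "'a::real_normed_vector"
  assumes "open U" "p \<in> U"
  shows "\<forall>\<^sub>F t in at_right 0. p + t *\<^sub>R w \<in> U"
proof -
  have "((\<lambda>t. p + t *\<^sub>R w) \<longlongrightarrow> p + 0 *\<^sub>R w) (at_right 0)" by (intro tendsto_intros)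
  then show ?thesis using topological_tendstoD assms by fastforce
qed

lemma eventually_at_right_01: "\<forall>\<^sub>F t in at_right (0::real). 0 < t \<and> t < 1"
  using eventually_conj[OF eventually_at_right_less[of 0] order_tendstoD(2)[OF tendsto_ident_at zero_less_one]] by simp

section \<open>The chambers on the two sides of a wall\<close>

context primitive_triangulated
begin

lemma wall_nonempty: "\<sigma> \<in> walls \<Longrightarrow> \<sigma> \<noteq> {}"
  using card_verts_wall by (fastforce simp: verts_def extreme_point_of_def)

lemma chamber_nonempty: "\<tau> \<in> chambers \<Longrightarrow> \<tau> \<noteq> {}"
  using card_verts_chamber by (fastforce simp: verts_def extreme_point_of_def)

lemma opposite_vertex:
  assumes "\<sigma> \<in> walls" "\<tau> \<in> chambers" "\<sigma> \<subseteq> \<tau>"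
  obtains x where "x \<notin> verts \<sigma>" "verts \<tau> = insert x (verts \<sigma>)"
proof -
  have sub: "verts \<sigma> \<subseteq> verts \<tau>" using subset_iff_verts wall_K chamber_K assms by blast
  have fin: "finite (verts \<tau>)" using finite_verts chamber_K assms by blast
  have "card (verts \<tau> - verts \<sigma>) = 1"
    using card_Diff_subset[OF finite_subset[OF sub fin] sub] card_verts_wall card_verts_chamber assms by simp
  then obtain x where "verts \<tau> - verts \<sigma> = {x}" using card_1_singletonE by blast
  then show thesis using sub that by blast
qed

text \<open>Move a little from the barycenter of \<sigma> towards x2. If x2 is not beyond \<sigma>
  as seen from x1, the point reached still lies in \<tau>1; all its coordinates in \<tau>2 are
  positive, so its carrier is the whole of \<open>verts \<tau>2\<close> and \<tau>2 is contained in
  \<tau>1.\<close>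

lemma same_side_imp_eq:
  assumes s: "\<sigma> \<in> walls" and t1: "\<tau>1 \<in> chambers" and t2: "\<tau>2 \<in> chambers"
    and v1: "x1 \<notin> verts \<sigma>" "verts \<tau>1 = insert x1 (verts \<sigma>)"
    and v2: "x2 \<notin> verts \<sigma>" "verts \<tau>2 = insert x2 (verts \<sigma>)"
    and pos: "coord \<tau>1 x1 x2 \<ge> 0"
  shows "\<tau>1 = \<tau>2"
proof -
  have sK: "\<sigma> \<in> K" "\<sigma> \<noteq> {}" and tK: "\<tau>1 \<in> K" "\<tau>2 \<in> K" using s t1 t2 wall_K wall_nonempty chamber_K by auto
  have sub: "\<sigma> \<subseteq> \<tau>1" "\<sigma> \<subseteq> \<tau>2" using subset_iff_verts sK tK v1 v2 by blast+
  define p where "p = barycenter \<sigma>"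
  have p: "p \<in> \<tau>1" "p \<in> \<tau>2" using barycenter_mem sK sub by (auto simp: p_def)
  have bcp: "bc p v = (if v \<in> verts \<sigma> then 1 / real CARD('d) else 0)" for v
    using bc_barycenter[OF sK] card_verts_wall[OF s] by (simp add: p_def)
  have ev: "\<forall>\<^sub>F t in at_right 0. (0 < t \<and> t < 1) \<and>
      (\<forall>w\<in>verts \<sigma>. (1 - t) * (1 / real CARD('d)) + t * coord \<tau>1 w x2 > 0)"
  proof (rule eventually_conj[OF eventually_at_right_01])
    have "\<forall>\<^sub>F t in at_right 0. (1 - t) * (1 / real CARD('d)) + t * coord \<tau>1 w x2 > 0" for w
      by (rule eventually_combination_pos) simp
    then show "\<forall>\<^sub>F t in at_right 0. \<forall>w\<in>verts \<sigma>. (1 - t) * (1 / real CARD('d)) + t * coord \<tau>1 w x2 > 0"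
      using finite_verts[OF sK(1)] by (intro eventually_ball_finite ballI)
  qed
  obtain t where t: "0 < t" "t < 1" "\<forall>w\<in>verts \<sigma>. (1 - t) * (1 / real CARD('d)) + t * coord \<tau>1 w x2 > 0"
    using eventually_happens'[OF _ ev] by auto
  define y where "y = p + t *\<^sub>R (x2 - p)"
  have cy: "coord \<tau> w y = (1 - t) * bc p w + t * coord \<tau> w x2" if "\<tau> \<in> chambers" "p \<in> \<tau>" "w \<in> verts \<tau>" for \<tau> w
    unfolding y_def using affine_function_comb[OF affine_coord[OF that(1)]] coord_eq_bc[OF that] by simp
  have y1: "y \<in> \<tau>1"
  proof (rule coord_nonneg_mem[OF t1])
    fix w assume w: "w \<in> verts \<tau>1"
    show "0 \<le> coord \<tau>1 w y"
      using cy[OF t1 p(1) w] t pos w v1 by (cases "w = x1") (auto simp: bcp less_imp_le)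
  qed
  have x2: "x2 \<in> \<tau>2" using v2 verts_sub[OF tK(2)] by auto
  have "y = (1 - t) *\<^sub>R p + t *\<^sub>R x2" by (simp add: y_def algebra_simps)
  then have y2: "y \<in> \<tau>2" using convex_simplex[OF tK(2)] p x2 t by (simp add: convex_alt)
  have "bc y w > 0" if w: "w \<in> verts \<tau>2" for w
    using cy[OF t2 p(2) w] coord_eq_bc[OF t2 y2 w] coord_vertex[OF t2, of x2 w] v2 w t
    by (cases "w = x2") (auto simp: bcp)
  then have "verts \<tau>2 \<subseteq> carrier y" by (auto simp: carrier_def)
  also have "\<dots> \<subseteq> verts \<tau>1" using carrier_subset_iff[OF tK(1)] y1 tK by blast
  finally have "\<tau>2 \<subseteq> \<tau>1" using subset_iff_verts tK by blast
  then show ?thesis using chamber_maximal[OF t2 tK(1)] by simp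
qed

text \<open>Distinct chambers have their apexes on opposite sides. The coordinates of the apexes of
  \<tau>1 and \<tau>2 both vanish on \<sigma>, hence are proportional, with a negative factor k; a
  third apex would be negative for both.\<close>

lemma wall_at_most_two:
  assumes s: "\<sigma> \<in> walls" and t: "\<tau>1 \<in> chambers" "\<tau>2 \<in> chambers" "\<tau>3 \<in> chambers"
    "\<sigma> \<subseteq> \<tau>1" "\<sigma> \<subseteq> \<tau>2" "\<sigma> \<subseteq> \<tau>3" and ne: "\<tau>1 \<noteq> \<tau>2"
  shows "\<tau>3 = \<tau>1 \<or> \<tau>3 = \<tau>2"
proof (rule ccontr)
  assume no: "\<not> (\<tau>3 = \<tau>1 \<or> \<tau>3 = \<tau>2)"
  obtain x1 where x1: "x1 \<notin> verts \<sigma>" "verts \<tau>1 = insert x1 (verts \<sigma>)" using opposite_vertex s t by metis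
  obtain x2 where x2: "x2 \<notin> verts \<sigma>" "verts \<tau>2 = insert x2 (verts \<sigma>)" using opposite_vertex s t by metis
  obtain x3 where x3: "x3 \<notin> verts \<sigma>" "verts \<tau>3 = insert x3 (verts \<sigma>)" using opposite_vertex s t by metis
  define k where "k = coord \<tau>1 x1 x2"
  have k: "k < 0" using same_side_imp_eq[OF s t(1,2) x1 x2] ne by (force simp: k_def)
  have k13: "coord \<tau>1 x1 x3 < 0" using same_side_imp_eq[OF s t(1,3) x1 x3] no by force
  have k23: "coord \<tau>2 x2 x3 < 0" using same_side_imp_eq[OF s t(2,3) x2 x3] no by force
  have "coord \<tau>1 x1 x3 = k * coord \<tau>2 x2 x3"
  proof (rule affine_function_eq[OF t(2) affine_coord[OF t(1)] affine_function_scale[OF affine_coord[OF t(2)]]])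
    fix v assume "v \<in> verts \<tau>2"
    then show "coord \<tau>1 x1 v = k * coord \<tau>2 x2 v"
      using x1 x2 coord_vertex[OF t(1), of v x1] coord_vertex[OF t(2), of v x2] by (auto simp: k_def)
  qed
  then show False using k k13 k23 mult_neg_neg[OF k k23] by simp
qed

text \<open>Leave \<tau>1 through the barycenter of \<sigma>, straight away from the apex. Since the
  barycenter is interior, the point reached is still in P and lies in some chamber; being close to
  the barycenter, that chamber contains it and therefore \<sigma>.\<close>

lemma interior_wall_second_chamber:
  assumes s: "\<sigma> \<in> walls" and t: "\<tau>1 \<in> chambers" "\<sigma> \<subseteq> \<tau>1" and int: "barycenter \<sigma> \<in> interior P"
  shows "\<exists>\<tau>2\<in>chambers. \<sigma> \<subseteq> \<tau>2 \<and> \<tau>2 \<noteq> \<tau>1"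
proof -
  have sK: "\<sigma> \<in> K" "\<sigma> \<noteq> {}" using s wall_K wall_nonempty by auto
  define p where "p = barycenter \<sigma>"
  obtain x1 where x1: "x1 \<notin> verts \<sigma>" "verts \<tau>1 = insert x1 (verts \<sigma>)" using opposite_vertex s t by metis
  have p1: "p \<in> \<tau>1" using barycenter_mem[OF sK] t by (auto simp: p_def)
  have c0: "coord \<tau>1 x1 p = 0" using coord_eq_bc[OF t(1) p1] bc_barycenter[OF sK] x1 by (simp add: p_def)
  obtain r where r: "r > 0" "\<And>\<sigma>. \<sigma> \<in> K \<Longrightarrow> \<sigma> \<inter> ball p r \<noteq> {} \<Longrightarrow> p \<in> \<sigma>"
    using simplex_near_point[of p] by blast
  have ev: "\<forall>\<^sub>F t in at_right 0. (0 < t \<and> t < 1) \<and> p + t *\<^sub>R (p - x1) \<in> interior P \<inter> ball p r"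
    by (rule eventually_conj[OF eventually_at_right_01 eventually_ray_in_open])
      (use int r in \<open>auto simp: p_def\<close>)
  obtain t where t0: "0 < t" "p + t *\<^sub>R (p - x1) \<in> interior P \<inter> ball p r"
    using eventually_happens'[OF _ ev] by auto
  define y where "y = p + t *\<^sub>R (p - x1)"
  have "y = p + (- t) *\<^sub>R (x1 - p)" by (simp add: y_def algebra_simps)
  then have "coord \<tau>1 x1 y = - t"
    using affine_function_comb[OF affine_coord[OF t(1)], of x1 p "- t" x1] c0 coord_vertex[OF t(1), of x1 x1] x1 by simp
  then have "y \<notin> \<tau>1" using coord_eq_bc[OF t(1), of y x1] bc_nonneg[OF chamber_K[OF t(1)], of y x1] x1 t0 by auto
  have "y \<in> P" using t0 interior_subset by (auto simp: y_def)
  then obtain \<tau>2 where t2: "\<tau>2 \<in> chambers" "y \<in> \<tau>2" using P_covered by blast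
  moreover have "y \<in> ball p r" using t0 by (simp add: y_def)
  ultimately have "p \<in> \<tau>2" using r(2)[OF chamber_K[OF t2(1)]] by blast
  then have "\<sigma> \<subseteq> \<tau>2" using barycenter_in_iff[OF sK chamber_K[OF t2(1)]] by (simp add: p_def)
  then show ?thesis using t2 \<open>y \<notin> \<tau>1\<close> by blast
qed

text \<open>A hyperplane supporting P at the barycenter contains all of \<sigma>, because a sum of
  nonnegative terms with positive weights vanishes. It is therefore a positive multiple of the
  coordinate of the apex of \<tau>1, and an apex on the other side would lie outside P.\<close>

lemma boundary_wall_unique_chamber:
  assumes s: "\<sigma> \<in> walls" and t: "\<tau>1 \<in> chambers" "\<tau>2 \<in> chambers" "\<sigma> \<subseteq> \<tau>1" "\<sigma> \<subseteq> \<tau>2"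
    and bd: "barycenter \<sigma> \<notin> interior P"
  shows "\<tau>1 = \<tau>2"
proof (rule ccontr)
  assume ne: "\<tau>1 \<noteq> \<tau>2"
  have sK: "\<sigma> \<in> K" "\<sigma> \<noteq> {}" using s wall_K wall_nonempty by auto
  define p where "p = barycenter \<sigma>"
  have p: "p \<in> P" "p \<in> \<sigma>" "p \<in> \<tau>1" using barycenter_mem[OF sK] t in_P[OF sK(1)] by (auto simp: p_def)
  have ah: "affine hull P = UNIV" using full_dim aff_dim_eq_full[of P] by simp
  then have ri: "rel_interior P = interior P" by (simp add: rel_interior_interior)
  obtain a where a: "a \<noteq> 0" "\<And>y. y \<in> P \<Longrightarrow> a \<bullet> p \<le> a \<bullet> y" "\<And>y. y \<in> interior P \<Longrightarrow> a \<bullet> p < a \<bullet> y"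
    using supporting_hyperplane_rel_boundary[OF convex_P p(1)] bd ri by (auto simp: p_def)
  define f where "f y = a \<bullet> y - a \<bullet> p" for y
  have "linear (\<lambda>y. a \<bullet> y)" by (simp add: linear_iff inner_add_right)
  then have f: "affine_function f" unfolding affine_function_def f_def
    by (intro exI[of _ "\<lambda>y. a \<bullet> y"] exI[of _ "- (a \<bullet> p)"]) auto
  have fP: "f y \<ge> 0" if "y \<in> P" for y using a(2)[OF that] by (simp add: f_def)
  have f0: "f v = 0" if v: "v \<in> verts \<sigma>" for v
  proof -
    have "0 = f (\<Sum>v\<in>verts \<sigma>. bc p v *\<^sub>R v)" using bc_combination[OF sK(1) p(2)] by (simp add: f_def)
    also have "\<dots> = (\<Sum>v\<in>verts \<sigma>. bc p v * f v)"
      by (rule affine_function_sum_scaleR[OF f bc_sum[OF sK(1) p(2)]])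
    finally have "(\<Sum>v\<in>verts \<sigma>. bc p v * f v) = 0" by simp
    then have "\<forall>v\<in>verts \<sigma>. bc p v * f v = 0"
      using finite_verts[OF sK(1)] fP in_P[OF sK(1)] verts_sub[OF sK(1)] bc_nonneg[OF sK(1) p(2)]
      by (subst (asm) sum_nonneg_eq_0_iff) auto
    then have "bc p v * f v = 0" using v by blast
    then show ?thesis using v bc_barycenter[OF sK] card_verts_wall[OF s] by (auto simp: p_def)
  qed
  obtain x1 where x1: "x1 \<notin> verts \<sigma>" "verts \<tau>1 = insert x1 (verts \<sigma>)" using opposite_vertex s t by metis
  obtain x2 where x2: "x2 \<notin> verts \<sigma>" "verts \<tau>2 = insert x2 (verts \<sigma>)" using opposite_vertex s t by metis
  have feq: "f y = f x1 * coord \<tau>1 x1 y" for y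
  proof (rule affine_function_eq[OF t(1) f affine_function_scale[OF affine_coord[OF t(1)]]])
    fix v assume "v \<in> verts \<tau>1"
    then show "f v = f x1 * coord \<tau>1 x1 v" using x1 coord_vertex[OF t(1), of v x1] f0 by auto
  qed
  have xP: "x1 \<in> P" "x2 \<in> P"
    using x1 x2 verts_sub[OF chamber_K[OF t(1)]] verts_sub[OF chamber_K[OF t(2)]] in_P chamber_K t by blast+
  obtain z where "z \<in> interior P" using interior_chamber[OF t(1)] interior_mono[of \<tau>1 P] in_P[OF chamber_K[OF t(1)]] by blast
  then have "f z > 0" using a(3) by (simp add: f_def)
  then have "f x1 \<noteq> 0" using feq[of z] by auto
  then have "f x1 > 0" using fP[OF xP(1)] by simp
  moreover have "coord \<tau>1 x1 x2 < 0" using same_side_imp_eq[OF s t(1,2) x1 x2] ne by force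
  ultimately have "f x2 < 0" using feq[of x2] mult_pos_neg by metis
  then show False using fP[OF xP(2)] by simp
qed

lemma chambers_at_interior_wall:
  assumes "\<sigma> \<in> walls" "barycenter \<sigma> \<in> interior P"
  obtains \<tau>1 \<tau>2 where "\<tau>1 \<noteq> \<tau>2" "{\<tau> \<in> chambers. \<sigma> \<subseteq> \<tau>} = {\<tau>1, \<tau>2}"
proof -
  obtain \<tau>1 where 1: "\<tau>1 \<in> chambers" "\<sigma> \<subseteq> \<tau>1" using chamber_above wall_K assms by blast
  obtain \<tau>2 where 2: "\<tau>2 \<in> chambers" "\<sigma> \<subseteq> \<tau>2" "\<tau>2 \<noteq> \<tau>1"
    using interior_wall_second_chamber[OF assms(1) 1 assms(2)] by blast
  then have "{\<tau> \<in> chambers. \<sigma> \<subseteq> \<tau>} = {\<tau>1, \<tau>2}"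
    using wall_at_most_two[OF assms(1)] 1 by blast
  then show thesis using that 2 by blast
qed

lemma chambers_at_boundary_wall:
  assumes "\<sigma> \<in> walls" "barycenter \<sigma> \<notin> interior P" "\<tau>1 \<in> chambers" "\<sigma> \<subseteq> \<tau>1"
  shows "{\<tau> \<in> chambers. \<sigma> \<subseteq> \<tau>} = {\<tau>1}"
  using boundary_wall_unique_chamber[OF assms(1)] assms by blast

lemma chambers_at_common_wall:
  assumes "\<tau>1 \<in> chambers" "\<tau>2 \<in> chambers" "\<tau>1 \<inter> \<tau>2 \<in> walls"
  shows "\<tau>1 \<noteq> \<tau>2" "{\<tau> \<in> chambers. \<tau>1 \<inter> \<tau>2 \<subseteq> \<tau>} = {\<tau>1, \<tau>2}"
proof -
  show "\<tau>1 \<noteq> \<tau>2" using assms by (auto simp: chambers_def walls_def)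
  then show "{\<tau> \<in> chambers. \<tau>1 \<inter> \<tau>2 \<subseteq> \<tau>} = {\<tau>1, \<tau>2}"
    using wall_at_most_two[OF assms(3,1,2)] assms by blast
qed

subsection \<open>Faces of the polytope\<close>

lemma interior_facet_disjoint: "F face_of P \<Longrightarrow> F \<noteq> P \<Longrightarrow> F \<inter> interior P = {}"
  by (rule face_of_disjoint_interior)

lemma rel_interior_P: "rel_interior P = interior P"
  using full_dim aff_dim_eq_full[of P] by (simp add: rel_interior_interior)

lemma boundary_in_facet:
  assumes "x \<in> P" "x \<notin> interior P"
  shows "\<exists>F. F facet_of P \<and> x \<in> F"
proof -
  have "x \<in> rel_frontier P" using assms closure_subset by (auto simp: rel_frontier_def rel_interior_P)
  then show ?thesis using rel_frontier_of_polyhedron[OF polytope_imp_polyhedron[OF polytope_P]] by auto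
qed

lemma facet_face: "F facet_of P \<Longrightarrow> F face_of P" "F facet_of P \<Longrightarrow> F \<noteq> P"
  "F facet_of P \<Longrightarrow> aff_dim F = int CARD('d) - 1"
  using full_dim by (auto simp: facet_of_def)

text \<open>The intersection with F is a face of \<sigma>, hence in K, and the only face of \<sigma>
  containing its barycenter is \<sigma>.\<close>

lemma face_contains_simplex_iff:
  assumes "F face_of P" "\<sigma> \<in> K" "\<sigma> \<noteq> {}"
  shows "barycenter \<sigma> \<in> F \<longleftrightarrow> \<sigma> \<subseteq> F"
proof
  assume b: "barycenter \<sigma> \<in> F"
  have sP: "\<sigma> \<subseteq> P" using in_P assms by blast
  have "F \<inter> \<sigma> face_of P \<inter> \<sigma>" using face_of_slice[OF assms(1) convex_simplex[OF assms(2)]] .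
  then have "F \<inter> \<sigma> \<in> K" using face_K[OF assms(2)] sP by (simp add: Int_absorb1)
  then have "\<sigma> \<subseteq> F \<inter> \<sigma>" using barycenter_in_iff[OF assms(2,3)] barycenter_mem[OF assms(2,3)] b by blast
  then show "\<sigma> \<subseteq> F" by blast
qed (use barycenter_mem assms in blast)

lemma face_contains_carrier:
  assumes "F face_of P" "x \<in> F"
  shows "convex hull (carrier x) \<subseteq> F"
proof -
  have xP: "x \<in> \<Union>K" using assms face_of_imp_subset Union_K by blast
  note cs = carrier_simplex[OF xP]
  have "F \<inter> convex hull (carrier x) face_of P \<inter> convex hull (carrier x)"
    using face_of_slice[OF assms(1)] by simp
  moreover have "P \<inter> convex hull (carrier x) = convex hull (carrier x)" using in_P cs(1) by blast
  ultimately have "F \<inter> convex hull (carrier x) \<in> K" using face_K[OF cs(1)] by simp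
  then have "carrier x \<subseteq> verts (F \<inter> convex hull (carrier x))"
    using carrier_subset_iff[OF _ xP] cs(3) assms(2) by blast
  then have "verts (convex hull carrier x) \<subseteq> verts (F \<inter> convex hull carrier x)" using cs(2) by simp
  then have "convex hull carrier x \<subseteq> F \<inter> convex hull carrier x"
    using subset_iff_verts cs(1) \<open>F \<inter> convex hull (carrier x) \<in> K\<close> by blast
  then show ?thesis by blast
qed

lemma boundary_simplex_in_facet:
  assumes "\<sigma> \<in> K" "\<sigma> \<noteq> {}" "barycenter \<sigma> \<notin> interior P"
  shows "\<exists>F. F facet_of P \<and> \<sigma> \<subseteq> F"
  using boundary_in_facet[of "barycenter \<sigma>"] face_contains_simplex_iff[OF _ assms(1,2)] facet_face(1)
    barycenter_mem[OF assms(1,2)] in_P[OF assms(1)] assms(3) by blast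

text \<open>Near the barycenter of \<sigma> the facet is covered by the affine hulls of the
  simplices of K in F through that point. One of these hulls contains the whole neighbourhood in F,
  so its simplex has the dimension of F.\<close>

lemma facet_wall:
  assumes "F facet_of P" "\<sigma> \<in> K" "\<sigma> \<noteq> {}" "\<sigma> \<subseteq> F"
  shows "\<exists>\<omega>\<in>walls. \<sigma> \<subseteq> \<omega> \<and> \<omega> \<subseteq> F"
proof -
  define p where "p = barycenter \<sigma>"
  have p: "p \<in> F" using barycenter_mem[OF assms(2,3)] assms(4) by (auto simp: p_def)
  obtain r where r: "r > 0" "\<And>\<sigma>. \<sigma> \<in> K \<Longrightarrow> \<sigma> \<inter> ball p r \<noteq> {} \<Longrightarrow> p \<in> \<sigma>"
    using simplex_near_point[of p] by blast
  define I where "I = {\<rho> \<in> K. \<rho> \<subseteq> F \<and> p \<in> \<rho>}"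
  have cF: "convex F" using facet_face(1)[OF assms(1)] face_of_imp_convex convex_P by blast
  have FP: "F \<subseteq> P" using facet_face(1)[OF assms(1)] face_of_imp_subset by blast
  have "F \<inter> ball p r \<subseteq> (\<Union>\<rho>\<in>I. affine hull \<rho>)"
  proof
    fix x assume x: "x \<in> F \<inter> ball p r"
    have xP: "x \<in> \<Union>K" using x FP Union_K by blast
    note cs = carrier_simplex[OF xP]
    have "convex hull carrier x \<subseteq> F" using face_contains_carrier[OF facet_face(1)[OF assms(1)]] x by blast
    moreover have "p \<in> convex hull carrier x" using r(2)[OF cs(1)] cs(3) x by blast
    ultimately have "convex hull carrier x \<in> I" using cs(1) by (simp add: I_def)
    moreover have "x \<in> affine hull (convex hull carrier x)" using hull_inc[OF cs(3)] .
    ultimately show "x \<in> (\<Union>\<rho>\<in>I. affine hull \<rho>)" by blast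
  qed
  moreover have "finite I" using finite_K by (simp add: I_def)
  moreover have ne: "F \<inter> ball p r \<noteq> {}" using p r by auto
  moreover have "convex (F \<inter> ball p r)" using cF by (simp add: convex_Int)
  ultimately obtain \<rho> where \<rho>: "\<rho> \<in> I" "F \<inter> ball p r \<subseteq> affine hull \<rho>"
    using convex_subset_finite_Union_affine[of I "F \<inter> ball p r" "\<lambda>\<rho>. affine hull \<rho>"] by auto
  have "affine hull (F \<inter> ball p r) = affine hull F"
    using affine_hull_convex_Int_open[OF cF open_ball ne] .
  then have "aff_dim F = aff_dim (F \<inter> ball p r)" by (metis aff_dim_affine_hull)
  also have "\<dots> \<le> aff_dim \<rho>" using aff_dim_subset[OF \<rho>(2)] by simp
  finally have "aff_dim \<rho> = int CARD('d) - 1"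
    using aff_dim_subset[of \<rho> F] \<rho>(1) facet_face(3)[OF assms(1)] by (simp add: I_def)
  then have "\<rho> \<in> walls" using \<rho>(1) by (simp add: I_def walls_def)
  moreover have "\<sigma> \<subseteq> \<rho>" using barycenter_in_iff[OF assms(2,3), of \<rho>] \<rho>(1) by (simp add: I_def p_def)
  ultimately show ?thesis using \<rho>(1) by (auto simp: I_def)
qed

lemma facet_has_wall:
  assumes "F facet_of P"
  shows "\<exists>\<omega>\<in>walls. \<omega> \<subseteq> F"
proof -
  have "F \<noteq> {}" using assms by (simp add: facet_of_def)
  then obtain x where x: "x \<in> F" by auto
  have xP: "x \<in> \<Union>K" using x assms facet_of_imp_subset Union_K by blast
  note cs = carrier_simplex[OF xP]
  have "convex hull carrier x \<noteq> {}" using cs(3) by blast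
  then show ?thesis
    using facet_wall[OF assms cs(1)] face_contains_carrier[OF facet_face(1)[OF assms] x] by blast
qed

end

section \<open>Functions on the vertices from gradients on the chambers\<close>

context primitive_triangulated
begin

lemma edge_simplex:
  assumes "\<tau> \<in> K" "v \<in> verts \<tau>" "w \<in> verts \<tau>"
  shows "convex hull {v, w} \<in> K" "verts (convex hull {v, w}) = {v, w}" "convex hull {v, w} \<noteq> {}"
  using sub_simplex[OF assms(1), of "{v, w}"] assms by auto

text \<open>An interior wall lies in two chambers, whose covectors then agree along it; a boundary
  wall lies in one chamber, whose covector then vanishes along it. The sum treats both cases at once
  and is also the evaluation of the family on the boundary of an edge class placed at the wall,
  which ties the condition to homology.\<close>

definition compatible :: "((real ^ 'd) set \<Rightarrow> bit ^ 'd) \<Rightarrow> bool"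
  where "compatible a \<longleftrightarrow> (\<forall>\<sigma>\<in>walls. \<forall>v\<in>verts \<sigma>. \<forall>w\<in>verts \<sigma>.
    (\<Sum>\<tau> | \<tau> \<in> chambers \<and> \<sigma> \<subseteq> \<tau>. pairing2 (mod2 v + mod2 w) (a \<tau>)) = 0)"

text \<open>Go around the edge: chambers through its barycenter are linked by walls that contain the
  edge, and compatibility keeps the pairing across each of them.\<close>

lemma compatible_on_edge:
  assumes "compatible a" and t: "\<tau> \<in> chambers" "\<tau>' \<in> chambers"
    and vw: "v \<in> verts \<tau> \<inter> verts \<tau>'" "w \<in> verts \<tau> \<inter> verts \<tau>'"
  shows "pairing2 (mod2 v + mod2 w) (a \<tau>) = pairing2 (mod2 v + mod2 w) (a \<tau>')"
proof -
  define e where "e = convex hull {v, w}"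
  have e: "e \<in> K" "verts e = {v, w}" "e \<noteq> {}" using edge_simplex[OF chamber_K[OF t(1)], of v w] vw by (auto simp: e_def)
  have in_iff: "barycenter e \<in> \<rho> \<longleftrightarrow> {v, w} \<subseteq> verts \<rho>" if "\<rho> \<in> K" for \<rho>
    using barycenter_in_iff[OF e(1,3) that] subset_iff_verts[OF e(1) that] e(2) by simp
  show ?thesis
  proof (rule star_connected[OF t])
    show "barycenter e \<in> \<tau>" "barycenter e \<in> \<tau>'" using in_iff chamber_K t vw by auto
    fix \<tau>1 \<tau>2
    assume a: "\<tau>1 \<in> chambers" "\<tau>2 \<in> chambers" "\<tau>1 \<inter> \<tau>2 \<in> walls" "barycenter e \<in> \<tau>1" "barycenter e \<in> \<tau>2"
    have "{v, w} \<subseteq> verts (\<tau>1 \<inter> \<tau>2)"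
      using in_iff verts_Int chamber_K a by auto
    then have "(\<Sum>\<tau> | \<tau> \<in> chambers \<and> \<tau>1 \<inter> \<tau>2 \<subseteq> \<tau>. pairing2 (mod2 v + mod2 w) (a \<tau>)) = 0"
      using assms(1) a(3) unfolding compatible_def by blast
    then have "pairing2 (mod2 v + mod2 w) (a \<tau>1) + pairing2 (mod2 v + mod2 w) (a \<tau>2) = 0"
      using chambers_at_common_wall[OF a(1-3)] by simp
    then show "pairing2 (mod2 v + mod2 w) (a \<tau>1) = pairing2 (mod2 v + mod2 w) (a \<tau>2)"
      by (simp add: vec_bit_eq_add)
  qed
qed

text \<open>A simplicial approximation of the identity, with ties between maximal coordinates broken
  by choice.\<close>

definition near_vertex :: "real ^ 'd \<Rightarrow> real ^ 'd"
  where "near_vertex x = (SOME v. v \<in> maxset x)"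

lemma near_vertex: "x \<in> P \<Longrightarrow> near_vertex x \<in> maxset x"
  using maxset_nonempty[of x] Union_K unfolding near_vertex_def by (metis equals0I someI)

text \<open>The coordinates sum to 1 over N vertices, so the largest is at least 1 / N; uniform
  continuity keeps its change below 1 / (N + 1). Near vertices of points close to x thus lie in the
  carrier of x and are vertices of one simplex.\<close>

lemma near_vertex_carrier_uniform:
  obtains \<delta> where "\<delta> > 0" "\<And>x y. \<lbrakk>x \<in> P; y \<in> P; dist x y < \<delta>\<rbrakk> \<Longrightarrow> near_vertex x \<in> carrier y"
proof -
  define N where "N = real (card vertices)"
  have "\<exists>\<delta>>0. \<forall>x\<in>P. \<forall>y\<in>P. dist y x < \<delta> \<longrightarrow> dist (bc y v) (bc x v) < 1 / (N + 1)" for v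
    using compact_uniformly_continuous[OF _ compact_P, of "\<lambda>x. bc x v"] continuous_on_bc[of v] Union_K
    unfolding uniformly_continuous_on_def N_def by auto
  then obtain \<delta> where d: "\<And>v. \<delta> v > 0"
    "\<And>v x y. \<lbrakk>x \<in> P; y \<in> P; dist y x < \<delta> v\<rbrakk> \<Longrightarrow> dist (bc y v) (bc x v) < 1 / (N + 1)" by metis
  define \<delta>' where "\<delta>' = Min (insert 1 (\<delta> ` vertices))"
  have "\<delta>' > 0" using finite_vertices d(1) by (simp add: \<delta>'_def)
  moreover have "near_vertex x \<in> carrier y" if xy: "x \<in> P" "y \<in> P" "dist x y < \<delta>'" for x y
  proof -
    define v where "v = near_vertex x"
    have v: "v \<in> vertices" "\<forall>w. bc x w \<le> bc x v" using near_vertex[OF xy(1)] by (auto simp: v_def maxset_def)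
    obtain \<sigma> where s: "\<sigma> \<in> K" "x \<in> \<sigma>" using xy Union_K by blast
    have "1 = sum (bc x) vertices" using bc_sum_vertices[OF s] by simp
    also have "\<dots> \<le> N * bc x v" unfolding N_def by (rule sum_bounded_above) (use v in auto)
    finally have 1: "1 \<le> N * bc x v" .
    moreover have "N \<ge> 0" by (simp add: N_def)
    moreover have "bc x v \<ge> 0" using bc_nonneg[OF s] .
    ultimately have "1 \<le> (N + 1) * bc x v" by (simp add: distrib_right)
    then have "1 / (N + 1) \<le> bc x v" using \<open>N \<ge> 0\<close> by (simp add: divide_le_eq mult.commute)
    moreover have "dist x y < \<delta> v" using xy(3) v(1) finite_vertices by (auto simp: \<delta>'_def)
    then have "dist (bc x v) (bc y v) < 1 / (N + 1)" using d(2)[OF xy(2,1)] by simp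
    ultimately have "bc y v > 0" by (simp add: dist_real_def)
    then show ?thesis by (simp add: carrier_def v_def)
  qed
  ultimately show thesis using that by blast
qed

text \<open>
  The \<open>1\<close>-cochain \<open>c\<close> becomes a local cocycle \<open>c (near_vertex x) (near_vertex y)\<close> on the convex set \<open>P\<close>.
\<close>

lemma simplicial_cocycle_is_coboundary:
  assumes c: "\<And>\<tau> u v w. \<lbrakk>\<tau> \<in> chambers; u \<in> verts \<tau>; v \<in> verts \<tau>; w \<in> verts \<tau>\<rbrakk> \<Longrightarrow> c u v + c v w = (c u w :: bit)"
  obtains f where "\<And>\<tau> v w. \<lbrakk>\<tau> \<in> chambers; v \<in> verts \<tau>; w \<in> verts \<tau>\<rbrakk> \<Longrightarrow> c v w = f v + f w"
proof -
  obtain \<delta> where d: "\<delta> > 0" "\<And>x y. \<lbrakk>x \<in> P; y \<in> P; dist x y < \<delta>\<rbrakk> \<Longrightarrow> near_vertex x \<in> carrier y"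
    using near_vertex_carrier_uniform by blast
  have "c (near_vertex x) (near_vertex y) + c (near_vertex y) (near_vertex z) = c (near_vertex x) (near_vertex z)"
    if "x \<in> P" "y \<in> P" "z \<in> P" "dist x y < \<delta>" "dist y z < \<delta>" "dist x z < \<delta>" for x y z
  proof -
    obtain \<tau> where t: "\<tau> \<in> chambers" "x \<in> \<tau>" using P_covered \<open>x \<in> P\<close> by blast
    have "carrier x \<subseteq> verts \<tau>" using carrier_subset_iff[OF chamber_K[OF t(1)]] t that Union_K by blast
    moreover have "near_vertex x \<in> carrier x" "near_vertex y \<in> carrier x" "near_vertex z \<in> carrier x"
      using d that by (auto simp: dist_commute)
    ultimately show ?thesis using c[OF t(1)] by blast
  qed
  then obtain f :: "real ^ 'd \<Rightarrow> bit" and \<delta>' where f: "\<delta>' > 0"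
    "\<And>x y. \<lbrakk>x \<in> P; y \<in> P; dist x y < \<delta>'\<rbrakk> \<Longrightarrow> c (near_vertex x) (near_vertex y) = f y - f x"
    using convex_local_cocycle_is_coboundary[OF convex_P polytope_imp_bounded[OF polytope_P] d(1),
        of "\<lambda>x y. c (near_vertex x) (near_vertex y)"] by blast
  have "c v w = f v + f w" if t: "\<tau> \<in> chambers" and v: "v \<in> verts \<tau>" and w: "w \<in> verts \<tau>" for \<tau> v w
  proof (cases "v = w")
    case True
    then show ?thesis using c[OF t v v v] by simp
  next
    case False
    have tK: "\<tau> \<in> K" using t chamber_K by simp
    define e where "e = convex hull {v, w}"
    have e: "e \<in> K" "verts e = {v, w}" using edge_simplex[OF tK v w] by (auto simp: e_def)
    obtain m :: nat where m: "dist v w / \<delta>' < real m" using reals_Archimedean2 by blast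
    have m0: "m > 0" using m f(1) by (metis divide_nonneg_pos gr0I not_le of_nat_0 zero_le_dist)
    define p where "p j = v + (real j / real m) *\<^sub>R (w - v)" for j :: nat
    have pe: "p j \<in> e" if "j \<le> m" for j
    proof -
      have "p j = (1 - real j / real m) *\<^sub>R v + (real j / real m) *\<^sub>R w" by (simp add: p_def algebra_simps)
      then show ?thesis using that m0 unfolding e_def segment_convex_hull[symmetric] in_segment
        by (intro exI[of _ "real j / real m"]) auto
    qed
    have np: "near_vertex (p j) \<in> {v, w}" if "j \<le> m" for j
      using near_vertex[OF in_P[OF e(1) pe[OF that]]] maxset_subset_verts[OF e(1) pe[OF that]] e(2) by blast
    \<comment> \<open>On the edge the near vertex is v or w, so increments of f along the sample
      points are differences of g, and both sums telescope.\<close>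
    define g where "g j = (if near_vertex (p j) = v then 0 else c v w)" for j
    have cvv: "c v v = 0" "c w w = 0" using c[OF t v v v] c[OF t w w w] by simp_all
    have cwv: "c w v = c v w" using c[OF t v w v] cvv by (simp add: vec_bit_eq_add)
    have step: "f (p (Suc j)) - f (p j) = g (Suc j) - g j" if "j < m" for j
    proof -
      have "p (Suc j) - p j = (1 / real m) *\<^sub>R (w - v)"
        by (simp add: p_def scaleR_diff_left[symmetric] diff_divide_distrib[symmetric])
      then have "dist (p j) (p (Suc j)) = dist v w / real m"
        by (metis abs_1 abs_of_nat divide_inverse_commute dist_commute dist_norm norm_scaleR abs_divide inverse_eq_divide)
      also have "\<dots> < \<delta>'" using m m0 f(1) by (simp add: field_simps)
      finally have "c (near_vertex (p j)) (near_vertex (p (Suc j))) = f (p (Suc j)) - f (p j)"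
        using f(2) in_P[OF e(1) pe] that by simp
      moreover have "c (near_vertex (p j)) (near_vertex (p (Suc j))) = g (Suc j) - g j"
        using np[of j] np[of "Suc j"] that cvv cwv False by (auto simp: g_def)
      ultimately show ?thesis by simp
    qed
    have "f (p m) - f (p 0) = (\<Sum>j<m. f (p (Suc j)) - f (p j))" by (rule sum_lessThan_telescope[symmetric])
    also have "\<dots> = (\<Sum>j<m. g (Suc j) - g j)" by (rule sum.cong) (use step in auto)
    also have "\<dots> = g m - g 0" by (rule sum_lessThan_telescope)
    finally have eq: "f (p m) - f (p 0) = g m - g 0" .
    have pv: "p 0 = v" "p m = w" using m0 by (auto simp: p_def)
    have "carrier u = {u}" "u \<in> \<Union>K" if "u \<in> verts \<tau>" for u
      using bc_vertex[OF tK that] verts_sub[OF tK] tK that by (auto simp: carrier_def split: if_splits)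
    then have "maxset v \<subseteq> {v}" "maxset w \<subseteq> {w}"
      using maxset_subset_carrier[of v] maxset_subset_carrier[of w] v w by auto
    then have "near_vertex v = v" "near_vertex w = w"
      using near_vertex[of v] near_vertex[of w] verts_sub[OF tK] in_P[OF tK] v w by auto
    then have "g 0 = 0" "g m = c v w" using pv False by (auto simp: g_def)
    then have "c v w = f w - f v" using eq pv by simp
    then show ?thesis by (simp add: add.commute)
  qed
  then show thesis using that by blast
qed

text \<open>For dimension at least two the boundary of P is connected. The simplices on which f is
  constantly 0 and those on which it is constantly 1 give two closed sets that cover the boundary
  and do not meet on it.\<close>

lemma boundary_function_constant:
  assumes d2: "CARD('d) \<ge> 2"
    and edge: "\<And>\<sigma> v w. \<lbrakk>\<sigma> \<in> K; \<sigma> \<noteq> {}; barycenter \<sigma> \<notin> interior P; v \<in> verts \<sigma>; w \<in> verts \<sigma>\<rbrakk> \<Longrightarrow> f v = (f w :: bit)"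
  shows "\<exists>b. \<forall>v\<in>vertices. v \<notin> interior P \<longrightarrow> f v = b"
proof -
  let ?D = "rel_frontier P"
  have Deq: "x \<in> ?D \<longleftrightarrow> x \<in> P \<and> x \<notin> interior P" for x
    using closure_closed[OF closed_P] by (simp add: rel_frontier_def rel_interior_P)
  have "connected ?D"
    by (rule connected_sphere_gen) (use convex_P polytope_imp_bounded[OF polytope_P] full_dim d2 in auto)
  define A where "A b = \<Union>{\<sigma> \<in> K. \<forall>v\<in>verts \<sigma>. f v = b}" for b
  have clA: "closed (A b)" for b
    unfolding A_def using finite_K closed_simplex by (intro closed_Union) auto
  have carr: "\<exists>b. \<forall>v\<in>carrier x. f v = b" "x \<in> convex hull (carrier x)" if x: "x \<in> ?D" for x
  proof -
    have xP: "x \<in> \<Union>K" using x Deq Union_K by blast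
    note cs = carrier_simplex[OF xP]
    show "x \<in> convex hull (carrier x)" by (rule cs(3))
    let ?s = "convex hull (carrier x)"
    obtain F where F: "F facet_of P" "x \<in> F" using boundary_in_facet x Deq by blast
    have ne: "?s \<noteq> {}" using cs(3) by blast
    have "?s \<subseteq> F" using face_contains_carrier facet_face(1) F by blast
    then have "barycenter ?s \<in> F" using barycenter_mem[OF cs(1) ne] by blast
    then have "barycenter ?s \<notin> interior P" using interior_facet_disjoint[of F] facet_face F(1) by blast
    then have "f v = f w" if "v \<in> carrier x" "w \<in> carrier x" for v w
      using edge[OF cs(1) ne, of v w] that cs(2) by simp
    then show "\<exists>b. \<forall>v\<in>carrier x. f v = b" by metis
  qed
  have cover: "?D \<subseteq> A 0 \<union> A 1"
  proof
    fix x assume x: "x \<in> ?D"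
    have xP: "x \<in> \<Union>K" using x Deq Union_K by blast
    note cs = carrier_simplex[OF xP]
    obtain b where b: "\<forall>v\<in>carrier x. f v = b" using carr[OF x] by blast
    have "x \<in> A b" unfolding A_def using cs(1,2,3) b by blast
    then show "x \<in> A 0 \<union> A 1" by (cases b) auto
  qed
  have val: "f v = b" if "x \<in> A b" "v \<in> carrier x" for x v b
  proof -
    obtain \<sigma> where s: "\<sigma> \<in> K" "\<forall>v\<in>verts \<sigma>. f v = b" "x \<in> \<sigma>"
      using \<open>x \<in> A b\<close> unfolding A_def by blast
    have "x \<in> \<Union>K" using s by blast
    then have "carrier x \<subseteq> verts \<sigma>" using carrier_subset_iff[OF s(1)] s(3) by blast
    then show ?thesis using s(2) that(2) by blast
  qed
  have disj: "A 0 \<inter> A 1 \<inter> ?D = {}"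
  proof (rule ccontr)
    assume "A 0 \<inter> A 1 \<inter> ?D \<noteq> {}"
    then obtain x where x: "x \<in> A 0" "x \<in> A 1" "x \<in> ?D" by blast
    have "x \<in> \<Union>K" using x Deq Union_K by blast
    then obtain v where "v \<in> carrier x" using carrier_simplex(4) by blast
    then show False using val[OF x(1)] val[OF x(2)] by force
  qed
  have "A 0 \<inter> ?D = {} \<or> A 1 \<inter> ?D = {}"
    using connected_closedD[OF \<open>connected ?D\<close> disj cover clA clA] .
  then obtain b where b: "?D \<subseteq> A b" using cover by blast
  have "f v = b" if v: "v \<in> vertices" "v \<notin> interior P" for v
  proof -
    obtain \<sigma> where s: "\<sigma> \<in> K" "v \<in> verts \<sigma>" using v by (auto simp: vertices_def)
    have "v \<in> ?D" using Deq v in_P[OF s(1)] verts_sub[OF s(1)] s by blast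
    moreover have "v \<in> carrier v" using bc_vertex[OF s] by (simp add: carrier_def)
    ultimately show ?thesis using val b by blast
  qed
  then show ?thesis by blast
qed

text \<open>Pairings along an edge do not depend on the chamber and form a simplicial cocycle, hence
  a coboundary. The condition at boundary walls makes its primitive constant along every boundary
  simplex, so constant on the boundary vertices.\<close>

theorem compatible_is_gradient:
  assumes d2: "CARD('d) \<ge> 2" and a: "compatible a"
  obtains f where "\<And>v. \<lbrakk>v \<in> vertices; v \<notin> interior P\<rbrakk> \<Longrightarrow> f v = 0" "\<And>\<tau>. \<tau> \<in> chambers \<Longrightarrow> a \<tau> = grad \<tau> f"
proof -
  define c where "c v w = pairing2 (mod2 v + mod2 w) (a (SOME \<tau>. \<tau> \<in> chambers \<and> v \<in> verts \<tau> \<and> w \<in> verts \<tau>))" for v w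
  have c: "c v w = pairing2 (mod2 v + mod2 w) (a \<tau>)" if "\<tau> \<in> chambers" "v \<in> verts \<tau>" "w \<in> verts \<tau>" for \<tau> v w
  proof -
    define \<tau>' where "\<tau>' = (SOME \<tau>. \<tau> \<in> chambers \<and> v \<in> verts \<tau> \<and> w \<in> verts \<tau>)"
    have "\<tau>' \<in> chambers \<and> v \<in> verts \<tau>' \<and> w \<in> verts \<tau>'"
      unfolding \<tau>'_def by (rule someI[of _ \<tau>]) (use that in simp)
    then show ?thesis using compatible_on_edge[OF a _ that(1), of \<tau>' v w] that by (simp add: c_def \<tau>'_def)
  qed
  have "c u v + c v w = c u w" if "\<tau> \<in> chambers" "u \<in> verts \<tau>" "v \<in> verts \<tau>" "w \<in> verts \<tau>" for \<tau> u v w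
    using c[OF that(1)] that(2-4) by (simp add: ac_simps flip: pairing2_add_left)
  then obtain f where f: "\<And>\<tau> v w. \<lbrakk>\<tau> \<in> chambers; v \<in> verts \<tau>; w \<in> verts \<tau>\<rbrakk> \<Longrightarrow> c v w = f v + f w"
    using simplicial_cocycle_is_coboundary[of c] by blast
  have "f v = f w" if s: "\<sigma> \<in> K" "\<sigma> \<noteq> {}" "barycenter \<sigma> \<notin> interior P" "v \<in> verts \<sigma>" "w \<in> verts \<sigma>" for \<sigma> v w
  proof -
    obtain F where F: "F facet_of P" "\<sigma> \<subseteq> F" using boundary_simplex_in_facet s by blast
    obtain \<omega> where w: "\<omega> \<in> walls" "\<sigma> \<subseteq> \<omega>" "\<omega> \<subseteq> F" using facet_wall[OF F(1) s(1,2) F(2)] by blast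
    note wK = wall_K[OF w(1)] wall_nonempty[OF w(1)]
    have "barycenter \<omega> \<in> F" using barycenter_mem[OF wK] w by blast
    then have bd: "barycenter \<omega> \<notin> interior P" using interior_facet_disjoint[of F] facet_face F(1) by blast
    obtain \<tau> where t: "\<tau> \<in> chambers" "\<omega> \<subseteq> \<tau>" using chamber_above wK by blast
    have vw: "v \<in> verts \<omega>" "w \<in> verts \<omega>" using subset_iff_verts[OF s(1) wK(1)] w s by blast+
    then have "(\<Sum>\<tau> | \<tau> \<in> chambers \<and> \<omega> \<subseteq> \<tau>. pairing2 (mod2 v + mod2 w) (a \<tau>)) = 0"
      using a w(1) unfolding compatible_def by blast
    then have "pairing2 (mod2 v + mod2 w) (a \<tau>) = 0"
      using chambers_at_boundary_wall[OF w(1) bd t] by simp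
    moreover have "v \<in> verts \<tau>" "w \<in> verts \<tau>" using vw subset_iff_verts[OF wK(1) chamber_K[OF t(1)]] t by blast+
    ultimately have "f v + f w = 0" using c[OF t(1)] f[OF t(1)] by metis
    then show ?thesis by (simp add: vec_bit_eq_add)
  qed
  then obtain b where b: "\<forall>v\<in>vertices. v \<notin> interior P \<longrightarrow> f v = b"
    using boundary_function_constant[OF d2, of f] by blast
  \<comment> \<open>Adding the boundary value b changes no gradient and makes the function vanish on
    the boundary.\<close>
  have "a \<tau> = grad \<tau> (\<lambda>v. f v + b)" if t: "\<tau> \<in> chambers" for \<tau>
  proof (rule grad_eqI[OF t, symmetric])
    fix v w assume vw: "v \<in> verts \<tau>" "w \<in> verts \<tau>"
    have "pairing2 (mod2 v + mod2 w) (a \<tau>) = f v + f w" using c[OF t vw] f[OF t vw] by simp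
    also have "\<dots> = (f v + b) + (f w + b)" by (simp add: ac_simps)
    finally show "pairing2 (mod2 v + mod2 w) (a \<tau>) = (f v + b) + (f w + b)" .
  qed
  then show thesis using that[of "\<lambda>v. f v + b"] b by simp
qed

end

section \<open>Orthogonal lattices modulo two\<close>

lemma inner_diff_commute: "(x - z) \<bullet> y = y \<bullet> x - y \<bullet> z" for x y z :: "'a::real_inner"
  by (metis inner_commute inner_diff_right)

lemma orthogonal_comp_tangent_iff:
  "y \<in> orthogonal_comp (tangent S) \<longleftrightarrow> (\<forall>x\<in>S. \<forall>z\<in>S. y \<bullet> x = y \<bullet> z)"
proof
  assume y: "y \<in> orthogonal_comp (tangent S)"
  show "\<forall>x\<in>S. \<forall>z\<in>S. y \<bullet> x = y \<bullet> z"
  proof (intro ballI)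
    fix x z assume "x \<in> S" "z \<in> S"
    then have "x - z \<in> tangent S" unfolding tangent_def by (intro span_base) auto
    then have "(x - z) \<bullet> y = 0" using y by (simp add: orthogonal_comp_def orthogonal_def)
    then show "y \<bullet> x = y \<bullet> z" using inner_diff_commute[of x z y] by simp
  qed
next
  assume eq: "\<forall>x\<in>S. \<forall>z\<in>S. y \<bullet> x = y \<bullet> z"
  have "y \<bullet> (x - z) = 0" if "x \<in> S" "z \<in> S" for x z
    using eq that by (metis inner_diff_right right_minus_eq)
  then have "{x - z |x z. x \<in> S \<and> z \<in> S} \<subseteq> {w. y \<bullet> w = 0}" by blast
  then have "tangent S \<subseteq> {w. y \<bullet> w = 0}" unfolding tangent_def by (intro span_minimal subspace_hyperplane)
  then show "y \<in> orthogonal_comp (tangent S)"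
    unfolding orthogonal_comp_def orthogonal_def by (auto simp: inner_commute)
qed

lemma mem_perp2_iff: "u \<in> perp2 S \<longleftrightarrow> (\<exists>y\<in>int_points. mod2 y = u \<and> (\<forall>x\<in>S. \<forall>z\<in>S. y \<bullet> x = y \<bullet> z))"
  unfolding perp2_def using orthogonal_comp_tangent_iff[of _ S] by blast

lemma perp2_antimono:
  assumes "S \<subseteq> T"
  shows "perp2 T \<subseteq> perp2 S"
proof
  fix u assume "u \<in> perp2 T"
  then obtain y where "y \<in> int_points" "mod2 y = u" "\<forall>x\<in>T. \<forall>z\<in>T. y \<bullet> x = y \<bullet> z" unfolding mem_perp2_iff by blast
  then show "u \<in> perp2 S" unfolding mem_perp2_iff using assms by blast
qed

lemma mod2_zero [simp]: "mod2 0 = 0"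
  by (simp add: mod2_def vec_eq_iff)

lemma zero_int_points [simp]: "0 \<in> int_points"
  by (simp add: int_points_def)

lemma zero_in_perp2 [simp]: "0 \<in> perp2 S"
  unfolding mem_perp2_iff by (rule bexI[of _ 0]) auto

lemma perp2_pairing:
  assumes "u \<in> perp2 S" "x \<in> S" "z \<in> S" "x \<in> int_points" "z \<in> int_points"
  shows "pairing2 (mod2 x + mod2 z) u = 0"
proof -
  obtain y where y: "y \<in> int_points" "mod2 y = u" "y \<bullet> x = y \<bullet> z" using assms(1-3) by (auto simp: mem_perp2_iff)
  have "(x - z) \<bullet> y = 0" using y(3) by (simp add: inner_diff_commute)
  then have "pairing2 (mod2 (x - z)) u = 0"
    using pairing2_mod2[OF int_points_diff[OF assms(4,5)] y(1)] y(2) by simp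
  then show ?thesis using mod2_diff[OF assms(4,5)] by simp
qed

context primitive_triangulated
begin

text \<open>The difficult inclusion is a lifting problem. Extend \<sigma> to a chamber, lift the
  pairings with u relative to a vertex of \<sigma> to 0 and 1, and take an integral covector with
  these values: it reduces to u by uniqueness of gradients and is constant on \<sigma>, where all
  lifted values are 0.\<close>

lemma perp2_simplex:
  assumes "\<sigma> \<in> K" "\<sigma> \<noteq> {}"
  shows "perp2 \<sigma> = {u. \<forall>v\<in>verts \<sigma>. \<forall>w\<in>verts \<sigma>. pairing2 (mod2 v + mod2 w) u = 0}"
proof
  show "perp2 \<sigma> \<subseteq> {u. \<forall>v\<in>verts \<sigma>. \<forall>w\<in>verts \<sigma>. pairing2 (mod2 v + mod2 w) u = 0}"
    using perp2_pairing verts_sub[OF assms(1)] verts_int[OF assms(1)] by blast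
  show "{u. \<forall>v\<in>verts \<sigma>. \<forall>w\<in>verts \<sigma>. pairing2 (mod2 v + mod2 w) u = 0} \<subseteq> perp2 \<sigma>"
  proof
    fix u assume "u \<in> {u. \<forall>v\<in>verts \<sigma>. \<forall>w\<in>verts \<sigma>. pairing2 (mod2 v + mod2 w) u = 0}"
    then have u: "pairing2 (mod2 v + mod2 w) u = 0" if "v \<in> verts \<sigma>" "w \<in> verts \<sigma>" for v w using that by blast
    obtain \<tau> where t: "\<tau> \<in> chambers" "\<sigma> \<subseteq> \<tau>" using chamber_above assms by blast
    have tK: "\<tau> \<in> K" using t chamber_K by simp
    have sub: "verts \<sigma> \<subseteq> verts \<tau>" using subset_iff_verts[OF assms(1) tK] t by simp
    have "verts \<sigma> \<noteq> {}" using assms convex_hull_verts by fastforce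
    then obtain v0 where v0: "v0 \<in> verts \<sigma>" by auto
    define h where "h x = (if pairing2 (mod2 x + mod2 v0) u = 0 then 0 else 1 :: int)" for x
    obtain y a where y: "y \<in> int_points" "\<forall>x\<in>verts \<tau>. y \<bullet> x = of_int (h x) + a"
      using chamber_lift[OF t(1), of h] by blast
    have "mod2 y = u"
    proof (rule gradient_unique[OF t(1)])
      fix v w assume v: "v \<in> verts \<tau>" and w: "w \<in> verts \<tau>"
      have vw: "v \<in> int_points" "w \<in> int_points" using v w verts_int tK by auto
      have "(v - w) \<bullet> y = of_int (h v - h w)"
        using y(2) v w by (simp add: inner_diff_commute)
      then have fl: "\<lfloor>(v - w) \<bullet> y\<rfloor> = h v - h w" by (metis floor_of_int)
      have oh: "(of_int (h x) :: bit) = pairing2 (mod2 x + mod2 v0) u" for x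
        by (cases "pairing2 (mod2 x + mod2 v0) u") (auto simp: h_def)
      have "pairing2 (mod2 v + mod2 w) (mod2 y) = of_int (h v - h w)"
        using pairing2_mod2[OF int_points_diff[OF vw] y(1)] mod2_diff[OF vw] fl by simp
      also have "\<dots> = pairing2 (mod2 v + mod2 v0) u + pairing2 (mod2 w + mod2 v0) u" by (simp add: oh)
      also have "\<dots> = pairing2 (mod2 v + mod2 w) u"
        by (simp add: ac_simps flip: pairing2_add_left)
      finally show "pairing2 (mod2 v + mod2 w) (mod2 y) = pairing2 (mod2 v + mod2 w) u" .
    qed
    moreover have const: "y \<bullet> x = a" if x: "x \<in> \<sigma>" for x
    proof -
      have va: "y \<bullet> v = a" if "v \<in> verts \<sigma>" for v using y(2) sub that u[OF that v0] by (auto simp: h_def)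
      have "y \<bullet> x = (\<Sum>v\<in>verts \<sigma>. bc x v * (y \<bullet> v))"
        using bc_combination[OF assms(1) x] by (metis (no_types, lifting) inner_scaleR_right inner_sum_right sum.cong)
      also have "\<dots> = a" using va bc_sum[OF assms(1) x] by (simp flip: sum_distrib_right)
      finally show ?thesis .
    qed
    ultimately show "u \<in> perp2 \<sigma>" unfolding mem_perp2_iff using y(1) const by metis
  qed
qed

lemma perp2_chamber:
  assumes "\<tau> \<in> chambers"
  shows "perp2 \<tau> = {0}"
proof -
  have "u = 0" if "u \<in> perp2 \<tau>" for u
    by (rule gradient_unique[OF assms])
      (use that perp2_simplex[OF chamber_K[OF assms] chamber_nonempty[OF assms]] in auto)
  then show ?thesis by auto
qed

lemma Sed_P: "Sed P = {0}"
proof -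
  obtain x where "x \<in> P" using full_dim by (cases "P = {}") auto
  then obtain \<tau> where t: "\<tau> \<in> chambers" using P_covered by blast
  have "\<tau> \<subseteq> P" using in_P[OF chamber_K[OF t]] by blast
  then have "Sed P \<subseteq> {0}" using perp2_antimono[of \<tau> P] perp2_chamber[OF t] by simp
  then show ?thesis using zero_in_perp2[of P] by blast
qed

text \<open>A wall in F spans the same affine subspace as F, so a covector constant on the wall is
  constant on F.\<close>

lemma perp2_facet:
  assumes "F facet_of P" "\<omega> \<in> walls" "\<omega> \<subseteq> F"
  shows "perp2 F = perp2 \<omega>"
proof
  show "perp2 F \<subseteq> perp2 \<omega>" using perp2_antimono assms by blast
  have "affine hull \<omega> = affine hull F"
    using assms wall_nonempty facet_face(3)[OF assms(1)]
    by (intro affine_dim_equal) (auto simp: walls_def hull_mono)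
  then have hull: "F \<subseteq> affine hull \<omega>" using hull_subset by metis
  show "perp2 \<omega> \<subseteq> perp2 F"
  proof
    fix u assume "u \<in> perp2 \<omega>"
    then obtain y where y: "y \<in> int_points" "mod2 y = u" "\<forall>x\<in>\<omega>. \<forall>z\<in>\<omega>. y \<bullet> x = y \<bullet> z"
      by (auto simp: mem_perp2_iff)
    obtain z where z: "z \<in> \<omega>" using wall_nonempty assms by blast
    have "\<omega> \<subseteq> {x. y \<bullet> x = y \<bullet> z}" using y(3) z by blast
    then have "affine hull \<omega> \<subseteq> {x. y \<bullet> x = y \<bullet> z}" by (intro hull_minimal affine_hyperplane)
    then have "\<forall>x\<in>F. y \<bullet> x = y \<bullet> z" using hull by blast
    then show "u \<in> perp2 F" unfolding mem_perp2_iff using y by metis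
  qed
qed

text \<open>An element of \<open>perp2 \<sigma>\<close> is determined by its common pairing b with
  the edges from \<sigma> to the apex x, so it is b times the gradient of the indicator of
  x.\<close>

lemma perp2_wall:
  assumes s: "\<sigma> \<in> walls" and t: "\<tau> \<in> chambers" and x: "x \<notin> verts \<sigma>" "verts \<tau> = insert x (verts \<sigma>)"
  shows "perp2 \<sigma> = {0, grad \<tau> (\<lambda>v. if v = x then 1 else 0)}"
    and "grad \<tau> (\<lambda>v. if v = x then 1 else 0) \<noteq> 0"
proof -
  let ?n = "grad \<tau> (\<lambda>v. if v = x then 1 else 0 :: bit)"
  have sK: "\<sigma> \<in> K" "\<sigma> \<noteq> {}" using s wall_K wall_nonempty by auto
  then have "verts \<sigma> \<noteq> {}" using convex_hull_verts by fastforce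
  then obtain w where w: "w \<in> verts \<sigma>" by auto
  have g: "pairing2 (mod2 v + mod2 v') ?n = (if v = x then 1 else 0) + (if v' = x then 1 else 0)"
    if "v \<in> verts \<tau>" "v' \<in> verts \<tau>" for v v' using grad[OF t that] .
  have "pairing2 (mod2 x + mod2 w) ?n = 1" using g[of x w] x w by auto
  then show "?n \<noteq> 0" by auto
  have "?n \<in> perp2 \<sigma>" unfolding perp2_simplex[OF sK] using g x by auto
  moreover have "u \<in> {0, ?n}" if u: "u \<in> perp2 \<sigma>" for u
  proof -
    have uz: "pairing2 (mod2 v + mod2 v') u = 0" if "v \<in> verts \<sigma>" "v' \<in> verts \<sigma>" for v v'
      using u that unfolding perp2_simplex[OF sK] by blast
    define b where "b = pairing2 (mod2 x + mod2 w) u"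
    have xv: "pairing2 (mod2 x + mod2 v) u = b" "pairing2 (mod2 v + mod2 x) u = b" if "v \<in> verts \<sigma>" for v
    proof -
      have "pairing2 (mod2 x + mod2 v) u = b + pairing2 (mod2 w + mod2 v) u"
        unfolding b_def by (simp add: ac_simps flip: pairing2_add_left)
      then show "pairing2 (mod2 x + mod2 v) u = b" using uz w that by simp
      then show "pairing2 (mod2 v + mod2 x) u = b" by (simp add: add.commute)
    qed
    have "u = grad \<tau> (\<lambda>v. if v = x then b else 0)"
      by (rule grad_eqI[OF t, symmetric]) (use x uz xv in \<open>auto simp: \<open>verts \<tau> = _\<close>\<close>)
    moreover have "grad \<tau> (\<lambda>v. if v = x then 0 else 0) = 0" by (rule grad_eqI[OF t]) auto
    ultimately show ?thesis by (cases b) auto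
  qed
  ultimately show "perp2 \<sigma> = {0, ?n}" by auto
qed

lemma perp2_wall_two:
  assumes "\<sigma> \<in> walls" "q \<in> perp2 \<sigma>" "q \<noteq> 0"
  shows "perp2 \<sigma> = {0, q}"
proof -
  obtain \<tau> where t: "\<tau> \<in> chambers" "\<sigma> \<subseteq> \<tau>" using chamber_above wall_K assms by blast
  obtain x where "x \<notin> verts \<sigma>" "verts \<tau> = insert x (verts \<sigma>)" using opposite_vertex[OF assms(1) t] by metis
  then show ?thesis using perp2_wall(1)[OF assms(1) t(1)] assms by auto
qed

lemma perp2_wall_nonzero:
  assumes "\<sigma> \<in> walls"
  obtains q where "q \<noteq> 0" "perp2 \<sigma> = {0, q}"
proof -
  obtain \<tau> where t: "\<tau> \<in> chambers" "\<sigma> \<subseteq> \<tau>" using chamber_above wall_K assms by blast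
  obtain x where "x \<notin> verts \<sigma>" "verts \<tau> = insert x (verts \<sigma>)" using opposite_vertex[OF assms(1) t] by metis
  then show thesis using perp2_wall[OF assms(1) t(1)] that by metis
qed

end

section \<open>Vertices of smooth polytopes\<close>

text \<open>Divide by the largest integer k for which the quotient stays integral; a nonzero
  coordinate of b bounds k.\<close>

lemma primitive_vector_multiple:
  assumes "b \<in> int_points" "b \<noteq> 0"
  obtains w t where "primitive_vector w" "t > 0" "b = t *\<^sub>R w"
proof -
  define A where "A = {k::nat. k \<ge> 1 \<and> (\<exists>w\<in>int_points. b = real k *\<^sub>R w)}"
  obtain i where i: "b $ i \<noteq> 0" using assms(2) by (auto simp: vec_eq_iff)
  have bound: "real k \<le> \<bar>b $ i\<bar>" if "k \<in> A" for k
  proof -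
    obtain w where w: "w \<in> int_points" "b = real k *\<^sub>R w" using \<open>k \<in> A\<close> by (auto simp: A_def)
    have "w $ i \<noteq> 0" using i w by auto
    moreover have "w $ i \<in> \<int>" using w by (simp add: int_points_def)
    ultimately have "\<bar>w $ i\<bar> \<ge> 1" using Ints_nonzero_abs_ge1 by blast
    then have "real k * 1 \<le> real k * \<bar>w $ i\<bar>" by (intro mult_left_mono) auto
    then show ?thesis using w by (simp add: abs_mult)
  qed
  have "A \<subseteq> {..nat \<lfloor>\<bar>b $ i\<bar>\<rfloor>}" using bound by (auto simp: le_nat_floor)
  then have fin: "finite A" using finite_subset by blast
  have "1 \<in> A" using assms by (auto simp: A_def)
  define k where "k = Max A"
  have kA: "k \<in> A" using fin \<open>1 \<in> A\<close> Max_in by (auto simp: k_def)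
  then obtain w where w: "w \<in> int_points" "b = real k *\<^sub>R w" "k \<ge> 1" by (auto simp: A_def)
  have "primitive_vector w"
    unfolding primitive_vector_def
  proof (intro conjI allI ballI impI)
    show "w \<in> int_points" "w \<noteq> 0" using w assms by auto
    fix j :: int and w' assume w': "w' \<in> int_points" "w = of_int j *\<^sub>R w'"
    have "j \<noteq> 0" using w' w assms by auto
    have "b = real (k * nat \<bar>j\<bar>) *\<^sub>R (of_int (sgn j) *\<^sub>R w')"
    proof -
      have "real (nat \<bar>j\<bar>) * of_int (sgn j) = of_int j" by (simp add: sgn_if)
      then show ?thesis using w(2) w'(2) by simp
    qed
    moreover have "of_int (sgn j) *\<^sub>R w' \<in> int_points" by (rule int_points_scaleR[OF w'(1)])
    moreover have "k * nat \<bar>j\<bar> \<ge> 1" using w(3) \<open>j \<noteq> 0\<close> by simp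
    ultimately have "k * nat \<bar>j\<bar> \<in> A" unfolding A_def by blast
    then have "k * nat \<bar>j\<bar> \<le> k" using fin by (simp add: k_def)
    then have "nat \<bar>j\<bar> \<le> 1" using w(3) by simp
    then show "\<bar>j\<bar> = 1" using \<open>j \<noteq> 0\<close> by linarith
  qed
  then show thesis using that[of w "real k"] w by simp
qed

lemma minimal_face:
  fixes P :: "'a::euclidean_space set"
  assumes "polytope P" "h \<in> P"
  obtains G where "G face_of P" "h \<in> rel_interior G"
proof -
  let ?A = "{G. G face_of P \<and> h \<in> G}"
  have "finite ?A" using finite_polytope_faces[OF assms(1)] by simp
  moreover have "P \<in> ?A" using assms face_of_refl polytope_imp_convex by auto
  ultimately obtain G where G: "G \<in> ?A" "\<And>G'. G' \<in> ?A \<Longrightarrow> G' \<subseteq> G \<Longrightarrow> G' = G"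
    using finite_has_minimal[of ?A] by (metis (no_types, lifting) empty_iff)
  have pG: "polytope G" using face_of_polytope_polytope assms(1) G(1) by blast
  have "h \<in> rel_interior G"
  proof (rule ccontr)
    assume "h \<notin> rel_interior G"
    then have "h \<in> rel_frontier G" using G(1) closure_subset by (auto simp: rel_frontier_def)
    then obtain F where F: "F face_of G" "F \<noteq> G" "h \<in> F"
      using rel_frontier_of_polyhedron_alt[OF polytope_imp_polyhedron[OF pG]] by blast
    then have "F \<in> ?A" using face_of_trans G(1) by blast
    then show False using G(2) F face_of_imp_subset by blast
  qed
  then show thesis using that G(1) by blast
qed

text \<open>Vertex figure: a hyperplane separates v from the other vertices, and the extreme points
  of its section Q of P lie on edges at v, where y is controlled by the edge directions. Each point
  of P lies on a segment from v to the hull C of the other vertices, and such a segment crosses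
  Q.\<close>

lemma polytope_in_edge_cone:
  fixes P :: "(real ^ 'd::finite) set"
  assumes P: "polytope P" and int: "{v. v extreme_point_of P} \<subseteq> int_points"
    and v: "v extreme_point_of P"
    and y: "\<And>w. w \<in> edge_directions P v \<Longrightarrow> y \<bullet> w \<ge> 0" and x: "x \<in> P"
  shows "y \<bullet> v \<le> y \<bullet> x"
proof (cases "x = v")
  case False
  define V where "V = {v. v extreme_point_of P}"
  have cP: "convex P" "compact P" using P polytope_imp_convex polytope_imp_compact by auto
  have PV: "P = convex hull V" unfolding V_def by (rule Krein_Milman_Minkowski[OF cP(2,1)])
  have finV: "finite V" unfolding V_def using finite_polyhedron_extreme_points polytope_imp_polyhedron P by blast
  have vV: "v \<in> V" using v by (simp add: V_def)
  define C where "C = convex hull (V - {v})"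
  have VP: "V \<subseteq> P" by (auto simp: V_def extreme_point_of_def)
  have "convex (P - {v})" using v extreme_point_of_stillconvex[OF cP(1)] by blast
  then have CP: "C \<subseteq> P - {v}" unfolding C_def using VP by (intro hull_minimal) auto
  have "compact C" unfolding C_def using finV by (intro finite_imp_compact_convex_hull) auto
  then have "closed C" by (rule compact_imp_closed)
  moreover have "convex C" by (simp add: C_def)
  moreover have "v \<notin> C" using CP by blast
  ultimately obtain c \<beta> where c: "c \<bullet> v < \<beta>" "\<And>z. z \<in> C \<Longrightarrow> c \<bullet> z > \<beta>"
    using separating_hyperplane_closed_point[of C v] by auto
  define Q where "Q = P \<inter> {x. c \<bullet> x = \<beta>}"
  have Q: "compact Q" "convex Q"
    unfolding Q_def using cP by (auto intro: compact_Int_closed closed_hyperplane convex_Int convex_hyperplane)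
  have ext: "y \<bullet> v \<le> y \<bullet> h" if h: "h extreme_point_of Q" for h
  proof -
    have hQ: "h \<in> P" "c \<bullet> h = \<beta>" using h by (auto simp: extreme_point_of_def Q_def)
    obtain G where G: "G face_of P" "h \<in> rel_interior G" using minimal_face[OF P hQ(1)] by blast
    have hG: "h \<in> G" using G rel_interior_subset by blast
    have GP: "G \<subseteq> P" using G face_of_imp_subset by blast
    have "aff_dim G \<le> 1"
    proof (rule ccontr)
      assume big: "\<not> aff_dim G \<le> 1"
      \<comment> \<open>If G had dimension two or more, its affine hull would meet the hyperplane in
        positive dimension. As h is in the relative interior of G, a short segment around h would
        stay in Q, against extremality.\<close>
      define A where "A = affine hull G \<inter> {x. c \<bullet> x = \<beta>}"
      have hA: "h \<in> A" using hG hQ by (simp add: A_def hull_inc)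
      have "aff_dim A \<ge> 1"
        unfolding A_def using aff_dim_affine_Int_hyperplane[OF affine_affine_hull, of G c \<beta>] big hA
        by (auto simp: A_def split: if_splits)
      then have "A \<noteq> {h}" by auto
      then obtain h' where h': "h' \<in> A" "h' \<noteq> h" using hA by blast
      obtain e where e: "e > 0" "ball h e \<inter> affine hull G \<subseteq> G" using G(2) by (auto simp: mem_rel_interior_ball)
      define s where "s = e / (2 * norm (h' - h))"
      have s: "s > 0" using e h' by (simp add: s_def)
      define w where "w = s *\<^sub>R (h' - h)"
      have nw: "norm w < e" using e h' by (simp add: w_def s_def)
      have w0: "w \<noteq> 0" using s h' by (simp add: w_def)
      have affA: "affine A" by (simp add: A_def affine_Int affine_hyperplane)
      have inA: "h + r *\<^sub>R w \<in> A" for r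
      proof -
        have "h + r *\<^sub>R w = (1 - r * s) *\<^sub>R h + (r * s) *\<^sub>R h'" by (simp add: w_def algebra_simps)
        then show ?thesis using affA hA h' by (simp add: affine_alt)
      qed
      have inQ: "h + r *\<^sub>R w \<in> Q" if r: "\<bar>r\<bar> = 1" for r
      proof -
        have "norm (r *\<^sub>R w) < e" using r nw by simp
        then have "h + r *\<^sub>R w \<in> ball h e" by (simp add: dist_norm)
        then have "h + r *\<^sub>R w \<in> G" using e(2) inA[of r] by (auto simp: A_def)
        then show ?thesis using GP inA[of r] by (auto simp: Q_def A_def)
      qed
      have "h \<in> open_segment (h + (-1) *\<^sub>R w) (h + 1 *\<^sub>R w)"
        unfolding in_segment
      proof (intro conjI exI[of _ "1/2"])
        have "2 *\<^sub>R w = (h + 1 *\<^sub>R w) - (h + (-1) *\<^sub>R w)" by (simp add: scaleR_2)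
        then show "h + (-1) *\<^sub>R w \<noteq> h + 1 *\<^sub>R w" using w0 by auto
        show "h = (1 - 1 / 2) *\<^sub>R (h + (-1) *\<^sub>R w) + (1 / 2) *\<^sub>R (h + 1 *\<^sub>R w)"
          by (simp add: vec_eq_iff field_simps)
      qed auto
      then show False using h inQ[of "-1"] inQ[of 1] by (auto simp: extreme_point_of_def)
    qed
    then have "collinear G" by (simp add: collinear_aff_dim)
    moreover have "convex G" "compact G" using G cP face_of_imp_convex face_of_imp_compact by blast+
    ultimately obtain a b where ab: "G = closed_segment a b"
      using compact_convex_collinear_segment hG by blast
    have abV: "a \<in> V" "b \<in> V" using segment_face_of G(1) ab by (auto simp: V_def)
    have abC: "c \<bullet> z > \<beta>" if "z \<in> V" "z \<noteq> v" for z
      using c(2)[of z] that hull_inc[of z "V - {v}"] by (simp add: C_def)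
    \<comment> \<open>One end of the segment G has to be v, since a segment between two other
      vertices lies strictly beyond the hyperplane. From v it runs along a positive multiple of a
      primitive edge direction.\<close>
    have key: "y \<bullet> v \<le> y \<bullet> h" if G': "G = closed_segment v b" and bV: "b \<in> V" for b
    proof -
      have bv: "b \<noteq> v" using G' hG hQ c(1) by auto
      have "b - v \<in> int_points" using int_points_diff int bV vV by (auto simp: V_def)
      then obtain w t where w: "primitive_vector w" "t > 0" "b - v = t *\<^sub>R w"
        using primitive_vector_multiple[of "b - v"] bv by auto
      have "aff_dim G = 1" using bv by (simp add: G' segment_convex_hull aff_dim_convex_hull aff_dim_2)
      then have "G edge_of P" using G(1) by (simp add: edge_of_def)
      moreover have "v \<in> G" "v + t *\<^sub>R w \<in> G" using w(3) by (auto simp: G' simp flip: w(3))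
      ultimately have "w \<in> edge_directions P v" using w(1,2) unfolding edge_directions_def by blast
      then have yw: "y \<bullet> w \<ge> 0" by (rule y)
      obtain r where r: "0 \<le> r" "h = (1 - r) *\<^sub>R v + r *\<^sub>R b" using hG G' by (auto simp: in_segment)
      have "h = v + r *\<^sub>R (b - v)" by (simp add: r algebra_simps)
      then have "y \<bullet> h = y \<bullet> v + r * t * (y \<bullet> w)" by (simp add: w(3) inner_add_right)
      then show ?thesis using yw r w(2) by simp
    qed
    show ?thesis
    proof (cases "a = v")
      case True
      then show ?thesis using key[of b] ab abV by simp
    next
      case a: False
      show ?thesis
      proof (cases "b = v")
        case True
        then show ?thesis using key[of a] ab abV closed_segment_commute by metis
      next
        case False
        have "{x. c \<bullet> x > \<beta>} = {x. \<beta> < c \<bullet> x}" by simp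
        then have "closed_segment a b \<subseteq> {x. c \<bullet> x > \<beta>}"
          using abC a False abV by (intro closed_segment_subset) (auto simp: convex_halfspace_gt)
        then show ?thesis using hG ab hQ by auto
      qed
    qed
  qed
  have Qy: "y \<bullet> v \<le> y \<bullet> h" if "h \<in> Q" for h
  proof -
    have "{h. h extreme_point_of Q} \<subseteq> {h. y \<bullet> h \<ge> y \<bullet> v}" using ext by auto
    then have "convex hull {h. h extreme_point_of Q} \<subseteq> {h. y \<bullet> h \<ge> y \<bullet> v}"
      by (intro hull_minimal convex_halfspace_ge)
    then show ?thesis using Krein_Milman_Minkowski[OF Q] that by blast
  qed
  \<comment> \<open>The segment from v to z meets Q at parameter s, and as s > 0 the inequality at
    that point implies the one at z.\<close>
  have Cy: "y \<bullet> v \<le> y \<bullet> z" if z: "z \<in> C" for z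
  proof -
    define s where "s = (\<beta> - c \<bullet> v) / (c \<bullet> z - c \<bullet> v)"
    have cz: "c \<bullet> z > \<beta>" using c(2)[OF z] .
    have s: "0 < s" "s < 1" using c(1) cz by (auto simp: s_def field_simps)
    define h where "h = v + s *\<^sub>R (z - v)"
    have "h = (1 - s) *\<^sub>R v + s *\<^sub>R z" by (simp add: h_def algebra_simps)
    then have "h \<in> P" using convexD_alt[OF cP(1), of v z s] CP z vV VP s by auto
    moreover have "c \<bullet> h = \<beta>" using c(1) cz by (simp add: h_def inner_add_right inner_diff_right s_def)
    ultimately have "y \<bullet> v \<le> y \<bullet> h" using Qy by (simp add: Q_def)
    then have "0 \<le> s * (y \<bullet> z - y \<bullet> v)" by (simp add: h_def inner_add_right inner_diff_right)
    then show ?thesis using s by (simp add: zero_le_mult_iff)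
  qed
  have ne: "V - {v} \<noteq> {}"
  proof
    assume "V - {v} = {}"
    then have "V = {v}" using vV by blast
    then show False using x False PV by simp
  qed
  have "V = insert v (V - {v})" using vV by blast
  then have "x \<in> convex hull (insert v (V - {v}))" using x PV by metis
  then obtain s t z where st: "s \<ge> 0" "t \<ge> 0" "s + t = 1" "z \<in> C" "x = s *\<^sub>R v + t *\<^sub>R z"
    unfolding convex_hull_insert[OF ne] C_def by blast
  have "y \<bullet> x = s * (y \<bullet> v) + t * (y \<bullet> z)" by (simp add: st(5) inner_add_right)
  moreover have "t * (y \<bullet> v) \<le> t * (y \<bullet> z)" using Cy[OF st(4)] st(2) by (rule mult_left_mono)
  moreover have "s * (y \<bullet> v) + t * (y \<bullet> v) = y \<bullet> v" using st(3) by (metis distrib_right mult_1)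
  ultimately show ?thesis by linarith
qed simp

text \<open>At a vertex the primitive edge directions form a lattice basis. The dual basis is
  integral, its members are normals of the facets through the vertex, and it generates
  \<open>N\<close>; so its reductions, which lie in the groups \<open>Sed F\<close>, generate
  \<open>N_2\<close>.\<close>

lemma smooth_facets_generate:
  fixes P :: "(real ^ 'd::finite) set" and \<psi> :: "bit ^ 'd \<Rightarrow> 'a"
  assumes smooth: "smooth_lattice_polytope P"
    and inv: "\<And>F q u. \<lbrakk>F facet_of P; q \<in> Sed F\<rbrakk> \<Longrightarrow> \<psi> (u + q) = \<psi> u"
  shows "\<psi> u = \<psi> u'"
proof -
  have P: "polytope P" "{v. v extreme_point_of P} \<subseteq> int_points" "aff_dim P = int CARD('d)"
    using smooth by (auto simp: smooth_lattice_polytope_def lattice_polytope_def)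
  have cP: "convex P" "compact P" "P \<noteq> {}"
    using P polytope_imp_convex polytope_imp_compact by auto
  obtain v where v: "v extreme_point_of P" using extreme_point_exists_convex[OF cP(2,1,3)] .
  have vP: "v \<in> P" using v by (simp add: extreme_point_of_def)
  define B where "B = edge_directions P v"
  have "lattice_basis B" using smooth v by (simp add: smooth_lattice_polytope_def B_def)
  then have ind: "independent B" and lat: "int_points = {\<Sum>b\<in>B. of_int (c b) *\<^sub>R b |c :: real ^ 'd \<Rightarrow> int. True}"
    by (auto simp: lattice_basis_def)
  have finB: "finite B" using ind by (rule independent_imp_finite)
  have axis_int: "axis i 1 \<in> int_points" for i :: 'd by (simp add: int_points_def axis_def)
  have "(\<Sum>b\<in>B. of_int (c b) *\<^sub>R b) \<in> span B" for c :: "real ^ 'd \<Rightarrow> int"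
    by (intro span_sum span_scale) (rule span_base)
  then have "int_points \<subseteq> span B" unfolding lat by blast
  then have "Basis \<subseteq> span B" using axis_int by (auto simp: Basis_vec_def)
  then have spanB: "span B = UNIV" using span_mono[of Basis "span B"] by (simp add: span_span top.extremum_uniqueI)
  have cardB: "card B = CARD('d)"
    using dim_eq_card[of B UNIV] ind spanB by simp
  have B_int: "b \<in> int_points" if "b \<in> B" for b
    using that by (auto simp: B_def edge_directions_def primitive_vector_def)
  have "\<exists>y\<in>int_points. \<forall>b\<in>B. y \<bullet> b = (if b = w then 1 else 0)" if w: "w \<in> B" for w
  proof -
    obtain L :: "real ^ 'd \<Rightarrow> real" where L: "linear L" "\<forall>b\<in>B. L b = (if b = w then 1 else 0)"
      using linear_independent_extend[OF ind, of "\<lambda>b. if b = w then 1 else 0"] by auto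
    define y :: "real ^ 'd" where "y = (\<chi> i. L (axis i 1))"
    have yL: "y \<bullet> x = L x" for x
    proof -
      have "L x = L (\<Sum>i\<in>UNIV. (x $ i) *\<^sub>R axis i 1)"
        using basis_expansion[of x] by (simp add: scalar_mult_eq_scaleR)
      also have "\<dots> = (\<Sum>i\<in>UNIV. x $ i * y $ i)"
        by (simp add: linear_sum[OF L(1)] linear_scale[OF L(1)] y_def)
      finally show ?thesis by (simp add: inner_vec_def mult.commute)
    qed
    have "L (axis i 1) \<in> \<int>" for i
    proof -
      obtain c where c: "axis i 1 = (\<Sum>b\<in>B. of_int (c b) *\<^sub>R b)" using axis_int[of i] unfolding lat by blast
      have "L (axis i 1) = (\<Sum>b\<in>B. of_int (c b) * (if b = w then 1 else 0))"
        unfolding c using L(2) by (simp add: linear_sum[OF L(1)] linear_scale[OF L(1)] cong: sum.cong)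
      also have "\<dots> = of_int (c w)" using finB w by (simp add: if_distrib cong: if_cong)
      finally show ?thesis by simp
    qed
    then have "y \<in> int_points" by (simp add: int_points_def y_def)
    then show ?thesis using yL L(2) by (intro bexI[of _ y]) auto
  qed
  then obtain y where y: "\<And>w. w \<in> B \<Longrightarrow> y w \<in> int_points"
    "\<And>w b. \<lbrakk>w \<in> B; b \<in> B\<rbrakk> \<Longrightarrow> y w \<bullet> b = (if b = w then 1 else 0)" by metis
  \<comment> \<open>The hyperplane supports P by the edge cone, contains v and steps in all edge
    directions except w, and misses a step in direction w; this fixes the dimension of the
    face.\<close>
  have facet: "P \<inter> {x. y w \<bullet> x = y w \<bullet> v} facet_of P" if w: "w \<in> B" for w
  proof -
    let ?F = "P \<inter> {x. y w \<bullet> x = y w \<bullet> v}"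
    have "y w \<bullet> v \<le> y w \<bullet> x" if "x \<in> P" for x
      by (rule polytope_in_edge_cone[OF P(1,2) v _ that]) (use y(2)[OF w] in \<open>simp add: B_def\<close>)
    then have face: "?F face_of P" by (intro face_of_Int_supporting_hyperplane_ge cP(1)) auto
    have vF: "v \<in> ?F" using vP by simp
    have dirs: "\<exists>t>0. v + t *\<^sub>R b \<in> P" if "b \<in> B" for b
      using that edge_of_imp_subset unfolding B_def edge_directions_def by blast
    have "b \<in> span ((\<lambda>x. - v + x) ` ?F)" if b: "b \<in> B - {w}" for b
    proof -
      obtain t where t: "t > 0" "v + t *\<^sub>R b \<in> P" using dirs b by blast
      then have "v + t *\<^sub>R b \<in> ?F" using y(2)[OF w, of b] b by (auto simp: inner_add_right)
      then have "t *\<^sub>R b \<in> span ((\<lambda>x. - v + x) ` ?F)"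
        by (intro span_base) (metis (no_types, lifting) add_minus_cancel imageI minus_add_cancel)
      then have "(1 / t) *\<^sub>R (t *\<^sub>R b) \<in> span ((\<lambda>x. - v + x) ` ?F)" by (rule span_scale)
      then show ?thesis using t by simp
    qed
    then have "B - {w} \<subseteq> span ((\<lambda>x. - v + x) ` ?F)" by blast
    then have "card (B - {w}) \<le> dim (span ((\<lambda>x. - v + x) ` ?F))"
      using independent_card_le_dim ind independent_mono by blast
    then have "int CARD('d) - 1 \<le> aff_dim ?F"
      using aff_dim_eq_dim[of v ?F] vF hull_inc[OF vF] cardB w finB by (simp add: dim_span)
    moreover have "aff_dim ?F < int CARD('d)"
    proof -
      obtain t where t: "t > 0" "v + t *\<^sub>R w \<in> P" using dirs w by blast
      then have "v + t *\<^sub>R w \<notin> ?F" using y(2)[OF w w] by (simp add: inner_add_right)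
      then have "?F \<noteq> P" using t by blast
      then show ?thesis using face_of_aff_dim_lt[OF cP(1) face] P(3) by simp
    qed
    ultimately have "aff_dim ?F = aff_dim P - 1" using P(3) by simp
    then show ?thesis using face vF by (auto simp: facet_of_def)
  qed
  \<comment> \<open>The periods of \<psi>. They contain the reduced dual basis, and it remains to
    see that they are everything.\<close>
  define Q where "Q = {q. \<forall>u. \<psi> (u + q) = \<psi> u}"
  have Q0: "0 \<in> Q" by (simp add: Q_def)
  have Qadd: "q + q' \<in> Q" if "q \<in> Q" "q' \<in> Q" for q q'
    using that by (simp add: Q_def flip: add.assoc)
  have Qy: "mod2 (y w) \<in> Q" if w: "w \<in> B" for w
  proof -
    have "mod2 (y w) \<in> Sed (P \<inter> {x. y w \<bullet> x = y w \<bullet> v})"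
      unfolding mem_perp2_iff by (rule bexI[OF _ y(1)[OF w]]) auto
    then show ?thesis using inv[OF facet[OF w]] by (simp add: Q_def)
  qed
  have mod2_scale: "mod2 (of_int k *\<^sub>R x) = (if even k then 0 else mod2 x)" if x: "x \<in> int_points" for k x
  proof -
    have "\<lfloor>of_int k * x $ i\<rfloor> = k * \<lfloor>x $ i\<rfloor>" for i
      using int_points_nth[OF x, of i] by (metis floor_of_int of_int_mult)
    then show ?thesis by (auto simp: mod2_def vec_eq_iff elim!: oddE)
  qed
  have Qsum: "mod2 (\<Sum>w\<in>A. of_int (k w) *\<^sub>R y w) \<in> Q \<and> (\<Sum>w\<in>A. of_int (k w) *\<^sub>R y w) \<in> int_points"
    if "A \<subseteq> B" for A and k :: "real ^ 'd \<Rightarrow> int"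
    using finite_subset[OF that finB] that
  proof (induction A rule: finite_induct)
    case empty
    then show ?case using Q0 by simp
  next
    case (insert w A)
    have w: "w \<in> B" using insert.prems by simp
    have ky: "of_int (k w) *\<^sub>R y w \<in> int_points" using int_points_scaleR y(1)[OF w] by blast
    have "mod2 (of_int (k w) *\<^sub>R y w) \<in> Q" using mod2_scale[OF y(1)[OF w]] Q0 Qy[OF w] by simp
    then show ?case using insert mod2_add[OF ky] Qadd int_points_add[OF ky] by simp
  qed
  have all: "q \<in> Q" for q
  proof -
    \<comment> \<open>The 0/1 lift of q is expanded in the dual basis, its coefficients being the
      integral pairings with the edge directions; both sides agree because B spans.\<close>
    define x :: "real ^ 'd" where "x = (\<chi> i. if q $ i = 0 then 0 else 1)"
    have x: "x \<in> int_points" "mod2 x = q" by (auto simp: x_def int_points_def mod2_def vec_eq_iff)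
    have xb: "\<exists>k::int. x \<bullet> b = of_int k" if "b \<in> B" for b
    proof -
      have "x \<bullet> b = of_int (\<Sum>i\<in>UNIV. \<lfloor>x $ i\<rfloor> * \<lfloor>b $ i\<rfloor>)"
        using x(1) B_int[OF that] by (simp add: inner_vec_def int_points_nth)
      then show ?thesis by blast
    qed
    then obtain k :: "real ^ 'd \<Rightarrow> int" where k: "\<And>b. b \<in> B \<Longrightarrow> x \<bullet> b = of_int (k b)" by metis
    define z where "z = (\<Sum>w\<in>B. of_int (k w) *\<^sub>R y w)"
    have "(x - z) \<bullet> b = 0" if b: "b \<in> B" for b
    proof -
      have "z \<bullet> b = (\<Sum>w\<in>B. of_int (k w) * (if b = w then 1 else 0))"
        unfolding z_def using y(2) b by (simp add: inner_sum_left cong: sum.cong)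
      also have "\<dots> = of_int (k b)" using finB b by (simp add: if_distrib cong: if_cong)
      finally show ?thesis using k[OF b] by (simp add: inner_diff_left)
    qed
    then have "B \<subseteq> {b. (x - z) \<bullet> b = 0}" by blast
    then have "span B \<subseteq> {b. (x - z) \<bullet> b = 0}" by (intro span_minimal subspace_hyperplane)
    then have "(x - z) \<bullet> (x - z) = 0" using spanB by blast
    then have "x = z" by simp
    then show ?thesis using Qsum[of B k] x(2) by (simp add: z_def)
  qed
  have "\<psi> (u + (u + u')) = \<psi> u" using all[of "u + u'"] unfolding Q_def by blast
  then show ?thesis by simp
qed

section \<open>The dual cells in barycentric coordinates\<close>

text \<open>The layer-cake decomposition of \<open>l\<close> into uniform weights on its superlevel sets.\<close>

definition layers :: "'a set \<Rightarrow> ('a \<Rightarrow> real) \<Rightarrow> 'a set set \<Rightarrow> ('a set \<Rightarrow> real) \<Rightarrow> bool"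
  where "layers A l C \<mu> \<longleftrightarrow> finite C \<and> C \<noteq> {} \<and>
    (\<forall>B\<in>C. {v \<in> A. \<forall>w\<in>A. l w \<le> l v} \<subseteq> B \<and> B \<subseteq> A \<and> B \<noteq> {}) \<and>
    (\<forall>B\<in>C. \<forall>B'\<in>C. B \<subseteq> B' \<or> B' \<subseteq> B) \<and> (\<forall>B\<in>C. 0 \<le> \<mu> B) \<and>
    (\<forall>v. l v = (\<Sum>B\<in>C. if v \<in> B then \<mu> B / real (card B) else 0))"

text \<open>Subtract the minimum m from all weights. The part removed is \<open>m * card A\<close>
  times the uniform weight on A, and the rest lives on the smaller set where l exceeds m. Points of
  maximal weight remain maximal, so they stay in all later layers.\<close>

lemma layers_exist:
  fixes l :: "'a \<Rightarrow> real"
  assumes "finite A" "A \<noteq> {}" "\<And>v. v \<in> A \<Longrightarrow> l v > 0" "\<And>v. v \<notin> A \<Longrightarrow> l v = 0"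
  shows "\<exists>C \<mu>. layers A l C \<mu>"
  using assms
proof (induction "card A" arbitrary: A l rule: less_induct)
  case less
  let ?M = "{v \<in> A. \<forall>w\<in>A. l w \<le> l v}"
  define m where "m = Min (l ` A)"
  have m_in: "m \<in> l ` A" and m_le: "m \<le> l v" if "v \<in> A" for v
    using less.prems(1,2) that by (auto simp: m_def)
  obtain v0 where v0: "v0 \<in> A" "l v0 = m" using m_in less.prems(2) by fastforce
  have m0: "m > 0" using v0 less.prems(3) by auto
  have cA: "card A > 0" using less.prems by (simp add: card_gt_0_iff)
  define A' where "A' = {v \<in> A. l v > m}"
  show ?case
  proof (cases "A' = {}")
    case True
    then have eq: "l v = m" if "v \<in> A" for v using m_le[OF that] that by (force simp: A'_def)
    then have M: "?M = A" by auto
    have "layers A l {A} (\<lambda>_. m * real (card A))"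
      unfolding layers_def using M less.prems(2,4) eq cA m0 by auto
    then show ?thesis by blast
  next
    case False
    define l' where "l' v = (if v \<in> A' then l v - m else 0)" for v
    have A'A: "A' \<subset> A" using v0 by (auto simp: A'_def)
    have "card A' < card A" using A'A less.prems(1) by (rule psubset_card_mono[rotated])
    moreover have "finite A'" using A'A less.prems(1) finite_subset by blast
    moreover have "l' v > 0" if "v \<in> A'" for v using that by (simp add: l'_def A'_def)
    moreover have "l' v = 0" if "v \<notin> A'" for v using that by (simp add: l'_def)
    ultimately obtain C \<mu> where "layers A' l' C \<mu>"
      using less.hyps[of A' l'] False by blast
    then have C: "finite C" "C \<noteq> {}"
      "\<forall>B\<in>C. {v \<in> A'. \<forall>w\<in>A'. l' w \<le> l' v} \<subseteq> B \<and> B \<subseteq> A' \<and> B \<noteq> {}"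
      "\<forall>B\<in>C. \<forall>B'\<in>C. B \<subseteq> B' \<or> B' \<subseteq> B" "\<forall>B\<in>C. (0::real) \<le> \<mu> B"
      "\<forall>v. l' v = (\<Sum>B\<in>C. if v \<in> B then \<mu> B / real (card B) else 0)"
      unfolding layers_def by - (elim conjE, assumption)+
    have M: "?M \<subseteq> {v \<in> A'. \<forall>w\<in>A'. l' w \<le> l' v}"
    proof
      fix v assume v: "v \<in> ?M"
      obtain w where w: "w \<in> A'" using False by auto
      then have "m < l v" using v by (fastforce simp: A'_def)
      then have "v \<in> A'" using v by (simp add: A'_def)
      moreover have "l' w \<le> l' v" if "w \<in> A'" for w
        using v that \<open>v \<in> A'\<close> A'A by (auto simp: l'_def)
      ultimately show "v \<in> {v \<in> A'. \<forall>w\<in>A'. l' w \<le> l' v}" by blast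
    qed
    have AC: "A \<notin> C" using C(3) A'A by blast
    define \<mu>' where "\<mu>' = \<mu>(A := m * real (card A))"
    have \<mu>': "\<mu>' A = m * real (card A)" "\<And>B. B \<in> C \<Longrightarrow> \<mu>' B = \<mu> B" using AC by (auto simp: \<mu>'_def)
    have eq: "l v = (\<Sum>B\<in>insert A C. if v \<in> B then \<mu>' B / real (card B) else 0)" for v
    proof -
      have "(\<Sum>B\<in>insert A C. if v \<in> B then \<mu>' B / real (card B) else 0) =
          (if v \<in> A then \<mu>' A / real (card A) else 0) + (\<Sum>B\<in>C. if v \<in> B then \<mu>' B / real (card B) else 0)"
        using C(1) AC by (rule sum.insert)
      also have "(\<Sum>B\<in>C. if v \<in> B then \<mu>' B / real (card B) else 0) = l' v"
        unfolding C(6)[rule_format] using \<mu>'(2) by (intro sum.cong) auto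
      finally have "(\<Sum>B\<in>insert A C. if v \<in> B then \<mu>' B / real (card B) else 0) = (if v \<in> A then m else 0) + l' v"
        using \<mu>'(1) cA by simp
      moreover have "l v = (if v \<in> A then m else 0) + l' v"
      proof (cases "v \<in> A")
        case True
        then show ?thesis using m_le[OF True] by (simp add: l'_def A'_def)
      next
        case False
        then have "v \<notin> A'" by (simp add: A'_def)
        then show ?thesis using less.prems(4)[OF False] False by (simp add: l'_def)
      qed
      ultimately show ?thesis by simp
    qed
    have sub: "?M \<subseteq> B" "B \<subseteq> A" "B \<noteq> {}" if "B \<in> C" for B
      using C(3)[rule_format, OF that] M A'A by (blast, blast, simp)
    have "\<forall>B\<in>insert A C. ?M \<subseteq> B \<and> B \<subseteq> A \<and> B \<noteq> {}"
    proof
      fix B assume "B \<in> insert A C"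
      then consider "B = A" | "B \<in> C" by blast
      then show "?M \<subseteq> B \<and> B \<subseteq> A \<and> B \<noteq> {}"
      proof cases
        case 1
        then show ?thesis using less.prems(2) by blast
      next
        case 2
        then show ?thesis using sub[OF 2] by blast
      qed
    qed
    moreover have "\<forall>B\<in>insert A C. \<forall>B'\<in>insert A C. B \<subseteq> B' \<or> B' \<subseteq> B"
    proof (intro ballI)
      fix B B' assume "B \<in> insert A C" "B' \<in> insert A C"
      then consider "B = A \<or> B' = A" "B \<subseteq> A" "B' \<subseteq> A" | "B \<in> C" "B' \<in> C" using sub(2) by blast
      then show "B \<subseteq> B' \<or> B' \<subseteq> B" using C(4) by cases (blast, metis)
    qed
    moreover have "\<forall>B\<in>insert A C. 0 \<le> \<mu>' B" using C(5) \<mu>' m0 by auto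
    ultimately have "layers A l (insert A C) \<mu>'"
      unfolding layers_def using eq C(1) by simp
    then show ?thesis by blast
  qed
qed

context simplicial
begin

lemma barycenter_hull:
  assumes "\<tau> \<in> K" "B \<subseteq> verts \<tau>"
  shows "barycenter (convex hull B) = (\<Sum>v\<in>B. (1 / real (card B)) *\<^sub>R v)"
  using verts_sub_simplex[OF assms]
  by (simp add: barycenter_def verts_def scaleR_sum_right divide_inverse)

lemma convex_max_cell_simplex:
  assumes "\<tau> \<in> K"
  shows "convex {x \<in> \<tau>. V \<subseteq> maxset x}"
  unfolding convex_alt
proof (intro ballI allI impI)
  fix x y and t :: real
  assume x: "x \<in> {x \<in> \<tau>. V \<subseteq> maxset x}" and y: "y \<in> {x \<in> \<tau>. V \<subseteq> maxset x}" and t: "0 \<le> t \<and> t \<le> 1"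
  let ?z = "(1 - t) *\<^sub>R x + t *\<^sub>R y"
  have "?z \<in> \<tau>" using convex_simplex[OF assms] x y t by (simp add: convex_alt)
  moreover have "v \<in> maxset ?z" if "v \<in> V" for v
  proof -
    have v: "v \<in> vertices" "\<forall>w. bc x w \<le> bc x v" "\<forall>w. bc y w \<le> bc y v"
      using x y that by (auto simp: maxset_def)
    have "bc ?z w \<le> bc ?z v" for w
      using bc_convex_combination[OF assms, of x y t] x y t v
      by (simp add: add_mono mult_left_mono)
    then show ?thesis using v(1) by (simp add: maxset_def)
  qed
  ultimately show "?z \<in> {x \<in> \<tau>. V \<subseteq> maxset x}" by blast
qed

lemma flag_cell_subset:
  assumes s: "s \<in> K" "s \<noteq> {}" and t: "\<tau> \<in> K" and C: "C \<in> flags s \<tau>"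
  shows "convex hull (barycenter ` C) \<subseteq> {x \<in> \<tau>. verts s \<subseteq> maxset x}"
proof (rule hull_minimal)
  show "convex {x \<in> \<tau>. verts s \<subseteq> maxset x}" by (rule convex_max_cell_simplex[OF t])
  show "barycenter ` C \<subseteq> {x \<in> \<tau>. verts s \<subseteq> maxset x}"
  proof
    fix x assume "x \<in> barycenter ` C"
    then obtain a where a: "a \<in> C" "x = barycenter a" by blast
    have f: "s face_of a" "a face_of \<tau>" using C a by (auto simp: flags_def)
    have aK: "a \<in> K" using face_K t f by blast
    have "s \<subseteq> a" "a \<subseteq> \<tau>" using f face_of_imp_subset by blast+
    then have ne: "a \<noteq> {}" using s by blast
    then show "x \<in> {x \<in> \<tau>. verts s \<subseteq> maxset x}"
      using a maxset_barycenter[OF aK ne] barycenter_mem[OF aK ne] \<open>a \<subseteq> \<tau>\<close> verts_face[OF f(1)] by auto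
  qed
qed

text \<open>The superlevel sets of the coordinates of x form a chain of vertex sets between
  \<open>verts s\<close> and the carrier. The uniform weight on such a set is the barycenter of the
  corresponding face, so the layer decomposition is a convex combination of barycenters along a
  flag.\<close>

lemma max_cell_in_flag:
  assumes s: "s \<in> K" "s \<noteq> {}" and x: "x \<in> \<Union>K" "verts s \<subseteq> maxset x"
  shows "\<exists>C\<in>flags s (convex hull (carrier x)). x \<in> convex hull (barycenter ` C)"
proof -
  note cs = carrier_simplex[OF x(1)]
  let ?\<tau> = "convex hull (carrier x)"
  obtain \<sigma> where \<sigma>: "\<sigma> \<in> K" "x \<in> \<sigma>" using x by blast
  have pos: "bc x v > 0" if "v \<in> carrier x" for v using that by (simp add: carrier_def)
  have zero: "bc x v = 0" if "v \<notin> carrier x" for v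
    using that bc_nonneg[OF \<sigma>, of v] by (simp add: carrier_def)
  obtain C \<mu> where "layers (carrier x) (bc x) C \<mu>"
    using layers_exist[of "carrier x" "bc x", OF cs(5,4) pos zero] by blast
  then have C: "finite C" "C \<noteq> {}"
    "\<forall>B\<in>C. {v \<in> carrier x. \<forall>w\<in>carrier x. bc x w \<le> bc x v} \<subseteq> B \<and> B \<subseteq> carrier x \<and> B \<noteq> {}"
    "\<forall>B\<in>C. \<forall>B'\<in>C. B \<subseteq> B' \<or> B' \<subseteq> B" "\<forall>B\<in>C. (0::real) \<le> \<mu> B"
    "\<forall>v. bc x v = (\<Sum>B\<in>C. if v \<in> B then \<mu> B / real (card B) else 0)"
    unfolding layers_def by - (elim conjE, assumption)+
  have sB: "verts s \<subseteq> B" if "B \<in> C" for B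
  proof -
    have "verts s \<subseteq> {v \<in> carrier x. \<forall>w\<in>carrier x. bc x w \<le> bc x v}"
      using x(2) maxset_subset_carrier[OF x(1)] by (auto simp: maxset_def)
    then show ?thesis using C(3) that by blast
  qed
  have BK: "convex hull B \<in> K" "verts (convex hull B) = B" "convex hull B face_of ?\<tau>" if "B \<in> C" for B
    using sub_simplex[OF cs(1), of B] cs(2) C(3) that by auto
  have "(\<lambda>B. convex hull B) ` C \<in> flags s ?\<tau>"
  proof -
    have "s face_of convex hull B" if "B \<in> C" for B
      using face_of_iff_subset[OF s(1) BK(1)[OF that]] subset_iff_verts[OF s(1) BK(1)[OF that]] BK(2)[OF that] sB[OF that]
      by simp
    moreover have "convex hull B face_of convex hull B' \<or> convex hull B' face_of convex hull B"
      if "B \<in> C" "B' \<in> C" for B B'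
      using face_of_iff_subset BK(1) that C(4) by (metis hull_mono)
    ultimately show ?thesis using C(2) BK(3) unfolding flags_def by auto
  qed
  moreover have "x \<in> convex hull (barycenter ` (\<lambda>B. convex hull B) ` C)"
  proof -
    have fB: "finite B" "card B > 0" if "B \<in> C" for B
      using C(3) that finite_subset[OF _ cs(5)] by (auto simp: card_gt_0_iff)
    have "(\<Sum>B\<in>C. \<mu> B *\<^sub>R barycenter (convex hull B)) =
        (\<Sum>B\<in>C. \<Sum>v\<in>carrier x. (if v \<in> B then \<mu> B / real (card B) else 0) *\<^sub>R v)"
    proof (rule sum.cong[OF refl])
      fix B assume B: "B \<in> C"
      have sub: "B \<subseteq> carrier x" using C(3) B by blast
      have "\<mu> B *\<^sub>R barycenter (convex hull B) = (\<Sum>v\<in>B. (\<mu> B / real (card B)) *\<^sub>R v)"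
        using barycenter_hull[OF cs(1), of B] cs(2) sub by (simp add: scaleR_sum_right)
      also have "\<dots> = (\<Sum>v\<in>carrier x. (if v \<in> B then \<mu> B / real (card B) else 0) *\<^sub>R v)"
        by (rule sum.mono_neutral_cong_left) (use cs(5) sub in auto)
      finally show "\<mu> B *\<^sub>R barycenter (convex hull B) =
        (\<Sum>v\<in>carrier x. (if v \<in> B then \<mu> B / real (card B) else 0) *\<^sub>R v)" .
    qed
    also have "\<dots> = (\<Sum>v\<in>carrier x. bc x v *\<^sub>R v)"
      by (subst sum.swap) (simp add: C(6)[rule_format] flip: scaleR_sum_left)
    also have "\<dots> = x" using bc_combination[OF cs(1) cs(3)] cs(2) by simp
    finally have 1: "(\<Sum>B\<in>C. \<mu> B *\<^sub>R barycenter (convex hull B)) = x" .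
    have "sum \<mu> C = (\<Sum>B\<in>C. \<Sum>v\<in>carrier x. if v \<in> B then \<mu> B / real (card B) else 0)"
    proof (rule sum.cong[OF refl])
      fix B assume B: "B \<in> C"
      have sub: "B \<subseteq> carrier x" using C(3) B by blast
      have "\<mu> B = (\<Sum>v\<in>B. \<mu> B / real (card B))" using fB[OF B] by (auto simp: card_gt_0_iff)
      also have "\<dots> = (\<Sum>v\<in>carrier x. if v \<in> B then \<mu> B / real (card B) else 0)"
        by (rule sum.mono_neutral_cong_left) (use cs(5) sub in auto)
      finally show "\<mu> B = (\<Sum>v\<in>carrier x. if v \<in> B then \<mu> B / real (card B) else 0)" .
    qed
    also have "\<dots> = (\<Sum>v\<in>carrier x. bc x v)" by (subst sum.swap) (simp add: C(6)[rule_format])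
    also have "\<dots> = 1" using bc_sum[OF cs(1,3)] cs(2) by simp
    finally have 2: "sum \<mu> C = 1" .
    have "(\<Sum>B\<in>C. \<mu> B *\<^sub>R barycenter (convex hull B)) \<in> convex hull (barycenter ` (\<lambda>B. convex hull B) ` C)"
      by (rule convex_sum[OF C(1) _ 2]) (use C(5) in \<open>auto intro!: hull_inc\<close>)
    then show ?thesis using 1 by simp
  qed
  ultimately show ?thesis by blast
qed

text \<open>The cell is starlike about the barycenter of s: within the carrier simplex of x the
  maximality conditions are linear inequalities satisfied by both ends of the segment.\<close>

lemma connected_max_cell:
  assumes "s \<in> K" "s \<noteq> {}"
  shows "connected {x \<in> \<Union>K. verts s \<subseteq> maxset x}"
proof (rule starlike_imp_connected)
  have b: "barycenter s \<in> s" "maxset (barycenter s) = verts s"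
    using barycenter_mem[OF assms] maxset_barycenter[OF assms] by auto
  have "closed_segment (barycenter s) x \<subseteq> {x \<in> \<Union>K. verts s \<subseteq> maxset x}"
    if x: "x \<in> \<Union>K" "verts s \<subseteq> maxset x" for x
  proof -
    note cs = carrier_simplex[OF x(1)]
    let ?\<tau> = "convex hull (carrier x)"
    have "s \<subseteq> ?\<tau>"
      using subset_iff_verts[OF assms(1) cs(1)] cs(2) x(2) maxset_subset_carrier[OF x(1)] by auto
    then have "barycenter s \<in> {x \<in> ?\<tau>. verts s \<subseteq> maxset x}" "x \<in> {x \<in> ?\<tau>. verts s \<subseteq> maxset x}"
      using b x(2) cs(3) by auto
    then have "closed_segment (barycenter s) x \<subseteq> {x \<in> ?\<tau>. verts s \<subseteq> maxset x}"
      using convex_max_cell_simplex[OF cs(1)] by (intro closed_segment_subset)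
    then show ?thesis using cs(1) by blast
  qed
  then show "starlike {x \<in> \<Union>K. verts s \<subseteq> maxset x}"
    unfolding starlike_def using assms(1) b by (intro bexI[of _ "barycenter s"]) auto
qed

end

context primitive_triangulated
begin

text \<open>One inclusion holds because every barycenter in a flag above s attains its maximal
  coordinate on all vertices of s, the other by the layer decomposition.\<close>

lemma cell_points_eq:
  assumes "s \<in> K" "s \<noteq> {}"
  shows "cell_points K (s, P) = {x \<in> P. verts s \<subseteq> maxset x}"
proof
  show "cell_points K (s, P) \<subseteq> {x \<in> P. verts s \<subseteq> maxset x}"
    using flag_cell_subset[OF assms] in_P unfolding cell_points_def cubical_cell_def by fastforce
  show "{x \<in> P. verts s \<subseteq> maxset x} \<subseteq> cell_points K (s, P)"
  proof
    fix x assume "x \<in> {x \<in> P. verts s \<subseteq> maxset x}"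
    then have x: "x \<in> \<Union>K" "verts s \<subseteq> maxset x" using Union_K by auto
    note cs = carrier_simplex[OF x(1)]
    obtain C where C: "C \<in> flags s (convex hull (carrier x))" "x \<in> convex hull (barycenter ` C)"
      using max_cell_in_flag[OF assms x] by blast
    have "s face_of convex hull (carrier x)"
      using face_of_iff_subset[OF assms(1) cs(1)] subset_iff_verts[OF assms(1) cs(1)] cs(2)
        x(2) maxset_subset_carrier[OF x(1)] by auto
    moreover have "convex hull (carrier x) \<subseteq> P" using in_P cs(1) by blast
    ultimately show "x \<in> cell_points K (s, P)"
      unfolding cell_points_def cubical_cell_def using C cs(1) by auto
  qed
qed

end

section \<open>Wedges of covectors\<close>

text \<open>
  The exterior power of degree \<open>CARD('d) - 1\<close> is identified with \<open>M\<^sub>2\<close>: the coordinate indexed by the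
  complement of \<open>{i}\<close> becomes the \<open>i\<close>-th coordinate.
\<close>

definition dual_wedge :: "bit ^ 'd::finite \<Rightarrow> 'd set \<Rightarrow> bit"
  where "dual_wedge m I = (\<Sum>i | I = UNIV - {i}. m $ i)"

lemma compl_singleton_eq: "{i. UNIV - {k} = UNIV - {i}} = {k}"
  by auto

lemma dual_wedge_compl [simp]: "dual_wedge m (UNIV - {i}) = m $ i"
  unfolding dual_wedge_def compl_singleton_eq by simp

lemma dual_wedge_other: "(\<And>i. I \<noteq> UNIV - {i}) \<Longrightarrow> dual_wedge m I = 0"
  unfolding dual_wedge_def by (intro sum.neutral) auto

lemma dual_wedge_add: "dual_wedge (m + m') = dual_wedge m + dual_wedge m'"
  by (auto simp: fun_eq_iff dual_wedge_def sum.distrib)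

lemma dual_wedge_zero [simp]: "dual_wedge 0 = 0"
  by (auto simp: fun_eq_iff dual_wedge_def)

lemma wedge_other_card:
  assumes "card I \<noteq> length us"
  shows "wedge us I = 0"
proof -
  have "card I = card {..<length us}" if "bij_betw g I {..<length us}" for g
    using that by (rule bij_betw_same_card)
  then have no: "\<not> bij_betw g I {..<length us}" for g using assms by (metis card_lessThan)
  show ?thesis unfolding wedge_def by (rule sum.neutral) (simp add: no)
qed

text \<open>An involution without fixed points groups the terms into equal pairs, and each pair
  cancels in characteristic two.\<close>

lemma sum_bit_involution:
  fixes F :: "'a \<Rightarrow> 'v::f2_vector"
  assumes "finite A" "\<And>x. x \<in> A \<Longrightarrow> h x \<in> A" "\<And>x. x \<in> A \<Longrightarrow> h x \<noteq> x"
    "\<And>x. x \<in> A \<Longrightarrow> h (h x) = x" "\<And>x. x \<in> A \<Longrightarrow> F (h x) = F x"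
  shows "sum F A = 0"
  using assms
proof (induction "card A" arbitrary: A rule: less_induct)
  case less
  show ?case
  proof (cases "A = {}")
    case False
    then obtain x where x: "x \<in> A" by auto
    let ?B = "A - {x, h x}"
    have "card ?B < card A" using less.prems(1) x by (intro psubset_card_mono) auto
    moreover have "h y \<in> ?B" if "y \<in> ?B" for y
    proof -
      have "h y \<noteq> x" "h y \<noteq> h x" using that less.prems(4) x by (metis DiffE insertCI)+
      then show ?thesis using less.prems(2) that by auto
    qed
    ultimately have "sum F ?B = 0" using less.hyps[of ?B] less.prems by auto
    moreover have "sum F A = sum F ?B + sum F {x, h x}"
      using less.prems(1,2) x by (intro sum.subset_diff) auto
    moreover have "sum F {x, h x} = 0" using less.prems(3,5) x by (simp add: eq_commute)
    ultimately show ?thesis by simp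
  qed simp
qed

text \<open>Perpendicularity to \<omega> writes column \<open>i0\<close> as the sum of the other
  columns j with coefficients \<omega>_j. Inserted into the minor without column k, only j = k
  survives and gives the minor without column \<open>i0\<close>; any other j repeats a
  column.\<close>

lemma wedge_hyperplane:
  fixes us :: "(bit ^ 'd::finite) list"
  assumes len: "Suc (length us) = CARD('d)" and perp: "\<And>u. u \<in> set us \<Longrightarrow> pairing2 \<omega> u = 0"
    and i0: "\<omega> $ i0 = 1" and k: "k \<noteq> i0"
  shows "wedge us (UNIV - {k}) = \<omega> $ k * wedge us (UNIV - {i0})"
proof -
  let ?n = "length us"
  define G where "G I = {g. g \<in> I \<rightarrow>\<^sub>E {..<?n} \<and> bij_betw g I {..<?n}}" for I :: "'d set"
  have finG: "finite (G I)" for I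
    unfolding G_def by (rule finite_subset[OF _ finite_PiE[of I "\<lambda>_. {..<?n}"]]) auto
  define I where "I = UNIV - {k}"
  define J where "J = UNIV - {k, i0}"
  have I: "I = insert i0 J" "i0 \<notin> J" using k by (auto simp: I_def J_def)
  have u_i0: "u $ i0 = (\<Sum>j\<in>UNIV - {i0}. \<omega> $ j * u $ j)" if "u \<in> set us" for u
  proof -
    have "0 = (\<Sum>j\<in>UNIV. \<omega> $ j * u $ j)" using perp[OF that] by (simp add: pairing2_def)
    also have "\<dots> = u $ i0 + (\<Sum>j\<in>UNIV - {i0}. \<omega> $ j * u $ j)"
      using i0 by (simp add: sum.remove[of UNIV i0])
    finally show ?thesis by (metis add.commute add.left_neutral vec_bit_eq_add)
  qed
  define T where "T j = (\<Sum>g\<in>G I. (us ! g i0) $ j * (\<Prod>i\<in>J. (us ! g i) $ i))" for j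
  have "wedge us I = (\<Sum>g\<in>G I. (us ! g i0) $ i0 * (\<Prod>i\<in>J. (us ! g i) $ i))"
    unfolding wedge_def G_def using I by (intro sum.cong) auto
  also have "\<dots> = (\<Sum>g\<in>G I. \<Sum>j\<in>UNIV - {i0}. \<omega> $ j * ((us ! g i0) $ j * (\<Prod>i\<in>J. (us ! g i) $ i)))"
  proof (rule sum.cong[OF refl])
    fix g assume "g \<in> G I"
    then have "g i0 < ?n" using I by (auto simp: G_def)
    then have "us ! g i0 \<in> set us" by simp
    then show "(us ! g i0) $ i0 * (\<Prod>i\<in>J. (us ! g i) $ i) =
        (\<Sum>j\<in>UNIV - {i0}. \<omega> $ j * ((us ! g i0) $ j * (\<Prod>i\<in>J. (us ! g i) $ i)))"
      using u_i0 by (simp add: sum_distrib_right mult.assoc)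
  qed
  also have "\<dots> = (\<Sum>j\<in>UNIV - {i0}. \<omega> $ j * T j)"
    unfolding T_def by (subst sum.swap) (simp add: sum_distrib_left)
  also have "\<dots> = \<omega> $ k * T k + (\<Sum>j\<in>J. \<omega> $ j * T j)"
  proof -
    have "UNIV - {i0} = insert k J" "k \<notin> J" using k by (auto simp: J_def)
    then show ?thesis by simp
  qed
  \<comment> \<open>T j is the minor in which column j stands in for column \<open>i0\<close>
    although it is already present. Exchanging the rows assigned to these two columns pairs equal
    terms.\<close>
  also have "(\<Sum>j\<in>J. \<omega> $ j * T j) = 0"
  proof (intro sum.neutral ballI)
    fix j assume j: "j \<in> J"
    have ji: "j \<noteq> i0" "j \<in> I" "i0 \<in> I" using j I by auto
    define h where "h g = g(i0 := g j, j := g i0)" for g :: "'d \<Rightarrow> nat"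
    have "T j = 0" unfolding T_def
    proof (rule sum_bit_involution[where h = h])
      show "finite (G I)" by (rule finG)
      fix g assume g: "g \<in> G I"
      have hg: "h g = (\<lambda>i. g (Transposition.transpose i0 j i))"
        by (auto simp: h_def fun_eq_iff Transposition.transpose_def)
      have "bij_betw (Transposition.transpose i0 j) I I"
        using ji by (intro bij_betw_byWitness[where f' = "Transposition.transpose i0 j"])
          (auto simp: Transposition.transpose_def)
      then have "bij_betw (h g) I {..<?n}"
        unfolding hg using g bij_betw_trans[of "Transposition.transpose i0 j" I I g] by (auto simp: G_def o_def)
      moreover have "h g \<in> I \<rightarrow>\<^sub>E {..<?n}" using g ji by (auto simp: G_def h_def PiE_iff extensional_def)
      ultimately show "h g \<in> G I" by (simp add: G_def)
      show "h g \<noteq> g"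
      proof
        assume "h g = g"
        then have "g j = g i0" by (metis fun_upd_apply h_def)
        moreover have "inj_on g I" using g by (auto simp: G_def bij_betw_def)
        ultimately show False using ji by (auto dest: inj_onD)
      qed
      show "h (h g) = g" using ji by (auto simp: h_def)
      have "(\<Prod>i\<in>J. (us ! h g i) $ i) = (us ! g i0) $ j * (\<Prod>i\<in>J - {j}. (us ! g i) $ i)"
      proof -
        have "(\<Prod>i\<in>J - {j}. (us ! h g i) $ i) = (\<Prod>i\<in>J - {j}. (us ! g i) $ i)"
          using I by (intro prod.cong) (auto simp: h_def)
        then show ?thesis using j ji prod.remove[of J j "\<lambda>i. (us ! h g i) $ i"] by (simp add: h_def)
      qed
      moreover have "(\<Prod>i\<in>J. (us ! g i) $ i) = (us ! g j) $ j * (\<Prod>i\<in>J - {j}. (us ! g i) $ i)"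
        using j prod.remove[of J j "\<lambda>i. (us ! g i) $ i"] by simp
      moreover have "h g i0 = g j" using ji by (simp add: h_def)
      ultimately show "(us ! h g i0) $ j * (\<Prod>i\<in>J. (us ! h g i) $ i) = (us ! g i0) $ j * (\<Prod>i\<in>J. (us ! g i) $ i)"
        by (simp add: mult.left_commute)
    qed
    then show "\<omega> $ j * T j = 0" by simp
  qed
  \<comment> \<open>Relabelling column \<open>i0\<close> as k identifies the two index sets and
    their bijections.\<close>
  also have "T k = wedge us (UNIV - {i0})"
  proof -
    define I' where "I' = UNIV - {i0}"
    have I': "I' = insert k J" "k \<notin> J" using k by (auto simp: I'_def J_def)
    define t where "t = Transposition.transpose i0 k"
    have tt: "t (t i) = i" for i by (simp add: t_def)
    have mem: "i \<in> I \<longleftrightarrow> t i \<in> I'" for i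
      using k by (auto simp: t_def I_def I'_def Transposition.transpose_def)
    have tI: "bij_betw t I' I"
      by (rule bij_betw_byWitness[where f' = t]) (use mem tt in auto)
    have tI': "bij_betw t I I'"
      by (rule bij_betw_byWitness[where f' = t]) (use mem tt in auto)
    have "T k = (\<Sum>g\<in>G I'. \<Prod>i\<in>I'. (us ! g i) $ i)"
      unfolding T_def
    proof (rule sum.reindex_bij_witness[where i = "\<lambda>g i. g (t i)" and j = "\<lambda>g i. g (t i)"])
      fix g assume g: "g \<in> G I"
      show "(\<lambda>i. g (t (t i))) = g" by (simp add: tt)
      show "(\<lambda>i. g (t i)) \<in> G I'"
        using g mem tt bij_betw_trans[OF tI, of g] unfolding G_def PiE_iff extensional_def o_def
        by simp
      have "(\<Prod>i\<in>J. (us ! g (t i)) $ i) = (\<Prod>i\<in>J. (us ! g i) $ i)"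
        using I I' by (intro prod.cong) (auto simp: t_def Transposition.transpose_def)
      then show "(\<Prod>i\<in>I'. (us ! g (t i)) $ i) = (us ! g i0) $ k * (\<Prod>i\<in>J. (us ! g i) $ i)"
        using I' by (simp add: t_def)
    next
      fix g assume g: "g \<in> G I'"
      show "(\<lambda>i. g (t (t i))) = g" by (simp add: tt)
      show "(\<lambda>i. g (t i)) \<in> G I"
        using g mem tt bij_betw_trans[OF tI', of g] unfolding G_def PiE_iff extensional_def o_def
        by simp
    qed
    then show ?thesis by (simp add: wedge_def G_def I'_def)
  qed
  finally show ?thesis by (simp add: I_def)
qed

text \<open>The vectors lie in a hyperplane of dimension CARD('d) - 1, whose top exterior power is
  one-dimensional; by \<open>wedge_hyperplane\<close> all minors are proportional to the entries of
  \<omega>. Index sets of another size contribute 0 on both sides.\<close>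

lemma wedge_in_hyperplane:
  fixes us :: "(bit ^ 'd::finite) list"
  assumes len: "Suc (length us) = CARD('d)" and perp: "\<And>u. u \<in> set us \<Longrightarrow> pairing2 \<omega> u = 0"
    and ne: "\<omega> \<noteq> 0"
  shows "wedge us = 0 \<or> wedge us = dual_wedge \<omega>"
proof -
  obtain i0 where i0: "\<omega> $ i0 = 1" using ne by (auto simp: vec_eq_iff)
  have eq: "wedge us (UNIV - {k}) = \<omega> $ k * wedge us (UNIV - {i0})" for k
    using wedge_hyperplane[OF len perp i0, of k] i0 by (cases "k = i0") auto
  have "wedge us I = wedge us (UNIV - {i0}) * dual_wedge \<omega> I" for I
  proof (cases "\<exists>k. I = UNIV - {k}")
    case True
    then obtain k where "I = UNIV - {k}" by blast
    then show ?thesis using eq[of k] by (simp add: mult.commute)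
  next
    case False
    have "card I \<noteq> length us"
    proof
      assume "card I = length us"
      then have "card (UNIV - I) = 1" using len by (simp add: card_Diff_subset)
      then obtain k where "UNIV - I = {k}" using card_1_singletonE by blast
      then show False using False by blast
    qed
    then show ?thesis using wedge_other_card dual_wedge_other False by (metis mult_zero_right)
  qed
  then show ?thesis by (cases "wedge us (UNIV - {i0})") (auto simp: fun_eq_iff)
qed

text \<open>The prescribed factor q matters for the quotient by \<open>Sed\<close>: a wedge with a
  factor in \<open>Sed\<close> dies there. The list is an explicit basis of the hyperplane that
  contains q.\<close>

lemma wedge_hyperplane_exists:
  fixes \<omega> q :: "bit ^ 'd::finite"
  assumes ne: "\<omega> \<noteq> 0" and q: "q \<noteq> 0" "pairing2 \<omega> q = 0"
  shows "\<exists>us. Suc (length us) = CARD('d) \<and> (\<forall>u\<in>set us. pairing2 \<omega> u = 0) \<and> q \<in> set us \<and> wedge us = dual_wedge \<omega>"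
proof -
  obtain i0 where i0: "\<omega> $ i0 = 1" using ne by (auto simp: vec_eq_iff)
  have "\<exists>k0. k0 \<noteq> i0 \<and> q $ k0 = 1"
  proof (rule ccontr)
    assume "\<not> ?thesis"
    then have z: "q $ j = 0" if "j \<noteq> i0" for j using that by auto
    have "pairing2 \<omega> q = \<omega> $ i0 * q $ i0 + (\<Sum>j\<in>UNIV - {i0}. \<omega> $ j * q $ j)"
      unfolding pairing2_def by (rule sum.remove) auto
    also have "\<dots> = q $ i0" using z i0 by simp
    finally have "q $ i0 = 0" using q(2) by simp
    then show False using z q(1) by (metis vec_eq_iff zero_index)
  qed
  then obtain k0 where k0: "k0 \<noteq> i0" "q $ k0 = 1" by blast
  \<comment> \<open>Away from coordinate \<open>i0\<close> the vectors other than q are unit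
    vectors, with the entry at \<open>i0\<close> fitted to be perpendicular to \<omega>. Since q has
    entry 1 at \<open>k0\<close>, putting it in place of that unit vector keeps the minor equal to
    1.\<close>
  define b where "b k = (if k = k0 then q else axis k 1 + (if \<omega> $ k = 1 then axis i0 1 else 0))" for k
  have perp: "pairing2 \<omega> (b k) = 0" if "k \<noteq> i0" for k
    using q(2) i0 by (cases "\<omega> $ k") (auto simp: b_def pairing2_add_right)
  obtain ks where ks: "set ks = UNIV - {i0}" "distinct ks" using finite_distinct_list[of "UNIV - {i0}"] by auto
  have len: "Suc (length ks) = CARD('d)" using distinct_card[OF ks(2)] ks(1) card_Suc_Diff1[of UNIV i0] by simp
  define us where "us = map b ks"
  let ?n = "length ks" and ?I = "UNIV - {i0}"
  have bij: "bij_betw (\<lambda>m. ks ! m) {..<?n} ?I"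
    using bij_betw_nth[OF ks(2) refl] ks(1) by simp
  define g0 where "g0 = restrict (inv_into {..<?n} (\<lambda>m. ks ! m)) ?I"
  have ks_g0: "ks ! g0 i = i" "g0 i < ?n" if "i \<noteq> i0" for i
    using that bij f_inv_into_f[of i "\<lambda>m. ks ! m" "{..<?n}"] inv_into_into[of i "\<lambda>m. ks ! m" "{..<?n}"]
    by (auto simp: g0_def bij_betw_def)
  have g0_bij: "bij_betw g0 ?I {..<?n}"
    using bij_betw_inv_into[OF bij] by (simp only: g0_def bij_betw_restrict_eq)
  have entry: "b k $ i = (if k = k0 then q $ i else if k = i then 1 else 0)" if "i \<noteq> i0" for k i
    using that by (auto simp: b_def axis_def)
  have "wedge us ?I = (\<Sum>g | g \<in> ?I \<rightarrow>\<^sub>E {..<?n} \<and> bij_betw g ?I {..<?n}. \<Prod>i\<in>?I. b (ks ! g i) $ i)"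
    unfolding wedge_def us_def length_map
  proof (intro sum.cong prod.cong refl)
    fix g i assume "g \<in> {g \<in> ?I \<rightarrow>\<^sub>E {..<?n}. bij_betw g ?I {..<?n}}" "i \<in> ?I"
    then have "g i < ?n" by auto
    then show "map b ks ! g i $ i = b (ks ! g i) $ i" by simp
  qed
  also have "\<dots> = (\<Sum>g | g \<in> ?I \<rightarrow>\<^sub>E {..<?n} \<and> bij_betw g ?I {..<?n}. if g = g0 then 1 else 0)"
  proof (rule sum.cong[OF refl])
    fix g assume "g \<in> {g \<in> ?I \<rightarrow>\<^sub>E {..<?n}. bij_betw g ?I {..<?n}}"
    then have g: "g \<in> ?I \<rightarrow>\<^sub>E {..<?n}" "bij_betw g ?I {..<?n}" by auto
    show "(\<Prod>i\<in>?I. b (ks ! g i) $ i) = (if g = g0 then 1 else 0)"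
    proof (cases "g = g0")
      case True
      have "b (ks ! g i) $ i = 1" if "i \<in> ?I" for i
        using entry[of i "ks ! g i"] ks_g0[of i] that k0 by (auto simp: True)
      then show ?thesis using True by simp
    next
      case False
      \<comment> \<open>For a nonzero product every column must select its own unit vector or q;
        injectivity then forces q to be used at \<open>k0\<close> only, which is the bijection
        \<open>g0\<close>.\<close>
      have "\<exists>i\<in>?I. ks ! g i \<noteq> k0 \<and> ks ! g i \<noteq> i"
      proof (rule ccontr)
        assume "\<not> ?thesis"
        then have alt: "ks ! g i = k0 \<or> ks ! g i = i" if "i \<in> ?I" for i using that by blast
        have inj: "inj_on (\<lambda>i. ks ! g i) ?I"
          using bij_betw_imp_inj_on[OF bij_betw_trans[OF g(2) bij]] by (simp add: o_def)
        have gi: "ks ! g i = i" if i: "i \<in> ?I" for i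
        proof (rule ccontr)
          assume "ks ! g i \<noteq> i"
          then have k: "ks ! g i = k0" "i \<noteq> k0" using alt[OF i] by auto
          moreover have "ks ! g k0 = k0" using alt[of k0] k0 by auto
          ultimately show False using inj_onD[OF inj, of i k0] i k0 by auto
        qed
        have "g = g0"
        proof
          fix i
          show "g i = g0 i"
          proof (cases "i = i0")
            case True
            then show ?thesis using g(1) by (auto simp: g0_def PiE_iff extensional_def)
          next
            case False
            then have "ks ! g i = ks ! g0 i" "g i < ?n" "g0 i < ?n" using gi ks_g0 g(1) by auto
            then show ?thesis using ks(2) nth_eq_iff_index_eq by blast
          qed
        qed
        then show False using False by simp
      qed
      then obtain i where i: "i \<in> ?I" "ks ! g i \<noteq> k0" "ks ! g i \<noteq> i" by blast
      then have "b (ks ! g i) $ i = 0" using entry[of i] by auto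
      then have "\<exists>i\<in>?I. b (ks ! g i) $ i = 0" using i(1) by blast
      then have "(\<Prod>i\<in>?I. b (ks ! g i) $ i) = 0" by (intro prod_zero) auto
      then show ?thesis using False by simp
    qed
  qed
  also have "\<dots> = 1"
  proof -
    have "finite {g. g \<in> ?I \<rightarrow>\<^sub>E {..<?n} \<and> bij_betw g ?I {..<?n}}"
      by (rule finite_subset[OF _ finite_PiE[of ?I "\<lambda>_. {..<?n}"]]) auto
    moreover have "g0 \<in> {g. g \<in> ?I \<rightarrow>\<^sub>E {..<?n} \<and> bij_betw g ?I {..<?n}}"
      using g0_bij ks_g0(2) by (auto simp: g0_def)
    ultimately show ?thesis by simp
  qed
  finally have one: "wedge us ?I = 1" .
  have uperp: "\<forall>u\<in>set us. pairing2 \<omega> u = 0" using perp ks(1) by (auto simp: us_def)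
  have l: "Suc (length us) = CARD('d)" using len by (simp add: us_def)
  have "b k0 = q" by (simp add: b_def)
  then have "q \<in> set us" using k0 ks(1) by (force simp: us_def)
  moreover have "wedge us \<noteq> 0" using one by (auto simp: fun_eq_iff)
  then have "wedge us = dual_wedge \<omega>" using wedge_in_hyperplane[OF l _ ne] uperp by blast
  ultimately show ?thesis using l uperp by blast
qed

section \<open>The Hessian on the star of an interior vertex\<close>

lemma minus_f2: "x - y = x + y" for x y :: "'v::f2_vector"
  by (metis add_diff_cancel_right' f2_add_self_left add.commute)

lemma cell_chains_iff:
  "f \<in> cell_chains A S q \<longleftrightarrow> (\<forall>e. if e \<in> A \<and> cell_dim e = q then f e \<in> S e else f e = 0)"
  unfolding cell_chains_def by (rule mem_Collect_eq)

lemma cell_chains_zero: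
  assumes "f \<in> cell_chains A S q" "\<not> (e \<in> A \<and> cell_dim e = q)"
  shows "f e = 0"
  using assms(1)[unfolded cell_chains_iff, THEN spec, of e] unfolding if_not_P[OF assms(2)] .

lemma cell_chains_mem:
  assumes "f \<in> cell_chains A S q" "e \<in> A" "cell_dim e = q"
  shows "f e \<in> S e"
  using assms(1)[unfolded cell_chains_iff, THEN spec, of e] unfolding if_P[OF conjI[OF assms(2,3)]] .

lemma coboundary_zero:
  assumes "\<And>e' e. trans_map G e' e 0 = 0"
  shows "coboundary A G 0 = 0"
proof
  show "coboundary A G 0 e = 0 e" for e by (simp add: coboundary_def assms)
qed

context primitive_triangulated
begin

lemma P_face: "P face_of P"
  using convex_P by (rule face_of_refl)

lemma X_cells_iff: "(\<sigma>, Q) \<in> X_cells P K \<longleftrightarrow> \<sigma> \<in> K \<and> Q face_of P \<and> \<sigma> \<subseteq> Q \<and> aff_dim \<sigma> \<ge> 1"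
  unfolding X_cells_def Y_cells_def by auto

lemma cell_dim_nonneg:
  assumes "e \<in> X_cells P K"
  shows "cell_dim e \<ge> 0"
proof -
  have "fst e \<subseteq> snd e" using assms X_cells_iff[of "fst e" "snd e"] by simp
  then show ?thesis using aff_dim_subset[of "fst e" "snd e"] by (simp add: cell_dim_def)
qed

lemma finite_X_cells: "finite (X_cells P K)"
proof -
  have "X_cells P K \<subseteq> K \<times> {F. F face_of P}" by (auto simp: X_cells_def Y_cells_def)
  then show ?thesis using finite_K finite_polytope_faces[OF polytope_P] by (meson finite_SigmaI finite_subset)
qed

lemma chamber_cell: "\<tau> \<in> chambers \<Longrightarrow> (\<tau>, P) \<in> X_cells P K" "\<tau> \<in> chambers \<Longrightarrow> cell_dim (\<tau>, P) = 0"
  using in_P P_face full_dim by (auto simp: X_cells_iff chambers_def cell_dim_def)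

lemma edge_of_simplex:
  assumes "\<sigma> \<in> K" "v \<in> verts \<sigma>" "w \<in> verts \<sigma>" "v \<noteq> w"
  shows "convex hull {v, w} edge_of \<sigma>" "edge_class (convex hull {v, w}) = mod2 v + mod2 w"
    "differential g (convex hull {v, w}) = g v + g w"
proof -
  have e: "convex hull {v, w} \<in> K" "verts (convex hull {v, w}) = {v, w}" using edge_simplex assms by auto
  have "aff_dim (convex hull {v, w}) = 1" using aff_dim_eq_card[OF e(1)] e(2) assms(4) by simp
  then show "convex hull {v, w} edge_of \<sigma>"
    using sub_simplex_face[OF assms(1), of "{v, w}"] assms by (simp add: edge_of_def)
  show "edge_class (convex hull {v, w}) = mod2 v + mod2 w" "differential g (convex hull {v, w}) = g v + g w"
    using e(2) assms(4) by (simp_all add: edge_class_def differential_def verts_def)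
qed

lemma simplex_edge:
  assumes "\<sigma> \<in> K" "s edge_of \<sigma>"
  obtains v w where "v \<in> verts \<sigma>" "w \<in> verts \<sigma>" "v \<noteq> w" "s = convex hull {v, w}"
proof -
  have f: "s face_of \<sigma>" "aff_dim s = 1" using assms by (auto simp: edge_of_def)
  have sK: "s \<in> K" using face_K assms f by blast
  have "card (verts s) = 2" using aff_dim_eq_card[OF sK] f(2) by simp
  then obtain v w where "verts s = {v, w}" "v \<noteq> w" by (meson card_2_iff)
  then show thesis using that verts_face[OF f(1)] convex_hull_verts[OF sK] by auto
qed

text \<open>There are no cells of dimension -1, so the class of the section has a single
  representative. On the 0-cell of a chamber, lifting it through the quotient map is the defining
  property of \<open>grad\<close>.\<close>

lemma hessian_lift:
  assumes "x \<in> hessian P K g"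
  obtains t where "x = coboundary (X_cells P K) constant_sheaf t" "\<And>\<tau>. \<tau> \<in> chambers \<Longrightarrow> t (\<tau>, P) = grad \<tau> g"
proof -
  let ?X = "X_cells P K"
  obtain s t where s: "s \<in> cohomologous ?X cocycle_sheaf 0 `` {differential_section P K g}"
    and t: "\<forall>e\<in>?X. cell_dim e = 0 \<longrightarrow> wave_quotient_map e (t e) = s e" "coboundary ?X constant_sheaf t = x"
    using assms unfolding hessian_def connecting_def by blast
  have "differential_section P K g - s \<in> coboundaries ?X cocycle_sheaf 0"
    using s by (auto simp: cohomologous_def)
  then obtain h where h: "h \<in> cell_chains ?X (stalk cocycle_sheaf) (- 1)"
    "differential_section P K g - s = coboundary ?X cocycle_sheaf h"
    unfolding coboundaries_def by auto
  have "h = 0"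
  proof
    fix e
    have "\<not> (e \<in> ?X \<and> cell_dim e = - 1)" using cell_dim_nonneg by fastforce
    then show "h e = 0 e" using cell_chains_zero[OF h(1)] by simp
  qed
  moreover have "coboundary ?X cocycle_sheaf 0 = (0 :: 'd cell \<Rightarrow> (real ^ 'd) set \<Rightarrow> bit)"
    by (rule coboundary_zero) (simp add: cocycle_sheaf_def fun_eq_iff)
  ultimately have "differential_section P K g - s = 0" using h(2) by (simp only:)
  then have seq: "s = differential_section P K g" by simp
  have "t (\<tau>, P) = grad \<tau> g" if \<tau>: "\<tau> \<in> chambers" for \<tau>
  proof (rule grad_eqI[OF \<tau>, symmetric])
    fix v w assume vw: "v \<in> verts \<tau>" "w \<in> verts \<tau>"
    show "pairing2 (mod2 v + mod2 w) (t (\<tau>, P)) = g v + g w"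
    proof (cases "v = w")
      case False
      let ?s = "convex hull {v, w}"
      note e = edge_of_simplex[OF chamber_K[OF \<tau>] vw False]
      have "wave_quotient_map (\<tau>, P) (t (\<tau>, P)) ?s = differential_section P K g (\<tau>, P) ?s"
        using t(1) chamber_cell[OF \<tau>] seq by metis
      then show ?thesis
        using e chamber_cell[OF \<tau>] by (simp add: wave_quotient_map_def differential_section_def)
    qed simp
  qed
  then show thesis using that t(2) by metis
qed

lemma interior_vertex: "v \<in> interior_vertices P K \<longleftrightarrow> v \<in> vertices \<and> v \<in> interior P"
  by (auto simp: interior_vertices_def vertices_eq)

lemma face_containing_interior:
  "Q face_of P \<Longrightarrow> v \<in> Q \<Longrightarrow> v \<in> interior P \<Longrightarrow> Q = P"
  using interior_facet_disjoint by blast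

lemma star_boundary_eq:
  assumes v: "v \<in> interior_vertices P K"
  shows "star_boundary P K v = {(\<sigma>, P) |\<sigma>. \<sigma> \<in> K \<and> v \<in> verts \<sigma> \<and> \<sigma> \<noteq> {v}}"
proof -
  have vK: "{v} \<in> K" and vint: "v \<in> interior P" using v by (auto simp: interior_vertices_def)
  have vv: "verts {v} = {v}" by (simp add: verts_def)
  have 1: "Q = P \<and> v \<in> verts \<sigma>" if "\<sigma> \<in> K" "Q face_of P" "\<sigma> \<subseteq> Q" "{v} face_of \<sigma>" for \<sigma> Q
  proof -
    have "v \<in> \<sigma>" using face_of_imp_subset that(4) by blast
    moreover have "verts {v} \<subseteq> verts \<sigma>" using verts_face that(4) by blast
    ultimately show ?thesis using face_containing_interior[OF that(2) _ vint] that(3) vv by blast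
  qed
  have 2: "{v} face_of \<sigma>" if "\<sigma> \<in> K" "v \<in> verts \<sigma>" for \<sigma>
    using that by (simp add: face_of_singleton verts_def)
  show ?thesis
  proof (intro subset_antisym subsetI)
    fix e assume "e \<in> star_boundary P K v"
    moreover obtain \<sigma> Q where e: "e = (\<sigma>, Q)" by (cases e)
    ultimately have e: "e = (\<sigma>, Q)" "\<sigma> \<in> K" "Q face_of P" "\<sigma> \<subseteq> Q" "{v} face_of \<sigma>" "(\<sigma>, Q) \<noteq> ({v}, P)"
      unfolding star_boundary_def Y_cells_def cell_le_def by simp_all
    then show "e \<in> {(\<sigma>, P) |\<sigma>. \<sigma> \<in> K \<and> v \<in> verts \<sigma> \<and> \<sigma> \<noteq> {v}}" using 1[OF e(2-5)] by auto
  next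
    fix e assume "e \<in> {(\<sigma>, P) |\<sigma>. \<sigma> \<in> K \<and> v \<in> verts \<sigma> \<and> \<sigma> \<noteq> {v}}"
    then obtain \<sigma> where e: "e = (\<sigma>, P)" "\<sigma> \<in> K" "v \<in> verts \<sigma>" "\<sigma> \<noteq> {v}" by blast
    have "\<sigma> \<noteq> {}" "\<sigma> \<subseteq> P" using verts_sub[OF e(2)] in_P[OF e(2)] e(3) by auto
    then show "e \<in> star_boundary P K v"
      using e 2[OF e(2,3)] P_face unfolding star_boundary_def Y_cells_def cell_le_def by auto
  qed
qed

lemma star_boundary_X0:
  assumes v: "v \<in> interior_vertices P K"
  shows "star_boundary P K v \<subseteq> X0_cells P K"
proof
  fix e assume e: "e \<in> star_boundary P K v"
  then obtain \<sigma> where s: "e = (\<sigma>, P)" "\<sigma> \<in> K" "v \<in> verts \<sigma>" "\<sigma> \<noteq> {v}" using star_boundary_eq[OF v] by auto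
  have "verts \<sigma> \<noteq> {v}" using s(2,4) convex_hull_verts by fastforce
  then have "card (verts \<sigma>) \<noteq> 1" using s(3) by (metis card_1_singletonE singletonD)
  moreover have "card (verts \<sigma>) > 0" using s(3) finite_verts[OF s(2)] by (auto simp: card_gt_0_iff)
  ultimately have "aff_dim \<sigma> \<ge> 1" using aff_dim_eq_card[OF s(2)] by simp
  then show "e \<in> X0_cells P K"
    using e v s(1) unfolding star_boundary_def X0_cells_def X_cells_def by auto
qed

lemma star_boundary_closed:
  assumes v: "v \<in> interior_vertices P K" and e: "e \<in> star_boundary P K v"
    and e': "e' \<in> X_cells P K" "cell_le e' e"
  shows "e' \<in> star_boundary P K v"
proof -
  have vint: "v \<in> interior P" using v by (auto simp: interior_vertices_def)
  obtain \<sigma> where s: "e = (\<sigma>, P)" "\<sigma> \<in> K" "v \<in> verts \<sigma>" "\<sigma> \<noteq> {v}" using e star_boundary_eq[OF v] by auto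
  obtain \<sigma>' Q' where s': "e' = (\<sigma>', Q')" by (cases e')
  have f: "\<sigma> face_of \<sigma>'" "\<sigma>' \<in> K" "Q' face_of P" "\<sigma>' \<subseteq> Q'"
    using e' s s' by (auto simp: cell_le_def X_cells_iff)
  have vs': "v \<in> verts \<sigma>'" using verts_face[OF f(1)] s(3) by blast
  then have "v \<in> Q'" using verts_sub[OF f(2)] f(4) by blast
  then have "Q' = P" using face_containing_interior[OF f(3) _ vint] by simp
  moreover have "\<sigma>' \<noteq> {v}"
  proof
    assume "\<sigma>' = {v}"
    then have "\<sigma> \<subseteq> {v}" using f(1) face_of_imp_subset by blast
    then show False using s verts_sub[OF s(2)] by blast
  qed
  ultimately show ?thesis using star_boundary_eq[OF v] s' f(2) vs' by simp
qed

text \<open>Wave stalks at chambers are zero, so at 0-cells (\<tau>, P) there is nothing to modify a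
  cocycle with. This turns equality of classes near an interior vertex into equality of
  cochains.\<close>

lemma wave_cochain_chamber:
  assumes "w \<in> cell_chains A (stalk wave_sheaf) 0" "A \<subseteq> X_cells P K" "snd e = P" "cell_dim e = 0"
  shows "w e = 0"
proof (cases "e \<in> A")
  case True
  then have "w e \<in> perp2 (fst e)" using cell_chains_mem[OF assms(1) _ assms(4)] by (simp add: wave_sheaf_def)
  moreover have "fst e \<in> chambers"
    using True assms(2-4) full_dim by (cases e) (auto simp: X_cells_iff chambers_def cell_dim_def)
  ultimately show ?thesis using perp2_chamber by blast
next
  case False
  then show ?thesis using cell_chains_zero[OF assms(1)] by blast
qed

text \<open>All 0-cells in the boundary of the dual cell of v come from chambers, so cohomologous
  cocycles agree on its 1-cells. Across each wall through v the gradient of \<epsilon> therefore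
  jumps as the gradient of the indicator of v does, and their sum is constant on the star.\<close>

lemma hessian_on_star:
  assumes d2: "CARD('d) \<ge> 2" and rho: "rho_uniform P K \<rho>"
    and eps: "restrict_class (X0_cells P K) wave_sheaf 1 (hessian P K \<epsilon>) = \<rho>"
    and v: "v \<in> interior_vertices P K"
  shows "\<exists>u. \<forall>\<tau>\<in>chambers. v \<in> verts \<tau> \<longrightarrow> grad \<tau> \<epsilon> + grad \<tau> (\<lambda>w. if w = v then 1 else 0) = u"
proof -
  let ?X = "X_cells P K" and ?Xo = "X0_cells P K" and ?S = "star_boundary P K v"
  let ?\<chi> = "\<lambda>w. if w = v then 1 else 0 :: bit"
  have X0X: "?Xo \<subseteq> ?X" by (auto simp: X0_cells_def)
  have SX0: "?S \<subseteq> ?Xo" by (rule star_boundary_X0[OF v])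
  have c0: "coboundary A wave_sheaf 0 = (0 :: 'd cell \<Rightarrow> bit ^ 'd)" for A
    by (rule coboundary_zero) (simp add: wave_sheaf_def)
  have zero_chain: "0 \<in> cell_chains A (stalk wave_sheaf) q" for A :: "'d cell set" and q
    by (auto simp: cell_chains_def wave_sheaf_def)
  have refl: "(f, f) \<in> cohomologous A wave_sheaf 1" if "f \<in> cocycles A wave_sheaf 1" for f and A :: "'d cell set"
    using that c0[of A] zero_chain[of A 0] unfolding cohomologous_def coboundaries_def by force
  have "\<rho> \<in> cohomology ?Xo wave_sheaf 1" using rho by (simp add: rho_uniform_def)
  then obtain r where r: "r \<in> cocycles ?Xo wave_sheaf 1" "\<rho> = cohomologous ?Xo wave_sheaf 1 `` {r}"
    unfolding cohomology_def by (rule quotientE)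
  have r_in: "r \<in> \<rho>" using refl[OF r(1)] r(2) by blast
  then have "r \<in> restrict_class ?Xo wave_sheaf 1 (hessian P K \<epsilon>)" using eps by simp
  then obtain x where x: "x \<in> hessian P K \<epsilon>" "((\<lambda>e. if e \<in> ?Xo then x e else 0), r) \<in> cohomologous ?Xo wave_sheaf 1"
    unfolding restrict_class_def by blast
  obtain w where w: "w \<in> cell_chains ?Xo (stalk wave_sheaf) 0"
    "(\<lambda>e. if e \<in> ?Xo then x e else 0) - r = coboundary ?Xo wave_sheaf w"
    using x(2) unfolding cohomologous_def coboundaries_def by auto
  define r' where "r' = (\<lambda>e. if e \<in> ?S then r e else 0)"
  \<comment> \<open>The star boundary contains every cell of X below one of its cells, so
    coboundaries at its cells are the same in every complex between it and X.\<close>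
  have faces: "{e' \<in> ?S. cell_le e' e \<and> cell_dim e' + 1 = cell_dim e} = {e' \<in> A. cell_le e' e \<and> cell_dim e' + 1 = cell_dim e}"
    if "e \<in> ?S" "?S \<subseteq> A" "A \<subseteq> ?X" for e A
    using star_boundary_closed[OF v that(1)] that(2,3) by blast
  have cob: "coboundary ?S G f' e = coboundary A G f e"
    if "e \<in> ?S" "?S \<subseteq> A" "A \<subseteq> ?X" "\<And>e. e \<in> ?S \<Longrightarrow> f' e = f e"
    for e A and f f' :: "'d cell \<Rightarrow> bit ^ 'd" and G :: "('d, bit ^ 'd) cell_sheaf"
  proof -
    have "(\<Sum>e' | e' \<in> ?S \<and> cell_le e' e \<and> cell_dim e' + 1 = cell_dim e. trans_map G e' e (f' e')) =
        (\<Sum>e' | e' \<in> A \<and> cell_le e' e \<and> cell_dim e' + 1 = cell_dim e. trans_map G e' e (f e'))"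
    proof (rule sum.cong[OF faces[OF that(1-3)]])
      fix e' assume "e' \<in> {e' \<in> A. cell_le e' e \<and> cell_dim e' + 1 = cell_dim e}"
      then have "e' \<in> ?S" unfolding faces[OF that(1-3), symmetric] by simp
      then show "trans_map G e' e (f' e') = trans_map G e' e (f e')" using that(4) by simp
    qed
    moreover have "e \<in> A" using that(1,2) by blast
    ultimately show ?thesis using that(1) by (simp add: coboundary_def)
  qed
  have "r' \<in> cocycles ?S wave_sheaf 1"
  proof -
    have r1: "r \<in> cell_chains ?Xo (stalk wave_sheaf) 1" "coboundary ?Xo wave_sheaf r = 0"
      using r(1) by (auto simp: cocycles_def)
    have "r' \<in> cell_chains ?S (stalk wave_sheaf) 1"
      using r1(1) SX0 by (auto simp: cell_chains_def r'_def split: if_splits)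
    moreover have "coboundary ?S wave_sheaf r' e = 0" for e
    proof (cases "e \<in> ?S")
      case True
      then show ?thesis using cob[OF True SX0 X0X, of r' r wave_sheaf] r1(2) by (simp add: r'_def)
    qed (simp add: coboundary_def)
    ultimately show ?thesis by (auto simp: cocycles_def)
  qed
  then have "r' \<in> restrict_class ?S wave_sheaf 1 \<rho>"
    unfolding restrict_class_def using r_in refl[of r' ?S] by (auto simp: r'_def)
  also have "restrict_class ?S wave_sheaf 1 \<rho> = restrict_class ?S wave_sheaf 1 (hessian P K ?\<chi>)"
    using rho v by (simp add: rho_uniform_def)
  finally obtain y where y: "y \<in> hessian P K ?\<chi>" "((\<lambda>e. if e \<in> ?S then y e else 0), r') \<in> cohomologous ?S wave_sheaf 1"
    unfolding restrict_class_def by blast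
  obtain w' where w': "w' \<in> cell_chains ?S (stalk wave_sheaf) 0"
    "(\<lambda>e. if e \<in> ?S then y e else 0) - r' = coboundary ?S wave_sheaf w'"
    using y(2) unfolding cohomologous_def coboundaries_def by auto
  obtain t where t: "x = coboundary ?X constant_sheaf t" "\<And>\<tau>. \<tau> \<in> chambers \<Longrightarrow> t (\<tau>, P) = grad \<tau> \<epsilon>"
    using hessian_lift[OF x(1)] by blast
  obtain t' where t': "y = coboundary ?X constant_sheaf t'" "\<And>\<tau>. \<tau> \<in> chambers \<Longrightarrow> t' (\<tau>, P) = grad \<tau> ?\<chi>"
    using hessian_lift[OF y(1)] by blast
  have SP: "snd e = P" if "e \<in> ?S" for e using that star_boundary_eq[OF v] by auto
  have xy: "x e = y e" if e: "e \<in> ?S" "cell_dim e = 1" for e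
  proof -
    have z: "coboundary A wave_sheaf f e = 0" if "f \<in> cell_chains A (stalk wave_sheaf) 0" "?S \<subseteq> A" "A \<subseteq> ?X" for A f
    proof -
      have "f e' = 0" if e': "e' \<in> A" "cell_le e' e" "cell_dim e' + 1 = cell_dim e" for e'
      proof -
        have "e' \<in> ?S" using star_boundary_closed[OF v e(1) _ e'(2)] e'(1) \<open>A \<subseteq> ?X\<close> by blast
        then show ?thesis
          using wave_cochain_chamber[OF \<open>f \<in> _\<close> \<open>A \<subseteq> ?X\<close>, of e'] SP[of e'] e'(3) e(2) by simp
      qed
      then have "(\<Sum>e' | e' \<in> A \<and> cell_le e' e \<and> cell_dim e' + 1 = cell_dim e. f e') = 0"
        by (intro sum.neutral) auto
      then show ?thesis by (simp add: coboundary_def wave_sheaf_def)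
    qed
    have "((\<lambda>e. if e \<in> ?Xo then x e else 0) - r) e = 0"
      unfolding w(2) by (rule z[OF w(1) SX0 X0X])
    then have 1: "x e = r e" using e SX0 by auto
    have "((\<lambda>e. if e \<in> ?S then y e else 0) - r') e = 0"
      unfolding w'(2) by (rule z[OF w'(1)]) (use SX0 X0X in auto)
    then have 2: "y e = r e" using e by (simp add: r'_def)
    show ?thesis using 1 2 by simp
  qed
  have wall: "coboundary ?X constant_sheaf f (\<sigma>, P) = (\<Sum>\<tau> | \<tau> \<in> chambers \<and> \<sigma> \<subseteq> \<tau>. f (\<tau>, P))"
    if s: "\<sigma> \<in> walls" "(\<sigma>, P) \<in> ?S" for \<sigma> and f :: "'d cell \<Rightarrow> bit ^ 'd"
  proof -
    have dim: "cell_dim (\<sigma>, P) = 1" using s(1) full_dim by (simp add: cell_dim_def walls_def)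
    have X: "(\<sigma>, P) \<in> ?X" using s SX0 X0X by blast
    have eq: "{e' \<in> ?X. cell_le e' (\<sigma>, P) \<and> cell_dim e' + 1 = cell_dim (\<sigma>, P)} = (\<lambda>\<tau>. (\<tau>, P)) ` {\<tau> \<in> chambers. \<sigma> \<subseteq> \<tau>}"
    proof (intro subset_antisym subsetI)
      fix e' assume e': "e' \<in> {e' \<in> ?X. cell_le e' (\<sigma>, P) \<and> cell_dim e' + 1 = cell_dim (\<sigma>, P)}"
      then have "e' \<in> ?S" using star_boundary_closed[OF v s(2)] by blast
      then obtain \<sigma>' where s': "e' = (\<sigma>', P)" "\<sigma>' \<in> K" using star_boundary_eq[OF v] by auto
      have "\<sigma> face_of \<sigma>'" using e' s' by (simp add: cell_le_def)
      moreover have "\<sigma>' \<in> chambers" using e' s' dim full_dim by (simp add: cell_dim_def chambers_def)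
      ultimately show "e' \<in> (\<lambda>\<tau>. (\<tau>, P)) ` {\<tau> \<in> chambers. \<sigma> \<subseteq> \<tau>}" using s'(1) face_of_imp_subset by blast
    next
      fix e' assume "e' \<in> (\<lambda>\<tau>. (\<tau>, P)) ` {\<tau> \<in> chambers. \<sigma> \<subseteq> \<tau>}"
      then obtain \<tau> where "e' = (\<tau>, P)" "\<tau> \<in> chambers" "\<sigma> \<subseteq> \<tau>" by blast
      then show "e' \<in> {e' \<in> ?X. cell_le e' (\<sigma>, P) \<and> cell_dim e' + 1 = cell_dim (\<sigma>, P)}"
        using dim chamber_cell[of \<tau>] face_of_iff_subset[OF wall_K[OF s(1)] chamber_K[of \<tau>]]
        by (simp add: cell_le_def)
    qed
    have "coboundary ?X constant_sheaf f (\<sigma>, P) = sum f ((\<lambda>\<tau>. (\<tau>, P)) ` {\<tau> \<in> chambers. \<sigma> \<subseteq> \<tau>})"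
      unfolding coboundary_def using X eq by (simp add: constant_sheaf_def)
    also have "\<dots> = (\<Sum>\<tau> | \<tau> \<in> chambers \<and> \<sigma> \<subseteq> \<tau>. f (\<tau>, P))"
      by (subst sum.reindex) (auto simp: inj_on_def)
    finally show ?thesis .
  qed
  have step: "grad \<tau>1 \<epsilon> + grad \<tau>1 ?\<chi> = grad \<tau>2 \<epsilon> + grad \<tau>2 ?\<chi>"
    if a: "\<tau>1 \<in> chambers" "\<tau>2 \<in> chambers" "\<tau>1 \<inter> \<tau>2 \<in> walls" "v \<in> verts \<tau>1" "v \<in> verts \<tau>2" for \<tau>1 \<tau>2
  proof -
    have vs: "v \<in> verts (\<tau>1 \<inter> \<tau>2)" using verts_Int chamber_K a by simp
    have "\<tau>1 \<inter> \<tau>2 \<noteq> {v}"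
    proof
      assume "\<tau>1 \<inter> \<tau>2 = {v}"
      then have "verts (\<tau>1 \<inter> \<tau>2) = {v}" by (simp add: verts_def)
      then show False using card_verts_wall[OF a(3)] d2 by simp
    qed
    then have S: "(\<tau>1 \<inter> \<tau>2, P) \<in> ?S" using star_boundary_eq[OF v] wall_K[OF a(3)] vs by auto
    have dim: "cell_dim (\<tau>1 \<inter> \<tau>2, P) = 1" using a(3) full_dim by (simp add: cell_dim_def walls_def)
    note ch = chambers_at_common_wall[OF a(1-3)]
    have "x (\<tau>1 \<inter> \<tau>2, P) = grad \<tau>1 \<epsilon> + grad \<tau>2 \<epsilon>"
      using wall[OF a(3) S, of t] t ch a by simp
    moreover have "y (\<tau>1 \<inter> \<tau>2, P) = grad \<tau>1 ?\<chi> + grad \<tau>2 ?\<chi>"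
      using wall[OF a(3) S, of t'] t' ch a by simp
    ultimately have "grad \<tau>1 \<epsilon> + grad \<tau>2 \<epsilon> = grad \<tau>1 ?\<chi> + grad \<tau>2 ?\<chi>" using xy[OF S dim] by simp
    then have "grad \<tau>1 \<epsilon> = (grad \<tau>1 ?\<chi> + grad \<tau>2 ?\<chi>) + grad \<tau>2 \<epsilon>" by (simp add: vec_bit_eq_add)
    then show ?thesis by (simp add: ac_simps)
  qed
  obtain \<tau>0 where \<tau>0: "\<tau>0 \<in> chambers" "v \<in> verts \<tau>0"
  proof -
    have vK: "{v} \<in> K" using v by (simp add: interior_vertices_def)
    obtain \<tau> where "\<tau> \<in> chambers" "{v} \<subseteq> \<tau>" using chamber_above[OF vK] by blast
    then show thesis using that subset_iff_verts[OF vK chamber_K[of \<tau>]] by (auto simp: verts_def)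
  qed
  have "grad \<tau> \<epsilon> + grad \<tau> ?\<chi> = grad \<tau>0 \<epsilon> + grad \<tau>0 ?\<chi>" if \<tau>: "\<tau> \<in> chambers" "v \<in> verts \<tau>" for \<tau>
  proof (rule star_connected[OF \<tau>(1) \<tau>0(1)])
    show "v \<in> \<tau>" "v \<in> \<tau>0" using verts_sub chamber_K \<tau> \<tau>0 by blast+
    fix \<tau>1 \<tau>2 assume a: "\<tau>1 \<in> chambers" "\<tau>2 \<in> chambers" "\<tau>1 \<inter> \<tau>2 \<in> walls" "v \<in> \<tau>1" "v \<in> \<tau>2"
    then have "v \<in> verts \<tau>1" "v \<in> verts \<tau>2" using vertex_in_simplex[OF _ chamber_K[OF \<tau>0(1)] \<tau>0(2)] chamber_K by blast+
    then show "grad \<tau>1 \<epsilon> + grad \<tau>1 ?\<chi> = grad \<tau>2 \<epsilon> + grad \<tau>2 ?\<chi>" using step a by blast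
  qed
  then show ?thesis by blast
qed

end

section \<open>Linear algebra over the field with two elements\<close>

lemma sum_fun_apply: "(\<Sum>i\<in>A. f i) x = (\<Sum>i\<in>A. f i x)" for f :: "'i \<Rightarrow> 'a \<Rightarrow> 'b::ab_group_add"
  by (induction A rule: infinite_finite_induct) auto

lemma f2_subspaceI:
  assumes "0 \<in> S" "\<And>x y. x \<in> S \<Longrightarrow> y \<in> S \<Longrightarrow> x + y \<in> S"
  shows "f2.subspace S"
  unfolding f2.subspace_def using assms by (auto simp: f2_scale_def)

lemma f2_span_insert: "f2.span (insert b B) = f2.span B \<union> (\<lambda>x. b + x) ` f2.span B"
proof (intro subset_antisym subsetI)
  fix x assume "x \<in> f2.span (insert b B)"
  then obtain k where k: "x - f2_scale k b \<in> f2.span B" using f2.span_insert by blast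
  show "x \<in> f2.span B \<union> (\<lambda>x. b + x) ` f2.span B"
  proof (cases "k = 0")
    case True
    then show ?thesis using k by (simp add: f2_scale_def)
  next
    case False
    then have "x - b \<in> f2.span B" using k by (simp add: f2_scale_def)
    moreover have "x = b + (x - b)" by simp
    ultimately show ?thesis by blast
  qed
next
  fix x assume "x \<in> f2.span B \<union> (\<lambda>x. b + x) ` f2.span B"
  moreover have "f2.span B \<subseteq> f2.span (insert b B)" by (rule f2.span_mono) auto
  moreover have "b \<in> f2.span (insert b B)" by (rule f2.span_base) simp
  ultimately show "x \<in> f2.span (insert b B)" using f2.span_add by blast
qed

lemma card_f2_span:
  assumes "finite B" "\<not> f2.dependent B"
  shows "finite (f2.span B) \<and> card (f2.span B) = 2 ^ card B"
  using assms
proof (induction B rule: finite_induct)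
  case empty
  then show ?case by simp
next
  case (insert b B)
  have b: "b \<notin> f2.span B" "\<not> f2.dependent B"
    using insert.prems insert.hyps(2) f2.independent_insert[of b B] by auto
  have disj: "f2.span B \<inter> (\<lambda>x. b + x) ` f2.span B = {}"
  proof (rule ccontr)
    assume "f2.span B \<inter> (\<lambda>x. b + x) ` f2.span B \<noteq> {}"
    then obtain x where "x \<in> f2.span B" "b + x \<in> f2.span B" by blast
    then have "b + x - x \<in> f2.span B" by (intro f2.span_diff)
    then show False using b(1) by simp
  qed
  have IH: "finite (f2.span B)" "card (f2.span B) = 2 ^ card B" using insert.IH[OF b(2)] by auto
  moreover have "card ((\<lambda>x. b + x) ` f2.span B) = card (f2.span B)" by (rule card_image) (simp add: inj_on_def)
  ultimately show ?case
    using insert.hyps disj by (simp add: f2_span_insert card_Un_disjoint)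
qed

lemma card_f2_subspace:
  assumes "f2.subspace S" "finite S"
  shows "card S = 2 ^ f2.dim S"
proof -
  obtain B where B: "B \<subseteq> S" "\<not> f2.dependent B" "S \<subseteq> f2.span B" "card B = f2.dim S"
    by (rule f2.basis_exists)
  have "f2.span B = S" using B f2.span_minimal[OF B(1) assms(1)] by blast
  moreover have "finite B" using B(1) assms(2) finite_subset by blast
  ultimately show ?thesis using card_f2_span[of B] B by simp
qed

text \<open>Extend a basis of B together with f to a basis of the whole space; l is the coordinate
  belonging to f.\<close>

lemma f2_separating_functional:
  fixes B :: "'v::f2_vector set"
  assumes B: "f2.subspace B" and f: "f \<notin> B"
  obtains l :: "'v \<Rightarrow> bit" where "\<And>x y. l (x + y) = l x + l y" "\<And>b. b \<in> B \<Longrightarrow> l b = 0" "l f = 1"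
proof -
  obtain B0 where B0: "B0 \<subseteq> B" "\<not> f2.dependent B0" "B \<subseteq> f2.span B0" "card B0 = f2.dim B"
    by (rule f2.basis_exists)
  have sp: "f2.span B0 = B" using B0 f2.span_minimal[OF B0(1) B] by blast
  have fB0: "f \<notin> B0" using f B0 by blast
  have ind: "\<not> f2.dependent (insert f B0)" using f2.independent_insert[of f B0] sp f B0(2) fB0 by simp
  define Bas where "Bas = f2.extend_basis (insert f B0)"
  have Bas: "\<not> f2.dependent Bas" "insert f B0 \<subseteq> Bas" "f2.span Bas = UNIV"
    using f2.independent_extend_basis[OF ind] f2.extend_basis_superset[OF ind] f2.span_extend_basis[OF ind]
    by (auto simp: Bas_def)
  define l where "l x = f2.representation Bas x f" for x
  have "l (x + y) = l x + l y" for x y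
    using f2.representation_add[OF Bas(1), of y x] Bas(3) by (simp add: l_def)
  moreover have "l b = 0" if "b \<in> B" for b
  proof (rule ccontr)
    assume ne: "l b \<noteq> 0"
    have "f2.representation Bas b = f2.representation B0 b"
      by (rule f2.representation_extend[OF Bas(1)]) (use that sp Bas(2) in auto)
    then have "f2.representation B0 b f \<noteq> 0" using ne by (simp add: l_def)
    then show False using f2.representation_ne_zero fB0 by blast
  qed
  moreover have "l f = 1" using f2.representation_basis[OF Bas(1), of f] Bas(2) by (simp add: l_def)
  ultimately show thesis using that by blast
qed

text \<open>Rank and nullity in the form of counting: all fibres over the image are translates of
  the kernel.\<close>

lemma card_additive_kernel:
  fixes F :: "'v::ab_group_add \<Rightarrow> 'w::ab_group_add"
  assumes "finite V" and sub: "\<And>x y. x \<in> V \<Longrightarrow> y \<in> V \<Longrightarrow> x + y \<in> V" "\<And>x y. x \<in> V \<Longrightarrow> y \<in> V \<Longrightarrow> x - y \<in> V"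
    and add: "\<And>x y. F (x + y) = F x + F y"
  shows "card V = card (F ` V) * card {x \<in> V. F x = 0}"
proof -
  have diff: "F (x - y) = F x - F y" for x y using add[of "x - y" y] by simp
  have fib: "card {x \<in> V. F x = y} = card {x \<in> V. F x = 0}" if "y \<in> F ` V" for y
  proof -
    obtain x0 where x0: "x0 \<in> V" "F x0 = y" using \<open>y \<in> F ` V\<close> by blast
    have "bij_betw (\<lambda>x. x - x0) {x \<in> V. F x = y} {x \<in> V. F x = 0}"
      by (rule bij_betw_byWitness[where f' = "\<lambda>x. x + x0"]) (use x0 sub add diff in auto)
    then show ?thesis by (rule bij_betw_same_card)
  qed
  have "card V = (\<Sum>x\<in>V. 1)" by simp
  also have "\<dots> = (\<Sum>y\<in>F ` V. \<Sum>x\<in>{x \<in> V. F x = y}. 1)" by (rule sum.image_gen[OF assms(1)])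
  also have "\<dots> = (\<Sum>y\<in>F ` V. card {x \<in> V. F x = 0})" using fib by (intro sum.cong) auto
  finally show ?thesis by simp
qed

lemma additive_span_zero:
  fixes F :: "'v::f2_vector \<Rightarrow> 'w::ab_group_add"
  assumes "x \<in> f2.span B" "\<And>x y. F (x + y) = F x + F y" "\<And>b. b \<in> B \<Longrightarrow> F b = 0"
  shows "F x = 0"
proof -
  have F0: "F 0 = 0" using assms(2)[of 0 0] by simp
  have "B \<subseteq> {x. F x = 0}" using assms(3) by auto
  moreover have "f2.subspace {x. F x = 0}" by (rule f2_subspaceI) (use F0 assms(2) in auto)
  ultimately have "f2.span B \<subseteq> {x. F x = 0}" by (rule f2.span_minimal)
  then show ?thesis using assms(1) by blast
qed

lemma bit_vec_expansion: "m = (\<Sum>i | m $ i = 1. axis i 1)" for m :: "bit ^ 'd::finite"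
proof -
  have "(\<Sum>i | m $ i = 1. axis i 1 $ j) = m $ j" for j
  proof -
    have "(\<Sum>i | m $ i = 1. axis i (1::bit) $ j) = (\<Sum>i | m $ i = 1. if i = j then 1 else 0)"
      by (rule sum.cong) (auto simp: axis_def)
    also have "\<dots> = m $ j" by (cases "m $ j") simp_all
    finally show ?thesis .
  qed
  then show ?thesis by (simp add: vec_eq_iff)
qed

lemma additive_functional_pairing:
  fixes L :: "bit ^ 'd::finite \<Rightarrow> bit"
  assumes add: "\<And>x y. L (x + y) = L x + L y"
  shows "L m = pairing2 m (\<chi> i. L (axis i 1))"
proof -
  have L0: "L 0 = 0" using add[of 0 0] by simp
  have Ls: "L (sum f A) = (\<Sum>i\<in>A. L (f i))" for f and A :: "'d set"
    by (induction A rule: infinite_finite_induct) (auto simp: L0 add)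
  have "L m = L (\<Sum>i | m $ i = 1. axis i 1)" using bit_vec_expansion[of m] by simp
  also have "\<dots> = (\<Sum>i | m $ i = 1. L (axis i 1))" by (rule Ls)
  also have "\<dots> = (\<Sum>i\<in>UNIV. m $ i * L (axis i 1))"
    by (rule sum.mono_neutral_cong_left) auto
  finally show ?thesis by (simp add: pairing2_def)
qed

lemma wedge_with_zero:
  assumes "0 \<in> set us"
  shows "wedge us = 0"
proof
  fix I
  obtain j where j: "j < length us" "us ! j = 0" using assms by (auto simp: in_set_conv_nth)
  have "(\<Prod>i\<in>I. (us ! g i) $ i) = 0" if "bij_betw g I {..<length us}" for g
  proof -
    have "j \<in> g ` I" using that j(1) by (simp add: bij_betw_def)
    then obtain i where i: "i \<in> I" "g i = j" by blast
    then have "\<exists>i\<in>I. (us ! g i) $ i = 0" using j by (intro bexI[of _ i]) auto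
    then show ?thesis by (intro prod_zero) auto
  qed
  then show "wedge us I = 0 I" unfolding wedge_def by (auto intro!: sum.neutral)
qed

section \<open>The Hodge number as the number of interior vertices\<close>

definition undual :: "('d::finite set \<Rightarrow> bit) \<Rightarrow> bit ^ 'd"
  where "undual w = (\<chi> i. w (UNIV - {i}))"

lemma undual_dual_wedge [simp]: "undual (dual_wedge m) = m"
  by (simp add: undual_def vec_eq_iff)

lemma undual_add: "undual (w + w') = undual w + undual w'"
  by (simp add: undual_def vec_eq_iff)

lemma undual_zero [simp]: "undual 0 = 0"
  by (simp add: undual_def vec_eq_iff)

lemma subspace_range_dual_wedge: "f2.subspace (range dual_wedge)"
  by (rule f2_subspaceI) (metis dual_wedge_zero rangeI, metis (no_types, opaque_lifting) dual_wedge_add image_iff UNIV_I)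

context primitive_triangulated
begin

abbreviation \<chi>1 :: "real ^ 'd \<Rightarrow> real ^ 'd \<Rightarrow> bit"
  where "\<chi>1 v \<equiv> (\<lambda>w. if w = v then 1 else 0)"

lemma edge_class_nonzero:
  assumes "\<sigma> \<in> K" "v \<in> verts \<sigma>" "w \<in> verts \<sigma>" "v \<noteq> w"
  shows "mod2 v + mod2 w \<noteq> 0"
proof
  assume 0: "mod2 v + mod2 w = 0"
  obtain \<tau> where t: "\<tau> \<in> chambers" "\<sigma> \<subseteq> \<tau>" using chamber_above assms by blast
  have "v \<in> verts \<tau>" "w \<in> verts \<tau>" using subset_iff_verts[OF assms(1) chamber_K[OF t(1)]] t assms by blast+
  then have "pairing2 (mod2 v + mod2 w) (grad \<tau> (\<chi>1 v)) = 1" using grad[OF t(1), of v w "\<chi>1 v"] assms(4) by simp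
  then show False using 0 by simp
qed

lemma perp2_edge:
  assumes "\<sigma> \<in> K" "v \<in> verts \<sigma>" "w \<in> verts \<sigma>" "v \<noteq> w"
  shows "perp2 (convex hull {v, w}) = {u. pairing2 (mod2 v + mod2 w) u = 0}"
proof -
  note e = edge_simplex[OF assms(1-3)]
  show ?thesis unfolding perp2_simplex[OF e(1,3)] e(2) by (auto simp: add.commute)
qed

text \<open>In dimension at least two a chamber has a third vertex, and the gradient of its
  indicator is nonzero but vanishes along the edge.\<close>

lemma edge_perp_nonzero:
  assumes d2: "CARD('d) \<ge> 2" and "\<sigma> \<in> K" "v \<in> verts \<sigma>" "w \<in> verts \<sigma>"
  shows "\<exists>q. q \<noteq> 0 \<and> pairing2 (mod2 v + mod2 w) q = 0"
proof -
  obtain \<tau> where t: "\<tau> \<in> chambers" "\<sigma> \<subseteq> \<tau>" using chamber_above assms by blast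
  have vw: "v \<in> verts \<tau>" "w \<in> verts \<tau>" using subset_iff_verts[OF assms(2) chamber_K[OF t(1)]] t assms by blast+
  have "card {v, w} < card (verts \<tau>)"
    using card_verts_chamber[OF t(1)] d2 card_insert_le_m1[of 2 "{w}" v] by (cases "v = w") auto
  then have "\<not> verts \<tau> \<subseteq> {v, w}" by (metis card_mono finite.emptyI finite.insertI leD)
  then obtain x where x: "x \<in> verts \<tau>" "x \<noteq> v" "x \<noteq> w" by blast
  have "pairing2 (mod2 v + mod2 w) (grad \<tau> (\<chi>1 x)) = 0" using grad[OF t(1) vw, of "\<chi>1 x"] x by simp
  moreover have "pairing2 (mod2 x + mod2 w) (grad \<tau> (\<chi>1 x)) = 1" using grad[OF t(1) x(1) vw(2), of "\<chi>1 x"] x by simp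
  then have "grad \<tau> (\<chi>1 x) \<noteq> 0" by auto
  ultimately show ?thesis by blast
qed

lemma hodge_den_P:
  assumes "snd e = P"
  shows "hodge_den p e = {0}"
proof -
  have "{wedge us |us. length us = p \<and> set us \<inter> Sed P \<noteq> {}} \<subseteq> {0}"
    using wedge_with_zero by (auto simp: Sed_P)
  then have "f2.span {wedge us |us. length us = p \<and> set us \<inter> Sed P \<noteq> {}} \<subseteq> f2.span {0}" by (rule f2.span_mono)
  then show ?thesis unfolding hodge_den_def wedge_kernel_def assms using f2.span_zero by fastforce
qed

lemma subspace_hodge: "f2.subspace (hodge_num p e)" "f2.subspace (hodge_den p e)"
  unfolding hodge_num_def hodge_den_def wedge_kernel_def by (rule f2.subspace_span)+

lemma hodge_den_subset_num: "hodge_den p e \<subseteq> hodge_num p e"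
  unfolding hodge_num_def by (rule subsetI, rule f2.span_base) simp

lemma edge_wedges:
  assumes d2: "CARD('d) \<ge> 2" and "\<sigma> \<in> K" "v \<in> verts \<sigma>" "w \<in> verts \<sigma>" "v \<noteq> w" "length us = CARD('d) - 1"
    "set us \<subseteq> perp2 (convex hull {v, w})"
  shows "wedge us = 0 \<or> wedge us = dual_wedge (mod2 v + mod2 w)"
  by (rule wedge_in_hyperplane) (use assms perp2_edge edge_class_nonzero in auto)

lemma edge_wedge_exists:
  assumes d2: "CARD('d) \<ge> 2" and "\<sigma> \<in> K" "v \<in> verts \<sigma>" "w \<in> verts \<sigma>" "v \<noteq> w"
    and q: "q \<noteq> 0" "pairing2 (mod2 v + mod2 w) q = 0"
  shows "\<exists>us. length us = CARD('d) - 1 \<and> set us \<subseteq> perp2 (convex hull {v, w}) \<and> q \<in> set us \<and>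
    wedge us = dual_wedge (mod2 v + mod2 w)"
proof -
  obtain us where us: "Suc (length us) = CARD('d)" "\<forall>u\<in>set us. pairing2 (mod2 v + mod2 w) u = 0" "q \<in> set us"
    "wedge us = dual_wedge (mod2 v + mod2 w)"
    using wedge_hyperplane_exists[OF edge_class_nonzero[OF assms(2-5)] q] by blast
  then show ?thesis using perp2_edge[OF assms(2-5)] by (intro exI[of _ us]) auto
qed

lemma dual_wedge_in_hodge_num:
  assumes d2: "CARD('d) \<ge> 2" and "\<sigma> \<in> K" "v \<in> verts \<sigma>" "w \<in> verts \<sigma>"
  shows "dual_wedge (mod2 v + mod2 w) \<in> hodge_num (CARD('d) - 1) (\<sigma>, Q)"
proof (cases "v = w")
  case True
  then show ?thesis using f2.subspace_0[OF subspace_hodge(1)] by simp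
next
  case False
  obtain q where "q \<noteq> 0" "pairing2 (mod2 v + mod2 w) q = 0" using edge_perp_nonzero[OF assms] by blast
  then obtain us where us: "length us = CARD('d) - 1" "set us \<subseteq> perp2 (convex hull {v, w})"
    "wedge us = dual_wedge (mod2 v + mod2 w)"
    using edge_wedge_exists[OF assms False] by blast
  have "convex hull {v, w} edge_of \<sigma>" using edge_of_simplex(1)[OF assms(2-4) False] .
  then have "wedge us \<in> (\<Union>s\<in>{s. s edge_of fst (\<sigma>, Q)}. {wedge us |us. length us = CARD('d) - 1 \<and> set us \<subseteq> perp2 s})"
    using us(1,2) by auto
  then show ?thesis unfolding hodge_num_def us(3) by (intro f2.span_base) blast
qed

text \<open>A wedge of degree CARD('d) - 1 of vectors perpendicular to an edge is 0 or the dual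
  wedge of the edge class. With \<open>dual_wedge_in_hodge_num\<close> this identifies the cosheaf
  at (\<sigma>, P) with the span of the edge classes of \<sigma>.\<close>

lemma hodge_num_P_subset:
  assumes d2: "CARD('d) \<ge> 2" and s: "\<sigma> \<in> K"
  shows "hodge_num (CARD('d) - 1) (\<sigma>, P) \<subseteq>
    f2.span {dual_wedge (mod2 v + mod2 w) |v w. v \<in> verts \<sigma> \<and> w \<in> verts \<sigma>}"
proof -
  let ?G = "{dual_wedge (mod2 v + mod2 w) |v w. v \<in> verts \<sigma> \<and> w \<in> verts \<sigma>}"
  have "wedge us \<in> f2.span ?G"
    if e: "e edge_of \<sigma>" and us: "length us = CARD('d) - 1" "set us \<subseteq> perp2 e" for e us
  proof -
    obtain v w where vw: "v \<in> verts \<sigma>" "w \<in> verts \<sigma>" "v \<noteq> w" "e = convex hull {v, w}"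
      using simplex_edge[OF s e] by blast
    have "wedge us = 0 \<or> wedge us = dual_wedge (mod2 v + mod2 w)"
      using edge_wedges[OF d2 s vw(1-3) us(1)] us(2) vw(4) by simp
    moreover have "dual_wedge (mod2 v + mod2 w) \<in> ?G" using vw by blast
    ultimately show ?thesis by (elim disjE) (simp_all add: f2.span_zero f2.span_base)
  qed
  moreover have "hodge_den (CARD('d) - 1) (\<sigma>, P) \<subseteq> f2.span ?G" using hodge_den_P f2.span_zero by auto
  ultimately show ?thesis unfolding hodge_num_def by (intro f2.span_minimal f2.subspace_span) auto
qed

lemma hodge_num_P_dual:
  assumes "CARD('d) \<ge> 2" "\<sigma> \<in> K" "x \<in> hodge_num (CARD('d) - 1) (\<sigma>, P)"
  shows "x = dual_wedge (undual x)"
proof -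
  have "f2.span {dual_wedge (mod2 v + mod2 w) |v w. v \<in> verts \<sigma> \<and> w \<in> verts \<sigma>} \<subseteq> range dual_wedge"
    by (intro f2.span_minimal subspace_range_dual_wedge) auto
  then have "x \<in> range dual_wedge" using hodge_num_P_subset[OF assms(1,2)] assms(3) by blast
  then show ?thesis by auto
qed

text \<open>Let q be the conormal of a facet containing Q. It lies in \<open>Sed Q\<close> and is
  perpendicular to every edge of \<sigma>, so the dual wedge of an edge can be written with q among
  its factors and vanishes in the quotient. Only the cells (\<sigma>, P) contribute to
  homology.\<close>

lemma hodge_num_proper_face:
  assumes d2: "CARD('d) \<ge> 2" and X: "(\<sigma>, Q) \<in> X_cells P K" and Q: "Q \<noteq> P"
  shows "hodge_num (CARD('d) - 1) (\<sigma>, Q) = hodge_den (CARD('d) - 1) (\<sigma>, Q)"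
proof
  have s: "\<sigma> \<in> K" "Q face_of P" "\<sigma> \<subseteq> Q" "aff_dim \<sigma> \<ge> 1" using X by (auto simp: X_cells_iff)
  then have "\<sigma> \<noteq> {}" by auto
  have "barycenter \<sigma> \<in> Q" using barycenter_mem[OF s(1) \<open>\<sigma> \<noteq> {}\<close>] s(3) by blast
  have "Q \<noteq> {}" using s \<open>\<sigma> \<noteq> {}\<close> by blast
  then obtain F where F: "F facet_of P" "Q \<subseteq> F"
    using face_of_polyhedron_subset_facet[OF polytope_imp_polyhedron[OF polytope_P] s(2) _ Q] by blast
  obtain \<omega> where w: "\<omega> \<in> walls" "\<omega> \<subseteq> F" using facet_has_wall[OF F(1)] by blast
  obtain q where q: "q \<noteq> 0" "perp2 \<omega> = {0, q}" using perp2_wall_nonzero[OF w(1)] by blast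
  have qQ: "q \<in> Sed Q" using perp2_facet[OF F(1) w] q perp2_antimono[OF F(2)] by blast
  have "wedge us \<in> hodge_den (CARD('d) - 1) (\<sigma>, Q)"
    if e: "e edge_of \<sigma>" and us: "length us = CARD('d) - 1" "set us \<subseteq> perp2 e" for e us
  proof -
    obtain v w where vw: "v \<in> verts \<sigma>" "w \<in> verts \<sigma>" "v \<noteq> w" "e = convex hull {v, w}"
      using simplex_edge[OF s(1) e] by blast
    have "e \<subseteq> Q" using e s(3) edge_of_imp_subset by blast
    then have "q \<in> perp2 e" using perp2_antimono qQ by blast
    then have "pairing2 (mod2 v + mod2 w) q = 0" using perp2_edge[OF s(1) vw(1-3)] vw(4) by simp
    then obtain us' where us': "length us' = CARD('d) - 1" "q \<in> set us'" "wedge us' = dual_wedge (mod2 v + mod2 w)"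
      using edge_wedge_exists[OF d2 s(1) vw(1-3) q(1)] by blast
    have "set us' \<inter> Sed Q \<noteq> {}" using us'(2) qQ by blast
    then have "wedge us' \<in> {wedge us |us. length us = CARD('d) - 1 \<and> set us \<inter> Sed Q \<noteq> {}}" using us'(1) by blast
    then have "wedge us' \<in> hodge_den (CARD('d) - 1) (\<sigma>, Q)"
      unfolding hodge_den_def wedge_kernel_def snd_conv by (rule f2.span_base)
    moreover have "wedge us = 0 \<or> wedge us = dual_wedge (mod2 v + mod2 w)"
      using edge_wedges[OF d2 s(1) vw(1-3) us(1)] us(2) vw(4) by simp
    ultimately show ?thesis using us'(3) f2.subspace_0[OF subspace_hodge(2)] by metis
  qed
  then show "hodge_num (CARD('d) - 1) (\<sigma>, Q) \<subseteq> hodge_den (CARD('d) - 1) (\<sigma>, Q)"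
    unfolding hodge_num_def by (intro f2.span_minimal subspace_hodge(2)) auto
qed (rule hodge_den_subset_num)

lemma hodge_num_mono:
  assumes "cell_le e' e"
  shows "hodge_num p e \<subseteq> hodge_num p e'"
proof -
  have f: "fst e face_of fst e'" "snd e' \<subseteq> snd e" using assms by (auto simp: cell_le_def)
  have "wedge_kernel p (Sed (snd e)) \<subseteq> wedge_kernel p (Sed (snd e'))"
    unfolding wedge_kernel_def using perp2_antimono[OF f(2)] by (intro f2.span_mono) blast
  moreover have "s edge_of fst e \<Longrightarrow> s edge_of fst e'" for s
    using f(1) face_of_trans by (auto simp: edge_of_def)
  ultimately show ?thesis unfolding hodge_num_def hodge_den_def by (intro f2.span_mono) blast
qed

end

lemma additive_sum:
  fixes F :: "'v::ab_group_add \<Rightarrow> 'w::ab_group_add"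
  assumes "\<And>x y. F (x + y) = F x + F y"
  shows "F (sum g A) = (\<Sum>x\<in>A. F (g x))"
  by (rule additive.sum[OF additive.intro]) (rule assms)

lemma undual_sum: "undual (sum f A) = (\<Sum>x\<in>A. undual (f x))"
  by (rule additive_sum[where F = undual]) (rule undual_add)

lemma pairing2_sum_left: "pairing2 (sum f A) u = (\<Sum>x\<in>A. pairing2 (f x) u)"
  by (rule additive_sum[where F = "\<lambda>m. pairing2 m u"]) (rule pairing2_add_left)

lemma boundary_map_add:
  fixes f g :: "'d::finite cell \<Rightarrow> 'v::f2_vector"
  shows "boundary_map A (f + g) = boundary_map A f + boundary_map A g"
proof
  show "boundary_map A (f + g) e = (boundary_map A f + boundary_map A g) e" for e
    by (cases "e \<in> A") (simp_all add: boundary_map_def sum.distrib)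
qed

lemma boundary_map_zero: "boundary_map A 0 = 0"
proof
  show "boundary_map A 0 e = 0 e" for e by (simp add: boundary_map_def)
qed

lemma subspace_cell_chains:
  assumes "\<And>e. f2.subspace (S e)"
  shows "f2.subspace (cell_chains A S q)"
proof (rule f2_subspaceI)
  show "0 \<in> cell_chains A S q" unfolding cell_chains_iff by (simp add: f2.subspace_0[OF assms])
  fix f g assume fg: "f \<in> cell_chains A S q" "g \<in> cell_chains A S q"
  show "f + g \<in> cell_chains A S q"
    unfolding cell_chains_iff
  proof
    fix e
    show "if e \<in> A \<and> cell_dim e = q then (f + g) e \<in> S e else (f + g) e = 0"
    proof (cases "e \<in> A \<and> cell_dim e = q")
      case True
      then have "f e + g e \<in> S e"
        using cell_chains_mem[OF fg(1)] cell_chains_mem[OF fg(2)] f2.subspace_add[OF assms] by blast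
      then show ?thesis using True by simp
    next
      case False
      then have "(f + g) e = 0" using cell_chains_zero[OF fg(1) False] cell_chains_zero[OF fg(2) False] by simp
      then show ?thesis unfolding if_not_P[OF False] .
    qed
  qed
qed

definition single :: "'a \<Rightarrow> 'v \<Rightarrow> 'a \<Rightarrow> 'v::f2_vector"
  where "single e w = (\<lambda>e'. if e' = e then w else 0)"

lemma single_add: "single e (w + w') = single e w + single e w'"
  by (auto simp: single_def fun_eq_iff)

lemma single_in_cell_chains:
  assumes "e \<in> A" "cell_dim e = q" "w \<in> S e" "\<And>e. 0 \<in> S e"
  shows "single e w \<in> cell_chains A S q"
  unfolding cell_chains_iff using assms by (auto simp: single_def)

lemma card_bit_functions:
  assumes "finite A"
  shows "card {h :: 'a \<Rightarrow> bit. \<forall>v. v \<notin> A \<longrightarrow> h v = 0} = 2 ^ card A"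
proof -
  have "bij_betw (\<lambda>h. {v. h v = 1}) {h :: 'a \<Rightarrow> bit. \<forall>v. v \<notin> A \<longrightarrow> h v = 0} (Pow A)"
  proof (rule bij_betw_byWitness[where f' = "\<lambda>B v. if v \<in> B then 1 else 0"])
    have "(if h v = 1 then 1 else 0) = h v" for h :: "'a \<Rightarrow> bit" and v by (cases "h v") simp_all
    then show "\<forall>h\<in>{h :: 'a \<Rightarrow> bit. \<forall>v. v \<notin> A \<longrightarrow> h v = 0}. (\<lambda>v. if v \<in> {v. h v = 1} then 1 else 0) = h"
      by simp
    have "{v. h v = 1} \<subseteq> A" if "\<forall>v. v \<notin> A \<longrightarrow> h v = 0" for h :: "'a \<Rightarrow> bit"
    proof
      fix v assume "v \<in> {v. h v = 1}"
      then show "v \<in> A" using that[rule_format, of v] by (cases "v \<in> A") simp_all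
    qed
    then show "(\<lambda>h. {v. h v = 1}) ` {h :: 'a \<Rightarrow> bit. \<forall>v. v \<notin> A \<longrightarrow> h v = 0} \<subseteq> Pow A" by blast
    have "{v. (if v \<in> B then 1 else 0 :: bit) = 1} = B" for B :: "'a set"
      using zero_neq_one by (auto split: if_splits)
    then show "\<forall>B\<in>Pow A. {v. (if v \<in> B then 1 else 0 :: bit) = 1} = B" by blast
    show "(\<lambda>B v. if v \<in> B then 1 else 0) ` Pow A \<subseteq> {h :: 'a \<Rightarrow> bit. \<forall>v. v \<notin> A \<longrightarrow> h v = 0}"
      by (rule image_subsetI) auto
  qed
  then have "card {h :: 'a \<Rightarrow> bit. \<forall>v. v \<notin> A \<longrightarrow> h v = 0} = card (Pow A)" by (rule bij_betw_same_card)
  then show ?thesis by (simp add: card_Pow[OF assms])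
qed

section \<open>Homology in degree zero as functions on the interior vertices\<close>

context primitive_triangulated
begin

abbreviation X :: "'d cell set"
  where "X \<equiv> X_cells P K"

abbreviation hnum :: "'d cell \<Rightarrow> ('d set \<Rightarrow> bit) set"
  where "hnum \<equiv> hodge_num (CARD('d) - 1)"

abbreviation hden :: "'d cell \<Rightarrow> ('d set \<Rightarrow> bit) set"
  where "hden \<equiv> hodge_den (CARD('d) - 1)"

lemma zero_in_hodge [simp]: "0 \<in> hodge_num p e" "0 \<in> hodge_den p e"
  using f2.subspace_0 subspace_hodge by blast+

lemma zero_cell_P:
  assumes "e \<in> X" "cell_dim e = 0" "snd e = P"
  obtains \<tau> where "\<tau> \<in> chambers" "e = (\<tau>, P)"
proof -
  obtain \<sigma> Q where e: "e = (\<sigma>, Q)" by (cases e)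
  then have "\<sigma> \<in> chambers"
    using assms full_dim by (simp add: X_cells_iff chambers_def cell_dim_def)
  then show thesis using that assms(3) e by simp
qed

lemma finite_interior_vertices: "finite (interior_vertices P K)"
  using finite_subset[OF _ finite_vertices] interior_vertex by blast

lemma boundary_map_P:
  assumes d2: "CARD('d) \<ge> 2" and t: "\<tau> \<in> chambers"
  shows "boundary_map X g (\<tau>, P) = (\<Sum>\<sigma> | \<sigma> \<in> walls \<and> \<sigma> \<subseteq> \<tau>. g (\<sigma>, P))"
proof -
  have dim: "cell_dim (\<tau>, P) = 0" "(\<tau>, P) \<in> X" using chamber_cell[OF t] by auto
  have eq: "{e \<in> X. cell_le (\<tau>, P) e \<and> cell_dim (\<tau>, P) + 1 = cell_dim e} = (\<lambda>\<sigma>. (\<sigma>, P)) ` {\<sigma> \<in> walls. \<sigma> \<subseteq> \<tau>}"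
  proof (intro subset_antisym subsetI)
    fix e assume e: "e \<in> {e \<in> X. cell_le (\<tau>, P) e \<and> cell_dim (\<tau>, P) + 1 = cell_dim e}"
    obtain \<sigma> Q where sQ: "e = (\<sigma>, Q)" by (cases e)
    have f: "\<sigma> \<in> K" "Q face_of P" "\<sigma> face_of \<tau>" "P \<subseteq> Q" "cell_dim e = 1"
      using e sQ dim by (auto simp: X_cells_iff cell_le_def)
    have "Q = P" using f face_of_imp_subset by blast
    then have "\<sigma> \<in> walls" using f full_dim sQ by (simp add: walls_def cell_dim_def)
    then show "e \<in> (\<lambda>\<sigma>. (\<sigma>, P)) ` {\<sigma> \<in> walls. \<sigma> \<subseteq> \<tau>}"
      using sQ \<open>Q = P\<close> f(3) face_of_imp_subset by blast
  next
    fix e assume "e \<in> (\<lambda>\<sigma>. (\<sigma>, P)) ` {\<sigma> \<in> walls. \<sigma> \<subseteq> \<tau>}"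
    then obtain \<sigma> where s: "e = (\<sigma>, P)" "\<sigma> \<in> walls" "\<sigma> \<subseteq> \<tau>" by blast
    have "e \<in> X" using s in_P[OF wall_K[OF s(2)]] P_face d2 by (auto simp: X_cells_iff walls_def)
    moreover have "cell_le (\<tau>, P) e"
      using face_of_iff_subset[OF wall_K[OF s(2)] chamber_K[OF t]] s by (simp add: cell_le_def)
    moreover have "cell_dim e = 1" using s full_dim by (simp add: cell_dim_def walls_def)
    ultimately show "e \<in> {e \<in> X. cell_le (\<tau>, P) e \<and> cell_dim (\<tau>, P) + 1 = cell_dim e}" using dim by simp
  qed
  have "boundary_map X g (\<tau>, P) = sum g ((\<lambda>\<sigma>. (\<sigma>, P)) ` {\<sigma> \<in> walls. \<sigma> \<subseteq> \<tau>})"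
    unfolding boundary_map_def using dim(2) eq by simp
  also have "\<dots> = (\<Sum>\<sigma> | \<sigma> \<in> walls \<and> \<sigma> \<subseteq> \<tau>. g (\<sigma>, P))"
    by (subst sum.reindex) (auto simp: inj_on_def)
  finally show ?thesis .
qed

lemma subspace_num_chains: "f2.subspace (cell_chains X hnum q)"
  by (rule subspace_cell_chains) (rule subspace_hodge(1))

lemma subspace_den_chains: "f2.subspace (cell_chains X hden q)"
  by (rule subspace_cell_chains) (rule subspace_hodge(2))

text \<open>Cells have nonnegative dimension, so a 0-chain has boundary zero.\<close>

lemma cycles_eq: "cell_cycles X hnum hden 0 = cell_chains X hnum 0"
proof -
  have "boundary_map X f = 0" if f: "f \<in> cell_chains X hnum 0" for f
  proof
    fix e'
    show "boundary_map X f e' = 0 e'"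
    proof (cases "e' \<in> X")
      case True
      have "f e = 0" if "cell_dim e' + 1 = cell_dim e" for e
        using cell_chains_zero[OF f] cell_dim_nonneg[OF True] that by simp
      then have "(\<Sum>e | e \<in> X \<and> cell_le e' e \<and> cell_dim e' + 1 = cell_dim e. f e) = 0"
        by (intro sum.neutral) blast
      then show ?thesis by (simp add: boundary_map_def)
    qed (simp add: boundary_map_def)
  qed
  moreover have "0 \<in> cell_chains X hden (0 - 1)"
    by (rule f2.subspace_0[OF subspace_den_chains])
  ultimately show ?thesis unfolding cell_cycles_def by auto
qed

lemma boundary_map_chain:
  assumes g: "g \<in> cell_chains X hnum 1"
  shows "boundary_map X g \<in> cell_chains X hnum 0"
  unfolding cell_chains_iff
proof
  fix e
  show "if e \<in> X \<and> cell_dim e = 0 then boundary_map X g e \<in> hnum e else boundary_map X g e = 0"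
  proof (cases "e \<in> X \<and> cell_dim e = 0")
    case True
    have "g e' \<in> hnum e" if "e' \<in> X" "cell_le e e'" "cell_dim e + 1 = cell_dim e'" for e'
      using cell_chains_mem[OF g that(1)] that(3) True hodge_num_mono[OF that(2)] by auto
    then have "(\<Sum>e' | e' \<in> X \<and> cell_le e e' \<and> cell_dim e + 1 = cell_dim e'. g e') \<in> hnum e"
      by (intro f2.subspace_sum[OF subspace_hodge(1)]) blast
    then show ?thesis using True by (simp add: boundary_map_def)
  next
    case False
    have "boundary_map X g e = 0"
    proof (cases "e \<in> X")
      case True
      then have "cell_dim e \<noteq> 0" using False by simp
      then have "g e' = 0" if "cell_dim e + 1 = cell_dim e'" for e'
        using cell_chains_zero[OF g] that by simp
      then have "(\<Sum>e' | e' \<in> X \<and> cell_le e e' \<and> cell_dim e + 1 = cell_dim e'. g e') = 0"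
        by (intro sum.neutral) blast
      then show ?thesis by (simp add: boundary_map_def)
    qed (simp add: boundary_map_def)
    then show ?thesis unfolding if_not_P[OF False] .
  qed
qed

lemma den_chains_subset: "cell_chains X hden q \<subseteq> cell_chains X hnum q"
proof
  fix f assume f: "f \<in> cell_chains X hden q"
  show "f \<in> cell_chains X hnum q"
    unfolding cell_chains_iff
  proof
    fix e
    show "if e \<in> X \<and> cell_dim e = q then f e \<in> hnum e else f e = 0"
      using cell_chains_mem[OF f, of e] cell_chains_zero[OF f, of e] hodge_den_subset_num[of _ e] by auto
  qed
qed

lemma boundaries_subset: "cell_boundaries X hnum hden 0 \<subseteq> cell_chains X hnum 0"
proof
  fix f assume "f \<in> cell_boundaries X hnum hden 0"
  then obtain g h where f: "f = boundary_map X g + h" "g \<in> cell_chains X hnum 1" "h \<in> cell_chains X hden 0"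
    unfolding cell_boundaries_def by auto
  show "f \<in> cell_chains X hnum 0"
    unfolding f(1)
    by (rule f2.subspace_add[OF subspace_num_chains boundary_map_chain[OF f(2)]])
      (use f(3) den_chains_subset in blast)
qed

lemma boundariesI:
  "g \<in> cell_chains X hnum 1 \<Longrightarrow> h \<in> cell_chains X hden 0 \<Longrightarrow> boundary_map X g + h \<in> cell_boundaries X hnum hden 0"
  unfolding cell_boundaries_def by auto

lemma subspace_boundaries: "f2.subspace (cell_boundaries X hnum hden 0)"
proof (rule f2_subspaceI)
  have 0: "0 \<in> cell_chains X hnum 1" "0 \<in> cell_chains X hden 0"
    using f2.subspace_0 subspace_num_chains subspace_den_chains by blast+
  then show "0 \<in> cell_boundaries X hnum hden 0" using boundariesI[OF 0] by (simp add: boundary_map_zero)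
  fix x y assume "x \<in> cell_boundaries X hnum hden 0" "y \<in> cell_boundaries X hnum hden 0"
  then obtain g h g' h' where x: "x = boundary_map X g + h" "g \<in> cell_chains X hnum 1" "h \<in> cell_chains X hden 0"
    and y: "y = boundary_map X g' + h'" "g' \<in> cell_chains X hnum 1" "h' \<in> cell_chains X hden 0"
    unfolding cell_boundaries_def by auto
  have "x + y = boundary_map X (g + g') + (h + h')" by (simp add: x y boundary_map_add ac_simps)
  moreover have "boundary_map X (g + g') + (h + h') \<in> cell_boundaries X hnum hden 0"
    by (rule boundariesI[OF f2.subspace_add[OF subspace_num_chains x(2) y(2)] f2.subspace_add[OF subspace_den_chains x(3) y(3)]])
  ultimately show "x + y \<in> cell_boundaries X hnum hden 0" by (simp only:)
qed

lemma finite_chains: "finite (cell_chains X hnum 0)"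
proof (rule finite_subset[OF _ finite_set_of_finite_funs[OF finite_X_cells, of "UNIV :: ('d set \<Rightarrow> bit) set"]])
  show "cell_chains X hnum 0 \<subseteq> {f. \<forall>x. (x \<in> X \<longrightarrow> f x \<in> UNIV) \<and> (x \<notin> X \<longrightarrow> f x = 0)}"
    using cell_chains_zero by blast
qed simp

text \<open>The pairing of a 0-chain with the compatible family of gradients of the indicator of v.
  It identifies 0-chains modulo boundaries with functions on the interior vertices, by
  \<open>\<Phi>_boundary\<close>, \<open>\<Phi>_image\<close> and
  \<open>\<Phi>_kernel\<close>.\<close>

definition \<Phi> :: "('d cell \<Rightarrow> 'd set \<Rightarrow> bit) \<Rightarrow> real ^ 'd \<Rightarrow> bit"
  where "\<Phi> f v = (if v \<in> interior_vertices P K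
    then \<Sum>\<tau>\<in>chambers. pairing2 (undual (f (\<tau>, P))) (grad \<tau> (\<chi>1 v)) else 0)"

lemma \<Phi>_add: "\<Phi> (f + g) = \<Phi> f + \<Phi> g"
  by (auto simp: fun_eq_iff \<Phi>_def undual_add pairing2_add_left sum.distrib)

text \<open>Both chambers at an interior wall contribute the difference of the same vertex values,
  so they cancel; a boundary wall does not contain v, which makes its difference zero.\<close>

lemma compatible_indicator:
  assumes v: "v \<in> interior_vertices P K"
  shows "compatible (\<lambda>\<tau>. grad \<tau> (\<chi>1 v))"
  unfolding compatible_def
proof (intro ballI)
  fix \<sigma> x y assume s: "\<sigma> \<in> walls" and xy: "x \<in> verts \<sigma>" "y \<in> verts \<sigma>"
  have eq: "pairing2 (mod2 x + mod2 y) (grad \<tau> (\<chi>1 v)) = \<chi>1 v x + \<chi>1 v y" if "\<tau> \<in> chambers" "\<sigma> \<subseteq> \<tau>" for \<tau>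
    using grad[OF that(1), of x y "\<chi>1 v"] subset_iff_verts[OF wall_K[OF s] chamber_K[OF that(1)]] that(2) xy by blast
  have "(\<Sum>\<tau> | \<tau> \<in> chambers \<and> \<sigma> \<subseteq> \<tau>. pairing2 (mod2 x + mod2 y) (grad \<tau> (\<chi>1 v))) =
      (\<Sum>\<tau> | \<tau> \<in> chambers \<and> \<sigma> \<subseteq> \<tau>. \<chi>1 v x + \<chi>1 v y)"
    by (rule sum.cong) (use eq in auto)
  also have "\<dots> = 0"
  proof (cases "barycenter \<sigma> \<in> interior P")
    case True
    obtain \<tau>1 \<tau>2 where "\<tau>1 \<noteq> \<tau>2" "{\<tau> \<in> chambers. \<sigma> \<subseteq> \<tau>} = {\<tau>1, \<tau>2}"
      using chambers_at_interior_wall[OF s True] by blast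
    then show ?thesis by simp
  next
    case False
    obtain F where F: "F facet_of P" "\<sigma> \<subseteq> F"
      using boundary_simplex_in_facet[OF wall_K[OF s] wall_nonempty[OF s] False] by blast
    have "z \<notin> interior P" if "z \<in> verts \<sigma>" for z
      using that verts_sub[OF wall_K[OF s]] F(2) interior_facet_disjoint[OF facet_face(1,2)[OF F(1)]] by blast
    then have "x \<noteq> v" "y \<noteq> v" using xy v interior_vertex by auto
    then show ?thesis by simp
  qed
  finally show "(\<Sum>\<tau> | \<tau> \<in> chambers \<and> \<sigma> \<subseteq> \<tau>. pairing2 (mod2 x + mod2 y) (grad \<tau> (\<chi>1 v))) = 0" .
qed

lemma den_chain_P:
  assumes "h \<in> cell_chains X hden q" "snd e = P"
  shows "h e = 0"
proof (cases "e \<in> X \<and> cell_dim e = q")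
  case True
  then have "h e \<in> hden e" using cell_chains_mem[OF assms(1)] by blast
  then show ?thesis using hodge_den_P[OF assms(2)] by simp
qed (use cell_chains_zero[OF assms(1)] in blast)

lemma finite_walls: "finite walls"
  using finite_K by (simp add: walls_def)

lemma wall_cell:
  assumes "CARD('d) \<ge> 2" "\<sigma> \<in> walls"
  shows "(\<sigma>, P) \<in> X" "cell_dim (\<sigma>, P) = 1"
  using assms in_P[OF wall_K[OF assms(2)]] P_face full_dim by (auto simp: X_cells_iff walls_def cell_dim_def)

text \<open>After exchanging the sums over chambers and walls, each wall contributes a combination
  of edge classes paired with a compatible family, which is zero.\<close>

lemma \<Phi>_boundary:
  assumes d2: "CARD('d) \<ge> 2" and f: "f \<in> cell_boundaries X hnum hden 0"
  shows "\<Phi> f = 0"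
proof
  fix v
  obtain g h where gh: "f = boundary_map X g + h" "g \<in> cell_chains X hnum 1" "h \<in> cell_chains X hden 0"
    using f unfolding cell_boundaries_def by auto
  show "\<Phi> f v = 0 v"
  proof (cases "v \<in> interior_vertices P K")
    case v: True
    have inner: "(\<Sum>\<tau> | \<tau> \<in> chambers \<and> \<sigma> \<subseteq> \<tau>. pairing2 (undual (g (\<sigma>, P))) (grad \<tau> (\<chi>1 v))) = 0"
      if s: "\<sigma> \<in> walls" for \<sigma>
    proof (rule additive_span_zero[where F = "\<lambda>w. \<Sum>\<tau> | \<tau> \<in> chambers \<and> \<sigma> \<subseteq> \<tau>. pairing2 (undual w) (grad \<tau> (\<chi>1 v))"])
      have "g (\<sigma>, P) \<in> hnum (\<sigma>, P)" using cell_chains_mem[OF gh(2)] wall_cell[OF d2 s] by blast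
      then show "g (\<sigma>, P) \<in> f2.span {dual_wedge (mod2 v + mod2 w) |v w. v \<in> verts \<sigma> \<and> w \<in> verts \<sigma>}"
        using hodge_num_P_subset[OF d2 wall_K[OF s]] by blast
      fix b assume "b \<in> {dual_wedge (mod2 v + mod2 w) |v w. v \<in> verts \<sigma> \<and> w \<in> verts \<sigma>}"
      then obtain x y where b: "b = dual_wedge (mod2 x + mod2 y)" "x \<in> verts \<sigma>" "y \<in> verts \<sigma>" by blast
      then show "(\<Sum>\<tau> | \<tau> \<in> chambers \<and> \<sigma> \<subseteq> \<tau>. pairing2 (undual b) (grad \<tau> (\<chi>1 v))) = 0"
        using compatible_indicator[OF v] s unfolding compatible_def b(1) undual_dual_wedge by blast
    qed (simp add: undual_add pairing2_add_left sum.distrib)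
    have ft: "f (\<tau>, P) = (\<Sum>\<sigma> | \<sigma> \<in> walls \<and> \<sigma> \<subseteq> \<tau>. g (\<sigma>, P))" if "\<tau> \<in> chambers" for \<tau>
      using boundary_map_P[OF d2 that, of g] den_chain_P[OF gh(3), of "(\<tau>, P)"] by (simp add: gh(1))
    have "\<Phi> f v = (\<Sum>\<tau>\<in>chambers. \<Sum>\<sigma> | \<sigma> \<in> walls \<and> \<sigma> \<subseteq> \<tau>. pairing2 (undual (g (\<sigma>, P))) (grad \<tau> (\<chi>1 v)))"
      using v by (simp add: \<Phi>_def ft undual_sum pairing2_sum_left cong: sum.cong)
    also have "\<dots> = (\<Sum>\<sigma>\<in>walls. \<Sum>\<tau> | \<tau> \<in> chambers \<and> \<sigma> \<subseteq> \<tau>. pairing2 (undual (g (\<sigma>, P))) (grad \<tau> (\<chi>1 v)))"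
      by (rule sum.swap_restrict[OF finite_chambers finite_walls])
    also have "\<dots> = 0" using inner by simp
    finally show ?thesis by simp
  qed (simp add: \<Phi>_def)
qed

lemma \<Phi>_edge:
  assumes d2: "CARD('d) \<ge> 2" and t: "\<tau> \<in> chambers" and xy: "x \<in> verts \<tau>" "y \<in> verts \<tau>"
  shows "(\<lambda>v. if v \<in> interior_vertices P K \<and> v = x then 1 else 0) +
      (\<lambda>v. if v \<in> interior_vertices P K \<and> v = y then 1 else 0) \<in> \<Phi> ` cell_chains X hnum 0"
proof (rule image_eqI)
  let ?f = "single (\<tau>, P) (dual_wedge (mod2 x + mod2 y))"
  show "?f \<in> cell_chains X hnum 0"
    by (rule single_in_cell_chains) (use chamber_cell[OF t] dual_wedge_in_hodge_num[OF d2 chamber_K[OF t] xy] in auto)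
  show "(\<lambda>v. if v \<in> interior_vertices P K \<and> v = x then 1 else 0) +
      (\<lambda>v. if v \<in> interior_vertices P K \<and> v = y then 1 else 0) = \<Phi> ?f"
  proof
    fix v
    have "(\<Sum>\<tau>'\<in>chambers. pairing2 (undual (?f (\<tau>', P))) (grad \<tau>' (\<chi>1 v))) =
        (\<Sum>\<tau>'\<in>chambers. if \<tau>' = \<tau> then pairing2 (mod2 x + mod2 y) (grad \<tau> (\<chi>1 v)) else 0)"
      by (rule sum.cong) (auto simp: single_def)
    also have "\<dots> = \<chi>1 v x + \<chi>1 v y"
      using finite_chambers t grad[OF t xy, of "\<chi>1 v"] by simp
    finally show "((\<lambda>v. if v \<in> interior_vertices P K \<and> v = x then 1 else 0) +
        (\<lambda>v. if v \<in> interior_vertices P K \<and> v = y then 1 else 0)) v = \<Phi> ?f v"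
      by (auto simp: \<Phi>_def)
  qed
qed

lemma boundary_vertex_exists: "\<exists>\<tau>\<in>chambers. \<exists>v\<in>verts \<tau>. v \<notin> interior P"
proof -
  have "P \<noteq> {}" using full_dim by auto
  then obtain v where v: "v extreme_point_of P" using extreme_point_exists_convex[OF compact_P convex_P] by blast
  then have "v \<in> P" by (simp add: extreme_point_of_def)
  then obtain \<tau> where t: "\<tau> \<in> chambers" "v \<in> \<tau>" using P_covered by blast
  have "\<tau> \<subseteq> P" using in_P[OF chamber_K[OF t(1)]] by blast
  then have "v \<in> verts \<tau>" using v t(2) by (auto simp: verts_def extreme_point_of_def)
  moreover have "v \<notin> interior P" using v by (rule extreme_point_not_in_interior)
  ultimately show ?thesis using t(1) by blast
qed

lemma vertex_in_chamber:
  assumes "v \<in> vertices"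
  obtains \<tau> where "\<tau> \<in> chambers" "v \<in> verts \<tau>"
proof -
  obtain \<sigma> where s: "\<sigma> \<in> K" "v \<in> verts \<sigma>" using assms by (auto simp: vertices_def)
  obtain \<tau> where t: "\<tau> \<in> chambers" "\<sigma> \<subseteq> \<tau>" using chamber_above[OF s(1)] by blast
  then show thesis using that subset_iff_verts[OF s(1) chamber_K[OF t(1)]] s(2) by blast
qed

text \<open>Chains supported on one chamber realise e x + e y for any two of its vertices. For a
  boundary vertex e is zero, and chambers linked by walls share vertices, so every e x is
  reached.\<close>

lemma \<Phi>_image:
  assumes d2: "CARD('d) \<ge> 2"
  shows "\<Phi> ` cell_chains X hnum 0 = {h. \<forall>v. v \<notin> interior_vertices P K \<longrightarrow> h v = 0}"
proof
  show "\<Phi> ` cell_chains X hnum 0 \<subseteq> {h. \<forall>v. v \<notin> interior_vertices P K \<longrightarrow> h v = 0}" by (auto simp: \<Phi>_def)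
  define S where "S = \<Phi> ` cell_chains X hnum 0"
  define e where "e x = (\<lambda>v. if v \<in> interior_vertices P K \<and> v = x then 1 else 0 :: bit)" for x
  have S: "f2.subspace S"
  proof (rule f2_subspaceI)
    have sub: "f2.subspace (cell_chains X hnum 0)" by (rule subspace_num_chains)
    have "\<Phi> 0 = 0" using \<Phi>_add[of 0 0] by simp
    then show "0 \<in> S" using f2.subspace_0[OF sub] unfolding S_def by force
    show "x + y \<in> S" if "x \<in> S" "y \<in> S" for x y
      using that f2.subspace_add[OF sub] unfolding S_def by (auto simp flip: \<Phi>_add)
  qed
  have edge: "e x \<in> S \<longleftrightarrow> e y \<in> S" if "\<tau> \<in> chambers" "x \<in> verts \<tau>" "y \<in> verts \<tau>" for \<tau> x y
  proof -
    have "e x + e y \<in> S" using \<Phi>_edge[OF d2 that] by (simp add: S_def e_def)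
    moreover have "e y = e x + (e x + e y)" "e x = e y + (e x + e y)" by (metis f2_add_self_left, metis add.commute f2_add_self_left)
    ultimately show ?thesis using f2.subspace_add[OF S] by metis
  qed
  obtain \<tau>0 v0 where v0: "\<tau>0 \<in> chambers" "v0 \<in> verts \<tau>0" "v0 \<notin> interior P" using boundary_vertex_exists by blast
  have "e v0 = 0" using v0(3) by (auto simp: e_def fun_eq_iff interior_vertex)
  then have e0: "e v0 \<in> S" using f2.subspace_0[OF S] by simp
  have good: "(\<forall>x\<in>verts \<tau>. e x \<in> S) = (\<forall>x\<in>verts \<tau>0. e x \<in> S)" if t: "\<tau> \<in> chambers" for \<tau>
  proof (rule all_chambers_connected[OF t v0(1)])
    fix \<tau>1 \<tau>2 assume a: "\<tau>1 \<in> chambers" "\<tau>2 \<in> chambers" "\<tau>1 \<inter> \<tau>2 \<in> walls"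
    have "verts (\<tau>1 \<inter> \<tau>2) \<noteq> {}" using card_verts_wall[OF a(3)] by fastforce
    then obtain z where "z \<in> verts \<tau>1" "z \<in> verts \<tau>2" using verts_Int chamber_K a by blast
    then show "(\<forall>x\<in>verts \<tau>1. e x \<in> S) = (\<forall>x\<in>verts \<tau>2. e x \<in> S)" using edge a by metis
  qed
  have all: "e x \<in> S" if x: "x \<in> vertices" for x
  proof -
    obtain \<tau> where t: "\<tau> \<in> chambers" "x \<in> verts \<tau>" using vertex_in_chamber[OF x] by blast
    have "\<forall>x\<in>verts \<tau>0. e x \<in> S" using edge[OF v0(1)] e0 v0(2) by blast
    then show ?thesis using good[OF t(1)] t(2) by blast
  qed
  show "{h. \<forall>v. v \<notin> interior_vertices P K \<longrightarrow> h v = 0} \<subseteq> \<Phi> ` cell_chains X hnum 0"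
  proof
    fix h :: "real ^ 'd \<Rightarrow> bit" assume h: "h \<in> {h. \<forall>v. v \<notin> interior_vertices P K \<longrightarrow> h v = 0}"
    define A where "A = {v \<in> interior_vertices P K. h v = 1}"
    have fA: "finite A" using finite_interior_vertices by (simp add: A_def)
    have "h = (\<Sum>x\<in>A. e x)"
    proof
      fix v
      have "(\<Sum>x\<in>A. e x) v = (\<Sum>x\<in>A. if x = v then 1 else 0)"
        unfolding sum_fun_apply by (rule sum.cong) (auto simp: e_def A_def)
      also have "\<dots> = h v" using fA h by (cases "h v") (auto simp: A_def)
      finally show "h v = (\<Sum>x\<in>A. e x) v" by simp
    qed
    moreover have "(\<Sum>x\<in>A. e x) \<in> S"
      by (rule f2.subspace_sum[OF S]) (use all interior_vertex in \<open>auto simp: A_def\<close>)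
    ultimately show "h \<in> \<Phi> ` cell_chains X hnum 0" by (simp add: S_def)
  qed
qed

lemma grad_interior_sum:
  assumes t: "\<tau> \<in> chambers" and f: "\<And>v. \<lbrakk>v \<in> vertices; v \<notin> interior P\<rbrakk> \<Longrightarrow> f v = 0"
  shows "grad \<tau> f = (\<Sum>v | v \<in> interior_vertices P K \<and> f v = 1. grad \<tau> (\<chi>1 v))"
proof (rule grad_eqI[OF t])
  let ?A = "{v. v \<in> interior_vertices P K \<and> f v = 1}"
  have fA: "finite ?A" using finite_interior_vertices by simp
  have ind: "(\<Sum>v\<in>?A. \<chi>1 v x) = f x" if "x \<in> verts \<tau>" for x
  proof -
    have x: "x \<in> vertices" using that verts_subset_vertices[OF chamber_K[OF t]] by blast
    have "(\<Sum>v\<in>?A. \<chi>1 v x) = (if x \<in> ?A then 1 else 0)" using fA by simp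
    also have "\<dots> = f x" using f[OF x] x interior_vertex by (cases "f x") auto
    finally show ?thesis .
  qed
  fix x y assume xy: "x \<in> verts \<tau>" "y \<in> verts \<tau>"
  have "pairing2 (mod2 x + mod2 y) (\<Sum>v\<in>?A. grad \<tau> (\<chi>1 v)) = (\<Sum>v\<in>?A. \<chi>1 v x + \<chi>1 v y)"
    unfolding pairing2_sum_right using grad[OF t xy] by (intro sum.cong) auto
  also have "\<dots> = f x + f y" unfolding sum.distrib using ind xy by simp
  finally show "pairing2 (mod2 x + mod2 y) (\<Sum>v\<in>?A. grad \<tau> (\<chi>1 v)) = f x + f y" .
qed

text \<open>A chain that is no boundary is detected by a functional l that kills boundaries.
  Restricted to the chambers, l is a family of covectors, compatible because it kills boundaries of
  wall chains, so it is the gradient of some f0. Then l f is the sum of the values of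
  \<open>\<Phi> f\<close> over the interior vertices with f0 v = 1, which is 0.\<close>

lemma \<Phi>_kernel:
  assumes d2: "CARD('d) \<ge> 2" and f: "f \<in> cell_chains X hnum 0" and \<Phi>f: "\<Phi> f = 0"
  shows "f \<in> cell_boundaries X hnum hden 0"
proof (rule ccontr)
  assume "f \<notin> cell_boundaries X hnum hden 0"
  then obtain l :: "('d cell \<Rightarrow> 'd set \<Rightarrow> bit) \<Rightarrow> bit" where l: "\<And>x y. l (x + y) = l x + l y"
    "\<And>b. b \<in> cell_boundaries X hnum hden 0 \<Longrightarrow> l b = 0" "l f = 1"
    using f2_separating_functional[OF subspace_boundaries] by blast
  have lsum: "l (sum g A) = (\<Sum>x\<in>A. l (g x))" for g :: "(real ^ 'd) set \<Rightarrow> _" and A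
    by (rule additive_sum[where F = l]) (rule l(1))
  define a where "a \<tau> = (\<chi> i. l (single (\<tau>, P) (dual_wedge (axis i 1))))" for \<tau>
  have la: "l (single (\<tau>, P) (dual_wedge m)) = pairing2 m (a \<tau>)" for \<tau> m
    unfolding a_def by (rule additive_functional_pairing) (simp only: dual_wedge_add single_add l(1))
  have zero1: "0 \<in> cell_chains X hnum 1"
    by (rule f2.subspace_0[OF subspace_num_chains])
  \<comment> \<open>On proper faces numerator and denominator coincide, so the part of a chain away
    from P is a denominator chain, and adding it to a boundary removes that part.\<close>
  have off_P: "(\<lambda>e. if snd e = P then 0 else k e) \<in> cell_chains X hden 0" if k: "k \<in> cell_chains X hnum 0" for k
    unfolding cell_chains_iff
  proof
    fix e
    show "if e \<in> X \<and> cell_dim e = 0 then (if snd e = P then 0 else k e) \<in> hden e else (if snd e = P then 0 else k e) = 0"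
    proof (cases "e \<in> X \<and> cell_dim e = 0")
      case True
      then have "k e \<in> hnum e" using cell_chains_mem[OF k] by blast
      then show ?thesis using True hodge_num_proper_face[OF d2, of "fst e" "snd e"] by auto
    next
      case False
      then show ?thesis using cell_chains_zero[OF k False] by auto
    qed
  qed
  have "compatible a"
    unfolding compatible_def
  proof (intro ballI)
    fix \<sigma> x y assume s: "\<sigma> \<in> walls" and xy: "x \<in> verts \<sigma>" "y \<in> verts \<sigma>"
    define g where "g = single (\<sigma>, P) (dual_wedge (mod2 x + mod2 y))"
    have g: "g \<in> cell_chains X hnum 1" unfolding g_def
      by (rule single_in_cell_chains) (use wall_cell[OF d2 s] dual_wedge_in_hodge_num[OF d2 wall_K[OF s] xy] in auto)
    define b where "b = boundary_map X g"
    have bc: "b \<in> cell_chains X hnum 0" using boundary_map_chain[OF g] by (simp add: b_def)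
    have "b + (\<lambda>e. if snd e = P then 0 else b e) \<in> cell_boundaries X hnum hden 0"
      unfolding b_def by (rule boundariesI[OF g off_P]) (use bc in \<open>simp add: b_def\<close>)
    moreover have "b + (\<lambda>e. if snd e = P then 0 else b e) =
        (\<Sum>\<tau> | \<tau> \<in> chambers \<and> \<sigma> \<subseteq> \<tau>. single (\<tau>, P) (dual_wedge (mod2 x + mod2 y)))"
    proof
      fix e
      have fin: "finite {\<tau>. \<tau> \<in> chambers \<and> \<sigma> \<subseteq> \<tau>}" using finite_chambers by simp
      show "(b + (\<lambda>e. if snd e = P then 0 else b e)) e =
        (\<Sum>\<tau> | \<tau> \<in> chambers \<and> \<sigma> \<subseteq> \<tau>. single (\<tau>, P) (dual_wedge (mod2 x + mod2 y))) e"
      proof (cases "\<exists>\<tau>\<in>chambers. e = (\<tau>, P)")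
        case True
        then obtain \<tau> where t: "\<tau> \<in> chambers" "e = (\<tau>, P)" by blast
        have "b e = (\<Sum>\<sigma>' | \<sigma>' \<in> walls \<and> \<sigma>' \<subseteq> \<tau>. if \<sigma>' = \<sigma> then dual_wedge (mod2 x + mod2 y) else 0)"
          unfolding b_def t(2) boundary_map_P[OF d2 t(1)] by (rule sum.cong) (auto simp: g_def single_def)
        also have "\<dots> = (if \<sigma> \<subseteq> \<tau> then dual_wedge (mod2 x + mod2 y) else 0)"
          using finite_walls s by simp
        also have "\<dots> = (\<Sum>\<tau>' | \<tau>' \<in> chambers \<and> \<sigma> \<subseteq> \<tau>'. if \<tau>' = \<tau> then dual_wedge (mod2 x + mod2 y) else 0)"
          using fin t(1) by simp
        also have "\<dots> = (\<Sum>\<tau> | \<tau> \<in> chambers \<and> \<sigma> \<subseteq> \<tau>. single (\<tau>, P) (dual_wedge (mod2 x + mod2 y))) e"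
          by (subst sum_fun_apply, rule sum.cong) (auto simp: single_def t(2))
        finally show ?thesis using t(2) by simp
      next
        case False
        have "(\<Sum>\<tau> | \<tau> \<in> chambers \<and> \<sigma> \<subseteq> \<tau>. single (\<tau>, P) (dual_wedge (mod2 x + mod2 y))) e = 0"
          by (subst sum_fun_apply, rule sum.neutral) (use False in \<open>auto simp: single_def\<close>)
        moreover have "b e = 0" if "snd e = P"
          using cell_chains_zero[OF bc, of e] zero_cell_P[of e] that False by metis
        ultimately show ?thesis by auto
      qed
    qed
    ultimately have "l (\<Sum>\<tau> | \<tau> \<in> chambers \<and> \<sigma> \<subseteq> \<tau>. single (\<tau>, P) (dual_wedge (mod2 x + mod2 y))) = 0"
      using l(2) by simp
    then show "(\<Sum>\<tau> | \<tau> \<in> chambers \<and> \<sigma> \<subseteq> \<tau>. pairing2 (mod2 x + mod2 y) (a \<tau>)) = 0"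
      by (simp add: lsum la)
  qed
  then obtain f0 where f0: "\<And>v. \<lbrakk>v \<in> vertices; v \<notin> interior P\<rbrakk> \<Longrightarrow> f0 v = 0" "\<And>\<tau>. \<tau> \<in> chambers \<Longrightarrow> a \<tau> = grad \<tau> f0"
    using compatible_is_gradient[OF d2] by blast
  let ?A = "{v. v \<in> interior_vertices P K \<and> f0 v = 1}"
  define h where "h = (\<lambda>e. if snd e = P then 0 else f e)"
  have "h \<in> cell_boundaries X hnum hden 0"
    using boundariesI[OF zero1 off_P[OF f]] by (simp add: boundary_map_zero h_def)
  then have lh: "l h = 0" by (rule l(2))
  have "f = (\<Sum>\<tau>\<in>chambers. single (\<tau>, P) (f (\<tau>, P))) + h"
  proof
    fix e
    show "f e = ((\<Sum>\<tau>\<in>chambers. single (\<tau>, P) (f (\<tau>, P))) + h) e"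
    proof (cases "\<exists>\<tau>\<in>chambers. e = (\<tau>, P)")
      case True
      then obtain \<tau> where t: "\<tau> \<in> chambers" "e = (\<tau>, P)" by blast
      have "(\<Sum>\<tau>\<in>chambers. single (\<tau>, P) (f (\<tau>, P))) e = (\<Sum>\<tau>'\<in>chambers. if \<tau>' = \<tau> then f e else 0)"
        by (subst sum_fun_apply, rule sum.cong) (auto simp: single_def t(2))
      also have "\<dots> = f e" using finite_chambers t(1) by simp
      finally show ?thesis by (simp add: h_def t(2))
    next
      case False
      have "(\<Sum>\<tau>\<in>chambers. single (\<tau>, P) (f (\<tau>, P))) e = 0"
        by (subst sum_fun_apply, rule sum.neutral) (use False in \<open>auto simp: single_def\<close>)
      moreover have "f e = 0" if "snd e = P"
        using cell_chains_zero[OF f, of e] zero_cell_P[of e] that False by metis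
      ultimately show ?thesis by (auto simp: h_def)
    qed
  qed
  then have "l f = l ((\<Sum>\<tau>\<in>chambers. single (\<tau>, P) (f (\<tau>, P))) + h)" by (rule arg_cong)
  also have "\<dots> = l (\<Sum>\<tau>\<in>chambers. single (\<tau>, P) (f (\<tau>, P))) + l h" by (rule l(1))
  also have "\<dots> = (\<Sum>\<tau>\<in>chambers. l (single (\<tau>, P) (f (\<tau>, P))))" by (simp only: lh lsum add_0_right)
  also have "\<dots> = (\<Sum>\<tau>\<in>chambers. \<Sum>v\<in>?A. pairing2 (undual (f (\<tau>, P))) (grad \<tau> (\<chi>1 v)))"
  proof (rule sum.cong[OF refl])
    fix \<tau> assume t: "\<tau> \<in> chambers"
    have "f (\<tau>, P) \<in> hnum (\<tau>, P)" using cell_chains_mem[OF f] chamber_cell[OF t] by blast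
    then have "f (\<tau>, P) = dual_wedge (undual (f (\<tau>, P)))" by (rule hodge_num_P_dual[OF d2 chamber_K[OF t]])
    then have "l (single (\<tau>, P) (f (\<tau>, P))) = pairing2 (undual (f (\<tau>, P))) (a \<tau>)" using la by metis
    also have "a \<tau> = (\<Sum>v\<in>?A. grad \<tau> (\<chi>1 v))" using f0(2)[OF t] grad_interior_sum[OF t f0(1)] by simp
    finally show "l (single (\<tau>, P) (f (\<tau>, P))) = (\<Sum>v\<in>?A. pairing2 (undual (f (\<tau>, P))) (grad \<tau> (\<chi>1 v)))"
      by (simp add: pairing2_sum_right)
  qed
  also have "\<dots> = (\<Sum>v\<in>?A. \<Phi> f v)" by (subst sum.swap) (simp add: \<Phi>_def)
  also have "\<dots> = 0" by (simp add: \<Phi>f)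
  finally show False using l(3) by simp
qed

text \<open>Dimensions over F2 are read off from cardinalities: \<Phi> maps the 0-chains onto the
  functions on the interior vertices with the boundaries as kernel.\<close>

theorem hodge_number_interior_vertices:
  assumes d2: "CARD('d) \<ge> 2"
  shows "hodge_number P K (CARD('d) - 1) 0 = card (interior_vertices P K)"
proof -
  let ?V = "cell_chains X hnum 0" and ?B = "cell_boundaries X hnum hden 0"
  have V: "f2.subspace ?V" by (rule subspace_num_chains)
  have "{f \<in> ?V. \<Phi> f = 0} = ?B" using \<Phi>_kernel[OF d2] \<Phi>_boundary[OF d2] boundaries_subset by blast
  moreover have "card ?V = card (\<Phi> ` ?V) * card {f \<in> ?V. \<Phi> f = 0}"
    by (rule card_additive_kernel[where F = \<Phi>])
      (use finite_chains f2.subspace_add[OF V] f2.subspace_diff[OF V] \<Phi>_add in blast)+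
  moreover have "card (\<Phi> ` ?V) = 2 ^ card (interior_vertices P K)"
    unfolding \<Phi>_image[OF d2] by (rule card_bit_functions[OF finite_interior_vertices])
  ultimately have "card ?V = 2 ^ card (interior_vertices P K) * card ?B" by simp
  moreover have "card ?V = 2 ^ f2.dim ?V" by (rule card_f2_subspace[OF V finite_chains])
  moreover have "card ?B = 2 ^ f2.dim ?B"
    by (rule card_f2_subspace[OF subspace_boundaries finite_subset[OF boundaries_subset finite_chains]])
  ultimately have "(2::nat) ^ f2.dim ?V = 2 ^ (card (interior_vertices P K) + f2.dim ?B)" by (simp add: power_add)
  then have "f2.dim ?V = card (interior_vertices P K) + f2.dim ?B" by simp
  then show ?thesis unfolding hodge_number_def homology_dim_def using cycles_eq by simp
qed

end

section \<open>Locally constant functions on the chambers of the hypersurface\<close>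

lemma f2_scale_add_left: "f2_scale (a + b) x = f2_scale a x + f2_scale b x"
  by (rule f2.scale_left_distrib)

lemma f2_scale_zero_right [simp]: "f2_scale a 0 = 0"
  by (simp add: f2_scale_def)

lemma pairing2_f2_scale: "pairing2 m (f2_scale c u) = c * pairing2 m u"
  by (cases c) simp_all

context primitive_triangulated
begin

definition sg :: "(real ^ 'd \<Rightarrow> bit) \<Rightarrow> bit ^ 'd \<Rightarrow> real ^ 'd \<Rightarrow> bit"
  where "sg \<epsilon> u v = \<epsilon> v + pairing2 (mod2 v) u"

lemma sg_add: "sg \<epsilon> u v + sg \<epsilon> u w = \<epsilon> v + \<epsilon> w + pairing2 (mod2 v + mod2 w) u"
  by (simp add: sg_def pairing2_add_left ac_simps)

lemma sg_eq_iff: "sg \<epsilon> u v = sg \<epsilon> u w \<longleftrightarrow> pairing2 (mod2 v + mod2 w) u = \<epsilon> v + \<epsilon> w"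
proof -
  have "sg \<epsilon> u v = sg \<epsilon> u w \<longleftrightarrow> sg \<epsilon> u v + sg \<epsilon> u w = 0" by (simp add: vec_bit_eq_add)
  also have "\<dots> \<longleftrightarrow> pairing2 (mod2 v + mod2 w) u = \<epsilon> v + \<epsilon> w"
    unfolding sg_add using vec_bit_eq_add[of "\<epsilon> v + \<epsilon> w" "pairing2 (mod2 v + mod2 w) u" 0] by auto
  finally show ?thesis .
qed

text \<open>
  A function on the pairs \<open>(\<tau>, u)\<close> with \<open>u \<noteq> grad \<tau> \<epsilon>\<close>, that is on the \<open>0\<close>-cells of the hypersurface
  in the torus; the values at \<open>u = grad \<tau> \<epsilon>\<close> are irrelevant. The two conditions come from the \<open>1\<close>-cells
  through an interior and through a boundary wall.
\<close>

definition locally_constant :: "(real ^ 'd \<Rightarrow> bit) \<Rightarrow> ((real ^ 'd) set \<Rightarrow> bit ^ 'd \<Rightarrow> bit) \<Rightarrow> bool"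
  where "locally_constant \<epsilon> \<phi> \<longleftrightarrow>
    (\<forall>\<tau>1\<in>chambers. \<forall>\<tau>2\<in>chambers. \<forall>u. \<tau>1 \<inter> \<tau>2 \<in> walls \<longrightarrow>
      (\<exists>v\<in>verts (\<tau>1 \<inter> \<tau>2). \<exists>w\<in>verts (\<tau>1 \<inter> \<tau>2). sg \<epsilon> u v \<noteq> sg \<epsilon> u w) \<longrightarrow> \<phi> \<tau>1 u = \<phi> \<tau>2 u) \<and>
    (\<forall>\<tau>\<in>chambers. \<forall>\<sigma>\<in>walls. \<forall>F q u. \<sigma> \<subseteq> \<tau> \<longrightarrow> F facet_of P \<longrightarrow> \<sigma> \<subseteq> F \<longrightarrow> q \<in> Sed F \<longrightarrow>
      (\<exists>v\<in>verts \<sigma>. \<exists>w\<in>verts \<sigma>. sg \<epsilon> u v \<noteq> sg \<epsilon> u w) \<longrightarrow> \<phi> \<tau> (u + q) = \<phi> \<tau> u)"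

definition moment :: "(real ^ 'd \<Rightarrow> bit) \<Rightarrow> ((real ^ 'd) set \<Rightarrow> bit ^ 'd \<Rightarrow> bit) \<Rightarrow> (real ^ 'd) set \<Rightarrow> bit ^ 'd"
  where "moment \<epsilon> \<phi> \<tau> = (\<Sum>u\<in>- {grad \<tau> \<epsilon>}. f2_scale (\<phi> \<tau> u) (u + grad \<tau> \<epsilon>))"

text \<open>The value at \<open>grad \<tau> \<epsilon>\<close> is chosen so that the sum over all \<open>u\<close> vanishes.\<close>

definition normalized :: "(real ^ 'd \<Rightarrow> bit) \<Rightarrow> ((real ^ 'd) set \<Rightarrow> bit ^ 'd \<Rightarrow> bit) \<Rightarrow> (real ^ 'd) set \<Rightarrow> bit ^ 'd \<Rightarrow> bit"
  where "normalized \<epsilon> \<phi> \<tau> u = (if u = grad \<tau> \<epsilon> then \<Sum>w\<in>- {grad \<tau> \<epsilon>}. \<phi> \<tau> w else \<phi> \<tau> u)"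

lemma sum_normalized: "(\<Sum>u\<in>UNIV. normalized \<epsilon> \<phi> \<tau> u) = 0"
proof -
  have "(\<Sum>u\<in>UNIV. normalized \<epsilon> \<phi> \<tau> u) =
      normalized \<epsilon> \<phi> \<tau> (grad \<tau> \<epsilon>) + (\<Sum>u\<in>UNIV - {grad \<tau> \<epsilon>}. normalized \<epsilon> \<phi> \<tau> u)"
    by (rule sum.remove) auto
  also have "(\<Sum>u\<in>UNIV - {grad \<tau> \<epsilon>}. normalized \<epsilon> \<phi> \<tau> u) = (\<Sum>w\<in>- {grad \<tau> \<epsilon>}. \<phi> \<tau> w)"
    by (rule sum.cong) (auto simp: normalized_def)
  finally show ?thesis by (simp add: normalized_def)
qed

text \<open>A function with sum zero has the same first moment about every point. Moments of
  different chambers, defined about different gradients, thereby become comparable.\<close>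

lemma moment_normalized: "moment \<epsilon> \<phi> \<tau> = (\<Sum>u\<in>UNIV. f2_scale (normalized \<epsilon> \<phi> \<tau> u) u)"
proof -
  let ?g = "grad \<tau> \<epsilon>"
  have lin: "(\<Sum>u\<in>A. f2_scale (h u) ?g) = f2_scale (sum h A) ?g" for h :: "bit ^ 'd \<Rightarrow> bit" and A
    by (rule additive_sum[where F = "\<lambda>c. f2_scale c ?g", symmetric]) (rule f2_scale_add_left)
  have "moment \<epsilon> \<phi> \<tau> = (\<Sum>u\<in>- {?g}. f2_scale (\<phi> \<tau> u) u) + (\<Sum>u\<in>- {?g}. f2_scale (\<phi> \<tau> u) ?g)"
    unfolding moment_def by (simp add: f2.scale_right_distrib sum.distrib)
  also have "(\<Sum>u\<in>- {?g}. f2_scale (\<phi> \<tau> u) ?g) = f2_scale (normalized \<epsilon> \<phi> \<tau> ?g) ?g"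
    unfolding lin by (simp add: normalized_def)
  also have "(\<Sum>u\<in>- {?g}. f2_scale (\<phi> \<tau> u) u) = (\<Sum>u\<in>UNIV - {?g}. f2_scale (normalized \<epsilon> \<phi> \<tau> u) u)"
    by (rule sum.cong) (auto simp: normalized_def)
  also have "(\<Sum>u\<in>UNIV - {?g}. f2_scale (normalized \<epsilon> \<phi> \<tau> u) u) + f2_scale (normalized \<epsilon> \<phi> \<tau> ?g) ?g =
      (\<Sum>u\<in>UNIV. f2_scale (normalized \<epsilon> \<phi> \<tau> u) u)"
    by (subst sum.remove[of UNIV ?g]) (auto simp: add.commute)
  finally show ?thesis .
qed

text \<open>On \<tau> the sign is an affine function with gradient
  \<open>u + grad \<tau> \<epsilon>\<close>, so it is constant on the wall exactly when this
  gradient annihilates the wall.\<close>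

lemma constant_on_wall_iff:
  assumes s: "\<sigma> \<in> walls" and t: "\<tau> \<in> chambers" "\<sigma> \<subseteq> \<tau>"
  shows "(\<exists>v\<in>verts \<sigma>. \<exists>w\<in>verts \<sigma>. sg \<epsilon> u v \<noteq> sg \<epsilon> u w) \<longleftrightarrow> u + grad \<tau> \<epsilon> \<notin> perp2 \<sigma>"
proof -
  have "pairing2 (mod2 v + mod2 w) (u + grad \<tau> \<epsilon>) = 0 \<longleftrightarrow> sg \<epsilon> u v = sg \<epsilon> u w"
    if "v \<in> verts \<sigma>" "w \<in> verts \<sigma>" for v w
  proof -
    have "v \<in> verts \<tau>" "w \<in> verts \<tau>"
      using that subset_iff_verts[OF wall_K[OF s] chamber_K[OF t(1)]] t(2) by blast+
    then have "pairing2 (mod2 v + mod2 w) (grad \<tau> \<epsilon>) = \<epsilon> v + \<epsilon> w" using grad[OF t(1)] by blast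
    then show ?thesis unfolding sg_eq_iff pairing2_add_right by (simp add: vec_bit_eq_add)
  qed
  then show ?thesis unfolding perp2_simplex[OF wall_K[OF s] wall_nonempty[OF s]] by blast
qed

lemma common_wall_eq:
  assumes s: "\<sigma> \<in> walls" and t: "\<tau>1 \<in> chambers" "\<tau>2 \<in> chambers" "\<tau>1 \<noteq> \<tau>2" "\<sigma> \<subseteq> \<tau>1" "\<sigma> \<subseteq> \<tau>2"
  shows "\<tau>1 \<inter> \<tau>2 = \<sigma>"
proof -
  have IK: "\<tau>1 \<inter> \<tau>2 \<in> K" using Int_K chamber_K t by blast
  have sub: "verts \<sigma> \<subseteq> verts (\<tau>1 \<inter> \<tau>2)" using subset_iff_verts[OF wall_K[OF s] IK] t by blast
  have "verts (\<tau>1 \<inter> \<tau>2) \<subset> verts \<tau>1"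
  proof
    show "verts (\<tau>1 \<inter> \<tau>2) \<subseteq> verts \<tau>1" using verts_Int chamber_K t by blast
    show "verts (\<tau>1 \<inter> \<tau>2) \<noteq> verts \<tau>1"
    proof
      assume "verts (\<tau>1 \<inter> \<tau>2) = verts \<tau>1"
      then have "\<tau>1 \<subseteq> \<tau>2" using verts_inject[OF IK chamber_K[OF t(1)]] by blast
      then show False using chamber_maximal[OF t(1) chamber_K[OF t(2)]] t(3) by simp
    qed
  qed
  then have "card (verts (\<tau>1 \<inter> \<tau>2)) < Suc CARD('d)"
    using psubset_card_mono[OF finite_verts[OF chamber_K[OF t(1)]]] card_verts_chamber[OF t(1)] by simp
  then have "verts \<sigma> = verts (\<tau>1 \<inter> \<tau>2)"
    using card_seteq[OF finite_verts[OF IK] sub] card_verts_wall[OF s] by simp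
  then show ?thesis using verts_inject[OF wall_K[OF s] IK] by simp
qed

text \<open>Away from the two orthants in which the sign is constant on the wall, local constancy
  makes the normalized functions equal. The gradient of \<epsilon> on \<tau>2 is one of these two
  orthants, so filled in values occur only there. Both functions have sum zero, so their difference
  has one value c at the two orthants, and its first moment is c q.\<close>

lemma interior_wall_difference:
  assumes lc: "locally_constant \<epsilon> \<phi>" and t: "\<tau>1 \<in> chambers" "\<tau>2 \<in> chambers" "\<tau>1 \<inter> \<tau>2 \<in> walls"
    and q: "q \<noteq> 0" "perp2 (\<tau>1 \<inter> \<tau>2) = {0, q}"
  obtains c where "moment \<epsilon> \<phi> \<tau>1 + moment \<epsilon> \<phi> \<tau>2 = f2_scale c q"
    "\<And>u. normalized \<epsilon> \<phi> \<tau>1 u + normalized \<epsilon> \<phi> \<tau>2 u = (if u \<in> {grad \<tau>1 \<epsilon>, grad \<tau>1 \<epsilon> + q} then c else 0)"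
proof -
  let ?g = "grad \<tau>1 \<epsilon>" and ?s = "\<tau>1 \<inter> \<tau>2"
  let ?L = "{?g, ?g + q}"
  define D where "D u = normalized \<epsilon> \<phi> \<tau>1 u + normalized \<epsilon> \<phi> \<tau>2 u" for u
  have cw: "u + ?g \<in> perp2 ?s \<longleftrightarrow> u + grad \<tau>2 \<epsilon> \<in> perp2 ?s" for u
    using constant_on_wall_iff[OF t(3) t(1), of \<epsilon> u] constant_on_wall_iff[OF t(3) t(2), of \<epsilon> u] by blast
  have inL: "u + ?g \<in> perp2 ?s \<longleftrightarrow> u \<in> ?L" for u
    unfolding q(2) using vec_bit_eq_add[of u ?g] by (auto simp: add.commute)
  have g2: "grad \<tau>2 \<epsilon> \<in> ?L" using cw[of "grad \<tau>2 \<epsilon>"] inL[of "grad \<tau>2 \<epsilon>"] by simp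
  have off: "D u = 0" if u: "u \<notin> ?L" for u
  proof -
    have "\<exists>v\<in>verts ?s. \<exists>w\<in>verts ?s. sg \<epsilon> u v \<noteq> sg \<epsilon> u w"
      using constant_on_wall_iff[OF t(3) t(1), of \<epsilon> u] inL u by blast
    then have "\<phi> \<tau>1 u = \<phi> \<tau>2 u" using lc t unfolding locally_constant_def by blast
    moreover have "u \<noteq> ?g" "u \<noteq> grad \<tau>2 \<epsilon>" using u g2 by auto
    ultimately show ?thesis by (simp add: D_def normalized_def)
  qed
  have gq: "?g \<noteq> ?g + q" using q(1) by simp
  have sumL: "(\<Sum>u\<in>UNIV. h u) = h ?g + h (?g + q)" if "\<And>u. u \<notin> ?L \<Longrightarrow> h u = 0" for h :: "bit ^ 'd \<Rightarrow> 'z::ab_group_add"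
  proof -
    have "(\<Sum>u\<in>UNIV. h u) = (\<Sum>u\<in>?L. h u)" by (rule sum.mono_neutral_right) (use that in auto)
    then show ?thesis using gq by simp
  qed
  have "D ?g + D (?g + q) = (\<Sum>u\<in>UNIV. D u)" using sumL[of D] off by simp
  also have "\<dots> = 0" unfolding D_def sum.distrib by (simp add: sum_normalized)
  finally have Deq: "D (?g + q) = D ?g" using vec_bit_eq_add[of "D ?g" "D (?g + q)" 0] by simp
  have "moment \<epsilon> \<phi> \<tau>1 + moment \<epsilon> \<phi> \<tau>2 = (\<Sum>u\<in>UNIV. f2_scale (D u) u)"
    unfolding moment_normalized D_def f2_scale_add_left sum.distrib ..
  also have "\<dots> = f2_scale (D ?g) ?g + f2_scale (D (?g + q)) (?g + q)"
    using sumL[of "\<lambda>u. f2_scale (D u) u"] off by simp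
  also have "\<dots> = f2_scale (D ?g) q" unfolding Deq by (cases "D ?g") simp_all
  finally have 1: "moment \<epsilon> \<phi> \<tau>1 + moment \<epsilon> \<phi> \<tau>2 = f2_scale (D ?g) q" .
  have "normalized \<epsilon> \<phi> \<tau>1 u + normalized \<epsilon> \<phi> \<tau>2 u = (if u \<in> ?L then D ?g else 0)" for u
    using off[of u] Deq unfolding D_def by auto
  then show thesis using that 1 by blast
qed

text \<open>Off the line {g, g + q}, with g the gradient of \<epsilon>, this is local constancy. The
  values off the line then cancel in pairs under the shift by q, and since the total sum is zero the
  two values on the line agree too.\<close>

lemma boundary_wall_invariance:
  assumes lc: "locally_constant \<epsilon> \<phi>" and s: "\<sigma> \<in> walls" and t: "\<tau> \<in> chambers" "\<sigma> \<subseteq> \<tau>"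
    and F: "F facet_of P" "\<sigma> \<subseteq> F" and q: "q \<in> Sed F"
  shows "normalized \<epsilon> \<phi> \<tau> (u + q) = normalized \<epsilon> \<phi> \<tau> u"
proof (cases "q = 0")
  case False
  let ?g = "grad \<tau> \<epsilon>" and ?\<psi> = "normalized \<epsilon> \<phi> \<tau>"
  let ?L = "{?g, ?g + q}"
  have "q \<in> perp2 \<sigma>" using q perp2_facet[OF F(1) s F(2)] by simp
  then have p: "perp2 \<sigma> = {0, q}" using perp2_wall_two[OF s _ False] by simp
  have inL: "u + ?g \<in> perp2 \<sigma> \<longleftrightarrow> u \<in> ?L" for u
    unfolding p using vec_bit_eq_add[of u ?g] by (auto simp: add.commute)
  have Lq: "u + q \<in> ?L \<longleftrightarrow> u \<in> ?L" for u
    using vec_bit_eq_add[of u q] by (auto simp: add.assoc add_self_eq_0)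
  have off: "?\<psi> (u + q) = ?\<psi> u" if u: "u \<notin> ?L" for u
  proof -
    have "\<exists>v\<in>verts \<sigma>. \<exists>w\<in>verts \<sigma>. sg \<epsilon> u v \<noteq> sg \<epsilon> u w"
      using constant_on_wall_iff[OF s t, of \<epsilon> u] inL u by blast
    then have "\<phi> \<tau> (u + q) = \<phi> \<tau> u" using lc s t F q unfolding locally_constant_def by blast
    moreover have "u \<noteq> ?g" "u + q \<noteq> ?g" using u Lq[of u] by auto
    ultimately show ?thesis by (simp add: normalized_def)
  qed
  have "(\<Sum>u\<in>- ?L. ?\<psi> u) = 0"
    by (rule sum_bit_involution[where h = "\<lambda>u. u + q"]) (use Lq off False in \<open>auto simp: add.assoc\<close>)
  moreover have "(\<Sum>u\<in>UNIV. ?\<psi> u) = (\<Sum>u\<in>- ?L. ?\<psi> u) + (\<Sum>u\<in>?L. ?\<psi> u)"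
    using sum.subset_diff[of ?L UNIV ?\<psi>] by (simp add: Compl_eq_Diff_UNIV)
  ultimately have "?\<psi> ?g + ?\<psi> (?g + q) = 0" using sum_normalized[of \<epsilon> \<phi> \<tau>] False by simp
  then have eq: "?\<psi> ?g = ?\<psi> (?g + q)" using vec_bit_eq_add[of "?\<psi> ?g" "?\<psi> (?g + q)" 0] by simp
  show ?thesis
  proof (cases "u \<in> ?L")
    case True
    then show ?thesis using eq by (auto simp: add.assoc)
  qed (rule off)
qed simp

text \<open>At an interior wall the two moments differ by a multiple of q, which vanishes along the
  wall. At a boundary wall the shift by q preserves the normalized function and the pairing with
  wall edges, so the terms cancel in pairs.\<close>

lemma moment_compatible:
  assumes lc: "locally_constant \<epsilon> \<phi>"
  shows "compatible (moment \<epsilon> \<phi>)"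
  unfolding compatible_def
proof (intro ballI)
  fix \<sigma> x y assume s: "\<sigma> \<in> walls" and xy: "x \<in> verts \<sigma>" "y \<in> verts \<sigma>"
  let ?m = "mod2 x + mod2 y"
  obtain q where q: "q \<noteq> 0" "perp2 \<sigma> = {0, q}" using perp2_wall_nonzero[OF s] by blast
  have "q \<in> perp2 \<sigma>" using q by blast
  then have mq: "pairing2 ?m q = 0"
    unfolding perp2_simplex[OF wall_K[OF s] wall_nonempty[OF s]] using xy by blast
  show "(\<Sum>\<tau> | \<tau> \<in> chambers \<and> \<sigma> \<subseteq> \<tau>. pairing2 ?m (moment \<epsilon> \<phi> \<tau>)) = 0"
  proof (cases "barycenter \<sigma> \<in> interior P")
    case True
    obtain \<tau>1 \<tau>2 where ne: "\<tau>1 \<noteq> \<tau>2" and eq: "{\<tau> \<in> chambers. \<sigma> \<subseteq> \<tau>} = {\<tau>1, \<tau>2}"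
      using chambers_at_interior_wall[OF s True] by blast
    have t: "\<tau>1 \<in> chambers" "\<tau>2 \<in> chambers" "\<sigma> \<subseteq> \<tau>1" "\<sigma> \<subseteq> \<tau>2" using eq by blast+
    have I: "\<tau>1 \<inter> \<tau>2 = \<sigma>" by (rule common_wall_eq[OF s t(1,2) ne t(3,4)])
    obtain c where c: "moment \<epsilon> \<phi> \<tau>1 + moment \<epsilon> \<phi> \<tau>2 = f2_scale c q"
      using interior_wall_difference[OF lc t(1,2), of q] I s q by metis
    have "(\<Sum>\<tau> | \<tau> \<in> chambers \<and> \<sigma> \<subseteq> \<tau>. pairing2 ?m (moment \<epsilon> \<phi> \<tau>)) =
        pairing2 ?m (moment \<epsilon> \<phi> \<tau>1 + moment \<epsilon> \<phi> \<tau>2)"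
      using ne by (simp add: eq pairing2_add_right)
    then show ?thesis by (simp add: c pairing2_f2_scale mq)
  next
    case False
    obtain F where F: "F facet_of P" "\<sigma> \<subseteq> F"
      using boundary_simplex_in_facet[OF wall_K[OF s] wall_nonempty[OF s] False] by blast
    obtain \<tau> where t: "\<tau> \<in> chambers" "\<sigma> \<subseteq> \<tau>" using chamber_above[OF wall_K[OF s]] by blast
    have qF: "q \<in> Sed F" using perp2_facet[OF F(1) s F(2)] q by simp
    have "pairing2 ?m (moment \<epsilon> \<phi> \<tau>) = (\<Sum>u\<in>UNIV. normalized \<epsilon> \<phi> \<tau> u * pairing2 ?m u)"
      by (simp add: moment_normalized pairing2_sum_right pairing2_f2_scale)
    also have "\<dots> = 0"
      by (rule sum_bit_involution[where h = "\<lambda>u. u + q"])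
        (use boundary_wall_invariance[OF lc s t F qF] q(1) mq in \<open>auto simp: add.assoc pairing2_add_right\<close>)
    finally show ?thesis using chambers_at_boundary_wall[OF s False t] by simp
  qed
qed

text \<open>With c q = 0 also c = 0, so the normalized functions of all chambers are one and the
  same function on \<open>N_2\<close>, including the filled in values. Any chamber at a facet then
  supplies its invariance under \<open>Sed\<close> of that facet.\<close>

lemma moment_zero_imp_constant:
  assumes smooth: "smooth_lattice_polytope P" and lc: "locally_constant \<epsilon> \<phi>"
    and zero: "\<And>\<tau>. \<tau> \<in> chambers \<Longrightarrow> moment \<epsilon> \<phi> \<tau> = 0"
    and t: "\<tau> \<in> chambers" "\<tau>' \<in> chambers" "u \<noteq> grad \<tau> \<epsilon>" "u' \<noteq> grad \<tau>' \<epsilon>"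
  shows "\<phi> \<tau> u = \<phi> \<tau>' u'"
proof -
  have eq: "normalized \<epsilon> \<phi> \<tau>1 = normalized \<epsilon> \<phi> \<tau>2" if t12: "\<tau>1 \<in> chambers" "\<tau>2 \<in> chambers" for \<tau>1 \<tau>2
  proof (rule all_chambers_connected[OF t12])
    fix \<tau>1 \<tau>2 assume a: "\<tau>1 \<in> chambers" "\<tau>2 \<in> chambers" "\<tau>1 \<inter> \<tau>2 \<in> walls"
    obtain q where q: "q \<noteq> 0" "perp2 (\<tau>1 \<inter> \<tau>2) = {0, q}" using perp2_wall_nonzero[OF a(3)] by blast
    obtain c where c: "moment \<epsilon> \<phi> \<tau>1 + moment \<epsilon> \<phi> \<tau>2 = f2_scale c q"
      "\<And>u. normalized \<epsilon> \<phi> \<tau>1 u + normalized \<epsilon> \<phi> \<tau>2 u = (if u \<in> {grad \<tau>1 \<epsilon>, grad \<tau>1 \<epsilon> + q} then c else 0)"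
      using interior_wall_difference[OF lc a q] by blast
    have "f2_scale c q = 0" using c(1) zero a by simp
    then have "c = 0" using q(1) by (cases c) simp_all
    then have "normalized \<epsilon> \<phi> \<tau>1 u + normalized \<epsilon> \<phi> \<tau>2 u = 0" for u using c(2)[of u] by simp
    then have "normalized \<epsilon> \<phi> \<tau>1 u = normalized \<epsilon> \<phi> \<tau>2 u" for u
      using vec_bit_eq_add[of "normalized \<epsilon> \<phi> \<tau>1 u" "normalized \<epsilon> \<phi> \<tau>2 u" 0] by simp
    then show "normalized \<epsilon> \<phi> \<tau>1 = normalized \<epsilon> \<phi> \<tau>2" by (rule ext)
  qed
  have "normalized \<epsilon> \<phi> \<tau> u = normalized \<epsilon> \<phi> \<tau> u'"
  proof (rule smooth_facets_generate[OF smooth])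
    fix F q u assume F: "F facet_of P" and q: "q \<in> Sed F"
    obtain \<sigma> where s: "\<sigma> \<in> walls" "\<sigma> \<subseteq> F" using facet_has_wall[OF F] by blast
    obtain \<tau>1 where t1: "\<tau>1 \<in> chambers" "\<sigma> \<subseteq> \<tau>1" using chamber_above[OF wall_K[OF s(1)]] by blast
    have "normalized \<epsilon> \<phi> \<tau>1 (u + q) = normalized \<epsilon> \<phi> \<tau>1 u"
      by (rule boundary_wall_invariance[OF lc s(1) t1 F s(2) q])
    then show "normalized \<epsilon> \<phi> \<tau> (u + q) = normalized \<epsilon> \<phi> \<tau> u" using eq[OF t1(1) t(1)] by simp
  qed
  also have "normalized \<epsilon> \<phi> \<tau> u' = normalized \<epsilon> \<phi> \<tau>' u'" using eq[OF t(1,2)] by simp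
  finally show ?thesis using t(3,4) by (simp add: normalized_def)
qed

lemma locally_constant_add:
  "locally_constant \<epsilon> \<phi> \<Longrightarrow> locally_constant \<epsilon> \<phi>' \<Longrightarrow> locally_constant \<epsilon> (\<lambda>\<tau> u. \<phi> \<tau> u + \<phi>' \<tau> u)"
  unfolding locally_constant_def by (intro conjI ballI allI impI; metis)

lemma locally_constant_zero: "locally_constant \<epsilon> (\<lambda>\<tau> u. 0)"
  by (simp add: locally_constant_def)

lemma locally_constant_sum:
  assumes "finite A" "\<And>i. i \<in> A \<Longrightarrow> locally_constant \<epsilon> (\<phi> i)"
  shows "locally_constant \<epsilon> (\<lambda>\<tau> u. \<Sum>i\<in>A. \<phi> i \<tau> u)"
  using assms by (induction A rule: finite_induct) (simp_all add: locally_constant_zero locally_constant_add)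

lemma moment_add: "moment \<epsilon> (\<lambda>\<tau> u. \<phi> \<tau> u + \<phi>' \<tau> u) \<tau> = moment \<epsilon> \<phi> \<tau> + moment \<epsilon> \<phi>' \<tau>"
  by (simp add: moment_def f2_scale_add_left sum.distrib)

lemma moment_sum:
  "finite A \<Longrightarrow> moment \<epsilon> (\<lambda>\<tau> u. \<Sum>i\<in>A. \<phi> i \<tau> u) \<tau> = (\<Sum>i\<in>A. moment \<epsilon> (\<phi> i) \<tau>)"
  by (induction A rule: finite_induct) (simp_all add: moment_add, simp add: moment_def)

text \<open>If \<open>U\<close> is the orthant of \<open>v\<close>, this is the indicator function of the boundary of \<open>v\<^sup>*\<close> in the orthant \<open>U\<close>.\<close>

definition sphere_fun :: "real ^ 'd \<Rightarrow> bit ^ 'd \<Rightarrow> (real ^ 'd) set \<Rightarrow> bit ^ 'd \<Rightarrow> bit"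
  where "sphere_fun v U \<tau> u = (if v \<in> verts \<tau> \<and> u = U then 1 else 0)"

definition orthant_of :: "(real ^ 'd \<Rightarrow> bit) \<Rightarrow> real ^ 'd \<Rightarrow> bit ^ 'd \<Rightarrow> bool"
  where "orthant_of \<epsilon> v U \<longleftrightarrow> (\<forall>\<tau>\<in>chambers. v \<in> verts \<tau> \<longrightarrow> grad \<tau> \<epsilon> + grad \<tau> (\<chi>1 v) = U)"

text \<open>By the choice of U, the sign in this orthant differs from the indicator of v by a
  constant on each chamber containing v.\<close>

lemma sg_orthant:
  assumes U: "orthant_of \<epsilon> v U" and t: "\<tau> \<in> chambers" "v \<in> verts \<tau>" "x \<in> verts \<tau>" "y \<in> verts \<tau>"
  shows "sg \<epsilon> U x = sg \<epsilon> U y \<longleftrightarrow> \<chi>1 v x = \<chi>1 v y"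
proof -
  have "grad \<tau> \<epsilon> + grad \<tau> (\<chi>1 v) = U" using U t(1,2) by (simp add: orthant_of_def)
  then have "pairing2 (mod2 x + mod2 y) U = (\<epsilon> x + \<epsilon> y) + (\<chi>1 v x + \<chi>1 v y)"
    using grad[OF t(1,3,4), of \<epsilon>] grad[OF t(1,3,4), of "\<chi>1 v"] by (metis pairing2_add_right)
  then show ?thesis unfolding sg_eq_iff by (auto simp: vec_bit_eq_add)
qed

text \<open>If in the orthant U the sign varies on a wall of a chamber at v, the wall contains v. An
  interior wall of this kind has v on both sides, and a wall in a facet cannot contain the interior
  vertex v.\<close>

lemma locally_constant_sphere:
  assumes v: "v \<in> interior_vertices P K" and U: "orthant_of \<epsilon> v U"
  shows "locally_constant \<epsilon> (sphere_fun v U)"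
proof -
  have mem: "v \<in> verts \<sigma>"
    if "\<sigma> \<in> walls" "\<tau> \<in> chambers" "\<sigma> \<subseteq> \<tau>" "v \<in> verts \<tau>" "x \<in> verts \<sigma>" "y \<in> verts \<sigma>" "sg \<epsilon> U x \<noteq> sg \<epsilon> U y" for \<sigma> \<tau> x y
  proof -
    have "x \<in> verts \<tau>" "y \<in> verts \<tau>"
      using that subset_iff_verts[OF wall_K[OF that(1)] chamber_K[OF that(2)]] by blast+
    then have "\<chi>1 v x \<noteq> \<chi>1 v y" using sg_orthant[OF U that(2,4)] that(7) by blast
    then show ?thesis using that(5,6) by (auto split: if_splits)
  qed
  show ?thesis
    unfolding locally_constant_def
  proof (intro conjI ballI allI impI)
    fix \<tau>1 \<tau>2 u
    assume a: "\<tau>1 \<in> chambers" "\<tau>2 \<in> chambers" "\<tau>1 \<inter> \<tau>2 \<in> walls"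
      "\<exists>x\<in>verts (\<tau>1 \<inter> \<tau>2). \<exists>y\<in>verts (\<tau>1 \<inter> \<tau>2). sg \<epsilon> u x \<noteq> sg \<epsilon> u y"
    have I: "verts (\<tau>1 \<inter> \<tau>2) = verts \<tau>1 \<inter> verts \<tau>2" using verts_Int chamber_K a by blast
    have "v \<in> verts \<tau>1 \<longleftrightarrow> v \<in> verts \<tau>2" if "u = U"
      using mem[OF a(3) a(1)] mem[OF a(3) a(2)] a(4) I that by blast
    then show "sphere_fun v U \<tau>1 u = sphere_fun v U \<tau>2 u" by (auto simp: sphere_fun_def)
  next
    fix \<tau> \<sigma> F q u
    assume a: "\<tau> \<in> chambers" "\<sigma> \<in> walls" "\<sigma> \<subseteq> \<tau>" "F facet_of P" "\<sigma> \<subseteq> F" "q \<in> Sed F"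
      "\<exists>x\<in>verts \<sigma>. \<exists>y\<in>verts \<sigma>. sg \<epsilon> u x \<noteq> sg \<epsilon> u y"
    have "v \<notin> F" using v interior_vertex interior_facet_disjoint[OF facet_face(1,2)[OF a(4)]] by blast
    then have vs: "v \<notin> verts \<sigma>" using verts_sub[OF wall_K[OF a(2)]] a(5) by blast
    have "q \<in> perp2 \<sigma>" using perp2_facet[OF a(4,2,5)] a(6) by simp
    then have "pairing2 (mod2 x + mod2 y) q = 0" if "x \<in> verts \<sigma>" "y \<in> verts \<sigma>" for x y
      using that unfolding perp2_simplex[OF wall_K[OF a(2)] wall_nonempty[OF a(2)]] by blast
    then have "\<exists>x\<in>verts \<sigma>. \<exists>y\<in>verts \<sigma>. sg \<epsilon> (u + q) x \<noteq> sg \<epsilon> (u + q) y"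
      using a(7) unfolding sg_eq_iff pairing2_add_right by (metis add_0_right)
    then show "sphere_fun v U \<tau> (u + q) = sphere_fun v U \<tau> u"
      using mem[OF a(2,1,3)] a(7) vs by (auto simp: sphere_fun_def)
  qed
qed

text \<open>Only the orthant U contributes, with \<open>U + grad \<tau> \<epsilon>\<close>, which by
  the choice of U is the gradient of the indicator. Without v among the vertices both sides are
  zero.\<close>

lemma moment_sphere:
  assumes U: "orthant_of \<epsilon> v U" and t: "\<tau> \<in> chambers" and d2: "CARD('d) \<ge> 2"
  shows "moment \<epsilon> (sphere_fun v U) \<tau> = grad \<tau> (\<chi>1 v)"
proof (cases "v \<in> verts \<tau>")
  case True
  have Ueq: "grad \<tau> \<epsilon> + grad \<tau> (\<chi>1 v) = U" using U t True by (simp add: orthant_of_def)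
  have "\<not> verts \<tau> \<subseteq> {v}" using card_verts_chamber[OF t] card_mono[of "{v}" "verts \<tau>"] by auto
  then obtain w where w: "w \<in> verts \<tau>" "w \<noteq> v" by blast
  have "pairing2 (mod2 v + mod2 w) (grad \<tau> (\<chi>1 v)) = 1" using grad[OF t True w(1), of "\<chi>1 v"] w(2) by simp
  then have "grad \<tau> (\<chi>1 v) \<noteq> 0" by auto
  then have ne: "U \<noteq> grad \<tau> \<epsilon>" using Ueq by (metis add_cancel_left_right)
  have "moment \<epsilon> (sphere_fun v U) \<tau> = (\<Sum>u\<in>- {grad \<tau> \<epsilon>}. if u = U then U + grad \<tau> \<epsilon> else 0)"
    unfolding moment_def by (rule sum.cong) (auto simp: sphere_fun_def True)
  also have "\<dots> = U + grad \<tau> \<epsilon>" using ne by simp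
  also have "\<dots> = grad \<tau> (\<chi>1 v)" by (simp add: Ueq[symmetric] add.commute)
  finally show ?thesis .
next
  case False
  then have "moment \<epsilon> (sphere_fun v U) \<tau> = 0" by (simp add: moment_def sphere_fun_def)
  moreover have "grad \<tau> (\<chi>1 v) = 0" by (rule grad_eqI[OF t]) (use False in auto)
  ultimately show ?thesis by simp
qed

theorem locally_constant_off_spheres:
  assumes d2: "CARD('d) \<ge> 2" and smooth: "smooth_lattice_polytope P" and lc: "locally_constant \<epsilon> \<phi>"
    and U: "\<And>v. v \<in> interior_vertices P K \<Longrightarrow> orthant_of \<epsilon> v (U v)"
    and t: "\<tau> \<in> chambers" "u \<noteq> grad \<tau> \<epsilon>" "\<And>v. v \<in> interior_vertices P K \<Longrightarrow> v \<in> verts \<tau> \<Longrightarrow> u \<noteq> U v"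
    and t': "\<tau>' \<in> chambers" "u' \<noteq> grad \<tau>' \<epsilon>" "\<And>v. v \<in> interior_vertices P K \<Longrightarrow> v \<in> verts \<tau>' \<Longrightarrow> u' \<noteq> U v"
  shows "\<phi> \<tau> u = \<phi> \<tau>' u'"
proof -
  obtain f where f: "\<And>v. \<lbrakk>v \<in> vertices; v \<notin> interior P\<rbrakk> \<Longrightarrow> f v = 0"
    "\<And>\<tau>. \<tau> \<in> chambers \<Longrightarrow> moment \<epsilon> \<phi> \<tau> = grad \<tau> f"
    using compatible_is_gradient[OF d2 moment_compatible[OF lc]] by blast
  define A where "A = {v. v \<in> interior_vertices P K \<and> f v = 1}"
  have fA: "finite A" using finite_interior_vertices by (simp add: A_def)
  have AI: "v \<in> interior_vertices P K" if "v \<in> A" for v using that by (simp add: A_def)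
  define \<phi>' where "\<phi>' \<tau> u = \<phi> \<tau> u + (\<Sum>v\<in>A. sphere_fun v (U v) \<tau> u)" for \<tau> u
  have lc': "locally_constant \<epsilon> \<phi>'"
    unfolding \<phi>'_def by (intro locally_constant_add lc locally_constant_sum fA locally_constant_sphere AI U)
  have zero: "moment \<epsilon> \<phi>' \<tau> = 0" if t: "\<tau> \<in> chambers" for \<tau>
  proof -
    have "moment \<epsilon> \<phi>' \<tau> = grad \<tau> f + (\<Sum>v\<in>A. grad \<tau> (\<chi>1 v))"
      unfolding \<phi>'_def moment_add moment_sum[OF fA] f(2)[OF t] using moment_sphere[OF U[OF AI] t d2] by simp
    also have "grad \<tau> f = (\<Sum>v\<in>A. grad \<tau> (\<chi>1 v))" unfolding A_def by (rule grad_interior_sum[OF t f(1)])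
    finally show ?thesis by simp
  qed
  \<comment> \<open>At the two given cells all sphere functions vanish, so the corrected function
    agrees there with the original one.\<close>
  have "(\<Sum>v\<in>A. sphere_fun v (U v) \<tau> u) = 0" "(\<Sum>v\<in>A. sphere_fun v (U v) \<tau>' u') = 0"
    using t(3) t'(3) AI by (auto intro!: sum.neutral simp: sphere_fun_def)
  then show ?thesis
    using moment_zero_imp_constant[OF smooth lc' zero t(1) t'(1) t(2) t'(2)] by (simp add: \<phi>'_def)
qed

end

section \<open>Topology of the real locus\<close>

lemma connected_components_of_clopen_cover:
  assumes cover: "\<Union>\<C> = topspace X"
    and clopen: "\<And>C. C \<in> \<C> \<Longrightarrow> connectedin X C \<and> openin X C \<and> closedin X C \<and> C \<noteq> {}"
  shows "connected_components_of X = \<C>"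
proof -
  have eq: "connected_component_of_set X x = C" if "C \<in> \<C>" "x \<in> C" for C x
  proof
    show "C \<subseteq> connected_component_of_set X x"
      using connected_component_of_maximal clopen[OF that(1)] that(2) by metis
    then have "\<not> disjnt (connected_component_of_set X x) C" using that(2) unfolding disjnt_def by blast
    then show "connected_component_of_set X x \<subseteq> C"
      using connectedin_clopen_cases[OF connectedin_connected_component_of] clopen[OF that(1)] by metis
  qed
  show ?thesis
  proof
    show "connected_components_of X \<subseteq> \<C>"
      unfolding connected_components_of_def using eq cover by blast
    show "\<C> \<subseteq> connected_components_of X"
    proof
      fix C assume C: "C \<in> \<C>"
      then obtain x where "x \<in> C" using clopen by blast
      then show "C \<in> connected_components_of X"
        unfolding connected_components_of_def using eq[OF C] cover C by blast
    qed
  qed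
qed

lemma openin_discrete_prod_iff:
  "openin (prod_topology (discrete_topology UNIV) Z) A \<longleftrightarrow>
    A \<subseteq> UNIV \<times> topspace Z \<and> (\<forall>u. openin Z {x. (u, x) \<in> A})" (is "?l \<longleftrightarrow> ?r")
proof
  assume A: ?l
  have "openin Z {x. (u, x) \<in> A}" for u
  proof -
    have "continuous_map Z (prod_topology (discrete_topology UNIV) Z) (\<lambda>x. (u, x))"
      by (intro continuous_map_pairedI continuous_map_id[unfolded id_def]) simp
    from openin_continuous_map_preimage[OF this A]
    have "openin Z {x \<in> topspace Z. (u, x) \<in> A}" .
    moreover have "{x \<in> topspace Z. (u, x) \<in> A} = {x. (u, x) \<in> A}" using openin_subset[OF A] by auto
    ultimately show ?thesis by simp
  qed
  then show ?r using openin_subset[OF A] by simp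
next
  assume r: ?r
  have "openin (prod_topology (discrete_topology UNIV) Z) (\<Union>u. {u} \<times> {x. (u, x) \<in> A})"
    by (rule openin_Union) (use r in \<open>auto simp: openin_prod_Times_iff\<close>)
  moreover have "(\<Union>u. {u} \<times> {x. (u, x) \<in> A}) = A" by auto
  ultimately show ?l by simp
qed

lemma perp2_add:
  assumes "u \<in> perp2 S" "u' \<in> perp2 S"
  shows "u + u' \<in> perp2 S"
proof -
  obtain y y' where y: "y \<in> int_points" "mod2 y = u" "\<forall>x\<in>S. \<forall>z\<in>S. y \<bullet> x = y \<bullet> z"
    and y': "y' \<in> int_points" "mod2 y' = u'" "\<forall>x\<in>S. \<forall>z\<in>S. y' \<bullet> x = y' \<bullet> z"
    using assms unfolding mem_perp2_iff by blast
  have "y + y' \<in> int_points" using y(1) y'(1) by (simp add: int_points_def)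
  moreover have "mod2 (y + y') = u + u'" using mod2_add[OF y(1) y'(1)] y(2) y'(2) by simp
  moreover have "\<forall>x\<in>S. \<forall>z\<in>S. (y + y') \<bullet> x = (y + y') \<bullet> z"
    unfolding inner_add_left using y(3) y'(3) by metis
  ultimately show ?thesis unfolding mem_perp2_iff by blast
qed

context primitive_triangulated
begin

definition point :: "bit ^ 'd \<Rightarrow> real ^ 'd \<Rightarrow> ((bit ^ 'd) \<times> (real ^ 'd)) set"
  where "point u x = real_locus_rel P `` {(u, x)}"

lemma smallest_face_interior:
  assumes "x \<in> interior P"
  shows "smallest_face P x = P"
proof -
  have "{F. F face_of P \<and> x \<in> F} = {P}"
    using face_containing_interior[OF _ _ assms] face_of_refl[OF convex_P] interior_subset assms by blast
  then show ?thesis by (simp add: smallest_face_def)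
qed

lemma Sed_smallest_face: "F face_of P \<Longrightarrow> x \<in> F \<Longrightarrow> Sed F \<subseteq> Sed (smallest_face P x)"
  unfolding smallest_face_def by (rule perp2_antimono) blast

lemma point_eq_iff:
  assumes "x \<in> P"
  shows "point u x = point u' x' \<longleftrightarrow> x = x' \<and> u + u' \<in> Sed (smallest_face P x)"
proof -
  let ?S = "Sed (smallest_face P x)"
  have pt: "point u x = {(w, x) |w. u + w \<in> ?S}" for u
    using assms by (auto simp: point_def real_locus_rel_def minus_f2)
  have 0: "0 \<in> ?S" by (rule zero_in_perp2)
  show ?thesis
  proof
    assume eq: "point u x = point u' x'"
    have "(u, x) \<in> point u x" unfolding pt using 0 by simp
    then have "(u, x) \<in> point u' x'" unfolding eq .
    then have "x = x'" by (simp add: point_def real_locus_rel_def)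
    moreover from this have "(u, x) \<in> point u' x" using \<open>(u, x) \<in> point u' x'\<close> by simp
    then have "u' + u \<in> ?S" unfolding pt by blast
    ultimately show "x = x' \<and> u + u' \<in> ?S" by (simp add: add.commute)
  next
    assume r: "x = x' \<and> u + u' \<in> ?S"
    have "u + w \<in> ?S \<longleftrightarrow> u' + w \<in> ?S" for w
    proof
      assume "u + w \<in> ?S"
      then have "(u + u') + (u + w) \<in> ?S" using perp2_add r by blast
      moreover have "(u + u') + (u + w) = u' + w" by (simp add: ac_simps)
      ultimately show "u' + w \<in> ?S" by simp
    next
      assume "u' + w \<in> ?S"
      then have "(u + u') + (u' + w) \<in> ?S" using perp2_add r by blast
      moreover have "(u + u') + (u' + w) = u + w" by (simp add: ac_simps)
      ultimately show "u + w \<in> ?S" by simp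
    qed
    then have "point u x = point u' x" unfolding pt by blast
    then show "point u x = point u' x'" using r by simp
  qed
qed

lemma point_interior_eq_iff:
  assumes "x \<in> interior P"
  shows "point u x = point u' x' \<longleftrightarrow> x = x' \<and> u = u'"
proof -
  have "x \<in> P" using assms interior_subset by blast
  from point_eq_iff[OF this] show ?thesis
    unfolding smallest_face_interior[OF assms] Sed_P by (simp add: vec_bit_eq_add)
qed

lemma point_preimage:
  assumes "A \<subseteq> interior P"
  shows "{x \<in> P. point u' x \<in> point u ` A} = (if u' = u then A else {})"
proof -
  have "point u' x \<in> point u ` A \<longleftrightarrow> x \<in> A \<and> u' = u" if "x \<in> P" for x
  proof
    assume "point u' x \<in> point u ` A"
    then obtain a where a: "a \<in> A" "point u a = point u' x" by force
    then show "x \<in> A \<and> u' = u" using point_interior_eq_iff[of a u u' x] assms by blast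
  qed blast
  moreover have "A \<subseteq> P" using assms interior_subset by blast
  ultimately show ?thesis by auto
qed

lemma topspace_real_locus: "topspace (real_locus P) = {point u x |u x. x \<in> P}"
  by (auto simp: real_locus_def topspace_quotient_top quotient_def point_def)

lemma openin_real_locus:
  "openin (real_locus P) W \<longleftrightarrow>
    W \<subseteq> topspace (real_locus P) \<and> (\<forall>u. openin (top_of_set P) {x \<in> P. point u x \<in> W})"
proof -
  have eq: "{x. (u, x) \<in> {z \<in> UNIV \<times> P. real_locus_rel P `` {z} \<in> W}} = {x \<in> P. point u x \<in> W}" for u
    by (auto simp: point_def)
  have "openin (real_locus P) W \<longleftrightarrow> W \<subseteq> topspace (real_locus P) \<and>
      openin (prod_topology (discrete_topology UNIV) (top_of_set P)) {z \<in> UNIV \<times> P. real_locus_rel P `` {z} \<in> W}"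
    unfolding real_locus_def openin_quotient_top topspace_quotient_top by simp
  moreover have "{z \<in> UNIV \<times> P. real_locus_rel P `` {z} \<in> W} \<subseteq> UNIV \<times> topspace (top_of_set P)" by auto
  ultimately show ?thesis unfolding openin_discrete_prod_iff eq by blast
qed

lemma closedin_real_locus:
  "closedin (real_locus P) W \<longleftrightarrow>
    W \<subseteq> topspace (real_locus P) \<and> (\<forall>u. closedin (top_of_set P) {x \<in> P. point u x \<in> W})"
proof -
  have "{x \<in> P. point u x \<in> topspace (real_locus P) - W} = P - {x \<in> P. point u x \<in> W}" for u
    by (auto simp: topspace_real_locus)
  then show ?thesis
    unfolding closedin_def openin_real_locus by (auto simp: closedin_def)
qed

lemma continuous_map_point: "continuous_map (top_of_set P) (real_locus P) (point u)"
  unfolding continuous_map_def by (auto simp: topspace_real_locus openin_real_locus)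

lemma openin_point_image:
  assumes "A \<subseteq> interior P" "open A"
  shows "openin (real_locus P) (point u ` A)"
proof -
  have "A \<subseteq> P" using assms(1) interior_subset by blast
  then have "openin (top_of_set P) A" using assms(2) by (simp add: open_subset)
  then show ?thesis
    unfolding openin_real_locus point_preimage[OF assms(1)] using \<open>A \<subseteq> P\<close> by (auto simp: topspace_real_locus)
qed

lemma closedin_point_image:
  assumes "A \<subseteq> interior P" "closed A"
  shows "closedin (real_locus P) (point u ` A)"
proof -
  have "A \<subseteq> P" using assms(1) interior_subset by blast
  then have "closedin (top_of_set P) A" using assms(2) by (simp add: closed_subset)
  then show ?thesis
    unfolding closedin_real_locus point_preimage[OF assms(1)] using \<open>A \<subseteq> P\<close> by (auto simp: topspace_real_locus)
qed

text \<open>Closed subsets of D are compact subsets of the interior, where no two orthants are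
  glued, and their images are closed in the real locus.\<close>

lemma embedding_map_point:
  assumes "D \<subseteq> interior P" "compact D"
  shows "embedding_map (top_of_set D) (real_locus P) (point u)"
proof (rule injective_closed_imp_embedding_map)
  have DP: "D \<subseteq> P" using assms(1) interior_subset by blast
  show "continuous_map (top_of_set D) (real_locus P) (point u)"
    by (rule continuous_map_from_subtopology_mono[OF continuous_map_point DP])
  show "inj_on (point u) (topspace (top_of_set D))"
  proof (rule inj_onI)
    fix x y assume "x \<in> topspace (top_of_set D)" "point u x = point u y"
    then show "x = y" using point_eq_iff[of x u u y] DP by auto
  qed
  show "closed_map (top_of_set D) (real_locus P) (point u)"
    unfolding closed_map_def
  proof (intro allI impI)
    fix A assume A: "closedin (top_of_set D) A"
    then have "compact A" "A \<subseteq> interior P"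
      using closedin_compact[OF assms(2)] closedin_imp_subset assms(1) by blast+
    then show "closedin (real_locus P) (point u ` A)" using closedin_point_image compact_imp_closed by blast
  qed
qed

lemma connectedin_point_image:
  assumes "S \<subseteq> P" "connected S"
  shows "connectedin (real_locus P) (point u ` S)"
  by (rule connectedin_continuous_map_image[OF continuous_map_point])
    (use assms in \<open>simp add: connectedin_subtopology\<close>)

text \<open>The cell of an edge consists of the points at which both ends have maximal coordinate,
  and the condition on u says that the ends carry different signs in the orthant u.\<close>

lemma T_hypersurface_eq:
  "T_hypersurface P K \<epsilon> = {point u x |u x. x \<in> P \<and> (\<exists>a\<in>maxset x. \<exists>b\<in>maxset x. sg \<epsilon> u a \<noteq> sg \<epsilon> u b)}"
    (is "_ = ?R")
proof -
  have sgn: "pairing2 (mod2 (a - b)) u + \<epsilon> a + \<epsilon> b = 1 \<longleftrightarrow> sg \<epsilon> u a \<noteq> sg \<epsilon> u b"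
    if "\<tau> \<in> K" "a \<in> verts \<tau>" "b \<in> verts \<tau>" for \<tau> a b u
  proof -
    have "mod2 (a - b) = mod2 a + mod2 b" using mod2_diff verts_int[OF that(1)] that by blast
    moreover have "p + e + f = 1 \<longleftrightarrow> p \<noteq> e + f" for p e f :: bit
      by (cases p; cases e; cases f) simp_all
    ultimately show ?thesis unfolding sg_eq_iff by simp
  qed
  have "r \<in> ?R" if r: "r \<in> T_hypersurface P K \<epsilon>" for r
  proof -
    obtain u s a b where s: "r \<in> real_locus_image P ({u} \<times> cell_points K (s, P))" "s \<in> K" "aff_dim s = 1"
      and ab: "{v. v extreme_point_of s} = {a, b}" "pairing2 (mod2 (a - b)) u + \<epsilon> a + \<epsilon> b = 1"
      using r unfolding T_hypersurface_def by blast
    have ne: "s \<noteq> {}" using s(3) by auto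
    have v: "verts s = {a, b}" using ab(1) by (simp add: verts_def)
    obtain x where x: "x \<in> P" "{a, b} \<subseteq> maxset x" "r = point u x"
      using s(1) unfolding cell_points_eq[OF s(2) ne] v real_locus_image_def point_def by blast
    have "sg \<epsilon> u a \<noteq> sg \<epsilon> u b" using sgn[OF s(2), of a b u] v ab(2) by simp
    then show ?thesis using x by blast
  qed
  moreover have "point u x \<in> T_hypersurface P K \<epsilon>"
    if x: "x \<in> P" and ab: "a \<in> maxset x" "b \<in> maxset x" "sg \<epsilon> u a \<noteq> sg \<epsilon> u b" for u x a b
  proof -
    obtain \<tau> where t: "\<tau> \<in> K" "x \<in> \<tau>" using x Union_K by blast
    have abt: "a \<in> verts \<tau>" "b \<in> verts \<tau>" using maxset_subset_verts[OF t] ab by blast+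
    have ne: "a \<noteq> b" using ab(3) by blast
    let ?s = "convex hull {a, b}"
    have s: "?s \<in> K" "verts ?s = {a, b}" "?s \<noteq> {}" by (rule edge_simplex[OF t(1) abt])+
    have d: "aff_dim ?s = 1" using ne by (simp add: aff_dim_convex_hull aff_dim_2)
    have e: "{v. v extreme_point_of ?s} = {a, b}" using s(2) by (simp add: verts_def)
    have p: "pairing2 (mod2 (a - b)) u + \<epsilon> a + \<epsilon> b = 1" using sgn[OF t(1) abt] ab(3) by simp
    have "x \<in> cell_points K (?s, P)" unfolding cell_points_eq[OF s(1,3)] s(2) using x ab by simp
    then have "point u x \<in> real_locus_image P ({u} \<times> cell_points K (?s, P))"
      unfolding real_locus_image_def point_def by blast
    then show ?thesis unfolding T_hypersurface_def using s(1) d ne e p by blast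
  qed
  ultimately show ?thesis by blast
qed

lemma T_hypersurface_subset: "T_hypersurface P K \<epsilon> \<subseteq> topspace (real_locus P)"
  unfolding T_hypersurface_eq topspace_real_locus by blast

lemma hypersurface_cell:
  assumes "\<tau> \<in> K" "a \<in> verts \<tau>" "b \<in> verts \<tau>" "sg \<epsilon> u a \<noteq> sg \<epsilon> u b"
  shows "connectedin (subtopology (real_locus P) (T_hypersurface P K \<epsilon>)) (point u ` {x \<in> P. {a, b} \<subseteq> maxset x})"
proof -
  note s = edge_simplex[OF assms(1-3)]
  have "connected {x \<in> P. {a, b} \<subseteq> maxset x}"
    using connected_max_cell[OF s(1,3)] unfolding s(2) Union_K .
  then have "connectedin (real_locus P) (point u ` {x \<in> P. {a, b} \<subseteq> maxset x})"
    by (rule connectedin_point_image[rotated]) blast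
  moreover have "point u ` {x \<in> P. {a, b} \<subseteq> maxset x} \<subseteq> T_hypersurface P K \<epsilon>"
    unfolding T_hypersurface_eq using assms(4) by blast
  ultimately show ?thesis by (simp add: connectedin_subtopology)
qed

subsection \<open>Dual cells of interior vertices\<close>

definition dual_cell :: "real ^ 'd \<Rightarrow> (real ^ 'd) set"
  where "dual_cell v = {x \<in> P. v \<in> maxset x}"

text \<open>For an interior vertex v this is the boundary of the ball [v, P]: the points at which
  some other vertex ties with v for the largest coordinate.\<close>

definition dual_sphere :: "real ^ 'd \<Rightarrow> (real ^ 'd) set"
  where "dual_sphere v = {x \<in> P. v \<in> maxset x \<and> maxset x \<noteq> {v}}"

lemma bc_zero_off_vertices: "x \<in> P \<Longrightarrow> w \<notin> vertices \<Longrightarrow> bc x w = 0"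
  using Union_K bc_zero verts_subset_vertices by blast

lemma bc_nonneg_P: "x \<in> P \<Longrightarrow> 0 \<le> bc x w"
  using Union_K bc_nonneg by blast

text \<open>On a facet the whole carrier of x, which contains v, would lie in the facet.\<close>

lemma bc_pos_interior:
  assumes v: "v \<in> interior P" and x: "x \<in> P" "bc x v > 0"
  shows "x \<in> interior P"
proof (rule ccontr)
  assume "x \<notin> interior P"
  then obtain F where F: "F facet_of P" "x \<in> F" using boundary_in_facet x(1) by blast
  have "v \<in> convex hull (carrier x)" using x(2) by (intro hull_inc) (simp add: carrier_def)
  then have "v \<in> F" using face_contains_carrier[OF facet_face(1)[OF F(1)] F(2)] by blast
  then show False using interior_facet_disjoint[OF facet_face(1,2)[OF F(1)]] v by blast
qed

lemma maxset_bc_pos: "x \<in> P \<Longrightarrow> v \<in> maxset x \<Longrightarrow> bc x v > 0"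
  using maxset_subset_carrier[of x] unfolding Union_K carrier_def by blast

lemma dual_cell_subset_interior: "v \<in> interior P \<Longrightarrow> dual_cell v \<subseteq> interior P"
  unfolding dual_cell_def using bc_pos_interior maxset_bc_pos by blast

lemma dual_sphere_eq: "dual_sphere v = {x \<in> dual_cell v. maxset x \<noteq> {v}}"
  by (auto simp: dual_sphere_def dual_cell_def)

lemma continuous_on_bc_P: "continuous_on P (\<lambda>x. bc x v)"
  using continuous_on_bc unfolding Union_K .

lemma open_bc_pos:
  assumes "v \<in> interior P"
  shows "open {x \<in> P. bc x v > 0}"
proof -
  have "closed {x \<in> P. bc x v \<le> 0}"
    by (intro continuous_on_closed_Collect_le continuous_on_bc_P continuous_on_const closed_P)
  moreover have "{x \<in> P. bc x v > 0} = interior P - {x \<in> P. bc x v \<le> 0}"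
    using bc_pos_interior[OF assms] interior_subset[of P] by force
  ultimately show ?thesis using open_Diff by auto
qed

lemma compact_dual_cell:
  assumes "v \<in> vertices"
  shows "compact (dual_cell v)"
proof -
  have "dual_cell v = P \<inter> (\<Inter>w. {x \<in> P. bc x w \<le> bc x v})"
    using assms by (auto simp: dual_cell_def maxset_def)
  moreover have "closed {x \<in> P. bc x w \<le> bc x v}" for w
    by (intro continuous_on_closed_Collect_le continuous_on_bc_P closed_P)
  ultimately show ?thesis using compact_P by (auto intro!: compact_Int_closed)
qed

lemma maxset_eq_singleton_iff:
  assumes "v \<in> vertices" "x \<in> P"
  shows "maxset x = {v} \<longleftrightarrow> (\<forall>w\<in>vertices - {v}. bc x w < bc x v)"
proof
  assume eq: "maxset x = {v}"
  show "\<forall>w\<in>vertices - {v}. bc x w < bc x v"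
  proof (rule ballI, rule ccontr)
    fix w assume w: "w \<in> vertices - {v}" "\<not> bc x w < bc x v"
    have "\<forall>z. bc x z \<le> bc x v" using eq by (auto simp: maxset_def)
    then have "\<forall>z. bc x z \<le> bc x w" using w(2) by (meson linorder_not_less order_trans)
    then have "w \<in> maxset x" using w(1) by (simp add: maxset_def)
    then show False using eq w(1) by blast
  qed
next
  assume r: "\<forall>w\<in>vertices - {v}. bc x w < bc x v"
  have "bc x w \<le> bc x v" for w
  proof (cases "w \<in> vertices - {v}")
    case False
    then show ?thesis using bc_zero_off_vertices[OF assms(2), of w] bc_nonneg_P[OF assms(2), of v] by (cases "w = v") simp_all
  next
    case True
    then show ?thesis using r less_imp_le by blast
  qed
  moreover have "\<not> bc x v \<le> bc x w" if "w \<in> vertices" "w \<noteq> v" for w using r that by (simp add: not_le)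
  ultimately show "maxset x = {v}" using assms(1) unfolding maxset_def by blast
qed

text \<open>Strict inequalities are open, which gives one inclusion. For the other, when w ties with
  v, a small move towards w makes the coordinate of w the larger one and leaves the cell.\<close>

lemma interior_dual_cell:
  assumes v: "v \<in> vertices" "v \<in> interior P"
  shows "interior (dual_cell v) = {x \<in> P. maxset x = {v}}" (is "_ = ?O")
proof
  show "?O \<subseteq> interior (dual_cell v)"
  proof (rule interior_maximal)
    show "?O \<subseteq> dual_cell v" by (auto simp: dual_cell_def)
    let ?C = "\<Union>w\<in>vertices - {v}. {x \<in> P. bc x v \<le> bc x w}"
    have "closed ?C"
      by (intro closed_UN finite_Diff finite_vertices ballI continuous_on_closed_Collect_le continuous_on_bc_P closed_P)
    moreover have "?O = interior P - ?C"
    proof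
      show "?O \<subseteq> interior P - ?C"
      proof
        fix x assume x: "x \<in> ?O"
        then have "x \<in> interior P" using dual_cell_subset_interior[OF v(2)] by (auto simp: dual_cell_def)
        moreover have "\<forall>w\<in>vertices - {v}. bc x w < bc x v" using maxset_eq_singleton_iff[OF v(1)] x by blast
        ultimately show "x \<in> interior P - ?C" by (auto simp: not_le[symmetric])
      qed
      show "interior P - ?C \<subseteq> ?O"
      proof
        fix x assume x: "x \<in> interior P - ?C"
        then have "x \<in> P" using interior_subset by blast
        moreover from this have "maxset x = {v}" using x by (subst maxset_eq_singleton_iff[OF v(1)]) (auto simp: not_le)
        ultimately show "x \<in> ?O" by blast
      qed
    qed
    ultimately show "open ?O" using open_Diff by auto
  qed
  show "interior (dual_cell v) \<subseteq> ?O"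
  proof
    fix x assume x: "x \<in> interior (dual_cell v)"
    then have D: "x \<in> dual_cell v" using interior_subset by blast
    then have xP: "x \<in> P" and xv: "v \<in> maxset x" by (auto simp: dual_cell_def)
    have "w = v" if w: "w \<in> maxset x" for w
    proof (rule ccontr)
      assume ne: "w \<noteq> v"
      obtain \<tau> where t: "\<tau> \<in> K" "x \<in> \<tau>" using xP Union_K by blast
      have wt: "w \<in> verts \<tau>" using maxset_subset_verts[OF t] w by blast
      then have wt': "w \<in> \<tau>" using verts_sub[OF t(1)] by blast
      obtain e where e: "e > 0" "ball x e \<subseteq> dual_cell v" using x mem_interior by metis
      define s where "s = min 1 (e / (2 * (1 + norm (w - x))))"
      have s: "0 < s" "s \<le> 1" using e(1) by (auto simp: s_def add_pos_nonneg)
      let ?y = "(1 - s) *\<^sub>R x + s *\<^sub>R w"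
      have "?y - x = s *\<^sub>R (w - x)" by (simp add: algebra_simps)
      then have "dist x ?y = s * norm (w - x)" using s(1) by (simp add: dist_norm norm_minus_commute[of x])
      also have "\<dots> \<le> e / (2 * (1 + norm (w - x))) * (1 + norm (w - x))"
        using s(1) e(1) by (intro mult_mono) (auto simp: s_def)
      also have "\<dots> = e / 2" 
      proof -
        have "e / (2 * c) * c = e / 2" if "c > 0" for c :: real using that by simp
        then show ?thesis using norm_ge_zero[of "w - x"] by (metis add_pos_nonneg zero_less_one)
      qed
      finally have "?y \<in> dual_cell v" using e by (auto simp: subset_iff)
      then have "bc ?y w \<le> bc ?y v" by (auto simp: dual_cell_def maxset_def)
      moreover have "bc ?y w = (1 - s) * bc x w + s" "bc ?y v = (1 - s) * bc x v"
        using bc_convex_combination[OF t wt', of s] bc_vertex[OF t(1) wt] s ne by auto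
      moreover have "bc x v \<le> bc x w" using w by (simp add: maxset_def)
      then have "(1 - s) * bc x v \<le> (1 - s) * bc x w" using s by (simp add: mult_left_mono)
      ultimately show False using s(1) by simp
    qed
    then show "x \<in> ?O" using xP xv by blast
  qed
qed

text \<open>At v its own coordinate is 1 and all others are 0, so along a segment from v to a point
  of the cell v is the strict maximum before the end. The cell is compact and starlike about v with
  these open segments in its interior, hence a ball.\<close>

lemma dual_cell_homeomorphic_ball:
  assumes v: "v \<in> vertices" "v \<in> interior P"
  obtains h k where "homeomorphism (cball (0 :: real ^ 'd) 1) (dual_cell v) h k" "h ` sphere 0 1 = dual_sphere v"
proof -
  let ?D = "dual_cell v"
  note int = interior_dual_cell[OF v]
  have vP: "v \<in> P" using v(2) interior_subset by blast
  obtain \<tau>0 where t0: "\<tau>0 \<in> K" "v \<in> verts \<tau>0" using v(1) by (auto simp: vertices_def)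
  have bv: "bc v = (\<lambda>w. if w = v then 1 else 0)" by (rule bc_vertex[OF t0])
  have "maxset v = {v}" unfolding maxset_eq_singleton_iff[OF v(1) vP] bv by simp
  then have vi: "v \<in> interior ?D" using int vP by blast
  then have ri: "rel_interior ?D = interior ?D" by (intro rel_interior_nonempty_interior) blast
  have "?D homeomorphic cball v 1 \<inter> affine hull ?D"
  proof (rule starlike_compact_projective2)
    show "compact ?D" by (rule compact_dual_cell[OF v(1)])
    show "v \<in> rel_interior ?D" unfolding ri by (rule vi)
    fix y assume y: "y \<in> ?D"
    then have yP: "y \<in> P" and yv: "v \<in> maxset y" by (auto simp: dual_cell_def)
    obtain \<tau> where t: "\<tau> \<in> K" "y \<in> \<tau>" using yP Union_K by blast
    have vt: "v \<in> verts \<tau>" using maxset_subset_verts[OF t] yv by blast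
    then have vt': "v \<in> \<tau>" using verts_sub[OF t(1)] by blast
    show "open_segment v y \<subseteq> rel_interior ?D"
    proof
      fix x assume "x \<in> open_segment v y"
      then obtain s where s: "0 < s" "s < 1" "x = (1 - s) *\<^sub>R v + s *\<^sub>R y" by (auto simp: in_segment)
      have xt: "x \<in> \<tau>"
        unfolding s(3) using convexD_alt[OF convex_simplex[OF t(1)] vt' t(2), of s] s by simp
      then have xP: "x \<in> P" using t(1) Union_K by blast
      have b: "bc x w = (1 - s) * bc v w + s * bc y w" for w
        unfolding s(3) by (rule bc_convex_combination[OF t(1) vt' t(2)]) (use s in auto)
      have "maxset x = {v}"
        unfolding maxset_eq_singleton_iff[OF v(1) xP]
      proof
        fix w assume w: "w \<in> vertices - {v}"
        have "bc y w \<le> bc y v" using yv by (simp add: maxset_def)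
        then have "s * bc y w \<le> s * bc y v" using s by simp
        then have "s * bc y w < 1 - s + s * bc y v" using s(2) by linarith
        then show "bc x w < bc x v" unfolding b bv using w by simp
      qed
      then show "x \<in> rel_interior ?D" unfolding ri int using xP by blast
    qed
  qed
  also have "affine hull ?D = UNIV" by (rule affine_hull_nonempty_interior) (use vi in blast)
  also have "cball v 1 \<inter> UNIV homeomorphic cball (0 :: real ^ 'd) 1"
    by (simp add: homeomorphic_balls)
  finally obtain h k where hk: "homeomorphism (cball (0 :: real ^ 'd) 1) ?D h k"
    unfolding homeomorphic_def using homeomorphism_symD by blast
  have inj: "inj_on h (cball 0 1)" "inj_on k ?D"
    using hk unfolding homeomorphism_def by (metis inj_on_inverseI)+
  have img: "h ` cball 0 1 = ?D" "k ` ?D = cball 0 1" using hk by (auto simp: homeomorphism_def)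
  \<comment> \<open>By invariance of domain h and its inverse map interiors into interiors, so the
    unit sphere corresponds to the points of the cell outside its interior.\<close>
  have "h \<in> interior (cball 0 1) \<rightarrow> interior (h ` cball 0 1)"
    by (rule continuous_image_subset_interior) (use hk inj in \<open>auto simp: homeomorphism_def\<close>)
  then have 1: "h ` ball 0 1 \<subseteq> interior ?D" unfolding img by auto
  have "k \<in> interior ?D \<rightarrow> interior (k ` ?D)"
    by (rule continuous_image_subset_interior) (use hk inj in \<open>auto simp: homeomorphism_def\<close>)
  then have 2: "k y \<in> ball 0 1" if "y \<in> interior ?D" for y using that unfolding img by auto
  have "interior ?D \<subseteq> h ` ball 0 1"
  proof
    fix y assume y: "y \<in> interior ?D"
    then have "h (k y) = y" using hk interior_subset unfolding homeomorphism_def by blast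
    then show "y \<in> h ` ball 0 1" using 2[OF y] by force
  qed
  with 1 have ball: "h ` ball 0 1 = interior ?D" by blast
  have "sphere (0 :: real ^ 'd) 1 = cball 0 1 - ball 0 1" by auto
  then have "h ` sphere 0 1 = h ` cball 0 1 - h ` ball 0 1"
    using inj_on_image_set_diff[OF inj(1), of "cball 0 1" "ball 0 1"] by auto
  also have "\<dots> = dual_sphere v" unfolding img ball int dual_sphere_eq by (auto simp: dual_cell_def)
  finally show thesis using that hk by blast
qed

lemma sphere_bounding_ball_dual:
  assumes v: "v \<in> vertices" "v \<in> interior P"
  shows "sphere_bounding_ball P (point u ` dual_sphere v) (point u ` dual_cell v)"
proof -
  have sub: "dual_cell v \<subseteq> interior P" by (rule dual_cell_subset_interior[OF v(2)])
  then have B: "point u ` dual_cell v \<subseteq> topspace (real_locus P)"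
    using interior_subset unfolding topspace_real_locus by blast
  obtain h k where hk: "homeomorphism (cball (0 :: real ^ 'd) 1) (dual_cell v) h k" and s: "h ` sphere 0 1 = dual_sphere v"
    using dual_cell_homeomorphic_ball[OF v] by blast
  have img: "h ` cball 0 1 = dual_cell v" using hk by (simp add: homeomorphism_def)
  have "homeomorphic_map (top_of_set (cball 0 1)) (top_of_set (dual_cell v)) h"
    unfolding homeomorphic_map_maps homeomorphic_maps_def
    by (rule exI[of _ k]) (use hk in \<open>auto simp: homeomorphism_def\<close>)
  then have "embedding_map (top_of_set (cball 0 1)) (top_of_set (dual_cell v)) h"
    unfolding surjective_embedding_map[symmetric] by blast
  from embedding_map_compose[OF this embedding_map_point[OF sub compact_dual_cell[OF v(1)], of u]]
  have "homeomorphic_map (top_of_set (cball 0 1)) (subtopology (real_locus P) (point u ` dual_cell v)) (point u \<circ> h)"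
    unfolding embedding_map_def topspace_euclidean_subtopology image_comp[symmetric] img .
  moreover have "(point u \<circ> h) ` sphere 0 1 = point u ` dual_sphere v" unfolding image_comp[symmetric] s ..
  ultimately show ?thesis unfolding sphere_bounding_ball_def using B by blast
qed

lemma dual_cell_torus: "v \<in> interior P \<Longrightarrow> point u ` dual_cell v \<subseteq> torus P"
  unfolding torus_def real_locus_image_def point_def using dual_cell_subset_interior by blast

lemma dual_sphere_closed_connected:
  assumes v: "v \<in> vertices" "v \<in> interior P" and d2: "CARD('d) \<ge> 2"
  shows "closed (dual_sphere v)" "connected (dual_sphere v)" "dual_sphere v \<noteq> {}"
proof -
  obtain h k where hk: "homeomorphism (cball (0 :: real ^ 'd) 1) (dual_cell v) h k" and s: "h ` sphere 0 1 = dual_sphere v"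
    using dual_cell_homeomorphic_ball[OF v] by blast
  have c: "continuous_on (sphere 0 1) h"
    using hk continuous_on_subset[OF _ sphere_cball] unfolding homeomorphism_def by blast
  show "closed (dual_sphere v)" unfolding s[symmetric]
    by (intro compact_imp_closed compact_continuous_image c) simp
  show "connected (dual_sphere v)" unfolding s[symmetric]
    by (intro connected_continuous_image c connected_sphere) (use d2 in simp)
  show "dual_sphere v \<noteq> {}" unfolding s[symmetric] by simp
qed

end

section \<open>Components of the hypersurface\<close>

context primitive_triangulated
begin

lemma hypersurface_point_in_chamber:
  assumes "r \<in> T_hypersurface P K \<epsilon>"
  obtains u x \<tau> a b where "r = point u x" "x \<in> P" "\<tau> \<in> chambers" "x \<in> \<tau>"
    "a \<in> maxset x" "b \<in> maxset x" "a \<in> verts \<tau>" "b \<in> verts \<tau>" "sg \<epsilon> u a \<noteq> sg \<epsilon> u b"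
proof -
  obtain u x a b where x: "r = point u x" "x \<in> P" "a \<in> maxset x" "b \<in> maxset x" "sg \<epsilon> u a \<noteq> sg \<epsilon> u b"
    using assms unfolding T_hypersurface_eq by blast
  obtain \<sigma> where s: "\<sigma> \<in> K" "x \<in> \<sigma>" using x(2) Union_K by blast
  obtain \<tau> where t: "\<tau> \<in> chambers" "\<sigma> \<subseteq> \<tau>" using chamber_above[OF s(1)] by blast
  have "x \<in> \<tau>" using s t by blast
  then have "maxset x \<subseteq> verts \<tau>" by (rule maxset_subset_verts[OF chamber_K[OF t(1)]])
  then show thesis using that x t(1) \<open>x \<in> \<tau>\<close> by blast
qed

text \<open>In the orthant U the vertex v is alone with its sign in its star. At a point with
  positive coordinate at v, two maximal vertices of different sign must therefore include v. The
  right-hand side meets the hypersurface with an open set, so the sphere is open in it.\<close>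

lemma dual_sphere_hypersurface:
  assumes v: "v \<in> interior P" and U: "orthant_of \<epsilon> v U"
  shows "point U ` dual_sphere v = T_hypersurface P K \<epsilon> \<inter> point U ` {x \<in> P. bc x v > 0}"
proof
  show "point U ` dual_sphere v \<subseteq> T_hypersurface P K \<epsilon> \<inter> point U ` {x \<in> P. bc x v > 0}"
  proof
    fix r assume "r \<in> point U ` dual_sphere v"
    then obtain x where x: "r = point U x" "x \<in> P" "v \<in> maxset x" "maxset x \<noteq> {v}"
      by (auto simp: dual_sphere_def)
    then obtain w where w: "w \<in> maxset x" "w \<noteq> v" by blast
    obtain \<sigma> where s: "\<sigma> \<in> K" "x \<in> \<sigma>" using x(2) Union_K by blast
    obtain \<tau> where t: "\<tau> \<in> chambers" "\<sigma> \<subseteq> \<tau>" using chamber_above[OF s(1)] by blast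
    have "maxset x \<subseteq> verts \<tau>" using maxset_subset_verts[OF chamber_K[OF t(1)]] s t by blast
    then have "sg \<epsilon> U v \<noteq> sg \<epsilon> U w" using sg_orthant[OF U t(1), of v w] x(3) w by auto
    then show "r \<in> T_hypersurface P K \<epsilon> \<inter> point U ` {x \<in> P. bc x v > 0}"
      unfolding T_hypersurface_eq using x w maxset_bc_pos by blast
  qed
  show "T_hypersurface P K \<epsilon> \<inter> point U ` {x \<in> P. bc x v > 0} \<subseteq> point U ` dual_sphere v"
  proof
    fix r assume r: "r \<in> T_hypersurface P K \<epsilon> \<inter> point U ` {x \<in> P. bc x v > 0}"
    then obtain x where x: "r = point U x" "x \<in> P" "bc x v > 0" by blast
    have "r \<in> T_hypersurface P K \<epsilon>" using r by blast
    then obtain u' x' \<tau> a b where t: "r = point u' x'" "x' \<in> P" "\<tau> \<in> chambers" "x' \<in> \<tau>"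
      "a \<in> maxset x'" "b \<in> maxset x'" "a \<in> verts \<tau>" "b \<in> verts \<tau>" "sg \<epsilon> u' a \<noteq> sg \<epsilon> u' b"
      by (rule hypersurface_point_in_chamber)
    have "x = x'" "U = u'"
      using point_interior_eq_iff[OF bc_pos_interior[OF v x(2,3)], of U u' x'] x(1) t(1) by simp_all
    then have ab: "a \<in> maxset x" "b \<in> maxset x" "sg \<epsilon> U a \<noteq> sg \<epsilon> U b" and xt: "x \<in> \<tau>" using t by simp_all
    have "v \<in> verts \<tau>" using bc_zero[OF chamber_K[OF t(3)] xt, of v] x(3) by force
    then have "(if a = v then 1 else 0 :: bit) \<noteq> (if b = v then 1 else 0)"
      using sg_orthant[OF U t(3) _ t(7,8)] ab(3) by blast
    then have "v \<in> maxset x \<and> maxset x \<noteq> {v}" using ab(1,2) by (auto split: if_splits)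
    then show "r \<in> point U ` dual_sphere v" using x by (auto simp: dual_sphere_def)
  qed
qed

lemma clopen_dual_sphere:
  assumes d2: "CARD('d) \<ge> 2" and v: "v \<in> vertices" "v \<in> interior P" and U: "orthant_of \<epsilon> v U"
  shows "openin (subtopology (real_locus P) (T_hypersurface P K \<epsilon>)) (point U ` dual_sphere v)"
    "closedin (subtopology (real_locus P) (T_hypersurface P K \<epsilon>)) (point U ` dual_sphere v)"
    "connectedin (subtopology (real_locus P) (T_hypersurface P K \<epsilon>)) (point U ` dual_sphere v)"
proof -
  note eq = dual_sphere_hypersurface[OF v(2) U]
  note cc = dual_sphere_closed_connected[OF v d2]
  have sub: "point U ` dual_sphere v \<subseteq> T_hypersurface P K \<epsilon>" unfolding eq by blast
  have "openin (real_locus P) (point U ` {x \<in> P. bc x v > 0})"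
    by (rule openin_point_image[OF _ open_bc_pos[OF v(2)]]) (use bc_pos_interior[OF v(2)] in blast)
  then show "openin (subtopology (real_locus P) (T_hypersurface P K \<epsilon>)) (point U ` dual_sphere v)"
    unfolding eq openin_subtopology by blast
  have "dual_sphere v \<subseteq> interior P" using dual_cell_subset_interior[OF v(2)] unfolding dual_sphere_eq by blast
  then have "closedin (real_locus P) (point U ` dual_sphere v)" using closedin_point_image cc(1) by blast
  then show "closedin (subtopology (real_locus P) (T_hypersurface P K \<epsilon>)) (point U ` dual_sphere v)"
    using sub unfolding closedin_subtopology by blast
  have "connectedin (real_locus P) (point U ` dual_sphere v)"
    by (rule connectedin_point_image[OF _ cc(2)]) (auto simp: dual_sphere_def)
  then show "connectedin (subtopology (real_locus P) (T_hypersurface P K \<epsilon>)) (point U ` dual_sphere v)"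
    using sub by (simp add: connectedin_subtopology)
qed

text \<open>
  If two vertices of a chamber had the same orthant \<open>U\<close>, then together with a third vertex of the
  chamber they would carry three pairwise different signs.
\<close>

lemma dual_cells_disjoint:
  assumes d2: "CARD('d) \<ge> 2" and v: "v \<in> interior P" "w \<in> interior P" "v \<noteq> w"
    and U: "orthant_of \<epsilon> v U" "orthant_of \<epsilon> w U'"
  shows "point U ` dual_cell v \<inter> point U' ` dual_cell w = {}"
proof (rule ccontr)
  assume "\<not> ?thesis"
  then obtain x x' where x: "x \<in> dual_cell v" "x' \<in> dual_cell w" "point U x = point U' x'" by blast
  have "x \<in> interior P" using dual_cell_subset_interior[OF v(1)] x(1) by blast
  then have e: "x = x'" "U = U'" using point_interior_eq_iff x(3) by blast+
  have xP: "x \<in> P" and m: "v \<in> maxset x" "w \<in> maxset x" using x e by (auto simp: dual_cell_def)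
  obtain \<sigma> where s: "\<sigma> \<in> K" "x \<in> \<sigma>" using xP Union_K by blast
  obtain \<tau> where t: "\<tau> \<in> chambers" "\<sigma> \<subseteq> \<tau>" using chamber_above[OF s(1)] by blast
  have vw: "v \<in> verts \<tau>" "w \<in> verts \<tau>" using maxset_subset_verts[OF chamber_K[OF t(1)]] s t m by blast+
  have "\<not> verts \<tau> \<subseteq> {v, w}"
    using card_verts_chamber[OF t(1)] card_mono[of "{v, w}" "verts \<tau>"] d2 v(3) by auto
  then obtain z where z: "z \<in> verts \<tau>" "z \<noteq> v" "z \<noteq> w" by blast
  have "sg \<epsilon> U v \<noteq> sg \<epsilon> U w" "sg \<epsilon> U v \<noteq> sg \<epsilon> U z"
    using sg_orthant[OF U(1) t(1) vw(1), of v w] sg_orthant[OF U(1) t(1) vw(1), of v z] vw z v(3) by auto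
  moreover have "sg \<epsilon> U w \<noteq> sg \<epsilon> U z"
    using sg_orthant[OF U(2) t(1) vw(2), of w z] vw z unfolding e by auto
  ultimately show False by (cases "sg \<epsilon> U v"; cases "sg \<epsilon> U w"; cases "sg \<epsilon> U z") simp_all
qed

text \<open>The cell of an edge is connected and contains the barycenters of all simplices with that
  edge, so T contains all or none of them. At a facet the orthants u and u + q are glued at the
  barycenter of the wall, which links the two barycenters of the chamber.\<close>

lemma locally_constant_clopen:
  assumes T: "openin (subtopology (real_locus P) (T_hypersurface P K \<epsilon>)) T"
    "closedin (subtopology (real_locus P) (T_hypersurface P K \<epsilon>)) T"
  shows "locally_constant \<epsilon> (\<lambda>\<tau> u. if point u (barycenter \<tau>) \<in> T then 1 else 0)"
proof -
  have cell: "point u x \<in> T \<longleftrightarrow> point u y \<in> T"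
    if "\<tau> \<in> K" "a \<in> verts \<tau>" "b \<in> verts \<tau>" "sg \<epsilon> u a \<noteq> sg \<epsilon> u b"
      "x \<in> P" "y \<in> P" "{a, b} \<subseteq> maxset x" "{a, b} \<subseteq> maxset y" for \<tau> a b u x y
  proof -
    let ?E = "point u ` {x \<in> P. {a, b} \<subseteq> maxset x}"
    have "?E \<subseteq> T \<or> disjnt ?E T" by (rule connectedin_clopen_cases[OF hypersurface_cell[OF that(1-4)] T(2,1)])
    moreover have "point u x \<in> ?E" "point u y \<in> ?E" using that by blast+
    ultimately show ?thesis unfolding disjnt_def by blast
  qed
  have bary: "barycenter \<tau> \<in> P" if "\<tau> \<in> K" "\<tau> \<noteq> {}" for \<tau>
    using barycenter_mem[OF that] that(1) Union_K by blast
  show ?thesis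
    unfolding locally_constant_def
  proof (intro conjI ballI allI impI)
    fix \<tau>1 \<tau>2 u
    assume t: "\<tau>1 \<in> chambers" "\<tau>2 \<in> chambers" "\<tau>1 \<inter> \<tau>2 \<in> walls"
      and "\<exists>v\<in>verts (\<tau>1 \<inter> \<tau>2). \<exists>w\<in>verts (\<tau>1 \<inter> \<tau>2). sg \<epsilon> u v \<noteq> sg \<epsilon> u w"
    then obtain a b where "a \<in> verts (\<tau>1 \<inter> \<tau>2)" "b \<in> verts (\<tau>1 \<inter> \<tau>2)" and ne: "sg \<epsilon> u a \<noteq> sg \<epsilon> u b" by blast
    then have ab: "a \<in> verts \<tau>1" "a \<in> verts \<tau>2" "b \<in> verts \<tau>1" "b \<in> verts \<tau>2"
      using verts_Int chamber_K t by blast+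
    have "point u (barycenter \<tau>1) \<in> T \<longleftrightarrow> point u (barycenter \<tau>2) \<in> T"
      by (rule cell[OF chamber_K[OF t(1)] ab(1,3) ne])
        (use ab bary[OF chamber_K[OF t(1)] chamber_nonempty[OF t(1)]] bary[OF chamber_K[OF t(2)] chamber_nonempty[OF t(2)]]
          maxset_barycenter[OF chamber_K[OF t(1)] chamber_nonempty[OF t(1)]]
          maxset_barycenter[OF chamber_K[OF t(2)] chamber_nonempty[OF t(2)]] in simp_all)
    then show "(if point u (barycenter \<tau>1) \<in> T then 1 else 0 :: bit) = (if point u (barycenter \<tau>2) \<in> T then 1 else 0)"
      by simp
  next
    fix \<tau> \<sigma> F q u
    assume t: "\<tau> \<in> chambers" and s: "\<sigma> \<in> walls" "\<sigma> \<subseteq> \<tau>" and F: "F facet_of P" "\<sigma> \<subseteq> F" and q: "q \<in> Sed F"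
      and "\<exists>v\<in>verts \<sigma>. \<exists>w\<in>verts \<sigma>. sg \<epsilon> u v \<noteq> sg \<epsilon> u w"
    then obtain a b where abs: "a \<in> verts \<sigma>" "b \<in> verts \<sigma>" and ne: "sg \<epsilon> u a \<noteq> sg \<epsilon> u b" by blast
    have ab: "a \<in> verts \<tau>" "b \<in> verts \<tau>"
      using abs subset_iff_verts[OF wall_K[OF s(1)] chamber_K[OF t]] s(2) by blast+
    have sK: "\<sigma> \<in> K" "\<sigma> \<noteq> {}" using wall_K[OF s(1)] wall_nonempty[OF s(1)] .
    have "q \<in> perp2 \<sigma>" using q perp2_facet[OF F(1) s(1) F(2)] by simp
    then have "pairing2 (mod2 a + mod2 b) q = 0" unfolding perp2_simplex[OF sK] using abs by blast
    then have ne': "sg \<epsilon> (u + q) a \<noteq> sg \<epsilon> (u + q) b" using ne unfolding sg_eq_iff pairing2_add_right by simp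
    have mem: "barycenter \<tau> \<in> P" "barycenter \<sigma> \<in> P" "{a, b} \<subseteq> maxset (barycenter \<tau>)" "{a, b} \<subseteq> maxset (barycenter \<sigma>)"
      unfolding maxset_barycenter[OF sK] maxset_barycenter[OF chamber_K[OF t] chamber_nonempty[OF t]]
      using bary[OF sK] bary[OF chamber_K[OF t] chamber_nonempty[OF t]] ab abs by simp_all
    have "barycenter \<sigma> \<in> F" using barycenter_mem[OF sK] F(2) by blast
    then have "q \<in> Sed (smallest_face P (barycenter \<sigma>))" using Sed_smallest_face[OF facet_face(1)[OF F(1)]] q by blast
    then have eq: "point (u + q) (barycenter \<sigma>) = point u (barycenter \<sigma>)"
      unfolding point_eq_iff[OF mem(2)] by (simp add: ac_simps)
    have "point (u + q) (barycenter \<tau>) \<in> T \<longleftrightarrow> point (u + q) (barycenter \<sigma>) \<in> T"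
      by (rule cell[OF chamber_K[OF t] ab ne' mem])
    also have "\<dots> \<longleftrightarrow> point u (barycenter \<tau>) \<in> T"
      unfolding eq by (rule cell[OF chamber_K[OF t] ab ne mem(2,1,4,3)])
    finally show "(if point (u + q) (barycenter \<tau>) \<in> T then 1 else 0 :: bit) = (if point u (barycenter \<tau>) \<in> T then 1 else 0)"
      by simp
  qed
qed

text \<open>A nonempty proper clopen part T of C would give a locally constant function on chambers
  and orthants that takes both values off the spheres, against
  \<open>locally_constant_off_spheres\<close>.\<close>

lemma hypersurface_minus_spheres:
  fixes \<epsilon> U
  defines "R \<equiv> subtopology (real_locus P) (T_hypersurface P K \<epsilon>)"
    and "C \<equiv> T_hypersurface P K \<epsilon> - (\<Union>v\<in>interior_vertices P K. point (U v) ` dual_sphere v)"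
  assumes d2: "CARD('d) \<ge> 2" and smooth: "smooth_lattice_polytope P"
    and U: "\<And>v. v \<in> interior_vertices P K \<Longrightarrow> orthant_of \<epsilon> v (U v)"
  shows "openin R C" "closedin R C" "connectedin R C"
proof -
  let ?S = "\<lambda>v. point (U v) ` dual_sphere v" and ?I = "interior_vertices P K"
  have top: "topspace R = T_hypersurface P K \<epsilon>"
    unfolding R_def using T_hypersurface_subset by (simp add: Int_absorb1)
  have clopen: "openin R (?S v)" "closedin R (?S v)" if "v \<in> ?I" for v
    unfolding R_def using clopen_dual_sphere[OF d2 _ _ U[OF that]] that unfolding interior_vertex by blast+
  have "closedin R (\<Union>v\<in>?I. ?S v)" using finite_interior_vertices clopen(2) by (intro closedin_Union) auto
  then show oC: "openin R C" unfolding C_def top[symmetric] by (rule openin_diff[OF openin_topspace])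
  have "openin R (\<Union>v\<in>?I. ?S v)" using clopen(1) by (intro openin_Union) auto
  then show cC: "closedin R C" unfolding C_def top[symmetric] by (rule closedin_diff[OF closedin_topspace])
  have no_proper: "T = {} \<or> T = C" if T: "openin R T" "closedin R T" "T \<subseteq> C" for T
  proof (rule ccontr)
    assume "\<not> ?thesis"
    then obtain p p' where p: "p \<in> T" "p \<in> C" "p' \<in> C" "p' \<notin> T" using T(3) by blast
    \<comment> \<open>A point of C shares a connected edge cell with the barycenter of a chamber in
      the same orthant. As C and T are clopen, the barycenter stays in C and has the same membership
      in T; lying off the spheres, it excludes the orthants U v.\<close>
    have rep: "\<exists>u \<tau>. \<tau> \<in> chambers \<and> u \<noteq> grad \<tau> \<epsilon> \<and> (\<forall>v\<in>?I. v \<in> verts \<tau> \<longrightarrow> u \<noteq> U v) \<and>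
        (r \<in> T \<longleftrightarrow> point u (barycenter \<tau>) \<in> T)" if r: "r \<in> C" for r
    proof -
      have "r \<in> T_hypersurface P K \<epsilon>" using r by (simp add: C_def)
      then obtain u x \<tau> a b where x: "r = point u x" "x \<in> P" "\<tau> \<in> chambers" "x \<in> \<tau>"
        and ab: "a \<in> maxset x" "b \<in> maxset x" "a \<in> verts \<tau>" "b \<in> verts \<tau>" "sg \<epsilon> u a \<noteq> sg \<epsilon> u b"
        by (rule hypersurface_point_in_chamber)
      let ?E = "point u ` {x \<in> P. {a, b} \<subseteq> maxset x}" and ?b = "barycenter \<tau>"
      have tK: "\<tau> \<in> K" "\<tau> \<noteq> {}" using chamber_K[OF x(3)] chamber_nonempty[OF x(3)] .
      have mb: "maxset ?b = verts \<tau>" by (rule maxset_barycenter[OF tK])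
      have bP: "?b \<in> P" using barycenter_mem[OF tK] tK(1) Union_K by blast
      have E: "connectedin R ?E" unfolding R_def by (rule hypersurface_cell[OF tK(1) ab(3-5)])
      have mem: "r \<in> ?E" "point u ?b \<in> ?E" using x ab bP mb by auto
      have CE: "?E \<subseteq> C \<or> disjnt ?E C" by (rule connectedin_clopen_cases[OF E cC oC])
      have TE: "?E \<subseteq> T \<or> disjnt ?E T" by (rule connectedin_clopen_cases[OF E T(2,1)])
      have bC: "point u ?b \<in> C" using CE mem r unfolding disjnt_def by blast
      have bT: "r \<in> T \<longleftrightarrow> point u ?b \<in> T" using TE mem unfolding disjnt_def by blast
      have g: "u \<noteq> grad \<tau> \<epsilon>"
        using grad[OF x(3) ab(3,4), of \<epsilon>] ab(5) unfolding sg_eq_iff by blast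
      have "u \<noteq> U v" if v: "v \<in> ?I" "v \<in> verts \<tau>" for v
      proof
        assume u: "u = U v"
        have "verts \<tau> \<noteq> {v}" using card_verts_chamber[OF x(3)] d2 by auto
        then have "?b \<in> dual_sphere v" using bP mb v(2) by (simp add: dual_sphere_def)
        then show False using bC u v(1) unfolding C_def by blast
      qed
      then show ?thesis using x(3) g bT by blast
    qed
    obtain u \<tau> where t: "\<tau> \<in> chambers" "u \<noteq> grad \<tau> \<epsilon>" "\<And>v. v \<in> ?I \<Longrightarrow> v \<in> verts \<tau> \<Longrightarrow> u \<noteq> U v"
      "point u (barycenter \<tau>) \<in> T" using rep[OF p(2)] p(1) by blast
    obtain u' \<tau>' where t': "\<tau>' \<in> chambers" "u' \<noteq> grad \<tau>' \<epsilon>" "\<And>v. v \<in> ?I \<Longrightarrow> v \<in> verts \<tau>' \<Longrightarrow> u' \<noteq> U v"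
      "point u' (barycenter \<tau>') \<notin> T" using rep[OF p(3)] p(4) by blast
    have "(if point u (barycenter \<tau>) \<in> T then 1 else 0 :: bit) = (if point u' (barycenter \<tau>') \<in> T then 1 else 0)"
      using locally_constant_off_spheres[OF d2 smooth locally_constant_clopen[OF T(1,2)[unfolded R_def]] U t(1-3) t'(1-3)]
      by blast
    then show False using t(4) t'(4) by simp
  qed
  have "connected_space (subtopology R C)"
    unfolding connected_space_clopen_in topspace_subtopology_subset[OF openin_subset[OF oC]]
  proof (intro allI impI, elim conjE)
    fix T assume T: "openin (subtopology R C) T" "closedin (subtopology R C) T"
    show "T = {} \<or> T = C"
      by (rule no_proper[OF openin_trans_full[OF T(1) oC] closedin_trans_full[OF T(2) cC] openin_imp_subset[OF T(1)]])
  qed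
  then show "connectedin R C" unfolding connectedin_def using openin_subset[OF oC] by blast
qed

lemma hypersurface_meets_facet:
  assumes F: "F facet_of P" and d2: "CARD('d) \<ge> 2"
  obtains u x where "x \<in> F" "x \<in> P" "x \<notin> interior P" "point u x \<in> T_hypersurface P K \<epsilon>"
proof -
  obtain \<sigma> where s: "\<sigma> \<in> walls" "\<sigma> \<subseteq> F" using facet_has_wall[OF F] by blast
  note sK = wall_K[OF s(1)] wall_nonempty[OF s(1)]
  obtain \<tau> where t: "\<tau> \<in> chambers" "\<sigma> \<subseteq> \<tau>" using chamber_above[OF sK(1)] by blast
  obtain a where a: "a \<in> verts \<sigma>" using card_verts_wall[OF s(1)] d2 by fastforce
  have "\<not> verts \<sigma> \<subseteq> {a}" using card_verts_wall[OF s(1)] card_mono[of "{a}" "verts \<sigma>"] d2 by auto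
  then obtain b where b: "b \<in> verts \<sigma>" "b \<noteq> a" by blast
  have ab: "a \<in> verts \<tau>" "b \<in> verts \<tau>"
    using a b subset_iff_verts[OF sK(1) chamber_K[OF t(1)]] t(2) by blast+
  \<comment> \<open>The orthant will be the gradient of h. Its pairing with the edge from a to b is
    \<epsilon> a + \<epsilon> b + 1, which makes the two signs differ.\<close>
  define h where "h = (\<lambda>z. if z = a then \<epsilon> a + \<epsilon> b + 1 else 0)"
  have "pairing2 (mod2 a + mod2 b) (grad \<tau> h) = \<epsilon> a + \<epsilon> b + 1" using grad[OF t(1) ab, of h] b(2) by (simp add: h_def)
  then have ne: "sg \<epsilon> (grad \<tau> h) a \<noteq> sg \<epsilon> (grad \<tau> h) b" unfolding sg_eq_iff by simp
  let ?x = "barycenter \<sigma>"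
  have x: "?x \<in> F" "?x \<in> P" using barycenter_mem[OF sK] s(2) sK(1) Union_K by blast+
  then have "?x \<notin> interior P" using interior_facet_disjoint[OF facet_face(1,2)[OF F]] by blast
  moreover have "point (grad \<tau> h) ?x \<in> T_hypersurface P K \<epsilon>"
    unfolding T_hypersurface_eq using x(2) a b(1) ne maxset_barycenter[OF sK] by blast
  ultimately show thesis using that x by blast
qed

theorem hypersurface_components:
  assumes d2: "CARD('d) \<ge> 2" and smooth: "smooth_lattice_polytope P"
    and U: "\<And>v. v \<in> interior_vertices P K \<Longrightarrow> orthant_of \<epsilon> v (U v)"
  shows "\<exists>\<S> C.
    connected_components_of (subtopology (real_locus P) (T_hypersurface P K \<epsilon>)) = insert C \<S> \<and>
    C \<notin> \<S> \<and> finite \<S> \<and> card \<S> = card (interior_vertices P K) \<and>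
    (\<exists>B. (\<forall>S\<in>\<S>. sphere_bounding_ball P S (B S) \<and> B S \<subseteq> torus P) \<and> disjoint_family_on B \<S>) \<and>
    (\<forall>F. F facet_of P \<longrightarrow> C \<inter> toric_divisor P F \<noteq> {})"
proof -
  let ?I = "interior_vertices P K"
  define S where "S v = point (U v) ` dual_sphere v" for v
  define D where "D v = point (U v) ` dual_cell v" for v
  define R where "R = subtopology (real_locus P) (T_hypersurface P K \<epsilon>)"
  define C where "C = T_hypersurface P K \<epsilon> - (\<Union>v\<in>?I. S v)"
  have I: "v \<in> vertices" "v \<in> interior P" if "v \<in> ?I" for v using that unfolding interior_vertex by blast+
  have top: "topspace R = T_hypersurface P K \<epsilon>"
    unfolding R_def using T_hypersurface_subset by (simp add: Int_absorb1)
  have SD: "S v \<subseteq> D v" for v unfolding S_def D_def dual_sphere_eq by blast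
  have Sne: "S v \<noteq> {}" if "v \<in> ?I" for v
    unfolding S_def using dual_sphere_closed_connected(3)[OF I[OF that] d2] by simp
  have disj: "D v \<inter> D w = {}" if "v \<in> ?I" "w \<in> ?I" "v \<noteq> w" for v w
    unfolding D_def by (rule dual_cells_disjoint[OF d2 I(2)[OF that(1)] I(2)[OF that(2)] that(3) U[OF that(1)] U[OF that(2)]])
  have inj: "inj_on S ?I"
  proof (rule inj_onI, rule ccontr)
    fix v w assume "v \<in> ?I" "w \<in> ?I" "S v = S w" "v \<noteq> w"
    then show False using disj[of v w] SD[of v] SD[of w] Sne[of v] by blast
  qed
  \<comment> \<open>The spheres lie over the interior of P, so hypersurface points over the boundary
    belong to C. This shows both that C is nonempty and that it meets every toric divisor.\<close>
  have boundary: "point u x \<in> C" if "x \<in> P" "x \<notin> interior P" "point u x \<in> T_hypersurface P K \<epsilon>" for u x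
  proof -
    have "point u x \<notin> S v" if v: "v \<in> ?I" for v
    proof
      assume "point u x \<in> S v"
      then obtain y where y: "y \<in> dual_cell v" "point u x = point (U v) y" unfolding S_def dual_sphere_eq by blast
      then have "x = y" using point_eq_iff[OF \<open>x \<in> P\<close>] by blast
      then show False using y(1) dual_cell_subset_interior[OF I(2)[OF v]] \<open>x \<notin> interior P\<close> by blast
    qed
    then show ?thesis using that(3) unfolding C_def by blast
  qed
  have meets: "C \<inter> toric_divisor P F \<noteq> {}" if "F facet_of P" for F
  proof -
    obtain u x where x: "x \<in> F" "x \<in> P" "x \<notin> interior P" "point u x \<in> T_hypersurface P K \<epsilon>"
      using hypersurface_meets_facet[OF \<open>F facet_of P\<close> d2] by metis
    have "point u x \<in> toric_divisor P F"
      unfolding toric_divisor_def real_locus_image_def point_def using x(1) by blast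
    then show ?thesis using boundary[OF x(2-4)] by blast
  qed
  have Cne: "C \<noteq> {}"
  proof -
    obtain \<tau> v where "\<tau> \<in> chambers" "v \<in> verts \<tau>" "v \<notin> interior P" using boundary_vertex_exists by blast
    then have "v \<in> P" using verts_sub[OF chamber_K] chamber_K Union_K by blast
    then show ?thesis using boundary_in_facet \<open>v \<notin> interior P\<close> meets by blast
  qed
  have C: "openin R C" "closedin R C" "connectedin R C"
    unfolding R_def C_def S_def by (rule hypersurface_minus_spheres[OF d2 smooth U]; assumption)+
  have sph: "openin R (S v)" "closedin R (S v)" "connectedin R (S v)" if "v \<in> ?I" for v
    unfolding R_def S_def by (rule clopen_dual_sphere[OF d2 I[OF that] U[OF that]])+
  have "connected_components_of R = insert C (S ` ?I)"
  proof (rule connected_components_of_clopen_cover)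
    have "(\<Union>v\<in>?I. S v) \<subseteq> T_hypersurface P K \<epsilon>"
      by (rule UN_least) (use openin_subset[OF sph(1)] top in simp)
    then show "\<Union> (insert C (S ` ?I)) = topspace R" unfolding top C_def Union_insert by (simp add: Un_absorb2)
    fix A assume "A \<in> insert C (S ` ?I)"
    then show "connectedin R A \<and> openin R A \<and> closedin R A \<and> A \<noteq> {}" using C Cne sph Sne by blast
  qed
  moreover have "C \<notin> S ` ?I" using Cne unfolding C_def by blast
  moreover have "finite (S ` ?I)" using finite_interior_vertices by blast
  moreover have "card (S ` ?I) = card ?I" by (rule card_image[OF inj])
  moreover have "\<exists>B. (\<forall>A\<in>S ` ?I. sphere_bounding_ball P A (B A) \<and> B A \<subseteq> torus P) \<and> disjoint_family_on B (S ` ?I)"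
  proof (intro exI conjI)
    let ?B = "\<lambda>A. D (the_inv_into ?I S A)"
    have B: "?B (S v) = D v" if "v \<in> ?I" for v using the_inv_into_f_f[OF inj that] by simp
    have "sphere_bounding_ball P (S v) (D v) \<and> D v \<subseteq> torus P" if "v \<in> ?I" for v
      unfolding S_def D_def using sphere_bounding_ball_dual[OF I[OF that]] dual_cell_torus[OF I(2)[OF that]] by blast
    then show "\<forall>A\<in>S ` ?I. sphere_bounding_ball P A (?B A) \<and> ?B A \<subseteq> torus P" using B by auto
    show "disjoint_family_on ?B (S ` ?I)"
      unfolding disjoint_family_on_def
    proof (intro ballI impI)
      fix A A' assume "A \<in> S ` ?I" "A' \<in> S ` ?I" "A \<noteq> A'"
      then show "?B A \<inter> ?B A' = {}" using B disj by (metis imageE)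
    qed
  qed
  ultimately show ?thesis using meets unfolding R_def by blast
qed

end

theorem proposition5p10:
  fixes P :: "(real ^ 'd::finite) set"
    and K :: "(real ^ 'd) set set"
    and n :: nat
    and \<rho> :: "('d cell \<Rightarrow> bit ^ 'd) set"
    and \<epsilon> :: "real ^ 'd \<Rightarrow> bit"
  assumes "n \<ge> 1" and "CARD('d) = n + 1"
    and "smooth_lattice_polytope P"
    and "primitive_triangulation P K"
    and "rho_uniform P K \<rho>"
    and "restrict_class (X0_cells P K) wave_sheaf 1 (hessian P K \<epsilon>) = \<rho>"
  shows "\<exists>\<S> C.
    connected_components_of (subtopology (real_locus P) (T_hypersurface P K \<epsilon>)) = insert C \<S> \<and>
    C \<notin> \<S> \<and> finite \<S> \<and> card \<S> = hodge_number P K n 0 \<and>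
    (\<exists>B. (\<forall>S\<in>\<S>. sphere_bounding_ball P S (B S) \<and> B S \<subseteq> torus P) \<and> disjoint_family_on B \<S>) \<and>
    (\<forall>F. F facet_of P \<longrightarrow> C \<inter> toric_divisor P F \<noteq> {})"
proof -
  have d2: "CARD('d) \<ge> 2" using assms(1,2) by simp
  interpret primitive_triangulated P K
    by standard (use assms(3,4) in \<open>auto simp: smooth_lattice_polytope_def lattice_polytope_def\<close>)
  have "\<exists>u. orthant_of \<epsilon> v u" if "v \<in> interior_vertices P K" for v
    unfolding orthant_of_def by (rule hessian_on_star[OF d2 assms(5,6) that])
  then obtain U where U: "\<And>v. v \<in> interior_vertices P K \<Longrightarrow> orthant_of \<epsilon> v (U v)" by metis
  have "hodge_number P K n 0 = card (interior_vertices P K)"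
    using hodge_number_interior_vertices[OF d2] assms(2) by simp
  then show ?thesis using hypersurface_components[OF d2 assms(3) U] by simp
qed

end
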